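(* Let $m\in\mathbb{Z}_{\ge1}$. (1) If $\overrightarrow{\mu}=(\mu_0,\mu_1,\ldots,\mu_m)\in(\mathcal{D}')^m\times M_+(\overline{\mathbb{D}})$ is a normalized allowable $(m+1)$-tuple, then the operator $M_z$ on $\mathscr{D}_{\overrightarrow{\mu}}$ is a cyclic Dirichlet type operator of order $m$. (2) Conversely, if $T\in\mathcal{B}(\mathcal{H})$ is a Dirichlet type operator of order $m$ with cyclic unit vector $e$, then the tuple $\overrightarrow{\mu}=(\mu_0,\mu_1,\ldots,\mu_m)\in(\mathcal{D}')^m\times M_+(\overline{\mathbb{D}})$ given by $$\hat\mu_j(k)=\overline{\hat\mu_j(-k)}=\langle\beta_j(T)e,T^ke\rangle_{\mathcal{H}},\qquad k\in\mathbb{Z}_{\ge0},\ j=0,1,\ldots,m-1,$$ $$\int_{\overline{\mathbb{D}}}z^k\overline{z}^l\,d\mu_m(z)=\langle\beta_m(T)T^ke,T^le\rangle_{\mathcal{H}},\qquad k,l\in\mathbb{Z}_{\ge0},$$ is a normalized allowable $(m+1)$-tuple, and there exists a unitary $U:\mathcal{H}\to\mathscr{D}_{\overrightarrow{\mu}}$ such that $UT=M_zU$ and $Ue=1$. (3) Moreover, if $T_j\in\mathcal{B}(\mathcal{H}_j)$, $j=1,2$, are cyclic Dirichlet type operators of order $m$ with cyclic unit vectors $e_j$, then the associated normalized allowable $(m+1)$-tuples (given by the formulas in (2)) coincide if and only if there exists a unitary $V:\mathcal{H}_1\to\mathcal{H}_2$ such that $VT_1=T_2V$ and $Ve_1=e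_2$.
   Context: $\mathbb{D}$ is the open unit disc, $\mathbb{T}$ the unit circle, $\overline{\mathbb{D}}=\mathbb{D}\cup\mathbb{T}$, $dA=\frac1\pi dx\,dy$, $\sigma$ is normalized arc-length measure on $\mathbb{T}$, $\mathcal{H},\mathcal{H}_j$ are complex Hilbert spaces, and $\mathcal{B}(\mathcal{H})$ is the algebra of bounded operators on $\mathcal{H}$. $M_+(X)$ is the set of finite non-negative Borel measures supported on $X$. $\mathcal{D}$ is the Fréchet space $C^\infty(\mathbb{T})$ and $\mathcal{D}'$ its topological dual (distributions on $\mathbb{T}$); $\hat\mu(k)=\mu(\overline{\zeta}^k)$, $k\in\mathbb{Z}$, are the Fourier coefficients of $\mu\in\mathcal{D}'$. Operators. For $T\in\mathcal{B}(\mathcal{H})$ and $n\ge0$, $$B_n(T)=\sum_{j=0}^n(-1)^j\binom nj T^{*j}T^j,\qquad \beta_n(T)=\sum_{j=0}^n(-1)^{n-j}\binom nj T^{*j}T^j.$$ For $m\ge1$, $T$ is a Dirichlet type operator of order $m$ if $(-1)^mB_n(T)\ge0$ for all $n\ge m$. A vector $e$ is cyclic for $T$ if $\{p(T)e:p\in\mathbb{C}[z]\}$ is dense in $\mathcal{H}$; $T$ is cyclic if it has a cyclic vector. Dirichlet integrals of polynomials. For $\mu\in\mathcal{D}'$ let $P_\mu(z)=\sum_{k\ge0}\hat\mu(k)z^k+\sum_{k\ge1}\hat\mu(-k)\overline{z}^k$, $z\in\mathbb{D}$, and for $f\in\mathbb{C}[z]$ put $$D_{\mu,k}(f)=\lim_{r\to1^-}\frac{1}{k!(k-1)!}\int_{r\mathbb{D}}|f^{(k)}(z)|^2P_\mu(z)(1-|z|^2)^{k-1}dA(z)\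 (k\ge1),\qquad D_{\mu,0}(f)=\lim_{r\to1^-}\int_{\mathbb{T}}|f(r\zeta)|^2P_\mu(r\zeta)\,d\sigma(\zeta).$$ (Equivalently $D_{\mu,k}(f)=\sum_{j,l\ge k}\binom{\min\{j,l\}}{k}\hat f(j)\overline{\hat f(l)}\hat\mu(l-j)$.) For $\mu\in M_+(\overline{\mathbb{D}})$, with $\mu_{(1)}=\mu|_{\mathbb{D}}$ and $\mu_{(2)}=\mu|_{\mathbb{T}}$, and $k\ge1$, $$D_{\mu,k}(f)=\int_{\mathbb{D}}|f^{(k)}(z)|^2U_{\mu,k}(z)\,dA(z),$$ $$U_{\mu,k}(z)=\frac{1}{((k-1)!)^2}\int_{\mathbb{D}}\frac{(-1)^{k+1}G_k(z,\zeta)}{(1-|\zeta|^2)^k}\,d\mu_{(1)}(\zeta)+\frac{1}{k!(k-1)!}\int_{\mathbb{T}}\frac{(1-|z|^2)^k}{|z-\zeta|^2}\,d\mu_{(2)}(\zeta),$$ $$G_k(z,\zeta)=|\zeta-z|^{2(k-1)}\log\left|\frac{1-z\overline\zeta}{\zeta-z}\right|^2+\sum_{l=1}^{k-1}\frac{(-1)^l}{l}|\zeta-z|^{2(k-1-l)}(1-|\zeta|^2)^l(1-|z|^2)^l\quad(z\neq\zeta).$$ Model spaces. For $\overrightarrow{\mu}=(\mu_0,\ldots,\mu_m)\in(\mathcal{D}')^m\times M_+(\overline{\mathbb{D}})$ (so $\mu_0,\ldots,\mu_{m-1}\in\mathcal{D}'$ and $\mu_m\in M_+(\overline{\mathbb{D}})$)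 let $$\|f\|_{\overrightarrow{\mu}}^2=\sum_{j=0}^mD_{\mu_j,j}(f),\qquad f\in\mathbb{C}[z],$$ with the associated sesquilinear form obtained by polarization. The tuple is allowable if there is $C>0$ with $0\le\|zf\|^2_{\overrightarrow{\mu}}\le C\|f\|^2_{\overrightarrow{\mu}}$ for all $f\in\mathbb{C}[z]$, and normalized if $\|1\|^2_{\overrightarrow{\mu}}=\hat\mu_0(0)=1$. For an allowable tuple, let $\mathcal{K}_{\overrightarrow{\mu}}=\{f\in\mathbb{C}[z]:\|f\|_{\overrightarrow{\mu}}=0\}$; $\mathscr{D}_{\overrightarrow{\mu}}$ is the Hilbert space completion of $\mathbb{C}[z]/\mathcal{K}_{\overrightarrow{\mu}}$ with respect to $\|\cdot\|_{\overrightarrow{\mu}}$, and $M_z$ on $\mathscr{D}_{\overrightarrow{\mu}}$ is the unique bounded extension of multiplication by $z$ on $\mathbb{C}[z]/\mathcal{K}_{\overrightarrow{\mu}}$. In $Ue=1$, $1$ denotes the class of the constant polynomial $1$. *)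

theory Defs
  imports
    "HOL-Analysis.Analysis"
    "HOL-Algebra.Module"
    "HOL-Computational_Algebra.Polynomial"
begin

section \<open>Complex Hilbert spaces with an explicit carrier\<close>

text \<open>
  The space \<open>\<D>\<^sub>\<mu>\<close> depends on the parameter \<open>\<mu>\<close> through its carrier and its inner product, so Hilbert
  spaces are records, extending the modules of HOL-Algebra by an inner product which is linear in
  the first argument. The ring fields \<open>mult\<close> and \<open>one\<close> inherited from the module record are
  irrelevant.
\<close>

definition complex_field :: "complex ring" where
  "complex_field = \<lparr>carrier = UNIV, mult = (*), one = 1, zero = 0, add = (+)\<rparr>"

lemma cring_complex_field: "cring complex_field"
proof (rule cringI)
  show "abelian_group complex_field"
  proof (rule abelian_groupI)
    fix x assume "x \<in> carrier complex_field"
    have "(- x) \<oplus>\<^bsub>complex_field\<^esub> x = \<zero>\<^bsub>complex_field\<^esub>"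
      by (simp add: complex_field_def)
    moreover have "- x \<in> carrier complex_field"
      by (simp add: complex_field_def)
    ultimately show "\<exists>y\<in>carrier complex_field. y \<oplus>\<^bsub>complex_field\<^esub> x = \<zero>\<^bsub>complex_field\<^esub>"
      by blast
  qed (auto simp: complex_field_def)
  show "Group.comm_monoid complex_field"
    by unfold_locales (auto simp: complex_field_def)
qed (auto simp: complex_field_def algebra_simps)

record 'a hilbert = "(complex, 'a) module" +
  ip :: "'a \<Rightarrow> 'a \<Rightarrow> complex"

locale complex_inner_product_space = module complex_field H for H (structure) +
  assumes ip_add_left:
      "\<lbrakk>x \<in> carrier H; y \<in> carrier H; z \<in> carrier H\<rbrakk> \<Longrightarrow> ip H (x \<oplus> y) z = ip H x z + ip H y z"
    and ip_smult_left:
      "\<lbrakk>x \<in> carrier H; y \<in> carrier H\<rbrakk> \<Longrightarrow> ip H (c \<odot> x) y = c * ip H x y"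
    and ip_cnj: "\<lbrakk>x \<in> carrier H; y \<in> carrier H\<rbrakk> \<Longrightarrow> ip H y x = cnj (ip H x y)"
    and ip_nonneg: "x \<in> carrier H \<Longrightarrow> 0 \<le> ip H x x"
    and ip_eq_0: "\<lbrakk>x \<in> carrier H; ip H x x = 0\<rbrakk> \<Longrightarrow> x = \<zero>"

definition hnorm :: "('a, 'b) hilbert_scheme \<Rightarrow> 'a \<Rightarrow> real" where
  "hnorm H x = sqrt (Re (ip H x x))"

text \<open>The value 0 off the carrier is there because \<^locale>\<open>Metric_space\<close> demands symmetry
  of the distance on the whole type.\<close>

definition hdist :: "('a, 'b) hilbert_scheme \<Rightarrow> 'a \<Rightarrow> 'a \<Rightarrow> real" where
  "hdist H x y = (if x \<in> carrier H \<and> y \<in> carrier H then hnorm H (x \<ominus>\<^bsub>H\<^esub> y) else 0)"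

text \<open>The definitions in \<^locale>\<open>Metric_space\<close> say nothing unless its axioms hold; here they do.\<close>

context complex_inner_product_space
begin

lemma a_inv_eq_smult:
  assumes "x \<in> carrier H"
  shows "\<ominus> x = (-1) \<odot> x"
proof -
  have R: "carrier complex_field = UNIV" "\<one>\<^bsub>complex_field\<^esub> = 1" "\<zero>\<^bsub>complex_field\<^esub> = 0"
    "\<And>a b. a \<oplus>\<^bsub>complex_field\<^esub> b = a + b"
    by (auto simp: complex_field_def)
  have z: "0 \<odot> x = \<zero>"
    using smult_l_null[OF assms] R by simp
  have "(-1) \<odot> x \<oplus> x = (-1) \<odot> x \<oplus> 1 \<odot> x"
    using smult_one[OF assms] R by simp
  also have "\<dots> = 0 \<odot> x"
    using smult_l_distr[of "-1" 1 x] assms R by simp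
  finally have "(-1) \<odot> x \<oplus> x = \<zero>" using z by simp
  moreover have "(-1) \<odot> x \<in> carrier H" using assms R by (intro smult_closed) auto
  ultimately show ?thesis
    using assms M.minus_equality by blast
qed

lemma ip_add_right:
  assumes "x \<in> carrier H" "y \<in> carrier H" "z \<in> carrier H"
  shows "ip H z (x \<oplus> y) = ip H z x + ip H z y"
  using assms ip_add_left[of x y z] ip_cnj[of _ z] ip_cnj[of z] M.add.m_closed[of x y]
  by (metis complex_cnj_add)

lemma smult_in: "x \<in> carrier H \<Longrightarrow> c \<odot> x \<in> carrier H"
  by (rule smult_closed) (auto simp: complex_field_def)

lemma ip_smult_right:
  assumes "x \<in> carrier H" "z \<in> carrier H"
  shows "ip H z (c \<odot> x) = cnj c * ip H z x"
  using assms ip_smult_left[of x z c] ip_cnj[of _ z] smult_in by (metis complex_cnj_mult)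

lemma norm_sq_add:
  assumes "x \<in> carrier H" "y \<in> carrier H"
  shows "ip H (x \<oplus> c \<odot> y) (x \<oplus> c \<odot> y) =
    ip H x x + cnj c * ip H x y + c * ip H y x + c * cnj c * ip H y y"
  using assms by (simp add: ip_add_left ip_add_right ip_smult_left ip_smult_right smult_in algebra_simps)

lemma Re_ip_le:
  assumes x: "x \<in> carrier H" and y: "y \<in> carrier H"
  shows "Re (ip H x y) \<le> hnorm H x * hnorm H y"
proof -
  let ?a = "Re (ip H x x)" and ?b = "Re (ip H x y)" and ?c = "Re (ip H y y)"
  have a: "?a \<ge> 0" and c: "?c \<ge> 0"
    using ip_nonneg[OF x] ip_nonneg[OF y] by (auto simp: less_eq_complex_def)
  have q: "0 \<le> ?a + 2 * t * ?b + t\<^sup>2 * ?c" for t :: real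
  proof -
    have "0 \<le> Re (ip H (x \<oplus> of_real t \<odot> y) (x \<oplus> of_real t \<odot> y))"
      using ip_nonneg[of "x \<oplus> of_real t \<odot> y"] x y smult_in by (auto simp: less_eq_complex_def)
    also have "\<dots> = ?a + 2 * t * ?b + t\<^sup>2 * ?c"
      using norm_sq_add[OF x y, of "of_real t"] ip_cnj[OF x y]
      by (simp add: power2_eq_square algebra_simps)
    finally show ?thesis .
  qed
  have "?b\<^sup>2 \<le> ?a * ?c"
  proof (cases "?c = 0")
    case True
    have "?b = 0"
    proof (rule ccontr)
      assume b: "?b \<noteq> 0"
      have "?a + 2 * (- (?a + 1) / (2 * ?b)) * ?b = -1"
        using b by (simp add: field_simps)
      then show False using q[of "- (?a + 1) / (2 * ?b)"] True by simp
    qed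
    then show ?thesis using True by simp
  next
    case False
    with c have c: "?c > 0" by simp
    have "0 \<le> ?a + 2 * (- ?b / ?c) * ?b + (- ?b / ?c)\<^sup>2 * ?c" by (rule q)
    also have "\<dots> = ?a - ?b\<^sup>2 / ?c" using c by (simp add: field_simps power2_eq_square)
    finally show ?thesis using c by (simp add: field_simps)
  qed
  then have "\<bar>?b\<bar> \<le> sqrt (?a * ?c)" by (metis real_sqrt_abs real_sqrt_le_mono)
  then show ?thesis by (simp add: hnorm_def real_sqrt_mult)
qed

lemma hnorm_nonneg: "x \<in> carrier H \<Longrightarrow> 0 \<le> hnorm H x"
  using ip_nonneg by (auto simp: hnorm_def less_eq_complex_def)

lemma hnorm_triangle:
  assumes x: "x \<in> carrier H" and y: "y \<in> carrier H"
  shows "hnorm H (x \<oplus> y) \<le> hnorm H x + hnorm H y"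
proof -
  have sq: "(hnorm H v)\<^sup>2 = Re (ip H v v)" if "v \<in> carrier H" for v
    using ip_nonneg[OF that] by (auto simp: hnorm_def less_eq_complex_def)
  have "(hnorm H (x \<oplus> y))\<^sup>2 = Re (ip H x x) + 2 * Re (ip H x y) + Re (ip H y y)"
    using x y sq[of "x \<oplus> y"] ip_cnj[OF x y] by (simp add: ip_add_left ip_add_right)
  also have "\<dots> \<le> (hnorm H x + hnorm H y)\<^sup>2"
    using Re_ip_le[OF x y] sq[OF x] sq[OF y] by (simp add: power2_sum)
  finally show ?thesis
    using hnorm_nonneg[OF x] hnorm_nonneg[OF y] by (auto intro: power2_le_imp_le)
qed

lemma Metric_space_hdist: "Metric_space (carrier H) (hdist H)"
proof
  show "0 \<le> hdist H x y" for x y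
    by (auto simp: hdist_def intro!: hnorm_nonneg)
  show "hdist H x y = hdist H y x" for x y
  proof (cases "x \<in> carrier H \<and> y \<in> carrier H")
    case True
    then have "x \<ominus> y = (-1) \<odot> (y \<ominus> x)"
      by (metis M.minus_closed M.minus_eq M.minus_minus M.minus_add M.a_comm M.a_inv_closed a_inv_eq_smult)
    then have "ip H (x \<ominus> y) (x \<ominus> y) = ip H (y \<ominus> x) (y \<ominus> x)"
      using True by (simp add: ip_smult_left ip_smult_right smult_in)
    then show ?thesis using True by (simp add: hdist_def hnorm_def)
  qed (auto simp: hdist_def)
  show "hdist H x y = 0 \<longleftrightarrow> x = y" if "x \<in> carrier H" "y \<in> carrier H" for x y
  proof
    assume "hdist H x y = 0"
    then have "ip H (x \<ominus> y) (x \<ominus> y) = 0"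
      using that ip_nonneg[of "x \<ominus> y"]
      by (auto simp: hdist_def hnorm_def less_eq_complex_def complex_eq_iff)
    then have "x \<ominus> y = \<zero>" using that ip_eq_0 by simp
    then have "x \<oplus> \<ominus> y = \<zero>" by (simp add: M.minus_eq)
    then show "x = y" using that M.minus_equality[of x "\<ominus> y"] by simp
  next
    assume "x = y"
    moreover have "ip H \<zero> \<zero> = 0"
      using ip_add_left[of "\<zero>" "\<zero>" "\<zero>"] by simp
    ultimately show "hdist H x y = 0"
      using that by (simp add: hdist_def hnorm_def M.r_neg M.minus_eq)
  qed
  show "hdist H x z \<le> hdist H x y + hdist H y z"
    if "x \<in> carrier H" "y \<in> carrier H" "z \<in> carrier H" for x y z
  proof -
    have "x \<ominus> z = (x \<ominus> y) \<oplus> (y \<ominus> z)"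
      using that by (simp add: M.minus_eq M.a_assoc M.r_neg2 M.r_neg1)
    then show ?thesis
      using that hnorm_triangle[of "x \<ominus> y" "y \<ominus> z"] by (simp add: hdist_def)
  qed
qed

end

locale complex_hilbert_space = complex_inner_product_space +
  assumes complete: "Metric_space.mcomplete (carrier H) (hdist H)"

definition linear_map ::
    "('a, 'c) hilbert_scheme \<Rightarrow> ('b, 'd) hilbert_scheme \<Rightarrow> ('a \<Rightarrow> 'b) \<Rightarrow> bool" where
  "linear_map H K T \<longleftrightarrow>
     T \<in> carrier H \<rightarrow> carrier K \<and>
     (\<forall>x\<in>carrier H. \<forall>y\<in>carrier H. T (x \<oplus>\<^bsub>H\<^esub> y) = T x \<oplus>\<^bsub>K\<^esub> T y) \<and>
     (\<forall>c. \<forall>x\<in>carrier H. T (c \<odot>\<^bsub>H\<^esub> x) = c \<odot>\<^bsub>K\<^esub> T x)"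

definition bounded_operators :: "('a, 'c) hilbert_scheme \<Rightarrow> ('a \<Rightarrow> 'a) set" where
  "bounded_operators H =
     {T. linear_map H H T \<and> (\<exists>C. \<forall>x\<in>carrier H. hnorm H (T x) \<le> C * hnorm H x)}"

definition unitary ::
    "('a, 'c) hilbert_scheme \<Rightarrow> ('b, 'd) hilbert_scheme \<Rightarrow> ('a \<Rightarrow> 'b) \<Rightarrow> bool" where
  "unitary H K U \<longleftrightarrow>
     linear_map H K U \<and> U ` carrier H = carrier K \<and>
     (\<forall>x\<in>carrier H. \<forall>y\<in>carrier H. ip K (U x) (U y) = ip H x y)"

definition adjoint_op :: "('a, 'c) hilbert_scheme \<Rightarrow> ('a \<Rightarrow> 'a) \<Rightarrow> 'a \<Rightarrow> 'a" where
  "adjoint_op H T y =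
     (THE z. z \<in> carrier H \<and> (\<forall>x\<in>carrier H. ip H (T x) y = ip H x z))"

definition positive_op :: "('a, 'c) hilbert_scheme \<Rightarrow> ('a \<Rightarrow> 'a) \<Rightarrow> bool" where
  "positive_op H A \<longleftrightarrow> (\<forall>x\<in>carrier H. 0 \<le> ip H (A x) x)"


section \<open>Dirichlet type operators\<close>

definition B_op :: "('a, 'c) hilbert_scheme \<Rightarrow> nat \<Rightarrow> ('a \<Rightarrow> 'a) \<Rightarrow> 'a \<Rightarrow> 'a" where
  "B_op H n T x =
     (\<Oplus>\<^bsub>H\<^esub>j\<in>{..n}. ((-1) ^ j * of_nat (n choose j)) \<odot>\<^bsub>H\<^esub> (adjoint_op H T ^^ j) ((T ^^ j) x))"

definition beta_op :: "('a, 'c) hilbert_scheme \<Rightarrow> nat \<Rightarrow> ('a \<Rightarrow> 'a) \<Rightarrow> 'a \<Rightarrow> 'a" where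
  "beta_op H n T x =
     (\<Oplus>\<^bsub>H\<^esub>j\<in>{..n}. ((-1) ^ (n - j) * of_nat (n choose j)) \<odot>\<^bsub>H\<^esub> (adjoint_op H T ^^ j) ((T ^^ j) x))"

definition dirichlet_type :: "nat \<Rightarrow> ('a, 'c) hilbert_scheme \<Rightarrow> ('a \<Rightarrow> 'a) \<Rightarrow> bool" where
  "dirichlet_type m H T \<longleftrightarrow>
     T \<in> bounded_operators H \<and>
     (\<forall>n\<ge>m. positive_op H (\<lambda>x. (-1) ^ m \<odot>\<^bsub>H\<^esub> B_op H n T x))"

definition poly_op :: "('a, 'c) hilbert_scheme \<Rightarrow> complex poly \<Rightarrow> ('a \<Rightarrow> 'a) \<Rightarrow> 'a \<Rightarrow> 'a" where
  "poly_op H p T x = (\<Oplus>\<^bsub>H\<^esub>j\<in>{..degree p}. coeff p j \<odot>\<^bsub>H\<^esub> (T ^^ j) x)"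

definition cyclic_vector :: "('a, 'c) hilbert_scheme \<Rightarrow> ('a \<Rightarrow> 'a) \<Rightarrow> 'a \<Rightarrow> bool" where
  "cyclic_vector H T e \<longleftrightarrow>
     e \<in> carrier H \<and>
     Metric_space.mtopology (carrier H) (hdist H) closure_of (range (\<lambda>p. poly_op H p T e))
       = carrier H"

definition cyclic_op :: "('a, 'c) hilbert_scheme \<Rightarrow> ('a \<Rightarrow> 'a) \<Rightarrow> bool" where
  "cyclic_op H T \<longleftrightarrow> (\<exists>e. cyclic_vector H T e)"


section \<open>Distributions on the unit circle\<close>

text \<open>
  Functions on the circle are functions on \<^typ>\<open>complex\<close> vanishing off the circle.
  \<open>circle_deriv k f t\<close> is the \<open>k\<close>-th derivative of \<open>t \<mapsto> f (e\<^sup>i\<^sup>t)\<close>.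
\<close>

primrec circle_deriv :: "nat \<Rightarrow> (complex \<Rightarrow> complex) \<Rightarrow> real \<Rightarrow> complex" where
  "circle_deriv 0 f = (\<lambda>t. f (cis t))"
| "circle_deriv (Suc k) f = (\<lambda>t. vector_derivative (circle_deriv k f) (at t))"

definition circle_smooth :: "(complex \<Rightarrow> complex) set" where
  "circle_smooth =
     {f. (\<forall>z. cmod z \<noteq> 1 \<longrightarrow> f z = 0) \<and> (\<forall>k t. circle_deriv k f differentiable (at t))}"

definition circle_seminorm :: "nat \<Rightarrow> (complex \<Rightarrow> complex) \<Rightarrow> real" where
  "circle_seminorm k f = (SUP t\<in>{0..2*pi}. cmod (circle_deriv k f t))"

definition circle_smooth_topology :: "(complex \<Rightarrow> complex) topology" where
  "circle_smooth_topology = topology_generated_by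
     {{g \<in> circle_smooth. circle_seminorm k (\<lambda>z. g z - f z) < \<epsilon>} | f k \<epsilon>.
        f \<in> circle_smooth \<and> 0 < \<epsilon>}"

text \<open>Functionals are \<^const>\<open>extensional\<close>, so that equality of distributions is equality in HOL.\<close>

type_synonym circle_functional = "(complex \<Rightarrow> complex) \<Rightarrow> complex"

definition circle_distributions :: "circle_functional set" where
  "circle_distributions =
     {\<mu> \<in> extensional circle_smooth.
        (\<forall>f\<in>circle_smooth. \<forall>g\<in>circle_smooth. \<mu> (\<lambda>z. f z + g z) = \<mu> f + \<mu> g) \<and>
        (\<forall>c. \<forall>f\<in>circle_smooth. \<mu> (\<lambda>z. c * f z) = c * \<mu> f) \<and>
        continuous_map circle_smooth_topology euclidean \<mu>}"

definition fourier_coeff :: "circle_functional \<Rightarrow> int \<Rightarrow> complex" where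
  "fourier_coeff \<mu> k = \<mu> (\<lambda>z. if cmod z = 1 then cnj z powi k else 0)"

definition poisson_ext :: "circle_functional \<Rightarrow> complex \<Rightarrow> complex" where
  "poisson_ext \<mu> z =
     (\<Sum>k. fourier_coeff \<mu> (int k) * z ^ k) +
     (\<Sum>k. fourier_coeff \<mu> (- int (Suc k)) * cnj z ^ Suc k)"


section \<open>Dirichlet integrals of polynomials\<close>

definition area_measure :: "complex measure" where
  "area_measure = scale_measure (ennreal (1 / pi)) lborel"

definition arc_measure :: "complex measure" where
  "arc_measure = distr (uniform_measure lborel {0..<2*pi}) borel cis"

definition dirichlet_dist :: "circle_functional \<Rightarrow> nat \<Rightarrow> complex poly \<Rightarrow> complex" where
  "dirichlet_dist \<mu> k f =
     (if k = 0 then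
        Lim (at_left 1) (\<lambda>r::real.
          LINT \<zeta>|arc_measure.
            of_real ((cmod (poly f (of_real r * \<zeta>)))\<^sup>2) * poisson_ext \<mu> (of_real r * \<zeta>))
      else
        Lim (at_left 1) (\<lambda>r::real.
          1 / (fact k * fact (k - 1)) *
          (LINT z:ball 0 r|area_measure.
            of_real ((cmod (poly ((pderiv ^^ k) f) z))\<^sup>2) * poisson_ext \<mu> z *
            of_real ((1 - (cmod z)\<^sup>2) ^ (k - 1)))))"

definition finite_borel_measures_on :: "complex set \<Rightarrow> complex measure set" where
  "finite_borel_measures_on X =
     {\<mu>. sets \<mu> = sets borel \<and> finite_measure \<mu> \<and> (AE z in \<mu>. z \<in> X)}"

definition G_kernel :: "nat \<Rightarrow> complex \<Rightarrow> complex \<Rightarrow> real" where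
  "G_kernel k z \<zeta> =
     cmod (\<zeta> - z) ^ (2 * (k - 1)) * ln ((cmod ((1 - z * cnj \<zeta>) / (\<zeta> - z)))\<^sup>2) +
     (\<Sum>l = 1..k - 1. (-1) ^ l / real l * cmod (\<zeta> - z) ^ (2 * (k - 1 - l)) *
        (1 - (cmod \<zeta>)\<^sup>2) ^ l * (1 - (cmod z)\<^sup>2) ^ l)"

definition U_potential :: "complex measure \<Rightarrow> nat \<Rightarrow> complex \<Rightarrow> real" where
  "U_potential \<mu> k z =
     1 / (fact (k - 1))\<^sup>2 *
       (LINT \<zeta>:ball 0 1|\<mu>. (-1) ^ (k + 1) * G_kernel k z \<zeta> / (1 - (cmod \<zeta>)\<^sup>2) ^ k) +
     1 / (fact k * fact (k - 1)) *
       (LINT \<zeta>:sphere 0 1|\<mu>. (1 - (cmod z)\<^sup>2) ^ k / (cmod (z - \<zeta>))\<^sup>2)"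

definition dirichlet_meas :: "complex measure \<Rightarrow> nat \<Rightarrow> complex poly \<Rightarrow> real" where
  "dirichlet_meas \<mu> k f =
     (LINT z:ball 0 1|area_measure. (cmod (poly ((pderiv ^^ k) f) z))\<^sup>2 * U_potential \<mu> k z)"


section \<open>Model spaces\<close>

text \<open>A tuple \<open>(\<mu>\<^sub>0, \<dots>, \<mu>\<^sub>m)\<close> is the pair of the list of its distributions \<open>\<mu>\<^sub>0, \<dots>, \<mu>\<^bsub>m-1\<^esub>\<close> and
  the measure \<open>\<mu>\<^sub>m\<close>.\<close>

type_synonym dirichlet_tuple = "circle_functional list \<times> complex measure"

definition dirichlet_tuples :: "nat \<Rightarrow> dirichlet_tuple set" where
  "dirichlet_tuples m =
     {(ds, \<nu>). length ds = m \<and> set ds \<subseteq> circle_distributions \<and>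
               \<nu> \<in> finite_borel_measures_on (cball 0 1)}"

text \<open>\<open>\<parallel>f\<parallel>\<^sup>2\<close>; it need not be real unless the tuple is allowable.\<close>

definition norm_sq :: "dirichlet_tuple \<Rightarrow> complex poly \<Rightarrow> complex" where
  "norm_sq \<mu> f =
     (\<Sum>j<length (fst \<mu>). dirichlet_dist (fst \<mu> ! j) j f) +
     of_real (dirichlet_meas (snd \<mu>) (length (fst \<mu>)) f)"

definition sesq_form :: "dirichlet_tuple \<Rightarrow> complex poly \<Rightarrow> complex poly \<Rightarrow> complex" where
  "sesq_form \<mu> f g =
     (\<Sum>n<4. \<i> ^ n * norm_sq \<mu> (f + Polynomial.smult (\<i> ^ n) g)) / 4"

text \<open>The inequalities below are those of the partial order on \<^typ>\<open>complex\<close>: they include that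
  the quantities compared are real.\<close>

definition allowable :: "nat \<Rightarrow> dirichlet_tuple \<Rightarrow> bool" where
  "allowable m \<mu> \<longleftrightarrow>
     \<mu> \<in> dirichlet_tuples m \<and>
     (\<exists>C::real. C > 0 \<and>
        (\<forall>f. 0 \<le> norm_sq \<mu> ([:0, 1:] * f) \<and>
             norm_sq \<mu> ([:0, 1:] * f) \<le> of_real C * norm_sq \<mu> f))"

definition normalized :: "dirichlet_tuple \<Rightarrow> bool" where
  "normalized \<mu> \<longleftrightarrow> norm_sq \<mu> 1 = 1"

text \<open>
  The completion of \<open>\<complex>[z]/\<K>\<close>, where \<open>\<K>\<close> is the kernel of the seminorm, is realized as the set of
  Cauchy sequences of polynomials modulo sequences tending to 0 in the seminorm. On constant
  sequences this identification is the one modulo \<open>\<K>\<close>.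
\<close>

definition poly_norm :: "dirichlet_tuple \<Rightarrow> complex poly \<Rightarrow> real" where
  "poly_norm \<mu> f = sqrt (Re (norm_sq \<mu> f))"

definition cauchy_seqs :: "dirichlet_tuple \<Rightarrow> (nat \<Rightarrow> complex poly) set" where
  "cauchy_seqs \<mu> = {s. \<forall>\<epsilon>>0. \<exists>N. \<forall>i\<ge>N. \<forall>j\<ge>N. poly_norm \<mu> (s i - s j) < \<epsilon>}"

definition null_rel :: "dirichlet_tuple \<Rightarrow> ((nat \<Rightarrow> complex poly) \<times> (nat \<Rightarrow> complex poly)) set" where
  "null_rel \<mu> =
     {(s, t). s \<in> cauchy_seqs \<mu> \<and> t \<in> cauchy_seqs \<mu> \<and>
              (\<lambda>n. poly_norm \<mu> (s n - t n)) \<longlonglongrightarrow> 0}"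

definition seq_class :: "dirichlet_tuple \<Rightarrow> (nat \<Rightarrow> complex poly) \<Rightarrow> (nat \<Rightarrow> complex poly) set" where
  "seq_class \<mu> s = null_rel \<mu> `` {s}"

definition seq_rep :: "(nat \<Rightarrow> complex poly) set \<Rightarrow> nat \<Rightarrow> complex poly" where
  "seq_rep X = (SOME s. s \<in> X)"

definition model_space :: "dirichlet_tuple \<Rightarrow> (nat \<Rightarrow> complex poly) set hilbert" where
  "model_space \<mu> =
     \<lparr>carrier = cauchy_seqs \<mu> // null_rel \<mu>,
      mult = undefined, one = undefined,
      zero = seq_class \<mu> (\<lambda>n. 0),
      add = (\<lambda>X Y. seq_class \<mu> (\<lambda>n. seq_rep X n + seq_rep Y n)),
      smult = (\<lambda>c X. seq_class \<mu> (\<lambda>n. Polynomial.smult c (seq_rep X n))),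
      ip = (\<lambda>X Y. lim (\<lambda>n. sesq_form \<mu> (seq_rep X n) (seq_rep Y n)))\<rparr>"

definition poly_class :: "dirichlet_tuple \<Rightarrow> complex poly \<Rightarrow> (nat \<Rightarrow> complex poly) set" where
  "poly_class \<mu> f = seq_class \<mu> (\<lambda>n. f)"

definition M_z :: "dirichlet_tuple \<Rightarrow> (nat \<Rightarrow> complex poly) set \<Rightarrow> (nat \<Rightarrow> complex poly) set" where
  "M_z \<mu> =
     (THE T. T \<in> bounded_operators (model_space \<mu>) \<and>
             T \<in> extensional (carrier (model_space \<mu>)) \<and>
             (\<forall>f. T (poly_class \<mu> f) = poly_class \<mu> ([:0, 1:] * f)))"

definition associated_tuple ::
    "nat \<Rightarrow> ('a, 'c) hilbert_scheme \<Rightarrow> ('a \<Rightarrow> 'a) \<Rightarrow> 'a \<Rightarrow> dirichlet_tuple \<Rightarrow> bool" where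
  "associated_tuple m H T e \<mu> \<longleftrightarrow>
     \<mu> \<in> dirichlet_tuples m \<and>
     (\<forall>j<m. \<forall>k.
        fourier_coeff (fst \<mu> ! j) (int k) = ip H (beta_op H j T e) ((T ^^ k) e) \<and>
        cnj (fourier_coeff (fst \<mu> ! j) (- int k)) = ip H (beta_op H j T e) ((T ^^ k) e)) \<and>
     (\<forall>k l. (LINT z|snd \<mu>. z ^ k * cnj z ^ l) =
        ip H (beta_op H m T ((T ^^ k) e)) ((T ^^ l) e))"

end

theory Submission
  imports Defs "HOL-Probability.Probability"
begin

text \<open>
The norm of a tuple is a quadratic form in the Taylor coefficients of a polynomial. Its matrix
\<open>gram\<close> is the sum of the matrices \<open>C(min j l, i) * c_i (l - j)\<close>, where \<open>c_i\<close> are the Fourier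
coefficients of the \<open>i\<close>-th distribution, and of the integral of \<open>newton m j l\<close> against the measure,
where \<open>newton m\<close> arises from the monomials \<open>z^j cnj z^l\<close> by summing \<open>m\<close> times along diagonals. The
difference \<open>A j l - A (j+1) (l+1)\<close> of matrices, iterated in \<open>bdiff\<close>, undoes one such summation and
is the counterpart of the passage from \<open>B_n(T)\<close> to \<open>B_(n+1)(T)\<close>. Up to sign, the \<open>m\<close>-th difference
of \<open>gram\<close> consists of the moments of the measure, and the \<open>i\<close>-th one, \<open>i < m\<close>, has the Fourier
coefficients of the \<open>i\<close>-th distribution in row and column \<open>0\<close>. These values determine the matrix
(\<open>bdiff_determines\<close>).

Hence, for \<open>n \<ge> m\<close>, the form of \<open>(-1)^m B_n(M_z)\<close> is the integral of \<open>|f|^2 (1 - |z|^2)^(n-m)\<close>, which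
is nonnegative. Conversely, let \<open>e\<close> be cyclic for \<open>T\<close> and \<open>A j l = <T^j e, T^l e>\<close>. All
differences of the \<open>m\<close>-th difference of \<open>A\<close> are positive up to one common sign, which makes it the
moment matrix of a measure on the closed disc (\<open>disc_moment_problem\<close>). The same positivity forces
\<open>T^k e\<close> to grow polynomially (\<open>orbit_growth\<close>), so the prescribed Fourier coefficients belong to
distributions (\<open>distribution_exists\<close>). For the tuple found in this way \<open>gram = A\<close>, that is, the norm
of \<open>p\<close> in the model space is the norm of \<open>p(T) e\<close>, and \<open>p \<mapsto> [p]\<close> induces the unitary. Tuples are
unique because moments determine a measure and Fourier coefficients a distribution. The last part
follows, as \<open>A\<close> is a unitary invariant of \<open>(T, e)\<close>.

The analytic core are the two formulas \<open>dirichlet_dist_eq_quad_form\<close> and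
\<open>dirichlet_meas_eq_quad_form\<close> for the Dirichlet integrals. For a point mass in the open disc an
automorphism of the disc turns the kernel \<open>G_kernel\<close> into a radial weight with explicit moments.
\<close>

notation LIMSEQ ("((_)/ ----> (_))" [60, 60] 60)

section \<open>Area and holomorphic maps\<close>

definition vec2 :: "complex => real^2" where
 "vec2 z = vector [Re z, Im z]"

definition cpx2 :: "real^2 => complex" where
 "cpx2 v = Complex (v$1) (v$2)"

lemma cpx2_vec2 [simp]: "cpx2 (vec2 z) = z" by (simp add: cpx2_def vec2_def)

lemma vec2_cpx2 [simp]: "vec2 (cpx2 v) = v" by (simp add: cpx2_def vec2_def vec_eq_iff forall_2)

lemma vec2_nth [simp]: "vec2 z $ 1 = Re z" "vec2 z $ 2 = Im z" by (simp_all add: vec2_def)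

lemma bounded_linear_cpx2: "bounded_linear cpx2"
proof -
 have "linear cpx2" by (rule linearI) (auto simp: cpx2_def complex_eq_iff)
 thus ?thesis using linear_conv_bounded_linear by blast
qed

lemma bounded_linear_vec2: "bounded_linear vec2"
proof -
 have "linear vec2" by (rule linearI) (auto simp: vec2_def vec_eq_iff forall_2)
 thus ?thesis using linear_conv_bounded_linear by blast
qed

lemma measurable_cpx2 [measurable]: "cpx2 : borel_measurable borel"
 using bounded_linear.continuous_on[OF bounded_linear_cpx2 continuous_on_id]
 by (intro borel_measurable_continuous_onI) simp

lemma [measurable]: "vec2 : borel_measurable borel"
 using bounded_linear.continuous_on[OF bounded_linear_vec2 continuous_on_id]
 by (intro borel_measurable_continuous_onI) simp

lemma lborel_complex_eq_distr: "(lborel :: complex measure) = distr lborel borel cpx2"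
proof (rule lborel_eqI)
 fix l u :: complex
 assume le: "!!b. b : Basis ==> l \<bullet> b <= u \<bullet> b"
 have le': "Re l <= Re u" "Im l <= Im u" using le[of 1] le[of \<i>] by (auto simp: Basis_complex_def)
 have "cpx2 -` box l u = box (vec2 l) (vec2 u)"
  by (auto simp: box_def Basis_complex_def cpx2_def Basis_vec_def inner_axis forall_2 inner_complex_def)
 hence "emeasure (distr lborel borel cpx2) (box l u) = emeasure lborel (box (vec2 l) (vec2 u))"
  by (subst emeasure_distr) auto
 also have "... = ennreal (\<Prod>b\<in>Basis. (vec2 u - vec2 l) \<bullet> b)"
 proof (rule emeasure_lborel_box)
  fix b :: "real^2" assume "b : Basis"
  then consider "b = axis 1 1" | "b = axis 2 1" by (auto simp: Basis_vec_def UNIV_2)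
  thus "vec2 l \<bullet> b <= vec2 u \<bullet> b"
   by cases (use le' in \<open>auto simp: inner_axis\<close>)
 qed
 also have "(\<Prod>b\<in>Basis. (vec2 u - vec2 l) \<bullet> b) = (Re u - Re l) * (Im u - Im l)" proof -
  have "(Basis :: (real^2) set) = {axis 1 1, axis 2 1}" by (auto simp: Basis_vec_def UNIV_2)
  moreover have "axis 1 (1::real) ~= (axis 2 1 :: real^2)" by (simp add: axis_eq_axis)
  ultimately have "(\<Prod>b\<in>Basis. (vec2 u - vec2 l) \<bullet> b) = (\<Prod>b\<in>{axis 1 1, axis 2 1}. (vec2 u - vec2 l) \<bullet> b)"
   by metis
  also have "... = (Re u - Re l) * (Im u - Im l)"
   using \<open>axis 1 (1::real) ~= (axis 2 1 :: real^2)\<close> by (simp add: inner_axis)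
  finally show ?thesis .
 qed
 also have "(Re u - Re l) * (Im u - Im l) = (\<Prod>b\<in>Basis. (u - l) \<bullet> b)"
  by (auto simp: Basis_complex_def inner_complex_def)
 finally show "emeasure (distr lborel borel cpx2) (box l u) = (\<Prod>b\<in>Basis. (u - l) \<bullet> b)" .
qed auto

text \<open>The factor \<open>|f'|^2\<close> is the Jacobian determinant of \<open>f\<close> as a map of the
plane; the change of variables for \<open>real^2\<close> is carried over to
\<open>complex\<close>.\<close>

lemma emeasure_image_holomorphic:
 fixes f f' :: "complex => complex"
 assumes B: "B : sets borel" and fB: "f ` B : sets borel"
  and der: "!!z. z : B ==> (f has_field_derivative f' z) (at z)"
  and inj: "inj_on f B" and fin: "emeasure lborel (f ` B) < \<infinity>"
  and f': "f' : borel_measurable borel"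
 shows "emeasure lborel (f ` B) = (\<integral>\<^sup>+z\<in>B. ennreal ((cmod (f' z))^2) \<partial>lborel)"
proof -
 define S where "S = vec2 ` B"
 define F where "F = (%v. vec2 (f (cpx2 v)))"
 define F' where "F' = (%v h. vec2 (f' (cpx2 v) * cpx2 h))"
 have S_eq: "S = cpx2 -` B" unfolding S_def by (auto simp: image_iff) (metis vec2_cpx2)
 have S: "S : sets borel" unfolding S_eq using measurable_sets[OF measurable_cpx2 B] by simp
 have FS_eq: "F ` S = cpx2 -` (f ` B)" unfolding S_def F_def by (auto simp: image_iff) (metis vec2_cpx2)
 have FS: "F ` S : sets borel" unfolding FS_eq using measurable_sets[OF measurable_cpx2 fB] by simp
 have derF: "(F has_derivative F' v) (at v within S)" if v: "v : S" for v
 proof -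
  have "(f has_derivative (%h. f' (cpx2 v) * h)) (at (cpx2 v))"
   using der[of "cpx2 v"] v unfolding S_eq by (simp add: has_field_derivative_def)
  hence "((%v. f (cpx2 v)) has_derivative (%h. f' (cpx2 v) * cpx2 h)) (at v)"
   by (rule has_derivative_compose[OF bounded_linear.has_derivative[OF bounded_linear_cpx2 has_derivative_ident]])
  thus ?thesis unfolding F_def F'_def
   by (rule has_derivative_at_withinI[OF bounded_linear.has_derivative[OF bounded_linear_vec2]])
 qed
 have injF: "inj_on F S" unfolding F_def S_def using inj by (auto simp: inj_on_def) (metis cpx2_vec2)
 have det: "\<bar>det (matrix (F' v))\<bar> = (cmod (f' (cpx2 v)))^2" for v
 proof -
  have "det (matrix (F' v)) = (Re (f' (cpx2 v)))^2 + (Im (f' (cpx2 v)))^2"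
   by (simp add: det_2 matrix_def F'_def cpx2_def axis_def power2_eq_square)
  thus ?thesis by (simp add: cmod_power2)
 qed
 have eq1: "emeasure lborel (F ` S) = emeasure lborel (f ` B)" proof -
  have "emeasure (distr lborel borel cpx2) (f ` B) = emeasure lborel (F ` S)"
   unfolding FS_eq using fB by (subst emeasure_distr) auto
  thus ?thesis by (simp add: lborel_complex_eq_distr)
 qed
 have lm: "F ` S : lmeasurable" using FS fin eq1 by (auto simp: fmeasurable_def)
 have Sl: "S : sets lebesgue" using S by auto
 have int: "(%v. \<bar>det (matrix (F' v))\<bar>) integrable_on S"
  using measurable_differentiable_image_eq[OF Sl derF injF] lm by blast
 have "measure lebesgue (F ` S) = integral S (%v. \<bar>det (matrix (F' v))\<bar>)"
  by (rule measure_differentiable_image_eq[OF Sl derF injF int])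
 hence meas: "measure lborel (F ` S) = integral S (%v. (cmod (f' (cpx2 v)))\<^sup>2)"
  using FS by (simp add: det)
 have hi: "((%v. (cmod (f' (cpx2 v)))\<^sup>2) has_integral integral S (%v. (cmod (f' (cpx2 v)))\<^sup>2)) S"
  using int by (simp add: det integrable_integral)
 have "(\<integral>\<^sup>+v\<in>S. ennreal ((cmod (f' (cpx2 v)))^2) \<partial>lborel) = ennreal (measure lborel (F ` S))"
 proof -
  have h2: "((%v. indicator S v * (cmod (f' (cpx2 v)))^2) has_integral
     integral S (%v. (cmod (f' (cpx2 v)))\<^sup>2)) UNIV"
   using hi has_integral_restrict_UNIV[of S "%v. (cmod (f' (cpx2 v)))\<^sup>2"]
   by (simp add: indicator_def of_bool_def if_distrib[of "%t. t * _"] cong: if_cong)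
  have "(\<integral>\<^sup>+v. ennreal (indicator S v * (cmod (f' (cpx2 v)))^2) \<partial>lborel)
    = ennreal (integral S (%v. (cmod (f' (cpx2 v)))\<^sup>2))"
   by (rule nn_integral_has_integral_lborel[OF _ _ h2]) (use S f' in auto)
  thus ?thesis unfolding meas by (simp add: ennreal_mult'' mult.commute flip: ennreal_indicator)
 qed
 also have "... = emeasure lborel (f ` B)"
  using eq1 fin emeasure_eq_ennreal_measure[of lborel "F ` S"] by (simp add: less_top)
 finally have "emeasure lborel (f ` B) = (\<integral>\<^sup>+v\<in>S. ennreal ((cmod (f' (cpx2 v)))^2) \<partial>lborel)" ..
 also have "... = (\<integral>\<^sup>+z\<in>B. ennreal ((cmod (f' z))^2) \<partial>lborel)" proof -
  have "(\<integral>\<^sup>+z\<in>B. ennreal ((cmod (f' z))^2) \<partial>distr lborel borel cpx2)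
    = (\<integral>\<^sup>+v\<in>cpx2 -` B. ennreal ((cmod (f' (cpx2 v)))^2) \<partial>lborel)"
   by (subst nn_integral_distr) (use B f' in \<open>auto simp: indicator_def intro!: nn_integral_cong\<close>)
  thus ?thesis by (simp add: lborel_complex_eq_distr S_eq)
 qed
 finally show ?thesis .
qed

definition disc_area :: "complex measure" where
 "disc_area = density lborel (%z. ennreal (indicator (ball 0 1) z / pi))"

lemma sets_disc_area [simp, measurable_cong]: "sets disc_area = sets borel" by (simp add: disc_area_def)

lemma space_disc_area [simp]: "space disc_area = UNIV" by (simp add: disc_area_def)

lemma area_measure_eq_density: "area_measure = density lborel (%_. ennreal (1 / pi))"
 by (rule measure_eqI) (auto simp: area_measure_def emeasure_density_const)

lemma [measurable]:
 "(%z::complex. ennreal (indicator (ball 0 1) z / pi)) : borel_measurable borel"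
 by (intro measurable_compose[OF _ measurable_ennreal] borel_measurable_divide borel_measurable_indicator) auto

lemma [measurable]:
 "(%z::complex. indicator (ball 0 1) z / pi :: real) : borel_measurable borel"
 by (intro borel_measurable_divide borel_measurable_indicator) auto

lemma emeasure_disc_area:
 assumes "A : sets borel"
 shows "emeasure disc_area A = ennreal (1 / pi) * emeasure lborel (A \<inter> ball 0 1)"
proof -
 have "emeasure disc_area A = (\<integral>\<^sup>+z. ennreal (1 / pi) * indicator (A \<inter> ball 0 1) z \<partial>lborel)"
  unfolding disc_area_def using assms
  by (subst emeasure_density) (auto intro!: nn_integral_cong borel_measurable_indicator borel_measurable_divide split: split_indicator)
 also have "... = ennreal (1 / pi) * emeasure lborel (A \<inter> ball 0 1)"
  using assms by (subst nn_integral_cmult_indicator) auto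
 finally show ?thesis .
qed

lemma emeasure_lborel_disc:
 assumes "0 <= r" shows "emeasure lborel (ball (0::complex) r) = ennreal (pi * r\<^sup>2)"
 using assms by (simp add: emeasure_ball unit_ball_vol_2 DIM_complex)

lemma finite_measure_disc_area: "finite_measure disc_area"
 by (rule finite_measureI) (simp add: emeasure_disc_area emeasure_lborel_disc flip: ennreal_mult')

lemma AE_disc_area: "AE z in disc_area. cmod z < 1"
 unfolding disc_area_def by (subst AE_density) (auto simp: indicator_def of_bool_def)

lemma integral_area_measure_ball:
 fixes f :: "complex => 'a :: {banach, second_countable_topology}"
 assumes [measurable]: "f : borel_measurable borel" and "r <= 1"
 shows "(LINT z:ball 0 r|area_measure. f z) = (LINT z|disc_area. indicator (ball 0 r) z *\<^sub>R f z)"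
 unfolding set_lebesgue_integral_def area_measure_eq_density disc_area_def using assms(2)
 by (subst (1 2) integral_density) (auto intro!: Bochner_Integration.integral_cong simp: indicator_def of_bool_def)

lemma integral_area_measure_unit_ball:
 fixes f :: "complex => 'a :: {banach, second_countable_topology}"
 assumes [measurable]: "f : borel_measurable borel"
 shows "(LINT z:ball 0 1|area_measure. f z) = (LINT z|disc_area. f z)"
 unfolding integral_area_measure_ball[OF assms order_refl]
 by (rule integral_cong_AE) (use AE_disc_area in \<open>auto simp: indicator_def\<close>)

text \<open>The density makes a holomorphic automorphism of the disc measure preserving.\<close>

lemma disc_area_automorphism:
 assumes f[measurable]: "f : borel_measurable borel" and f'[measurable]: "f' : borel_measurable borel"
  and bij: "bij_betw f (ball 0 1) (ball 0 1)"
  and der: "!!z. z : ball 0 1 ==> (f has_field_derivative f' z) (at z)"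
 shows "distr (density disc_area (%z. ennreal ((cmod (f' z))^2))) borel f = disc_area"
proof (rule measure_eqI)
 fix A assume "A : sets (distr (density disc_area (%z. ennreal ((cmod (f' z))^2))) borel f)"
 hence A[measurable]: "A : sets borel" by simp
 define B where "B = f -` A \<inter> ball 0 1"
 have B[measurable]: "B : sets borel" unfolding B_def using measurable_sets[OF f A] by auto
 have fB: "f ` B = A \<inter> ball 0 1" proof
  show "f ` B \<subseteq> A \<inter> ball 0 1" using bij unfolding B_def bij_betw_def by auto
  show "A \<inter> ball 0 1 \<subseteq> f ` B" proof
   fix x assume x: "x : A \<inter> ball 0 1"
   then obtain y where "y : ball 0 1" "x = f y" using bij unfolding bij_betw_def by (metis IntD2 imageE)
   thus "x : f ` B" using x unfolding B_def by auto
  qed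
 qed
 have fin: "emeasure lborel (f ` B) < \<infinity>"
  unfolding fB by (rule le_less_trans[OF emeasure_mono[of _ "ball 0 1"]]) (auto simp: emeasure_lborel_disc)
 have "emeasure (distr (density disc_area (%z. ennreal ((cmod (f' z))^2))) borel f) A
   = (\<integral>\<^sup>+z. ennreal (indicator (ball 0 1) z / pi) * (ennreal ((cmod (f' z))^2) * indicator (f -` A) z) \<partial>lborel)"
  using measurable_sets[OF f A]
  using B by (simp add: emeasure_distr emeasure_density) (unfold disc_area_def, subst nn_integral_density, auto)
 also have "... = (\<integral>\<^sup>+z. ennreal (1 / pi) * (ennreal ((cmod (f' z))^2) * indicator B z) \<partial>lborel)"
  by (intro nn_integral_cong) (auto simp: B_def split: split_indicator)
 also have "... = ennreal (1 / pi) * (\<integral>\<^sup>+z\<in>B. ennreal ((cmod (f' z))^2) \<partial>lborel)"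
  by (subst nn_integral_cmult) auto
 also have "(\<integral>\<^sup>+z\<in>B. ennreal ((cmod (f' z))^2) \<partial>lborel) = emeasure lborel (f ` B)"
 proof (rule emeasure_image_holomorphic[symmetric, OF B])
  have "B \<subseteq> ball 0 1" by (auto simp: B_def)
  thus "inj_on f B" using bij inj_on_subset unfolding bij_betw_def by blast
  show "!!z. z : B ==> (f has_field_derivative f' z) (at z)"
   using \<open>B \<subseteq> ball 0 1\<close> der by auto
 qed (use fin in \<open>auto simp: fB\<close>)
 also have "ennreal (1 / pi) * emeasure lborel (f ` B) = emeasure disc_area A"
  by (simp add: fB emeasure_disc_area)
 finally show "emeasure (distr (density disc_area (%z. ennreal ((cmod (f' z))^2))) borel f) A = emeasure disc_area A" .
qed auto

text \<open>Archimedes in the plane: for a uniformly distributed point of the disc, \<open>|z|^2\<close> is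
uniform. So radial integrals over the disc become integrals over the unit interval.\<close>

lemma distr_norm_sq_disc_area:
 "distr disc_area borel (%z. (cmod z)\<^sup>2) = density lborel (indicator {0<..<1})"
proof (rule measure_eqI_lessThan)
 fix x :: real
 have 1: "emeasure (distr disc_area borel (%z. (cmod z)\<^sup>2)) {x<..} = ennreal (1 - max 0 x)"
 proof -
  have "emeasure (distr disc_area borel (%z. (cmod z)\<^sup>2)) {x<..}
    = emeasure disc_area ((%z. (cmod z)\<^sup>2) -` {x<..})" by (subst emeasure_distr) auto
  also have "... = ennreal (1 / pi) * emeasure lborel (((%z. (cmod z)\<^sup>2) -` {x<..}) \<inter> ball 0 1)"
   by (rule emeasure_disc_area) (rule borel_open, auto intro!: open_vimage continuous_intros)
  also have "emeasure lborel (((%z. (cmod z)\<^sup>2) -` {x<..}) \<inter> ball (0::complex) 1) = ennreal (pi * (1 - max 0 x))"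
  proof -
   have key: "x < (cmod z)^2 \<longleftrightarrow> sqrt x < cmod z" for z
    using real_sqrt_less_iff[of x "(cmod z)\<^sup>2"] by simp
   consider "x < 0" | "0 <= x" "x < 1" | "x >= 1" by linarith
   thus ?thesis proof cases
    case 1
    hence "((%z. (cmod z)\<^sup>2) -` {x<..}) \<inter> ball (0::complex) 1 = ball 0 1"
     by (auto intro!: less_le_trans[of x 0])
    thus ?thesis using 1 by (simp add: emeasure_lborel_disc)
   next
    case 2
    have "((%z. (cmod z)\<^sup>2) -` {x<..}) \<inter> ball (0::complex) 1 = ball 0 1 - cball 0 (sqrt x)"
     using key by (auto simp: not_le)
    also have "emeasure lborel ... = emeasure lborel (ball (0::complex) 1) - emeasure lborel (cball (0::complex) (sqrt x))"
    proof (rule emeasure_Diff)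
     show "cball 0 (sqrt x) \<subseteq> ball (0::complex) 1" proof
      fix t :: complex assume "t : cball 0 (sqrt x)"
      moreover have "sqrt x < 1" using 2 by simp
      ultimately have "cmod t < 1" unfolding mem_cball_0 by (rule le_less_trans)
      thus "t : ball 0 1" by simp
     qed
     show "emeasure lborel (cball (0::complex) (sqrt x)) ~= \<infinity>"
      using emeasure_lborel_cball_finite[of "0::complex" "sqrt x"] by (simp only: less_top infinity_ennreal_def)
    qed auto
    also have "... = ennreal (pi - pi * x)"
     using 2 by (simp add: emeasure_lborel_disc emeasure_cball unit_ball_vol_2 DIM_complex ennreal_minus)
    finally show ?thesis using 2 by (simp add: algebra_simps)
   next
    case 3
    hence "((%z. (cmod z)\<^sup>2) -` {x<..}) \<inter> ball (0::complex) 1 = {}" proof -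
     have "~ (x < (cmod z)^2 & cmod z < 1)" for z using 3 key[of z] real_sqrt_ge_one[of x] by linarith
     thus ?thesis by auto
    qed
    thus ?thesis using 3 by (simp add: ennreal_neg mult_nonneg_nonpos)
   qed
  qed
  also have "ennreal (1 / pi) * ennreal (pi * (1 - max 0 x)) = ennreal (1 - max 0 x)"
   by (simp flip: ennreal_mult')
  finally show ?thesis .
 qed
 show "emeasure (distr disc_area borel (%z. (cmod z)\<^sup>2)) {x<..} < \<infinity>" unfolding 1 by simp
 have "emeasure (density lborel (indicator {0<..<1})) {x<..} = emeasure lborel ({0<..<1} \<inter> {x<..})"
  by (subst emeasure_density) (auto simp flip: indicator_inter_arith)
 also have "{0<..<1} \<inter> {x<..} = {max 0 x<..<1}" by auto
 also have "emeasure lborel {max 0 x<..<1} = ennreal (1 - max 0 x)"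
  by (cases "max 0 x <= 1") (auto simp: ennreal_neg)
 finally show "emeasure (distr disc_area borel (%z. (cmod z)\<^sup>2)) {x<..}
   = emeasure (density lborel (indicator {0<..<1})) {x<..}" using 1 by simp
qed auto

section \<open>Rotation invariant measures\<close>

text \<open>All that is used of a rotation invariant measure: mixed moments vanish off the diagonal, where
they equal \<open>w\<close>. A bound \<open>rho < 1\<close> makes power series converge
uniformly.\<close>

definition circular_measure :: "complex measure => real => (nat => real) => bool" where
 "circular_measure M rho w \<longleftrightarrow> finite_measure M & sets M = sets borel & 0 <= rho & (AE z in M. cmod z <= rho) &
   (ALL a b. (LINT z|M. z ^ a * cnj z ^ b) = (if a = b then of_real (w a) else 0))"

lemma nn_integral_radial_disc_area:
 assumes [measurable]: "g : borel_measurable borel"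
 shows "(\<integral>\<^sup>+z. g ((cmod z)^2) \<partial>disc_area) = (\<integral>\<^sup>+x\<in>{0<..<1}. g x \<partial>lborel)"
proof -
 have "(\<integral>\<^sup>+z. g ((cmod z)^2) \<partial>disc_area) = (\<integral>\<^sup>+x. g x \<partial>distr disc_area borel (%z. (cmod z)\<^sup>2))"
  by (subst nn_integral_distr) auto
 also have "... = (\<integral>\<^sup>+x\<in>{0<..<1}. g x \<partial>lborel)"
  unfolding distr_norm_sq_disc_area by (subst nn_integral_density) (auto simp: mult.commute)
 finally show ?thesis .
qed

lemma integral_radial_disc_area:
 fixes g :: "real => real"
 assumes [measurable]: "g : borel_measurable borel"
 shows "(LINT z|disc_area. g ((cmod z)^2)) = (LINT x:{0<..<1}|lborel. g x)"
proof -
 have "(LINT z|disc_area. g ((cmod z)^2)) = (LINT x|distr disc_area borel (%z. (cmod z)\<^sup>2). g x)"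
  by (subst integral_distr) auto
 also have "... = (LINT x|density lborel (%x. ennreal (indicator {0<..<1} x)). g x)"
  unfolding distr_norm_sq_disc_area by (simp add: ennreal_indicator)
 also have "... = (LINT x:{0<..<1}|lborel. g x)"
  unfolding set_lebesgue_integral_def by (subst integral_density) auto
 finally show ?thesis .
qed

lemma integral_disc_area_rotate:
 fixes f :: "complex => complex"
 assumes u: "cmod u = 1" and [measurable]: "f : borel_measurable borel"
 shows "(LINT z|disc_area. f (u * z)) = (LINT z|disc_area. f z)"
proof -
 have "bij_betw (%z. u * z) (ball 0 1) (ball 0 1)"
 proof (rule bij_betw_byWitness[where f' = "%z. z / u"])
  show "ALL a:ball 0 1. u * a / u = a" "ALL a:ball 0 1. u * (a / u) = a" using u by auto
 qed (use u in \<open>auto simp: norm_mult norm_divide\<close>)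
 hence "distr (density disc_area (%z. ennreal ((cmod u)^2))) borel (%z. u * z) = disc_area"
  by (intro disc_area_automorphism) (auto intro!: derivative_eq_intros)
 hence "distr disc_area borel (%z. u * z) = disc_area" by (simp add: u density_1)
 hence "(LINT z|disc_area. f z) = (LINT z|distr disc_area borel (%z. u * z). f z)" by simp
 also have "... = (LINT z|disc_area. f (u * z))" by (subst integral_distr) auto
 finally show ?thesis ..
qed

lemma circular_disc_area:
 assumes [measurable]: "kap : borel_measurable borel" and nn: "!!x. 0 <= kap x" and rho: "0 <= rho"
  and supp: "!!x. 0 < x ==> x < 1 ==> rho\<^sup>2 < x ==> kap x = 0"
  and int: "set_integrable lborel {0<..<1} kap"
 shows "circular_measure (density disc_area (%z. ennreal (kap ((cmod z)^2)))) rho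
      (%n. LINT x:{0<..<1}|lborel. x ^ n * kap x)" unfolding circular_measure_def
proof (intro conjI allI)
 let ?M = "density disc_area (%z. ennreal (kap ((cmod z)^2)))"
 have "emeasure ?M (space ?M) = (\<integral>\<^sup>+z. ennreal (kap ((cmod z)^2)) \<partial>disc_area)"
  by (subst emeasure_density) auto
 also have "... = (\<integral>\<^sup>+x\<in>{0<..<1}. ennreal (kap x) \<partial>lborel)"
  by (rule nn_integral_radial_disc_area) auto
 also have "... = (\<integral>\<^sup>+x. ennreal (norm (indicator {0<..<1} x *\<^sub>R kap x)) \<partial>lborel)"
  using nn by (intro nn_integral_cong) (auto split: split_indicator)
 also have "... < \<infinity>"
  using int unfolding set_integrable_def by (simp add: integrable_iff_bounded)
 finally show "finite_measure ?M" by (intro finite_measureI) auto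
 show "sets ?M = sets borel" by simp
 show "AE z in ?M. cmod z <= rho" proof (subst AE_density)
  show "AE z in disc_area. 0 < ennreal (kap ((cmod z)^2)) --> cmod z <= rho" using AE_disc_area
  proof eventually_elim
   case (elim z)
   show ?case proof (intro impI, rule ccontr)
    assume *: "0 < ennreal (kap ((cmod z)^2))" "~ cmod z <= rho"
    hence "rho\<^sup>2 < (cmod z)^2" "0 < (cmod z)^2" using rho by (auto intro!: power_strict_mono)
    moreover have "(cmod z)\<^sup>2 < 1" using elim by (simp add: power_less_one_iff)
    ultimately show False using supp * by auto
   qed
  qed
 qed auto
 fix a b :: nat
 let ?f = "%z. kap ((cmod z)^2) *\<^sub>R (z ^ a * cnj z ^ b)"
 have mm: "(%z::complex. z ^ a * cnj z ^ b) : borel_measurable disc_area"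
  unfolding measurable_cong_sets[OF sets_disc_area refl]
  by (intro borel_measurable_continuous_onI continuous_intros)
 have m[measurable]: "?f : borel_measurable borel"
  by (intro borel_measurable_scaleR) (measurable, intro borel_measurable_continuous_onI continuous_intros)
 have eq: "(LINT z|?M. z ^ a * cnj z ^ b) = (LINT z|disc_area. ?f z)" by (subst integral_density)
    (auto simp: nn mm)
 show "(LINT z|?M. z ^ a * cnj z ^ b) = (if a = b then of_real (LINT x:{0<..<1}|lborel. x ^ a * kap x) else 0)"
 proof (cases "a = b")
  case True
  have "(LINT z|disc_area. ?f z) = (LINT z|disc_area. complex_of_real (((cmod z)^2) ^ a * kap ((cmod z)^2)))"
   using True by (intro Bochner_Integration.integral_cong)
    (auto simp: scaleR_conv_of_real complex_norm_square[symmetric] simp flip: power_mult_distrib)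
  also have "... = of_real (LINT x:{0<..<1}|lborel. x ^ a * kap x)"
   unfolding integral_complex_of_real by (subst integral_radial_disc_area) auto
  finally show ?thesis using eq True by simp
 next
  case False
  define u where "u = cis (pi / (real a - real b))"
  have u: "cmod u = 1" by (simp add: u_def)
  have ua: "u ^ a * cnj u ^ b = -1" proof -
   have "u ^ a * cnj u ^ b = cis (real a * (pi / (real a - real b)) - real b * (pi / (real a - real b)))"
    unfolding u_def cis_cnj by (simp add: Complex.DeMoivre cis_mult)
   also have "real a * (pi / (real a - real b)) - real b * (pi / (real a - real b)) = pi" proof -
    have "real a * (pi / (real a - real b)) - real b * (pi / (real a - real b))
      = (real a - real b) * (pi / (real a - real b))" by (rule left_diff_distrib[symmetric])
    thus ?thesis using False by simp
   qed
   finally show ?thesis by simp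
  qed
  have "(LINT z|disc_area. ?f z) = (LINT z|disc_area. ?f (u * z))"
   by (rule integral_disc_area_rotate[symmetric, OF u m])
  also have "... = (LINT z|disc_area. - ?f z)" proof (intro Bochner_Integration.integral_cong refl)
   fix z
   have "(u * z) ^ a * cnj (u * z) ^ b = (u ^ a * cnj u ^ b) * (z ^ a * cnj z ^ b)"
    by (simp add: power_mult_distrib mult_ac)
   thus "?f (u * z) = - ?f z" using ua by (simp add: norm_mult u)
  qed
  also have "... = - (LINT z|disc_area. ?f z)" by simp
  finally have "(LINT z|disc_area. ?f z) = 0" by simp
  thus ?thesis using eq False by simp
 qed
qed (use rho in auto)

text \<open>Termwise integration of a power series against a finite measure.\<close>

lemma integral_power_series:
 fixes c :: "nat => complex" and h :: "complex => complex"
 assumes M: "finite_measure M" "sets M = sets borel" "AE z in M. cmod z <= rho" "0 <= rho"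
  and h[measurable]: "h : borel_measurable borel" and hb: "AE z in M. cmod (h z) <= C"
  and c: "summable (%n. cmod (c n) * rho ^ n)"
 shows "integrable M (%z. h z * (\<Sum>n. c n * z ^ n))"
  and "(%n. c n * (LINT z|M. h z * z ^ n)) sums (LINT z|M. h z * (\<Sum>n. c n * z ^ n))"
proof -
 interpret finite_measure M by fact
 have [measurable_cong]: "sets M = sets borel" by fact
 let ?C = "max 0 C"
 let ?f = "%n z. h z * (c n * z ^ n)"
 have bd: "AE z in M. ALL n. norm (?f n z) <= ?C * (cmod (c n) * rho ^ n)" using M(3) hb
 proof eventually_elim
  case (elim z)
  show ?case proof
   fix n
   have "cmod z ^ n <= rho ^ n" using elim(1) by (intro power_mono) auto
   moreover have "cmod (h z) <= ?C" using elim(2) by simp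
   ultimately show "norm (?f n z) <= ?C * (cmod (c n) * rho ^ n)"
    by (simp add: norm_mult norm_power mult_mono mult_left_mono M(4))
  qed
 qed
 have int: "integrable M (?f n)" for n
  by (rule integrable_const_bound[where B = "?C * (cmod (c n) * rho ^ n)"])
    (use bd in \<open>auto elim: eventually_mono\<close>)
 have s: "summable (%n. ?C * (cmod (c n) * rho ^ n))" using c by (rule summable_mult)
 have s1: "AE z in M. summable (%n. norm (?f n z))"
  using bd by eventually_elim (rule summable_comparison_test[OF _ s], auto)
 have s2: "summable (%n. LINT z|M. norm (?f n z))"
 proof (rule summable_comparison_test[OF _ summable_mult2[OF s, of "measure M (space M)"]])
  have "norm (LINT z|M. norm (?f n z)) <= ?C * (cmod (c n) * rho ^ n) * measure M (space M)" for n
  proof -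
   have "(LINT z|M. norm (?f n z)) <= (LINT z|M. ?C * (cmod (c n) * rho ^ n))"
    by (rule integral_mono_AE) (use bd int in \<open>auto elim: eventually_mono\<close>)
   moreover have "0 <= (LINT z|M. norm (?f n z))" by (rule integral_nonneg_AE) auto
   ultimately show ?thesis by (simp add: mult_ac)
  qed
  thus "EX N. ALL n>=N. norm (LINT z|M. norm (?f n z)) <= ?C * (cmod (c n) * rho ^ n) * measure M (space M)"
   by blast
 qed
 have e: "AE z in M. (\<Sum>n. ?f n z) = h z * (\<Sum>n. c n * z ^ n)" using M(3)
 proof eventually_elim
  case (elim z)
  have "summable (%n. c n * z ^ n)"
  proof (rule summable_norm_cancel, rule summable_comparison_test[OF _ c])
   have "cmod z ^ n <= rho ^ n" for n using elim by (intro power_mono) auto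
   thus "EX N. ALL n>=N. norm (norm (c n * z ^ n)) <= cmod (c n) * rho ^ n"
    by (auto simp: norm_mult norm_power mult_left_mono)
  qed
  thus ?case by (rule suminf_mult)
 qed
 have m: "(%z. \<Sum>n. ?f n z) : borel_measurable M" by measurable
 have m': "(%z. h z * (\<Sum>n. c n * z ^ n)) : borel_measurable M" by measurable
 have i1: "integrable M (%z. \<Sum>n. ?f n z)" by (rule integrable_suminf[OF int s1 s2])
 thus "integrable M (%z. h z * (\<Sum>n. c n * z ^ n))" using integrable_cong_AE[OF m m' e] by simp
 have "(%n. integral\<^sup>L M (?f n)) sums (LINT z|M. (\<Sum>n. ?f n z))" by (rule sums_integral[OF int s1 s2])
 also have "(LINT z|M. (\<Sum>n. ?f n z)) = (LINT z|M. h z * (\<Sum>n. c n * z ^ n))"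
  by (rule integral_cong_AE[OF m m' e])
 also have "(%n. integral\<^sup>L M (?f n)) = (%n. c n * (LINT z|M. h z * z ^ n))"
  by (simp add: mult.left_commute)
 finally show "(%n. c n * (LINT z|M. h z * z ^ n)) sums (LINT z|M. h z * (\<Sum>n. c n * z ^ n))" .
qed

lemma circular_measure_bound:
 assumes "circular_measure M rho w"
 shows "AE z in M. cmod (z ^ a * cnj z ^ b) <= rho ^ (a + b)"
proof -
 have "AE z in M. cmod z <= rho" using assms by (simp add: circular_measure_def)
 thus ?thesis proof eventually_elim
  case (elim z)
  have "cmod z ^ (a + b) <= rho ^ (a + b)" using elim by (intro power_mono) auto
  thus ?case by (simp add: norm_mult norm_power power_add)
 qed
qed

lemma circular_integral_series:
 fixes c :: "nat => complex"
 assumes M: "circular_measure M rho w" and c: "summable (%n. cmod (c n) * rho ^ n)"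
 shows "integrable M (%z. z ^ a * cnj z ^ b * (\<Sum>n. c n * z ^ n))"
  and "(LINT z|M. z ^ a * cnj z ^ b * (\<Sum>n. c n * z ^ n)) = (if a <= b then c (b - a) * of_real (w b) else 0)"
proof -
 have M': "finite_measure M" "sets M = sets borel" "AE z in M. cmod z <= rho" "0 <= rho"
  using M by (auto simp: circular_measure_def)
 have m: "(%z::complex. z ^ a * cnj z ^ b) : borel_measurable borel"
  by (auto intro!: borel_measurable_continuous_onI continuous_intros)
 note * = integral_power_series[OF M' m circular_measure_bound[OF M] c]
 show "integrable M (%z. z ^ a * cnj z ^ b * (\<Sum>n. c n * z ^ n))" by (rule *(1))
 have "(LINT z|M. z ^ a * cnj z ^ b * z ^ n) = (if a + n = b then of_real (w b) else 0)" for n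
 proof -
  have "(LINT z|M. z ^ a * cnj z ^ b * z ^ n) = (LINT z|M. z ^ (a + n) * cnj z ^ b)"
   by (simp add: power_add mult_ac)
  thus ?thesis using M by (simp add: circular_measure_def)
 qed
 hence "(%n. c n * (LINT z|M. z ^ a * cnj z ^ b * z ^ n))
   = (%n. if n = b - a then (if a <= b then c n * of_real (w b) else 0) else 0)"
  by (auto simp: fun_eq_iff)
 with *(2) have "(%n. if n = b - a then (if a <= b then c n * of_real (w b) else 0) else 0) sums
   (LINT z|M. z ^ a * cnj z ^ b * (\<Sum>n. c n * z ^ n))" by simp
 moreover have "(%n. if n = b - a then (if a <= b then c n * of_real (w b) else 0) else 0) sums
   (if a <= b then c (b - a) * of_real (w b) else 0)"
  using sums_single[of "b - a" "%n. if a <= b then c n * of_real (w b) else 0"] by simp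
 ultimately show "(LINT z|M. z ^ a * cnj z ^ b * (\<Sum>n. c n * z ^ n)) = (if a <= b then c (b - a) * of_real (w b) else 0)"
  using sums_unique2 by blast
qed

lemma cnj_suminf:
 fixes f :: "nat => complex"
 assumes "summable f" shows "cnj (\<Sum>n. f n) = (\<Sum>n. cnj (f n))"
 using bounded_linear.suminf[OF bounded_linear_cnj assms] .

lemma summable_of_bound:
 fixes c :: "nat => complex"
 assumes "summable (%n. cmod (c n) * rho ^ n)" "cmod z <= rho"
 shows "summable (%n. c n * z ^ n)"
proof (rule summable_norm_cancel, rule summable_comparison_test[OF _ assms(1)])
 have "cmod z ^ n <= rho ^ n" for n using assms by (intro power_mono) auto
 thus "EX N. ALL n>=N. norm (norm (c n * z ^ n)) <= cmod (c n) * rho ^ n"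
  by (auto simp: norm_mult norm_power mult_left_mono)
qed

lemma circular_integral_cnj_series:
 fixes c :: "nat => complex"
 assumes M: "circular_measure M rho w" and c: "summable (%n. cmod (c n) * rho ^ n)"
 shows "integrable M (%z. z ^ a * cnj z ^ b * (\<Sum>n. c n * cnj z ^ n))"
  and "(LINT z|M. z ^ a * cnj z ^ b * (\<Sum>n. c n * cnj z ^ n)) = (if b <= a then c (a - b) * of_real (w a) else 0)"
proof -
 have c': "summable (%n. cmod (cnj (c n)) * rho ^ n)" using c by simp
 have [measurable_cong]: "sets M = sets borel" using M by (auto simp: circular_measure_def)
 note * = circular_integral_series[OF M c', of b a]
 let ?f = "%z. cnj (z ^ b * cnj z ^ a * (\<Sum>n. cnj (c n) * z ^ n))"
 let ?g = "%z. z ^ a * cnj z ^ b * (\<Sum>n. c n * cnj z ^ n)"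
 have cm: "(%z::complex. cnj z) : borel_measurable borel"
  by (intro borel_measurable_continuous_onI continuous_intros)
 have AE: "AE z in M. ?f z = ?g z" proof -
  have "AE z in M. cmod z <= rho" using M by (simp add: circular_measure_def)
  thus ?thesis proof eventually_elim
   case (elim z)
   show ?case using summable_of_bound[OF c' elim] by (simp add: cnj_suminf mult_ac)
  qed
 qed
 have mf: "?f : borel_measurable M"
  using borel_measurable_integrable[OF *(1)] measurable_compose[OF _ cm] by blast
 have mg: "?g : borel_measurable M" using measurable_compose[OF _ cm, of "%z. z" M] by measurable
 have fi: "integrable M ?f" using *(1) by (subst complex_integrable_cnj)
 thus "integrable M ?g" using integrable_cong_AE[OF mf mg AE] by simp
 have "integral\<^sup>L M ?g = integral\<^sup>L M ?f" using integral_cong_AE[OF mf mg AE] by simp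
 also have "... = cnj (LINT z|M. z ^ b * cnj z ^ a * (\<Sum>n. cnj (c n) * z ^ n))"
  by (rule Bochner_Integration.integral_cnj)
 finally show "integral\<^sup>L M ?g = (if b <= a then c (a - b) * of_real (w a) else 0)"
  by (simp add: *(2))
qed

lemma circular_integral_product:
 fixes c d :: "nat => complex"
 assumes M: "circular_measure M rho w" and c: "summable (%n. cmod (c n) * rho ^ n)"
  and d: "summable (%n. cmod (d n) * rho ^ n)"
 shows "(%n. c n * d n * of_real (w n)) sums (LINT z|M. (\<Sum>n. d n * cnj z ^ n) * (\<Sum>n. c n * z ^ n))"
proof -
 have M': "finite_measure M" "sets M = sets borel" "AE z in M. cmod z <= rho" "0 <= rho"
  using M by (auto simp: circular_measure_def)
 have cm: "(%z::complex. cnj z) : borel_measurable borel"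
  by (intro borel_measurable_continuous_onI continuous_intros)
 have [measurable]: "(%z::complex. \<Sum>n. d n * cnj z ^ n) : borel_measurable borel"
  using measurable_compose[OF _ cm, of "%z. z"] by measurable
 have "AE z in M. cmod (\<Sum>n. d n * cnj z ^ n) <= (\<Sum>n. cmod (d n) * rho ^ n)" using M'(3)
 proof eventually_elim
  case (elim z)
  have le: "norm (d n * cnj z ^ n) <= cmod (d n) * rho ^ n" for n
   using elim by (auto simp: norm_mult norm_power intro!: mult_left_mono power_mono)
  have s: "summable (%n. norm (d n * cnj z ^ n))"
   by (rule summable_comparison_test[OF _ d]) (use le in auto)
  have "cmod (\<Sum>n. d n * cnj z ^ n) <= (\<Sum>n. norm (d n * cnj z ^ n))"
   by (rule summable_norm[OF s])
  also have "... <= (\<Sum>n. cmod (d n) * rho ^ n)" by (rule suminf_le[OF le s d])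
  finally show ?case .
 qed
 note * = integral_power_series(2)[OF M' _ this c]
 have "(LINT z|M. (\<Sum>n. d n * cnj z ^ n) * z ^ n) = d n * of_real (w n)" for n
 proof -
  have "(LINT z|M. (\<Sum>n. d n * cnj z ^ n) * z ^ n) = (LINT z|M. z ^ n * cnj z ^ 0 * (\<Sum>n. d n * cnj z ^ n))"
   by (simp add: mult.commute)
  thus ?thesis using circular_integral_cnj_series(2)[OF M d, of n 0] by simp
 qed
 hence "(%n. c n * (LINT z|M. (\<Sum>n. d n * cnj z ^ n) * z ^ n)) = (%n. c n * d n * of_real (w n))"
  by (simp add: mult.assoc)
 with * show ?thesis by simp
qed

section \<open>Quadratic forms of polynomials\<close>

definition quad_form :: "(nat => nat => complex) => complex poly => complex" where
 "quad_form A f = (SUM j<=degree f. SUM l<=degree f. coeff f j * cnj (coeff f l) * A j l)"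

lemma poly_as_sum_le:
 fixes p :: "complex poly"
 assumes "degree p <= N" shows "poly p z = (SUM j<=N. coeff p j * z ^ j)"
proof -
 have "(SUM j<=N. coeff p j * z ^ j) = (SUM j<=degree p. coeff p j * z ^ j)"
  by (rule sum.mono_neutral_right) (use assms coeff_eq_0[of p] in auto)
 thus ?thesis by (simp add: poly_altdef)
qed

lemma cmod_poly_sq:
 assumes "degree p <= N"
 shows "complex_of_real ((cmod (poly p z))^2) =
  (SUM j<=N. SUM l<=N. coeff p j * cnj (coeff p l) * (z ^ j * cnj z ^ l))"
 unfolding complex_norm_square poly_as_sum_le[OF assms] cnj_sum sum_product
 by (intro sum.cong refl) (simp add: mult_ac)

lemma coeff_higher_pderiv_fact:
 "coeff ((pderiv ^^ k) (f::complex poly)) j = fact (j + k) / fact j * coeff f (j + k)"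
proof -
 have "fact (j + k) = (fact j * pochhammer (of_nat (Suc j)) k :: complex)"
  using pochhammer_product[of j "j + k" "1::complex"] by (simp add: pochhammer_fact[symmetric] pochhammer_of_nat)
 thus ?thesis by (simp add: coeff_higher_pderiv)
qed

lemma degree_higher_pderiv_le: "degree ((pderiv ^^ k) (f::complex poly)) <= degree f"
 by (rule degree_le) (simp add: coeff_higher_pderiv coeff_eq_0)

lemma sum_coeff_higher_pderiv:
 fixes f :: "complex poly"
 assumes "degree f <= N"
 shows "(SUM j<=N. coeff ((pderiv ^^ k) f) j * X j) =
  (SUM j<=N. coeff f j * (if k <= j then fact j / fact (j - k) * X (j - k) else 0))"
proof -
 have "(SUM j<=N. coeff f j * (if k <= j then fact j / fact (j - k) * X (j - k) else 0))
   = (SUM j:{k..N+k}. coeff f j * (if k <= j then fact j / fact (j - k) * X (j - k) else 0))"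
  by (rule sum.mono_neutral_cong) (use assms coeff_eq_0[of f] in auto)
 also have "... = (SUM j:{0..N}. coeff f (j + k) * (fact (j + k) / fact j * X j))"
  using sum.shift_bounds_cl_nat_ivl[of "%j. coeff f j * (if k <= j then fact j / fact (j - k) * X (j - k) else 0)" 0 k N]
  by simp
 also have "... = (SUM j<=N. coeff ((pderiv ^^ k) f) j * X j)"
  by (simp add: coeff_higher_pderiv_fact atLeast0AtMost mult_ac)
 finally show ?thesis ..
qed

lemma sum_sum_coeff_higher_pderiv:
 fixes f :: "complex poly"
 shows "(SUM j<=degree f. SUM l<=degree f. coeff ((pderiv ^^ k) f) j * cnj (coeff ((pderiv ^^ k) f) l) * W j l) =
  quad_form (%j l. if k <= j & k <= l then fact j / fact (j - k) * (fact l / fact (l - k)) * W (j - k) (l - k) else 0) f"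
proof -
 let ?p = "(pderiv ^^ k) f"
 have inner: "(SUM l<=degree f. cnj (coeff ?p l) * W j l) =
   (SUM l<=degree f. cnj (coeff f l) * (if k <= l then fact l / fact (l - k) * W j (l - k) else 0))" for j
 proof -
  have "cnj (SUM l<=degree f. coeff ?p l * cnj (W j l)) =
    cnj (SUM l<=degree f. coeff f l * (if k <= l then fact l / fact (l - k) * cnj (W j (l - k)) else 0))"
   by (subst sum_coeff_higher_pderiv) auto
  thus ?thesis by (simp add: cnj_sum if_distrib[of cnj] cong: if_cong)
 qed
 have "(SUM j<=degree f. SUM l<=degree f. coeff ?p j * cnj (coeff ?p l) * W j l)
   = (SUM j<=degree f. coeff ?p j * (SUM l<=degree f. cnj (coeff ?p l) * W j l))"
  by (simp add: sum_distrib_left mult.assoc)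
 also have "... = (SUM j<=degree f. coeff ?p j *
   (SUM l<=degree f. cnj (coeff f l) * (if k <= l then fact l / fact (l - k) * W j (l - k) else 0)))"
  by (simp add: inner)
 also have "... = (SUM j<=degree f. coeff f j * (if k <= j then fact j / fact (j - k) *
   (SUM l<=degree f. cnj (coeff f l) * (if k <= l then fact l / fact (l - k) * W (j - k) (l - k) else 0)) else 0))"
  by (subst sum_coeff_higher_pderiv) auto
 also have "... = quad_form (%j l. if k <= j & k <= l then fact j / fact (j - k) * (fact l / fact (l - k)) * W (j - k) (l - k) else 0) f"
  unfolding quad_form_def
  by (intro sum.cong refl) (auto simp: sum_distrib_left mult_ac intro!: sum.cong)
 finally show ?thesis .
qed

lemma [measurable]: "cnj : borel_measurable borel"
 by (intro borel_measurable_continuous_onI continuous_intros)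

lemma [measurable]: "poly (p :: complex poly) : borel_measurable borel"
 by (intro borel_measurable_continuous_onI continuous_intros)

section \<open>Dirichlet integrals of distributions\<close>

definition poisson_series :: "(int => complex) => complex => complex" where
 "poisson_series c z = (\<Sum>k. c (int k) * z ^ k) + (\<Sum>k. c (- int (Suc k)) * cnj z ^ Suc k)"

text \<open>The growth condition under which the Poisson series converges in the open disc.\<close>

definition subexponential :: "(int => complex) => bool" where
 "subexponential c \<longleftrightarrow> (ALL rho. 0 <= rho --> rho < 1 -->
   summable (%k. cmod (c (int k)) * rho ^ k) & summable (%k. cmod (c (- int (Suc k))) * rho ^ k))"

lemma circular_integral_poisson:
 assumes M: "circular_measure M rho w" and c: "subexponential c" and rho: "rho < 1"
 shows "integrable M (%z. z ^ a * cnj z ^ b * poisson_series c z)"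
  and "(LINT z|M. z ^ a * cnj z ^ b * poisson_series c z) = c (int b - int a) * of_real (w (max a b))"
proof -
 have rho0: "0 <= rho" using M by (simp add: circular_measure_def)
 have s: "summable (%k. cmod (c (int k)) * rho ^ k)" "summable (%k. cmod (c (- int (Suc k))) * rho ^ k)"
  using c rho rho0 unfolding subexponential_def by blast+
 have [measurable_cong]: "sets M = sets borel" using M by (auto simp: circular_measure_def)
 note 1 = circular_integral_series[OF M s(1), of a b]
 note 2 = circular_integral_cnj_series[OF M s(2), of a "Suc b"]
 let ?f = "%z. z ^ a * cnj z ^ b * (\<Sum>k. c (int k) * z ^ k)"
 let ?g = "%z. z ^ a * cnj z ^ Suc b * (\<Sum>k. c (- int (Suc k)) * cnj z ^ k)"
 let ?h = "%z. z ^ a * cnj z ^ b * poisson_series c z"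
 have AE: "AE z in M. ?f z + ?g z = ?h z" proof -
  have "AE z in M. cmod z <= rho" using M by (simp add: circular_measure_def)
  thus ?thesis proof eventually_elim
   case (elim z)
   have "summable (%k. c (- int (Suc k)) * cnj z ^ k)"
    using summable_of_bound[OF s(2), of "cnj z"] elim by simp
   hence "(\<Sum>k. c (- int (Suc k)) * cnj z ^ Suc k) = cnj z * (\<Sum>k. c (- int (Suc k)) * cnj z ^ k)"
    by (subst suminf_mult[symmetric]) (auto simp: mult_ac)
   thus ?case by (simp add: poisson_series_def algebra_simps)
  qed
 qed
 have mh: "?h : borel_measurable M" unfolding poisson_series_def by measurable
 have i: "integrable M (%z. ?f z + ?g z)" using 1(1) 2(1) by auto
 thus "integrable M ?h" using integrable_cong_AE[OF borel_measurable_integrable[OF i] mh AE] by simp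
 have "integral\<^sup>L M ?h = (LINT z|M. ?f z + ?g z)"
  using integral_cong_AE[OF borel_measurable_integrable[OF i] mh AE] by simp
 also have "... = integral\<^sup>L M ?f + integral\<^sup>L M ?g"
  by (rule Bochner_Integration.integral_add[OF 1(1) 2(1)])
 also have "... = c (int b - int a) * of_real (w (max a b))"
  unfolding 1(2) 2(2) by (auto simp: of_nat_diff max_def Suc_diff_Suc algebra_simps)
 finally show "integral\<^sup>L M ?h = c (int b - int a) * of_real (w (max a b))" .
qed

lemma circular_integral_poly_poisson:
 assumes M: "circular_measure M rho w" and c: "subexponential c" and rho: "rho < 1" and N: "degree p <= N"
 shows "integrable M (%z. of_real ((cmod (poly p z))^2) * poisson_series c z)"
  and "(LINT z|M. of_real ((cmod (poly p z))^2) * poisson_series c z)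
   = (SUM j<=N. SUM l<=N. coeff p j * cnj (coeff p l) * (c (int l - int j) * of_real (w (max j l))))"
proof -
 have eq: "of_real ((cmod (poly p z))^2) * poisson_series c z =
   (SUM j<=N. SUM l<=N. coeff p j * cnj (coeff p l) * (z ^ j * cnj z ^ l * poisson_series c z))" for z
  unfolding cmod_poly_sq[OF N] sum_distrib_right by (simp add: mult_ac)
 note i = circular_integral_poisson[OF M c rho]
 show "integrable M (%z. of_real ((cmod (poly p z))^2) * poisson_series c z)"
  unfolding eq by (intro Bochner_Integration.integrable_sum integrable_mult_right i)
 show "(LINT z|M. of_real ((cmod (poly p z))^2) * poisson_series c z)
   = (SUM j<=N. SUM l<=N. coeff p j * cnj (coeff p l) * (c (int l - int j) * of_real (w (max j l))))"
  unfolding eq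
  by (subst Bochner_Integration.integral_sum, intro Bochner_Integration.integrable_sum integrable_mult_right i)
    (subst Bochner_Integration.integral_sum, intro integrable_mult_right i, simp add: i(2))
qed

lemma LINT_uniform_measure_interval:
 fixes g :: "real => complex"
 assumes [measurable]: "g : borel_measurable borel"
 shows "(LINT t|uniform_measure lborel {0..<2*pi}. g t) = (1 / (2*pi)) *\<^sub>R (LINT t:{0..2*pi}|lborel. g t)"
proof -
 have "uniform_measure lborel {0..<2*pi} = density lborel (%t. ennreal (indicator {0..<2*pi} t / (2*pi)))"
  unfolding uniform_measure_def
  by (intro density_cong) (auto simp: divide_ennreal simp flip: ennreal_indicator)
 hence "(LINT t|uniform_measure lborel {0..<2*pi}. g t) = (LINT t|lborel. (indicator {0..<2*pi} t / (2*pi)) *\<^sub>R g t)"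
  by (simp add: integral_density)
 also have "... = (LINT t|lborel. (1 / (2*pi)) *\<^sub>R (indicator {0..2*pi} t *\<^sub>R g t))"
 proof (rule integral_cong_AE)
  show "AE t in lborel. (indicator {0..<2*pi} t / (2*pi)) *\<^sub>R g t = (1 / (2*pi)) *\<^sub>R (indicator {0..2*pi} t *\<^sub>R g t)"
   using AE_lborel_singleton[of "2*pi"] by eventually_elim (auto split: split_indicator)
 qed auto
 also have "... = (1 / (2*pi)) *\<^sub>R (LINT t|lborel. indicator {0..2*pi} t *\<^sub>R g t)"
  by (rule integral_scaleR_right)
 finally show ?thesis unfolding set_lebesgue_integral_def .
qed

lemma integral_cis_int:
 "(LINT t:{0..2*pi}|lborel. cis (of_int n * t)) = (if n = 0 then 2 * pi else 0)"
proof (cases "n = 0")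
 case True
 have "(LINT t:{0..2*pi}|lborel. cis (of_int n * t)) = (LINT t:{0..2*pi}|lborel. (1::complex))"
  using True by simp
 also have "... = measure lborel {0..2*pi} *\<^sub>R 1" by (rule set_integral_const) auto
 finally show ?thesis using True by (simp add: scaleR_conv_of_real)
next
 case False
 have d: "((%t. cis (of_int n * t) / (\<i> * of_int n)) has_vector_derivative cis (of_int n * t)) (at t within {0..2*pi})" for t
 proof -
  have "((%t. cis (of_int n * t)) has_derivative (%h. (of_int n * h) *\<^sub>R (\<i> * cis (of_int n * t)))) (at t)"
   by (rule has_derivative_cis) (auto intro!: derivative_eq_intros)
  hence "((%t. cis (of_int n * t)) has_vector_derivative (of_int n * \<i> * cis (of_int n * t))) (at t)"
   unfolding has_vector_derivative_def by (simp add: scaleR_conv_of_real mult_ac)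
  hence "((%t. cis (of_int n * t) / (\<i> * of_int n)) has_vector_derivative (of_int n * \<i> * cis (of_int n * t)) / (\<i> * of_int n)) (at t)"
   by (rule has_vector_derivative_divide)
  thus ?thesis using False by (auto intro: has_vector_derivative_at_within)
 qed
 have "(LINT t:{0..2*pi}|lborel. cis (of_int n * t)) =
   cis (of_int n * (2*pi)) / (\<i> * of_int n) - cis (of_int n * 0) / (\<i> * of_int n)"
  unfolding set_lebesgue_integral_def
  by (rule integral_FTC_atLeastAtMost[where F = "%t. cis (of_int n * t) / (\<i> * of_int n)"])
    (use d in \<open>auto intro!: continuous_intros\<close>)
 also have "cis (of_int n * (2*pi)) = 1" using cis_multiple_2pi[of "of_int n"] by (simp add: mult_ac)
 finally show ?thesis using False by simp
qed

lemma circular_arc_measure: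
 assumes r: "0 <= r"
 shows "circular_measure (distr arc_measure borel (%z. of_real r * z)) r (%n. r ^ (2 * n))"
proof -
 have p: "prob_space (uniform_measure lborel {0..<2*pi})" by (rule prob_space_uniform_measure) auto
 then interpret prob_space "uniform_measure lborel {0..<2*pi}" .
 have cism[measurable]: "cis : borel_measurable borel"
  by (intro borel_measurable_continuous_onI continuous_intros)
 have eq: "distr arc_measure borel (%z. of_real r * z) = distr (uniform_measure lborel {0..<2*pi}) borel (%t. of_real r * cis t)"
  unfolding arc_measure_def by (subst distr_distr) (auto simp: o_def)
 show ?thesis unfolding eq circular_measure_def
 proof (intro conjI allI)
  show "finite_measure (distr (uniform_measure lborel {0..<2*pi}) borel (%t. of_real r * cis t))"
   by (rule finite_measure_distr) simp
  show "AE z in distr (uniform_measure lborel {0..<2*pi}) borel (%t. complex_of_real r * cis t). cmod z <= r"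
   using r by (subst AE_distr_iff) (auto simp: norm_mult)
  fix a b
  have "(LINT z|distr (uniform_measure lborel {0..<2*pi}) borel (%t. of_real r * cis t). z ^ a * cnj z ^ b)
    = (LINT t|uniform_measure lborel {0..<2*pi}. of_real (r ^ (a + b)) * cis (of_int (int a - int b) * t))"
   by (subst integral_distr)
     (auto simp: power_mult_distrib cis_cnj Complex.DeMoivre cis_mult power_add algebra_simps intro!: Bochner_Integration.integral_cong)
  also have "... = of_real (r ^ (a + b)) * (1 / (2*pi)) *\<^sub>R (LINT t:{0..2*pi}|lborel. cis (of_int (int a - int b) * t))"
   by (subst integral_mult_right_zero, subst LINT_uniform_measure_interval) auto
  also have "... = (if a = b then of_real (r ^ (2 * a)) else 0)" proof (cases "a = b")
   case True
   have I: "(LINT t:{0..2*pi}|lborel. cis (of_int (int a - int b) * t)) = of_real (2 * pi)"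
    unfolding integral_cis_int using True by (simp only: diff_self refl if_True)
   have e: "r ^ (a + b) = r ^ (2 * a)" unfolding True mult_2 ..
   have "(1 / (2*pi)) *\<^sub>R complex_of_real (2 * pi) = 1" by (simp add: scaleR_conv_of_real)
   thus ?thesis unfolding I e using True by (simp only: mult_1_right if_True refl)
  next
   case False
   have I: "(LINT t:{0..2*pi}|lborel. cis (of_int (int a - int b) * t)) = 0"
    unfolding integral_cis_int using False by simp
   show ?thesis unfolding I using False by simp
  qed
  finally show "(LINT z|distr (uniform_measure lborel {0..<2*pi}) borel (%t. of_real r * cis t). z ^ a * cnj z ^ b)
    = (if a = b then of_real (r ^ (2 * a)) else 0)" .
 qed (use r in auto)
qed

lemma LINT_beta:
 "set_integrable lborel {0<..<1::real} (%x. x ^ n * (1 - x) ^ k)"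
 "(LINT x:{0<..<1}|lborel. x ^ n * (1 - x) ^ k) = fact n * fact k / (fact (n + k + 1) :: real)"
proof -
 have si: "set_integrable lborel {0..1::real} (%x. x ^ n * (1 - x) ^ k)"
  by (rule borel_integrable_atLeastAtMost') (intro continuous_intros)
 thus "set_integrable lborel {0<..<1::real} (%x. x ^ n * (1 - x) ^ k)"
  by (rule set_integrable_subset) auto
 have "((%t. t powr (real (n + 1) - 1) * (1 - t) powr (real (k + 1) - 1)) has_integral Beta (real (n + 1)) (real (k + 1))) {0..1}"
  by (rule has_integral_Beta_real) auto
 hence "((%t. t powr (real (n + 1) - 1) * (1 - t) powr (real (k + 1) - 1)) has_integral Beta (real (n + 1)) (real (k + 1))) {0<..<1}"
  by (simp add: has_integral_Icc_iff_Ioo)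
 hence "((%t. t ^ n * (1 - t) ^ k) has_integral Beta (real (n + 1)) (real (k + 1))) {0<..<1}"
  by (rule has_integral_eq[rotated]) (auto simp: powr_realpow)
 moreover have "Beta (real (n + 1)) (real (k + 1)) = fact n * fact k / (fact (n + k + 1) :: real)"
 proof -
  have "Gamma (real (n + 1) + real (k + 1)) = fact (n + k + 1)"
   using Gamma_fact[of "n + k + 1", where 'a = real] by (simp add: add_ac)
  thus ?thesis
   using Gamma_fact[of n, where 'a = real] Gamma_fact[of k, where 'a = real] by (simp add: Beta_def add_ac)
 qed
 moreover have "set_integrable lborel {0<..<1::real} (%x. x ^ n * (1 - x) ^ k)"
  by (rule set_integrable_subset[OF si]) auto
 ultimately show "(LINT x:{0<..<1}|lborel. x ^ n * (1 - x) ^ k) = fact n * fact k / (fact (n + k + 1) :: real)"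
  using set_borel_integral_eq_integral(2)[of "{0<..<1::real}" "%x. x ^ n * (1 - x) ^ k"] integral_unique by metis
qed

text \<open>Moments of the weight \<open>(1 - |z|^2)^k\<close> on the disc of radius \<open>r\<close>; they
tend to values of the beta function as \<open>r\<close> tends to \<open>1\<close>.\<close>

definition beta_part :: "real => nat => nat => real" where
 "beta_part r k n = (LINT x:{0<..<1}|lborel. x ^ n * (indicator {..<r\<^sup>2} x * (1 - x) ^ k))"

lemma beta_part_tendsto: "((%r. beta_part r k n) \<longlongrightarrow> fact n * fact k / fact (n + k + 1)) (at_left 1)"
proof -
 let ?L = "fact n * fact k / fact (n + k + 1) :: real"
 have bd: "\<bar>beta_part r k n - ?L\<bar> <= 1 - r\<^sup>2" if r: "0 < r" "r < 1" for r
 proof -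
  have i1: "set_integrable lborel {0<..<1} (%x::real. x ^ n * (1 - x) ^ k)" by (rule LINT_beta)
  have i2: "set_integrable lborel {0<..<1} (%x::real. x ^ n * (indicator {..<r\<^sup>2} x * (1 - x) ^ k))"
   by (rule set_integrable_bound[OF i1]) (auto simp: set_borel_measurable_def split: split_indicator)
  have r2: "r\<^sup>2 < 1" "0 < r\<^sup>2" using r by (simp_all add: power_less_one_iff)
  hence pos: "r\<^sup>2 <= x ==> 0 < x" for x by linarith
  hence ind: "(%x. indicat_real {0<..<1} x *\<^sub>R indicat_real {r\<^sup>2..<1} x) = indicat_real {r\<^sup>2..<1}"
   by (intro ext) (auto split: split_indicator)
  have "?L - beta_part r k n = (LINT x:{0<..<1}|lborel. x ^ n * (1 - x) ^ k - x ^ n * (indicator {..<r\<^sup>2} x * (1 - x) ^ k))"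
   unfolding beta_part_def LINT_beta(2)[symmetric] by (rule set_integral_diff(2)[OF i1 i2, symmetric])
  also have "\<bar>...\<bar> <= (LINT x:{0<..<1}|lborel. indicator {r\<^sup>2..<1} x)"
   unfolding set_lebesgue_integral_def real_norm_def[symmetric]
  proof (rule order_trans[OF integral_norm_bound], rule integral_mono[OF integrable_norm])
   show "integrable lborel (%x::real. indicat_real {0<..<1} x *\<^sub>R indicat_real {r\<^sup>2..<1} x)"
    unfolding ind using emeasure_lborel_Ico[of "r\<^sup>2" 1] r2(1) by (intro integrable_real_indicator) auto
   show "integrable lborel (%x. indicat_real {0<..<1} x *\<^sub>R (x ^ n * (1 - x) ^ k - x ^ n * (indicat_real {..<r\<^sup>2} x * (1 - x) ^ k)))"
    using set_integral_diff(1)[OF i1 i2] by (simp add: set_integrable_def)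
   fix x :: real
   show "norm (indicat_real {0<..<1} x *\<^sub>R (x ^ n * (1 - x) ^ k - x ^ n * (indicat_real {..<r\<^sup>2} x * (1 - x) ^ k)))
      <= indicat_real {0<..<1} x *\<^sub>R indicat_real {r\<^sup>2..<1} x"
    by (auto simp: abs_mult power_abs mult_le_one power_le_one split: split_indicator)
  qed
  also have "... = measure lborel {r\<^sup>2..<1}" proof -
   show ?thesis unfolding set_lebesgue_integral_def ind by simp
  qed
  finally show ?thesis using r2 by (simp add: abs_minus_commute)
 qed
 have "((%r. 1 - r\<^sup>2 :: real) \<longlongrightarrow> 1 - 1\<^sup>2) (at_left 1)" by (intro tendsto_intros)
 hence z: "((%r. 1 - r\<^sup>2 :: real) \<longlongrightarrow> 0) (at_left 1)" by simp
 have "((%r. \<bar>beta_part r k n - ?L\<bar>) \<longlongrightarrow> 0) (at_left 1)"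
 proof (rule tendsto_sandwich[OF _ _ tendsto_const z])
  show "\<forall>\<^sub>F r in at_left 1. \<bar>beta_part r k n - ?L\<bar> <= 1 - r\<^sup>2"
   using eventually_at_left_real[of 0 "1::real", OF zero_less_one] by eventually_elim (rule bd, auto)
 qed auto
 hence "((%r. beta_part r k n - ?L) \<longlongrightarrow> 0) (at_left 1)"
  by (rule tendsto_rabs_zero_cancel)
 thus ?thesis by (simp add: LIM_zero_iff)
qed

lemma circular_beta_part:
 assumes "0 <= r"
 shows "circular_measure (density disc_area (%z. ennreal (indicator {..<r\<^sup>2} ((cmod z)^2) * (max 0 (1 - (cmod z)\<^sup>2)) ^ k))) r (beta_part r k)"
proof -
 let ?k = "%x::real. indicator {..<r\<^sup>2} x * (max 0 (1 - x)) ^ k :: real"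
 have si: "set_integrable lborel {0<..<1} ?k" by (rule set_integrable_bound[OF LINT_beta(1)[of 0 0]])
    (auto simp: set_borel_measurable_def power_le_one split: split_indicator)
 have "circular_measure (density disc_area (%z. ennreal (?k ((cmod z)^2)))) r (%n. LINT x:{0<..<1}|lborel. x ^ n * ?k x)"
  by (rule circular_disc_area) (use assms si in auto)
 also have "(%n. LINT x:{0<..<1}|lborel. x ^ n * ?k x) = beta_part r k" unfolding beta_part_def
  by (intro ext set_lebesgue_integral_cong) (auto split: split_indicator)
 finally show ?thesis .
qed

lemma integral_beta_part:
 fixes f :: "complex => complex"
 assumes f[measurable]: "f : borel_measurable borel" and r: "0 <= r" "r <= 1"
 shows "(LINT z:ball 0 r|area_measure. f z * of_real ((1 - (cmod z)\<^sup>2) ^ k)) =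
  (LINT z|density disc_area (%z. ennreal (indicator {..<r\<^sup>2} ((cmod z)^2) * (max 0 (1 - (cmod z)\<^sup>2)) ^ k)). f z)"
proof -
 have "(LINT z|density disc_area (%z. ennreal (indicator {..<r\<^sup>2} ((cmod z)^2) * (max 0 (1 - (cmod z)\<^sup>2)) ^ k)). f z)
   = (LINT z|disc_area. (indicator {..<r\<^sup>2} ((cmod z)^2) * (max 0 (1 - (cmod z)\<^sup>2)) ^ k) *\<^sub>R f z)"
  by (subst integral_density) auto
 also have "... = (LINT z|disc_area. indicator (ball 0 r) z *\<^sub>R (f z * of_real ((1 - (cmod z)\<^sup>2) ^ k)))"
 proof (rule integral_cong_AE)
  have "cmod z < r \<longleftrightarrow> (cmod z)\<^sup>2 < r\<^sup>2" for z
   using r by (metis norm_ge_zero power_strict_mono power2_less_imp_less zero_less_numeral)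
  moreover have "cmod z < 1 ==> max 0 (1 - (cmod z)\<^sup>2) = 1 - (cmod z)\<^sup>2" for z
   using power_le_one[of "cmod z" 2] by simp
  ultimately show "AE z in disc_area. (indicator {..<r\<^sup>2} ((cmod z)^2) * (max 0 (1 - (cmod z)\<^sup>2)) ^ k) *\<^sub>R f z
    = indicator (ball 0 r) z *\<^sub>R (f z * of_real ((1 - (cmod z)\<^sup>2) ^ k))"
   using AE_disc_area by (auto simp: scaleR_conv_of_real indicator_def elim!: eventually_mono)
  have [measurable]: "(%x::complex. complex_of_real ((1 - (cmod x)\<^sup>2) ^ k)) : borel_measurable borel"
   by (intro borel_measurable_continuous_onI continuous_intros)
  show "(%z. indicator (ball 0 r) z *\<^sub>R (f z * of_real ((1 - (cmod z)\<^sup>2) ^ k))) : borel_measurable disc_area"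
   by (intro borel_measurable_scaleR borel_measurable_indicator borel_measurable_times) auto
 qed auto
 also have "... = (LINT z:ball 0 r|area_measure. f z * of_real ((1 - (cmod z)\<^sup>2) ^ k))"
  by (rule integral_area_measure_ball[symmetric]) (use r in auto)
 finally show ?thesis ..
qed

lemma fact_binomial_max_min:
 assumes "k <= j" "k <= l" "0 < k"
 shows "fact j / fact (j - k) * (fact l / fact (l - k)) * (fact (max j l - k) * fact (k - 1) / fact (max j l))
   / (fact k * fact (k - 1)) = (of_nat (min j l choose k) :: complex)"
proof (cases "j <= l")
 case True
 thus ?thesis using assms by (simp add: binomial_fact max_def min_def)
next
 case False
 thus ?thesis using assms by (simp add: binomial_fact max_def min_def)
qed

text \<open>On the disc of radius \<open>r\<close> the Poisson series is integrated termwise. A factor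
\<open>z^j cnj z^l\<close> meets only the coefficient of index \<open>l - j\<close>, and its
integral contains \<open>max j l\<close>. In the limit the beta values combine with the factorials
of the derivatives to \<open>min j l choose k\<close>.\<close>

lemma dirichlet_dist_eq_quad_form:
 assumes c: "subexponential (fourier_coeff mu)"
 shows "dirichlet_dist mu k f = quad_form (%j l. of_nat (min j l choose k) * fourier_coeff mu (int l - int j)) f"
proof -
 let ?c = "fourier_coeff mu" and ?N = "degree f"
 have P: "poisson_ext mu = poisson_series ?c"
  by (simp add: fun_eq_iff poisson_ext_def poisson_series_def)
 have Pm[measurable]: "poisson_series ?c : borel_measurable borel"
  unfolding poisson_series_def by measurable
 show ?thesis proof (cases "k = 0")
  case True
  let ?g = "%r::real. LINT u|arc_measure. of_real ((cmod (poly f (of_real r * u)))^2) * poisson_ext mu (of_real r * u)"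
  let ?h = "%r::real. (SUM j<=?N. SUM l<=?N. coeff f j * cnj (coeff f l) * (?c (int l - int j) * of_real (r ^ (2 * max j l))))"
  have eq: "?g r = ?h r" if r: "0 < r" "r < 1" for r
  proof -
   have "?g r = (LINT z|distr arc_measure borel (%z. of_real r * z). of_real ((cmod (poly f z))^2) * poisson_series ?c z)"
    unfolding P by (subst integral_distr) (auto simp: arc_measure_def)
   thus ?thesis using circular_integral_poly_poisson(2)[OF circular_arc_measure c, of r f ?N] r by simp
  qed
  have "(?h \<longlongrightarrow> (SUM j<=?N. SUM l<=?N. coeff f j * cnj (coeff f l) * (?c (int l - int j) * of_real (1 ^ (2 * max j l))))) (at_left 1)"
   by (intro tendsto_intros)
  moreover have "\<forall>\<^sub>F r in at_left 1. ?h r = ?g r"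
   using eventually_at_left_real[of 0 "1::real", OF zero_less_one] by eventually_elim (rule eq[symmetric], auto)
  ultimately have "(?g \<longlongrightarrow> (SUM j<=?N. SUM l<=?N. coeff f j * cnj (coeff f l) * (?c (int l - int j) * of_real (1 ^ (2 * max j l))))) (at_left 1)"
   by (rule Lim_transform_eventually)
  hence "(?g \<longlongrightarrow> quad_form (%j l. of_nat (min j l choose k) * ?c (int l - int j)) f) (at_left 1)"
   using True by (simp add: quad_form_def)
  thus ?thesis using True by (simp add: dirichlet_dist_def tendsto_Lim)
 next
  case False
  let ?p = "(pderiv ^^ k) f"
  let ?g = "%r::real. 1 / (fact k * fact (k - 1)) *
     (LINT z:ball 0 r|area_measure. of_real ((cmod (poly ?p z))^2) * poisson_ext mu z * of_real ((1 - (cmod z)\<^sup>2) ^ (k - 1)))"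
  let ?W = "%w j l. ?c (int l - int j) * of_real (w (max j l))"
  let ?h = "%w. 1 / (fact k * fact (k - 1)) *
    (SUM j<=?N. SUM l<=?N. coeff ?p j * cnj (coeff ?p l) * ?W w j l)"
  let ?w = "%n. fact n * fact (k - 1) / fact (n + (k - 1) + 1) :: real"
  have eq: "?g r = ?h (beta_part r (k - 1))" if r: "0 < r" "r < 1" for r
  proof -
   have "(LINT z:ball 0 r|area_measure. of_real ((cmod (poly ?p z))^2) * poisson_ext mu z * of_real ((1 - (cmod z)\<^sup>2) ^ (k - 1)))
     = (SUM j<=?N. SUM l<=?N. coeff ?p j * cnj (coeff ?p l) * ?W (beta_part r (k - 1)) j l)"
    unfolding P by (subst integral_beta_part)
      (use r circular_integral_poly_poisson(2)[OF circular_beta_part c, of r ?p ?N] degree_higher_pderiv_le in auto)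
   thus ?thesis by simp
  qed
  have "((%r. ?h (beta_part r (k - 1))) \<longlongrightarrow> ?h ?w) (at_left 1)"
   by (intro tendsto_intros beta_part_tendsto)
  moreover have "\<forall>\<^sub>F r in at_left 1. ?h (beta_part r (k - 1)) = ?g r"
   using eventually_at_left_real[of 0 "1::real", OF zero_less_one] by eventually_elim (rule eq[symmetric], auto)
  ultimately have lim: "(?g \<longlongrightarrow> ?h ?w) (at_left 1)" by (rule Lim_transform_eventually)
  have "?h ?w = quad_form (%j l. of_nat (min j l choose k) * ?c (int l - int j)) f"
   unfolding sum_sum_coeff_higher_pderiv quad_form_def sum_distrib_left
  proof (intro sum.cong refl)
   fix j l
   show "1 / (fact k * fact (k - 1)) * (coeff f j * cnj (coeff f l) * (if k <= j & k <= l then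
      fact j / fact (j - k) * (fact l / fact (l - k)) * ?W ?w (j - k) (l - k) else 0))
     = coeff f j * cnj (coeff f l) * (of_nat (min j l choose k) * ?c (int l - int j))"
   proof (cases "k <= j & k <= l")
    case True
    have m: "max (j - k) (l - k) = max j l - k" "max j l - k + (k - 1) + 1 = max j l"
      "int (l - k) - int (j - k) = int l - int j" using True False by auto
    show ?thesis using True False fact_binomial_max_min[of k j l, symmetric] unfolding m
     by (simp add: mult_ac)
   next
    case False2: False
    hence "min j l choose k = 0" by (intro binomial_eq_0) auto
    thus ?thesis using False2 by auto
   qed
  qed
  thus ?thesis using lim False by (simp add: dirichlet_dist_def tendsto_Lim)
 qed
qed

section \<open>The potential of a point in the disc\<close>

lemma negative_binomial_sums:
 fixes x :: complex
 assumes "cmod x < 1"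
 shows "(%n. of_nat ((n + k) choose k) * x ^ n) sums (1 / (1 - x) ^ (k + 1))"
proof -
 have x1: "1 - x ~= 0" using assms by auto
 have "(%n. ((- of_nat (k + 1)) gchoose n) * (- x) ^ n) sums (1 + - x) powr (- of_nat (k + 1))"
  by (rule gen_binomial_complex) (use assms in simp)
 moreover have "((- of_nat (k + 1)) gchoose n) * (- x) ^ n = of_nat ((n + k) choose k) * x ^ n" for n
 proof -
  have "((- of_nat (k + 1)) gchoose n :: complex) = (-1) ^ n * (of_nat (n + k) gchoose n)"
   by (subst gbinomial_minus) (simp add: algebra_simps)
  also have "(of_nat (n + k) gchoose n :: complex) = of_nat ((n + k) choose k)"
   unfolding binomial_gbinomial[symmetric] using binomial_symmetric[of n "n + k"] by simp
  finally have g: "((- of_nat (k + 1)) gchoose n :: complex) = (-1) ^ n * of_nat ((n + k) choose k)" .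
  have "(-1) ^ n * of_nat ((n + k) choose k) * ((-1) ^ n * x ^ n) = ((-1) ^ n * (-1) ^ n) * (of_nat ((n + k) choose k) * x ^ n)"
   by (simp only: mult_ac)
  thus ?thesis unfolding g power_minus[of x] by simp
 qed
 moreover have "(1 + - x) powr (- of_nat (k + 1)) = 1 / (1 - x) ^ (k + 1)" proof -
  have "(1 - x) powr (of_nat (k + 1)) = (1 - x) ^ (k + 1)" using x1 powr_nat'[of "1 - x" "k + 1"] by simp
  thus ?thesis unfolding powr_minus by (simp only: divide_inverse mult_1_left diff_conv_add_uminus)
 qed
 ultimately show ?thesis by simp
qed

lemma negative_binomial_sums_real:
 fixes x :: real
 assumes "\<bar>x\<bar> < 1"
 shows "(%n. of_nat ((n + k) choose k) * x ^ n) sums (1 / (1 - x) ^ (k + 1))"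
proof -
 have "(%n. complex_of_real (of_nat ((n + k) choose k) * x ^ n)) sums complex_of_real (1 / (1 - x) ^ (k + 1))"
  using negative_binomial_sums[of "of_real x" k] assms by simp
 thus ?thesis by (simp only: sums_of_real_iff)
qed

lemma summable_negative_binomial:
 assumes "0 <= x" "x < (1::real)"
 shows "summable (%n. of_nat ((n + k) choose k) * x ^ n)"
 using negative_binomial_sums_real[of x k] assms by (auto simp: sums_iff)

text \<open>The kernel at \<open>0\<close> as a function of \<open>x = |z|^2\<close>. Its derivative is
\<open>- (1 - x)^(m-1) / x^m\<close>, which gives positivity and, by partial integration, the
moments.\<close>

definition green_radial :: "nat => real => real" where
 "green_radial m x = (-1) ^ (m + 1) * (- ln x + (\<Sum>l = 1..m - 1. (-1) ^ l / real l * (1 / x - 1) ^ l))"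

lemma green_radial_deriv:
 assumes x: "0 < x" and m: "0 < m"
 shows "(green_radial m has_real_derivative - ((1 - x) ^ (m - 1) / x ^ m)) (at x)"
proof -
 let ?y = "1 / x - 1"
 have d: "((%x. (-1) ^ l / real l * (1 / x - 1) ^ l) has_real_derivative (- ((- ?y) ^ (l - 1))) * (- 1 / x\<^sup>2)) (at x)"
  if l: "l : {1..m - 1}" for l
 proof -
  have s: "(-1) ^ l * y ^ (l - 1) = - ((- y) ^ (l - 1))" for y :: real
   using l by (cases l) (simp_all add: power_minus[of y])
  have "((%x. (-1) ^ l / real l * (1 / x - 1) ^ l) has_real_derivative
    (-1) ^ l / real l * (real l * ?y ^ (l - 1) * (- 1 / x\<^sup>2))) (at x)"
   using x by (auto intro!: derivative_eq_intros simp: power2_eq_square field_simps)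
  also have "(-1) ^ l / real l * (real l * ?y ^ (l - 1) * (- 1 / x\<^sup>2)) = ((-1) ^ l * ?y ^ (l - 1)) * (- 1 / x\<^sup>2)"
   using l by simp
  finally show ?thesis unfolding s .
 qed
 have "(green_radial m has_real_derivative
   (-1) ^ (m + 1) * (- (1 / x) + (\<Sum>l = 1..m - 1. (- ((- ?y) ^ (l - 1))) * (- 1 / x\<^sup>2)))) (at x)"
  unfolding green_radial_def[abs_def]
  by (intro DERIV_cmult DERIV_add DERIV_minus DERIV_sum d) (use x in \<open>auto intro!: derivative_eq_intros\<close>)
 also have "(\<Sum>l = 1..m - 1. (- ((- ?y) ^ (l - 1))) * (- 1 / x\<^sup>2)) = (1 / x\<^sup>2) * (\<Sum>i<m - 1. (- ?y) ^ i)"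
 proof -
  have "(\<Sum>l = 1..m - 1. (- ((- ?y) ^ (l - 1))) * (- 1 / x\<^sup>2)) = (\<Sum>l = 1..m - 1. (- ?y) ^ (l - 1) / x\<^sup>2)"
   by (intro sum.cong) auto
  also have "... = (\<Sum>i<m - 1. (- ?y) ^ i / x\<^sup>2)"
   by (rule sum.reindex_bij_witness[where i = Suc and j = "%l. l - 1"]) auto
  finally show ?thesis by (simp add: sum_distrib_left)
 qed
 also have "(\<Sum>i<m - 1. (- ?y) ^ i) = x * (1 - (- ?y) ^ (m - 1))" proof -
  have "- ?y ~= 1" using x by simp
  hence "(\<Sum>i<m - 1. (- ?y) ^ i) = ((- ?y) ^ (m - 1) - 1) / (- ?y - 1)" by (rule geometric_sum)
  thus ?thesis using x by (simp add: field_simps)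
 qed
 also have "(-1) ^ (m + 1) * (- (1 / x) + 1 / x\<^sup>2 * (x * (1 - (- ?y) ^ (m - 1)))) = - ((1 - x) ^ (m - 1) / x ^ m)"
 proof -
  have "(-1) ^ (m + 1) * (- (1 / x) + 1 / x\<^sup>2 * (x * (1 - (- ?y) ^ (m - 1)))) = - ((-1) ^ (m + 1) * (- ?y) ^ (m - 1) / x)"
   using x by (simp add: field_simps power2_eq_square)
  also have "(-1) ^ (m + 1) * (- ?y) ^ (m - 1) = ?y ^ (m - 1)" proof -
   have "(-1) ^ (m + 1) * (- y) ^ (m - 1) = y ^ (m - 1)" for y :: real
    using m by (cases m) (simp_all add: power_minus[of y] flip: mult.assoc)
   thus ?thesis .
  qed
  also have "?y ^ (m - 1) / x = (1 - x) ^ (m - 1) / x ^ m" proof -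
   have "?y = (1 - x) / x" using x by (simp add: field_simps)
   thus ?thesis using m x by (cases m) (simp_all add: power_divide)
  qed
  finally show ?thesis .
 qed
 finally show ?thesis .
qed

lemma green_radial_1 [simp]: "green_radial m 1 = 0" by (auto simp: green_radial_def intro!: sum.neutral)

lemma green_radial_nonneg:
 assumes "0 < x" "x <= 1" "0 < m"
 shows "0 <= green_radial m x"
proof -
 have "green_radial m 1 <= green_radial m x" proof (rule DERIV_nonpos_imp_nonincreasing[OF assms(2)])
  fix y assume y: "x <= y" "y <= 1"
  have "- ((1 - y) ^ (m - 1) / y ^ m) <= 0" using y assms by simp
  thus "EX d. (green_radial m has_real_derivative d) (at y) & d <= 0"
   using green_radial_deriv[of y m] y assms by auto
 qed
 thus ?thesis by simp
qed

lemma [measurable]: "green_radial m : borel_measurable borel"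
 unfolding green_radial_def[abs_def] by measurable

definition radial_weight :: "nat => real => real" where
 "radial_weight m x = (if 0 < x & x < 1 then x ^ (m - 1) * green_radial m x else 0)"

lemma [measurable]: "radial_weight m : borel_measurable borel"
 unfolding radial_weight_def[abs_def] by measurable

lemma radial_weight_nonneg: "0 < m ==> 0 <= radial_weight m x"
 using green_radial_nonneg[of x m] by (auto simp: radial_weight_def)

lemma power_green_radial_tendsto_0:
 assumes "0 < m"
 shows "((%x. x ^ (n + m) * green_radial m x) \<longlongrightarrow> 0) (at_right 0)"
proof -
 have 1: "((%x::real. x ^ (n + m) * ln x) \<longlongrightarrow> 0) (at_right 0)" proof -
  have "((%x::real. x ^ (n + m - 1) * (x * ln x)) \<longlongrightarrow> 0 ^ (n + m - 1) * 0) (at_right 0)"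
  proof (intro tendsto_mult tendsto_power)
   show "((%x::real. x * ln x) \<longlongrightarrow> 0) (at_right 0)" by real_asymp
  qed (auto intro!: tendsto_eq_intros)
  moreover have "x ^ (n + m - 1) * (x * ln x) = x ^ (n + m) * ln x" for x :: real
   using assms by (cases "n + m") (auto simp: mult_ac)
  ultimately show ?thesis by (simp only: mult_zero_right)
 qed
 have 2: "((%x::real. x ^ (n + m) * ((-1) ^ l / real l * (1 / x - 1) ^ l)) \<longlongrightarrow> 0) (at_right 0)"
  if "l : {1..m - 1}" for l
 proof -
  have "((%x::real. (-1) ^ l / real l * (x ^ (n + m - l) * (1 - x) ^ l)) \<longlongrightarrow> (-1) ^ l / real l * (0 ^ (n + m - l) * (1 - 0) ^ l)) (at_right 0)"
   by (intro tendsto_intros)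
  moreover have "(-1) ^ l / real l * (0 ^ (n + m - l) * (1 - 0) ^ l) = (0::real)" proof -
   have "0 < n + m - l" using that assms by auto
   hence "(0::real) ^ (n + m - l) = 0" by (rule zero_power)
   thus ?thesis by (simp only: mult_zero_left mult_zero_right)
  qed
  ultimately have "((%x::real. (-1) ^ l / real l * (x ^ (n + m - l) * (1 - x) ^ l)) \<longlongrightarrow> 0) (at_right 0)"
   by (simp only:)
  moreover have "\<forall>\<^sub>F x in at_right 0. (-1) ^ l / real l * (x ^ (n + m - l) * (1 - x) ^ l) = x ^ (n + m) * ((-1) ^ l / real l * (1 / x - 1) ^ l)"
   using eventually_at_right_less[of 0]
  proof eventually_elim
   case (elim x)
   have "(1 / x - 1) = (1 - x) / x" using elim by (simp add: field_simps)
   moreover have "x ^ (n + m) = x ^ (n + m - l) * x ^ l"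
    unfolding power_add[symmetric] using that by (intro arg_cong[where f = "power x"]) auto
   ultimately show ?case using elim by (simp add: power_divide)
  qed
  ultimately show ?thesis by (rule Lim_transform_eventually)
 qed
 have "((%x. (-1) ^ (m + 1) * (- (x ^ (n + m) * ln x) + (\<Sum>l = 1..m - 1. x ^ (n + m) * ((-1) ^ l / real l * (1 / x - 1) ^ l)))) \<longlongrightarrow>
   (-1) ^ (m + 1) * (- 0 + (\<Sum>l = 1..m - 1. 0))) (at_right 0)"
  by (intro tendsto_mult tendsto_const tendsto_add tendsto_minus 1 tendsto_sum 2)
 moreover have "(-1) ^ (m + 1) * (- (x ^ (n + m) * ln x) + (\<Sum>l = 1..m - 1. x ^ (n + m) * ((-1) ^ l / real l * (1 / x - 1) ^ l)))
   = x ^ (n + m) * green_radial m x" for x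
  unfolding green_radial_def by (simp add: sum_distrib_left algebra_simps)
 ultimately show ?thesis by simp
qed

lemma LINT_radial_weight:
 assumes m: "0 < m"
 shows "set_integrable lborel {0<..<1} (%x. x ^ n * radial_weight m x)"
  and "(LINT x:{0<..<1}|lborel. x ^ n * radial_weight m x) = fact n * fact (m - 1) / (real (n + m) * fact (n + m))"
proof -
 define P where "P x = (SUM i<=m - 1. of_nat ((m - 1) choose i) * (- 1) ^ i * x ^ (n + i + 1) / (real (n + i + 1)))" for x :: real
 have dP: "(P has_real_derivative x ^ n * (1 - x) ^ (m - 1)) (at x)" for x
 proof -
  have "(P has_real_derivative (SUM i<=m - 1. of_nat ((m - 1) choose i) * (- 1) ^ i * x ^ (n + i))) (at x)"
   unfolding P_def[abs_def]
  proof (rule DERIV_sum)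
   fix i
   have "((%x. x ^ (n + i + 1)) has_real_derivative real (n + i + 1) * x ^ (n + i)) (at x)"
    using DERIV_pow[of "n + i + 1" x UNIV] by simp
   hence "((%x. (of_nat ((m - 1) choose i) * (- 1) ^ i) * x ^ (n + i + 1) / real (n + i + 1)) has_real_derivative
     (of_nat ((m - 1) choose i) * (- 1) ^ i) * (real (n + i + 1) * x ^ (n + i)) / real (n + i + 1)) (at x)"
    by (intro DERIV_cdivide DERIV_cmult)
   thus "((%x. of_nat ((m - 1) choose i) * (- 1) ^ i * x ^ (n + i + 1) / real (n + i + 1)) has_real_derivative
     of_nat ((m - 1) choose i) * (- 1) ^ i * x ^ (n + i)) (at x)"
    by (simp only: mult.assoc nonzero_mult_div_cancel_left of_nat_eq_0_iff add_is_0 one_neq_zero simp_thms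
      times_divide_eq_right mult.left_commute[of _ "real (n + i + 1)"])
  qed
  also have "(SUM i<=m - 1. of_nat ((m - 1) choose i) * (- 1) ^ i * x ^ (n + i)) = x ^ n * (SUM i<=m - 1. of_nat ((m - 1) choose i) * (- x) ^ i * 1 ^ (m - 1 - i))"
   by (simp add: sum_distrib_left power_add power_minus[of x] mult_ac)
  also have "(SUM i<=m - 1. of_nat ((m - 1) choose i) * (- x) ^ i * 1 ^ (m - 1 - i)) = (- x + 1) ^ (m - 1)"
   by (rule binomial_ring[symmetric])
  finally show ?thesis by simp
 qed
 have P0: "P 0 = 0" by (simp add: P_def)
 have contP: "isCont P x" for x using dP by (rule DERIV_isCont)
 have P1: "P 1 = fact n * fact (m - 1) / fact (n + m)" proof -
  have "(LBINT x=ereal 0..ereal 1. x ^ n * (1 - x) ^ (m - 1)) = P 1 - P 0"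
  proof (rule interval_integral_FTC_finite)
   show "continuous_on {min 0 1..max 0 1} (%x::real. x ^ n * (1 - x) ^ (m - 1))"
    by (intro continuous_intros)
   fix x :: real
   show "(P has_vector_derivative x ^ n * (1 - x) ^ (m - 1)) (at x within {min 0 1..max 0 1})"
    using dP[of x] unfolding has_real_derivative_iff_has_vector_derivative by (rule has_vector_derivative_at_within)
  qed
  moreover have "(LBINT x=ereal 0..ereal 1. x ^ n * (1 - x) ^ (m - 1)) = (LINT x:{0<..<1}|lborel. x ^ n * (1 - x) ^ (m - 1))"
   by (simp add: interval_lebesgue_integral_def einterval_eq)
  ultimately show ?thesis using LINT_beta(2)[of n "m - 1"] m P0 by simp
 qed
 define F where "F x = (x ^ (n + m) * green_radial m x + P x) / real (n + m)" for x
 have nm: "real (n + m) > 0" using m by simp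
 have dF0: "(F has_real_derivative (real (n + m) * x ^ (n + m - 1) * green_radial m x
    + x ^ (n + m) * (- ((1 - x) ^ (m - 1) / x ^ m)) + x ^ n * (1 - x) ^ (m - 1)) / real (n + m)) (at x)"
  if x: "0 < x" for x
  proof -
   have "((%x. x ^ (n + m)) has_real_derivative real (n + m) * x ^ (n + m - 1)) (at x)"
    using DERIV_pow[of "n + m" x UNIV] by simp
   from DERIV_cdivide[OF DERIV_add[OF DERIV_mult[OF this green_radial_deriv[OF x m]] dP], of "real (n + m)"]
   show ?thesis unfolding F_def[abs_def] by (simp only: mult.commute)
  qed
 have dF: "(F has_real_derivative x ^ n * radial_weight m x) (at x)" if x: "0 < x" "x < 1" for x
 proof -
  note dF0[OF x(1)]
  also have "x ^ (n + m) * (- ((1 - x) ^ (m - 1) / x ^ m)) = - (x ^ n * (1 - x) ^ (m - 1))"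
   using x by (simp add: power_add)
  finally have dd: "(F has_real_derivative (real (n + m) * x ^ (n + m - 1) * green_radial m x
    + - (x ^ n * (1 - x) ^ (m - 1)) + x ^ n * (1 - x) ^ (m - 1)) / real (n + m)) (at x)" .
  show ?thesis proof -
   have "x ^ (n + m - 1) = x ^ n * x ^ (m - 1)" unfolding power_add[symmetric] using m by simp
   thus "(F has_real_derivative x ^ n * radial_weight m x) (at x)"
    using x nm m dd by (simp add: radial_weight_def mult.assoc)
  qed
 qed
 have cont: "isCont (%x. x ^ n * radial_weight m x) x" if x: "0 < x" "x < 1" for x
 proof -
  have "isCont (green_radial m) x" using green_radial_deriv[OF x(1) m] by (rule DERIV_isCont)
  hence "isCont (%x. x ^ n * (x ^ (m - 1) * green_radial m x)) x" by (intro continuous_intros)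
  moreover have "\<forall>\<^sub>F y in nhds x. y ^ n * (y ^ (m - 1) * green_radial m y) = y ^ n * radial_weight m y"
  proof -
   have "\<forall>\<^sub>F y in nhds x. y : {0<..<1}" by (rule eventually_nhds_in_open) (use x in auto)
   thus ?thesis by eventually_elim (simp add: radial_weight_def)
  qed
  ultimately show ?thesis by (rule isCont_cong[THEN iffD1, rotated])
 qed
 have A: "((F \<circ> real_of_ereal) \<longlongrightarrow> 0) (at_right (ereal 0))" proof -
  have "(P \<longlongrightarrow> P 0) (at_right 0)"
   using contP[of 0] unfolding isCont_def filterlim_at_split by blast
  hence "((%x. (x ^ (n + m) * green_radial m x + P x) / real (n + m)) \<longlongrightarrow> (0 + P 0) / real (n + m)) (at_right 0)"
   by (intro tendsto_intros power_green_radial_tendsto_0 m) (use m in auto)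
  hence "(F \<longlongrightarrow> 0) (at_right 0)" by (simp add: F_def[abs_def] P0)
  thus ?thesis by (simp add: ereal_tendsto_simps)
 qed
 have B: "((F \<circ> real_of_ereal) \<longlongrightarrow> F 1) (at_left (ereal 1))" proof -
  have "isCont F 1" by (rule DERIV_isCont[OF dF0]) simp
  hence "(F \<longlongrightarrow> F 1) (at_left 1)" unfolding isCont_def filterlim_at_split by blast
  thus ?thesis by (simp add: ereal_tendsto_simps)
 qed
 note FTC = interval_integral_FTC_nonneg[of "ereal 0" "ereal 1" F "%x. x ^ n * radial_weight m x", OF _ _ _ _ A B]
 show "set_integrable lborel {0<..<1} (%x. x ^ n * radial_weight m x)"
  using FTC(1) dF cont radial_weight_nonneg[OF m] by (simp add: einterval_eq)
 have "(LBINT x=ereal 0..ereal 1. x ^ n * radial_weight m x) = F 1 - 0"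
  using FTC(2) dF cont radial_weight_nonneg[OF m] by simp
 moreover have "(LBINT x=ereal 0..ereal 1. x ^ n * radial_weight m x) = (LINT x:{0<..<1}|lborel. x ^ n * radial_weight m x)"
  by (simp add: interval_lebesgue_integral_def einterval_eq)
 moreover have "F 1 = fact n * fact (m - 1) / (real (n + m) * fact (n + m))" by (simp add: F_def P1)
 ultimately show "(LINT x:{0<..<1}|lborel. x ^ n * radial_weight m x) = fact n * fact (m - 1) / (real (n + m) * fact (n + m))"
  by simp
qed

lemma circular_radial_weight:
 assumes m: "0 < m"
 shows "circular_measure (density disc_area (%z. ennreal (radial_weight m ((cmod z)^2)))) 1
   (%n. fact n * fact (m - 1) / (real (n + m) * fact (n + m)))"
proof -
 have "circular_measure (density disc_area (%z. ennreal (radial_weight m ((cmod z)^2)))) 1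
   (%n. LINT x:{0<..<1}|lborel. x ^ n * radial_weight m x)" by (rule circular_disc_area)
    (use m radial_weight_nonneg LINT_radial_weight(1)[of m 0] in auto)
 thus ?thesis by (simp add: LINT_radial_weight(2)[OF m])
qed

text \<open>The involutive automorphism of the disc that exchanges \<open>0\<close> and the parameter.\<close>

definition moebius :: "complex => complex => complex" where
 "moebius u w = (u - w) / (1 - cnj u * w)"

lemma moebius_denom:
 assumes "cmod u < 1" "cmod w <= 1" shows "1 - cnj u * w ~= 0" "1 - u * cnj w ~= 0"
proof -
 have "cmod (cnj u * w) < 1"
  using assms by (metis complex_mod_cnj mult_left_le_one_le mult_mono norm_ge_zero norm_mult order_le_less_trans mult.right_neutral mult_left_mono)
 thus "1 - cnj u * w ~= 0" by auto
 thus "1 - u * cnj w ~= 0" by (metis complex_cnj_cnj complex_cnj_diff complex_cnj_mult complex_cnj_one complex_cnj_zero_iff)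
qed

lemma one_minus_moebius:
 assumes "cmod u < 1" "cmod w <= 1"
 shows "1 - (cmod (moebius u w))\<^sup>2 = (1 - (cmod u)\<^sup>2) * (1 - (cmod w)\<^sup>2) / (cmod (1 - cnj u * w))^2"
proof -
 note d = moebius_denom[OF assms]
 have "complex_of_real (1 - (cmod (moebius u w))\<^sup>2) = complex_of_real ((1 - (cmod u)\<^sup>2) * (1 - (cmod w)\<^sup>2) / (cmod (1 - cnj u * w))^2)"
  unfolding moebius_def of_real_diff of_real_mult of_real_divide of_real_1 complex_norm_square
   complex_cnj_divide complex_cnj_diff complex_cnj_mult complex_cnj_cnj complex_cnj_one
 proof -
  let ?D = "(1 - cnj u * w) * (1 - u * cnj w)"
  have "1 - (u - w) / (1 - cnj u * w) * ((cnj u - cnj w) / (1 - u * cnj w)) = (?D - (u - w) * (cnj u - cnj w)) / ?D"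
   using d by (simp only: times_divide_times_eq) (simp add: diff_divide_distrib)
  also have "?D - (u - w) * (cnj u - cnj w) = (1 - u * cnj u) * (1 - w * cnj w)"
   by (simp add: algebra_simps)
  finally show "1 - (u - w) / (1 - cnj u * w) * ((cnj u - cnj w) / (1 - u * cnj w))
    = (1 - u * cnj u) * (1 - w * cnj w) / ?D" .
 qed
 thus ?thesis using of_real_eq_iff by blast
qed

lemma moebius_in_disc:
 assumes "cmod u < 1" "cmod w < 1" shows "cmod (moebius u w) < 1"
proof -
 have "0 < (1 - (cmod u)\<^sup>2) * (1 - (cmod w)\<^sup>2) / (cmod (1 - cnj u * w))^2"
  using assms moebius_denom(1)[of u w] by (intro divide_pos_pos mult_pos_pos) (auto simp: power_less_one_iff)
 hence "(cmod (moebius u w))\<^sup>2 < 1" using one_minus_moebius[of u w] assms by simp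
 thus ?thesis by (simp add: power_less_one_iff)
qed

lemma moebius_sub:
 assumes "cmod u < 1" "cmod w <= 1"
 shows "u - moebius u w = w * (1 - u * cnj u) / (1 - cnj u * w)"
  and "1 - cnj u * moebius u w = (1 - u * cnj u) / (1 - cnj u * w)"
 using moebius_denom[OF assms] by (simp_all add: moebius_def field_simps)

lemma one_minus_norm_sq:
 assumes "cmod u < 1"
 shows "1 - u * cnj u = of_real (1 - (cmod u)\<^sup>2)" "0 < 1 - (cmod u)\<^sup>2"
 using assms unfolding of_real_diff complex_norm_square by (auto simp: power_less_one_iff)

lemma one_minus_norm_sq_neq_0:
 assumes "cmod u < 1" shows "1 - u * cnj u ~= 0"
 unfolding one_minus_norm_sq(1)[OF assms] using one_minus_norm_sq(2)[OF assms] by (simp only: of_real_eq_0_iff)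

lemma moebius_involution:
 assumes "cmod u < 1" "cmod w <= 1" shows "moebius u (moebius u w) = w"
proof -
 have "1 - u * cnj u ~= 0" by (rule one_minus_norm_sq_neq_0[OF assms(1)])
 thus ?thesis
  using moebius_sub[OF assms] moebius_denom[OF assms] by (simp add: moebius_def[of u "moebius u w"])
qed

lemma measurable_moebius [measurable]: "moebius u : borel_measurable borel"
 unfolding moebius_def[abs_def] by measurable

lemma disc_area_moebius:
 assumes u: "cmod u < 1"
 shows "distr (density disc_area (%w. ennreal ((1 - (cmod u)\<^sup>2)^2 / cmod (1 - cnj u * w) ^ 4))) borel (moebius u) = disc_area"
proof -
 let ?f' = "%w. - (1 - u * cnj u) / (1 - cnj u * w)^2"
 have "distr (density disc_area (%w. ennreal ((cmod (?f' w))^2))) borel (moebius u) = disc_area"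
 proof (rule disc_area_automorphism)
  show "bij_betw (moebius u) (ball 0 1) (ball 0 1)" by (rule bij_betw_byWitness[where f' = "moebius u"])
     (use u in \<open>auto simp: moebius_involution moebius_in_disc\<close>)
  fix w assume w: "w : ball (0::complex) 1"
  note d = moebius_denom[OF u, of w]
  show "(moebius u has_field_derivative ?f' w) (at w)" unfolding moebius_def[abs_def] using d w
   by (auto intro!: derivative_eq_intros simp: field_simps power2_eq_square)
 qed measurable
 moreover have "(cmod (?f' w))\<^sup>2 = (1 - (cmod u)\<^sup>2)^2 / cmod (1 - cnj u * w) ^ 4" for w
  using one_minus_norm_sq[OF u]
  by (simp add: norm_divide norm_power power_divide del: of_real_diff flip: power_mult)
 ultimately show ?thesis by simp
qed

definition green :: "nat => complex => complex => real" where
 "green m u z = (-1) ^ (m + 1) * G_kernel m z u / ((fact (m - 1))^2 * (1 - (cmod u)\<^sup>2) ^ m)"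

text \<open>Since \<open>1 - |moebius|^2\<close> is \<open>(1 - |z|^2) (1 - |w|^2)\<close> over a squared
modulus, the kernel at any point is a multiple of the radial one composed with the automorphism.\<close>

lemma G_kernel_moebius:
 assumes u: "cmod u < 1" and w: "cmod w < 1" "w ~= 0" and m: "0 < m"
 shows "G_kernel m (moebius u w) u = (-1) ^ (m + 1) * (cmod (u - moebius u w) ^ (2 * (m - 1)) * green_radial m ((cmod w)^2))"
proof -
 let ?z = "moebius u w" and ?x = "(cmod w)\<^sup>2"
 have w': "cmod w <= 1" using w by simp
 note d = moebius_denom[OF u w'] and s = moebius_sub[OF u w'] and p = one_minus_norm_sq[OF u]
 have q0: "1 - u * cnj u ~= 0" by (rule one_minus_norm_sq_neq_0[OF u])
 have ne: "u - ?z ~= 0" using s(1) d w q0 by simp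
 have "(1 - ?z * cnj u) / (u - ?z) = 1 / w" proof -
  have a1: "1 - ?z * cnj u = (1 - u * cnj u) / (1 - cnj u * w)"
   using s(2) by (simp only: mult.commute[of ?z])
  have "Q ~= 0 ==> D ~= 0 ==> (Q / D) / (w * Q / D) = 1 / w" for Q D :: complex using w(2) by simp
  thus ?thesis unfolding a1 s(1) using q0 d(1) by blast
 qed
 hence ln: "ln ((cmod ((1 - ?z * cnj u) / (u - ?z)))^2) = - ln ?x"
  by (simp add: norm_divide power_divide ln_div ln_realpow w)
 have t: "(1 - (cmod u)\<^sup>2) * (1 - (cmod ?z)\<^sup>2) = (cmod (u - ?z))^2 * (1 / ?x - 1)" proof -
  have "(cmod (u - ?z))\<^sup>2 = ?x * (1 - (cmod u)\<^sup>2)^2 / (cmod (1 - cnj u * w))^2"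
   unfolding s(1) p(1) norm_mult norm_divide norm_of_real using p(2) by (simp add: power_divide power_mult_distrib)
  thus ?thesis unfolding one_minus_moebius[OF u w']
  proof -
   fix q D assume e: "(cmod (u - ?z))\<^sup>2 = ?x * q\<^sup>2 / D"
   have "?x * (1 / ?x - 1) = 1 - ?x" using w(2) by (simp add: right_diff_distrib)
   hence "q * (q * (1 - ?x) / D) = q\<^sup>2 / D * (?x * (1 / ?x - 1))" by (simp only: power2_eq_square times_divide_eq_right times_divide_eq_left mult.assoc)
   also have "... = (cmod (u - ?z))^2 * (1 / ?x - 1)" unfolding e by (simp only: times_divide_eq_right times_divide_eq_left mult_ac)
   finally show "q * (q * (1 - ?x) / D) = (cmod (u - ?z))^2 * (1 / ?x - 1)" .
  qed
 qed
 have "G_kernel m ?z u = cmod (u - ?z) ^ (2 * (m - 1)) * (- ln ?x) +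
   (\<Sum>l = 1..m - 1. cmod (u - ?z) ^ (2 * (m - 1)) * ((-1) ^ l / real l * (1 / ?x - 1) ^ l))"
  unfolding G_kernel_def ln
 proof (intro arg_cong2[where f = "(+)"] refl sum.cong)
  fix l assume l: "l : {1..m - 1}"
  have "(-1) ^ l / real l * cmod (u - ?z) ^ (2 * (m - 1 - l)) * (1 - (cmod u)\<^sup>2) ^ l * (1 - (cmod ?z)\<^sup>2) ^ l
    = (-1) ^ l / real l * cmod (u - ?z) ^ (2 * (m - 1 - l)) * ((1 - (cmod u)\<^sup>2) * (1 - (cmod ?z)\<^sup>2)) ^ l"
   by (simp add: power_mult_distrib)
  also have "... = (cmod (u - ?z) ^ (2 * (m - 1 - l)) * cmod (u - ?z) ^ (2 * l)) * ((-1) ^ l / real l * (1 / ?x - 1) ^ l)"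
   unfolding t power_mult_distrib power_mult[symmetric] by (simp only: mult_ac)
  also have "cmod (u - ?z) ^ (2 * (m - 1 - l)) * cmod (u - ?z) ^ (2 * l) = cmod (u - ?z) ^ (2 * (m - 1))"
   unfolding power_add[symmetric] by (rule arg_cong[where f = "power _"]) (use l in auto)
  finally show "(-1) ^ l / real l * cmod (u - ?z) ^ (2 * (m - 1 - l)) * (1 - (cmod u)\<^sup>2) ^ l * (1 - (cmod ?z)\<^sup>2) ^ l
    = cmod (u - ?z) ^ (2 * (m - 1)) * ((-1) ^ l / real l * (1 / ?x - 1) ^ l)" .
 qed
 also have "... = (-1) ^ (m + 1) * (cmod (u - ?z) ^ (2 * (m - 1)) * green_radial m ?x)" proof -
  have "(-1) ^ (m + 1) * (A * ((-1) ^ (m + 1) * B)) = ((-1) ^ (m + 1) * (-1) ^ (m + 1)) * (A * B)" for A B :: real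
   by (simp only: mult_ac)
  hence "(-1) ^ (m + 1) * (A * ((-1) ^ (m + 1) * B)) = A * B" for A B :: real by simp
  thus ?thesis unfolding green_radial_def sum_distrib_left[symmetric] by (simp only: distrib_left)
 qed
 finally show ?thesis .
qed

lemma green_moebius:
 assumes u: "cmod u < 1" and w: "cmod w < 1" "w ~= 0" and m: "0 < m"
 shows "(1 - (cmod u)\<^sup>2)\<^sup>2 / cmod (1 - cnj u * w) ^ 4 * green m u (moebius u w) =
  (1 - (cmod u)\<^sup>2) ^ m / (fact (m - 1))^2 / cmod (1 - cnj u * w) ^ (2 * (m + 1)) * radial_weight m ((cmod w)^2)"
proof -
 have w': "cmod w <= 1" using w by simp
 note d = moebius_denom[OF u w'] and s = moebius_sub[OF u w'] and p = one_minus_norm_sq[OF u]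
 let ?q = "1 - (cmod u)\<^sup>2" and ?D = "cmod (1 - cnj u * w)" and ?g = "green_radial m ((cmod w)^2)"
 have D: "?D > 0" using d by simp
 have e: "cmod (u - moebius u w) ^ (2 * (m - 1)) = ((cmod w)^2) ^ (m - 1) * (?q\<^sup>2) ^ (m - 1) / ?D ^ (2 * (m - 1))"
  unfolding s(1) p(1) norm_mult norm_divide norm_of_real
  using p(2) by (simp add: power_divide power_mult_distrib flip: power_mult)
 have "green m u (moebius u w) = cmod (u - moebius u w) ^ (2 * (m - 1)) * ?g / ((fact (m - 1))^2 * ?q ^ m)"
  unfolding green_def G_kernel_moebius[OF assms] by (simp flip: mult.assoc power_add)
 also have "... = (?q\<^sup>2) ^ (m - 1) / ?D ^ (2 * (m - 1)) * radial_weight m ((cmod w)^2) / ((fact (m - 1))^2 * ?q ^ m)"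
  unfolding e using w by (simp add: radial_weight_def power_less_one_iff)
 finally have *: "green m u (moebius u w) = ..." .
 obtain k where k: "m = Suc k" using m by (cases m) auto
 have a: "?q\<^sup>2 * (?q\<^sup>2) ^ (m - 1) = ?q ^ m * ?q ^ m"
  unfolding k by (simp add: power2_eq_square power_mult_distrib mult_ac)
 have b: "?D ^ 4 * ?D ^ (2 * (m - 1)) = ?D ^ (2 * (m + 1))"
  unfolding k power_add[symmetric] by (rule arg_cong[where f = "power _"]) simp
 have alg: "Q ~= 0 ==> Q * Q * R / (E * (F * Q)) = Q / F / E * R" for Q R E F :: real by simp
 have "?q\<^sup>2 / ?D ^ 4 * green m u (moebius u w)
   = (?q\<^sup>2 * (?q\<^sup>2) ^ (m - 1)) * radial_weight m ((cmod w)^2) / ((?D ^ 4 * ?D ^ (2 * (m - 1))) * ((fact (m - 1))^2 * ?q ^ m))"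
  unfolding * by (simp only: times_divide_times_eq times_divide_eq_left times_divide_eq_right divide_divide_eq_left mult_ac)
 thus ?thesis unfolding a b using p(2) by (subst (asm) alg) auto
qed

text \<open>The matrix entries contributed by a unit mass at \<open>z\<close>. The coefficients are those of
\<open>(1 - t)^(-k)\<close>, whence \<open>k\<close> summations along the diagonal.\<close>

definition newton :: "nat => nat => nat => complex => complex" where
 "newton k j l z =
   (\<Sum>i<Suc (min j l) - k. of_nat ((i + k - 1) choose i) * (z ^ (j - k - i) * cnj z ^ (l - k - i)))"

lemma newton_shift:
 "newton k (j + k) (l + k) z = (SUM i<=min j l. of_nat ((i + k - 1) choose i) * (z ^ (j - i) * cnj z ^ (l - i)))"
proof -
 have "Suc (min (j + k) (l + k)) - k = Suc (min j l)" by auto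
 thus ?thesis unfolding newton_def by (simp add: lessThan_Suc_atMost)
qed

lemma power_series_coeffs_eq:
 fixes u v :: "nat => complex"
 assumes "!!a. cmod a < 1 ==> (%n. u n * a ^ n) sums s a" "!!a. cmod a < 1 ==> (%n. v n * a ^ n) sums s a"
 shows "u = v"
proof -
 have r: "fps_conv_radius (Abs_fps u) > 0" if "!!a. cmod a < 1 ==> (%n. u n * a ^ n) sums s a" for u :: "nat => complex"
 proof -
  have "conv_radius u >= ereal 1" proof (rule conv_radius_geI_ex)
   fix r :: real assume "0 < r" "ereal r < ereal 1"
   thus "EX z. norm z = r & summable (%n. u n * z ^ n)"
    using that[of "of_real r"] by (intro exI[of _ "of_real r"]) (auto simp: sums_iff)
  qed
  thus ?thesis
   unfolding fps_conv_radius_def by (simp add: fps_nth_Abs_fps) (metis ereal_less(2) less_le_trans one_ereal_def zero_less_one)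
 qed
 have "\<forall>\<^sub>F a in nhds 0. a : ball (0::complex) 1" by (rule eventually_nhds_in_open) auto
 hence "\<forall>\<^sub>F a in nhds 0. eval_fps (Abs_fps u) a = eval_fps (Abs_fps v) a"
  by eventually_elim (use assms in \<open>auto simp: eval_fps_def sums_iff\<close>)
 hence "Abs_fps u = Abs_fps v" by (rule eval_fps_eqD[OF r r, rotated 2]) (use assms in auto)
 thus ?thesis by (metis fps_nth_Abs_fps ext)
qed

lemma integral_cnj_power_series:
 fixes d :: "nat => complex" and h :: "complex => complex"
 assumes M: "finite_measure M" "sets M = sets borel" "AE z in M. cmod z <= rho" "0 <= rho"
  and h[measurable]: "h : borel_measurable borel" and hb: "AE z in M. cmod (h z) <= C"
  and d: "summable (%n. cmod (d n) * rho ^ n)"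
 shows "(%n. d n * (LINT z|M. h z * cnj z ^ n)) sums (LINT z|M. h z * (\<Sum>n. d n * cnj z ^ n))"
proof -
 have [measurable_cong]: "sets M = sets borel" by fact
 have d': "summable (%n. cmod (cnj (d n)) * rho ^ n)" using d by simp
 have "(%n. cnj (d n) * (LINT z|M. cnj (h z) * z ^ n)) sums (LINT z|M. cnj (h z) * (\<Sum>n. cnj (d n) * z ^ n))"
  by (rule integral_power_series(2)[OF M _ _ d', of _ C]) (use hb in auto)
 hence "(%n. cnj (cnj (d n) * (LINT z|M. cnj (h z) * z ^ n))) sums cnj (LINT z|M. cnj (h z) * (\<Sum>n. cnj (d n) * z ^ n))"
  by (subst sums_cnj)
 moreover have "cnj (cnj (d n) * (LINT z|M. cnj (h z) * z ^ n)) = d n * (LINT z|M. h z * cnj z ^ n)" for n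
  unfolding complex_cnj_mult complex_cnj_cnj Bochner_Integration.integral_cnj[symmetric] by simp
 moreover have "cnj (LINT z|M. cnj (h z) * (\<Sum>n. cnj (d n) * z ^ n)) = (LINT z|M. h z * (\<Sum>n. d n * cnj z ^ n))"
  unfolding Bochner_Integration.integral_cnj[symmetric]
 proof (rule integral_cong_AE)
  show "AE z in M. cnj (cnj (h z) * (\<Sum>n. cnj (d n) * z ^ n)) = h z * (\<Sum>n. d n * cnj z ^ n)"
   using M(3)
  proof eventually_elim
   case (elim z)
   show ?case using summable_of_bound[OF d' elim] by (simp add: cnj_suminf)
  qed
 qed measurable
 ultimately show ?thesis by (simp only:)
qed

text \<open>Moments are read off by comparing coefficients of two power series, first in \<open>a\<close> and
then in \<open>b\<close>.\<close>

lemma moments_from_generating_function: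
 fixes c :: "nat => complex" and S :: "nat => nat => complex"
 assumes M: "finite_measure M" "sets M = sets borel" "AE z in M. cmod z <= 1"
  and c: "!!r. 0 <= r ==> r < 1 ==> summable (%n. cmod (c n) * r ^ n)"
  and S: "!!j b. cmod b < 1 ==> (%l. S j l * b ^ l) sums s j b"
  and gen: "!!a b. cmod a < 1 ==> cmod b < 1 ==>
    (%j. s j b * a ^ j) sums (LINT z|M. (\<Sum>n. (c n * b ^ n) * cnj z ^ n) * (\<Sum>n. (c n * a ^ n) * z ^ n))"
 shows "c j * c l * (LINT z|M. z ^ j * cnj z ^ l) = S j l"
proof -
 have cs: "summable (%n. cmod (c n * a ^ n) * 1 ^ n)" if "cmod a < 1" for a
  using c[of "cmod a"] that by (simp add: norm_mult norm_power)
 have bnd: "AE z in M. cmod (\<Sum>n. (c n * b ^ n) * cnj z ^ n) <= (\<Sum>n. cmod (c n * b ^ n))" if b: "cmod b < 1" for b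
  using M(3)
 proof eventually_elim
  case (elim z)
  have le: "norm (c n * b ^ n * cnj z ^ n) <= cmod (c n * b ^ n)" for n
   using elim by (simp add: norm_mult norm_power mult_left_le power_le_one)
  have s0: "summable (%n. cmod (c n * b ^ n))" using cs[OF b] by simp
  have s: "summable (%n. norm (c n * b ^ n * cnj z ^ n))"
   by (rule summable_comparison_test[OF _ s0]) (use le in auto)
  have "cmod (\<Sum>n. c n * b ^ n * cnj z ^ n) <= (\<Sum>n. norm (c n * b ^ n * cnj z ^ n))"
   by (rule summable_norm[OF s])
  also have "... <= (\<Sum>n. cmod (c n * b ^ n))" by (rule suminf_le[OF le s s0])
  finally show ?case .
 qed
 have step1: "c j * (LINT z|M. (\<Sum>n. (c n * b ^ n) * cnj z ^ n) * z ^ j) = s j b" if b: "cmod b < 1" for j b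
 proof -
  have "(%j. c j * (LINT z|M. (\<Sum>n. (c n * b ^ n) * cnj z ^ n) * z ^ j)) = (%j. s j b)"
  proof (rule power_series_coeffs_eq)
   fix a :: complex assume a: "cmod a < 1"
   have "(%n. c n * a ^ n * (LINT z|M. (\<Sum>n. (c n * b ^ n) * cnj z ^ n) * z ^ n)) sums
     (LINT z|M. (\<Sum>n. (c n * b ^ n) * cnj z ^ n) * (\<Sum>n. (c n * a ^ n) * z ^ n))"
    by (rule integral_power_series(2)[OF M _ _ bnd[OF b] cs[OF a]]) auto
   thus "(%n. c n * (LINT z|M. (\<Sum>n. (c n * b ^ n) * cnj z ^ n) * z ^ n) * a ^ n) sums
     (LINT z|M. (\<Sum>n. (c n * b ^ n) * cnj z ^ n) * (\<Sum>n. (c n * a ^ n) * z ^ n))"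
    by (simp add: mult_ac)
  qed (rule gen[OF _ b])
  thus ?thesis by (rule fun_cong)
 qed
 have "(%l. c j * c l * (LINT z|M. z ^ j * cnj z ^ l)) = S j" proof (rule power_series_coeffs_eq)
  fix b :: complex assume b: "cmod b < 1"
  have zb: "AE z in M. cmod (z ^ j) <= 1"
   using M(3) by eventually_elim (simp add: norm_power power_le_one)
  have "(%l. c l * b ^ l * (LINT z|M. z ^ j * cnj z ^ l)) sums (LINT z|M. z ^ j * (\<Sum>n. (c n * b ^ n) * cnj z ^ n))"
   by (rule integral_cnj_power_series[OF M _ _ zb cs[OF b]]) auto
  hence "(%l. c j * (c l * b ^ l * (LINT z|M. z ^ j * cnj z ^ l))) sums (c j * (LINT z|M. z ^ j * (\<Sum>n. (c n * b ^ n) * cnj z ^ n)))"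
   by (rule sums_mult)
  also have "c j * (LINT z|M. z ^ j * (\<Sum>n. (c n * b ^ n) * cnj z ^ n)) = s j b"
   using step1[OF b, of j] by (simp add: mult.commute)
  finally show "(%l. c j * c l * (LINT z|M. z ^ j * cnj z ^ l) * b ^ l) sums s j b"
   by (simp add: mult_ac)
 qed (rule S)
 thus ?thesis by (rule fun_cong)
qed

text \<open>Generating function \<open>1 / ((1 - a b)^m (1 - a z) (1 - b cnj z))\<close>; the first statement
is the sum over one index only.\<close>

lemma newton_generating_function:
 assumes m: "0 < m" and z: "cmod z <= 1" and b: "cmod b < 1"
 shows "(%l. newton m (j + m) (l + m) z * b ^ l) sums
   ((SUM i<=j. of_nat ((i + m - 1) choose i) * (b ^ i * z ^ (j - i))) / (1 - b * cnj z))" (is ?A)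
  and "cmod a < 1 ==> (%j. (SUM i<=j. of_nat ((i + m - 1) choose i) * (b ^ i * z ^ (j - i))) / (1 - b * cnj z) * a ^ j) sums
   (1 / ((1 - a * b) ^ m * (1 - a * z) * (1 - b * cnj z)))" (is "_ ==> ?B")
proof -
 have bz: "cmod (b * cnj z) < 1"
  using b z by (metis complex_mod_cnj mult_left_le norm_ge_zero norm_mult order_le_less_trans)
 let ?u = "%i. if i <= j then of_nat ((i + m - 1) choose i) * (b ^ i * z ^ (j - i)) else 0 :: complex"
 have geo: "summable (%q. norm (x ^ q))" "(\<Sum>q. x ^ q) = 1 / (1 - x)" if "cmod x < 1" for x :: complex
  using that by (simp_all add: norm_power summable_geometric suminf_geometric)
 have su: "(\<Sum>i. ?u i) = (SUM i<=j. of_nat ((i + m - 1) choose i) * (b ^ i * z ^ (j - i)))"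
  by (subst suminf_finite[of "{..j}"]) auto
 have "(%l. SUM i<=l. ?u i * (b * cnj z) ^ (l - i)) sums ((\<Sum>i. ?u i) * (\<Sum>q. (b * cnj z) ^ q))"
 proof (rule Cauchy_product_sums)
  show "summable (%k. norm (?u k))" by (rule summable_finite[of "{..j}"]) auto
 qed (rule geo[OF bz])
 moreover have "(SUM i<=l. ?u i * (b * cnj z) ^ (l - i)) = newton m (j + m) (l + m) z * b ^ l" for l
 proof -
  have "(SUM i<=l. ?u i * (b * cnj z) ^ (l - i)) = (SUM i<=min j l. ?u i * (b * cnj z) ^ (l - i))"
   by (rule sum.mono_neutral_right) auto
  also have "... = (SUM i<=min j l. of_nat ((i + m - 1) choose i) * (z ^ (j - i) * cnj z ^ (l - i)) * b ^ l)"
  proof (intro sum.cong refl)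
   fix i assume i: "i : {..min j l}"
   hence "b ^ l = b ^ i * b ^ (l - i)" by (simp flip: power_add)
   thus "?u i * (b * cnj z) ^ (l - i) = of_nat ((i + m - 1) choose i) * (z ^ (j - i) * cnj z ^ (l - i)) * b ^ l"
    using i by (simp add: power_mult_distrib mult_ac)
  qed
  finally show ?thesis by (simp add: newton_shift sum_distrib_right)
 qed
 ultimately show ?A using su geo(2)[OF bz] by simp
 assume a: "cmod a < 1"
 have az: "cmod (a * z) < 1" using a z by (metis mult_left_le norm_ge_zero norm_mult order_le_less_trans)
 have ab: "cmod (a * b) < 1" using a b by (metis less_imp_le mult_left_le norm_ge_zero norm_mult order_le_less_trans)
 have ch: "(i + m - 1) choose i = (i + (m - 1)) choose (m - 1)" for i
  using m binomial_symmetric[of i "i + m - 1"] by simp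
 have nb: "(%i. of_nat ((i + m - 1) choose i) * x ^ i) sums (1 / (1 - x) ^ m)" if "cmod x < 1" for x :: complex
  using negative_binomial_sums[OF that, of "m - 1"] m unfolding ch by simp
 have "(%j. SUM i<=j. (of_nat ((i + m - 1) choose i) * (a * b) ^ i) * (a * z) ^ (j - i)) sums
   ((\<Sum>i. of_nat ((i + m - 1) choose i) * (a * b) ^ i) * (\<Sum>q. (a * z) ^ q))"
 proof (rule Cauchy_product_sums)
  show "summable (%i. norm (of_nat ((i + m - 1) choose i) * (a * b) ^ i))"
   using summable_negative_binomial[of "cmod (a * b)" "m - 1"] ab unfolding ch by (simp add: norm_mult norm_power)
 qed (rule geo[OF az])
 hence "(%j. (SUM i<=j. (of_nat ((i + m - 1) choose i) * (a * b) ^ i) * (a * z) ^ (j - i)) / (1 - b * cnj z)) sums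
   (((\<Sum>i. of_nat ((i + m - 1) choose i) * (a * b) ^ i) * (\<Sum>q. (a * z) ^ q)) / (1 - b * cnj z))"
  by (rule sums_divide)
 also have "(\<Sum>i. of_nat ((i + m - 1) choose i) * (a * b) ^ i) = 1 / (1 - a * b) ^ m"
  using nb[OF ab] by (simp add: sums_iff)
 also have "(\<Sum>q. (a * z) ^ q) = 1 / (1 - a * z)" by (rule geo[OF az])
 also have "(%j. (SUM i<=j. (of_nat ((i + m - 1) choose i) * (a * b) ^ i) * (a * z) ^ (j - i)) / (1 - b * cnj z)) =
   (%j. (SUM i<=j. of_nat ((i + m - 1) choose i) * (b ^ i * z ^ (j - i))) / (1 - b * cnj z) * a ^ j)"
 proof
  fix j
  have "(SUM i<=j. (of_nat ((i + m - 1) choose i) * (a * b) ^ i) * (a * z) ^ (j - i))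
    = (SUM i<=j. of_nat ((i + m - 1) choose i) * (b ^ i * z ^ (j - i)) * a ^ j)"
  proof (intro sum.cong refl)
   fix i assume "i : {..j}"
   hence "a ^ j = a ^ i * a ^ (j - i)" by (simp flip: power_add)
   thus "(of_nat ((i + m - 1) choose i) * (a * b) ^ i) * (a * z) ^ (j - i) = of_nat ((i + m - 1) choose i) * (b ^ i * z ^ (j - i)) * a ^ j"
    by (simp add: power_mult_distrib mult_ac)
  qed
  thus "(SUM i<=j. (of_nat ((i + m - 1) choose i) * (a * b) ^ i) * (a * z) ^ (j - i)) / (1 - b * cnj z) =
   (SUM i<=j. of_nat ((i + m - 1) choose i) * (b ^ i * z ^ (j - i))) / (1 - b * cnj z) * a ^ j"
   by (simp add: sum_distrib_right)
 qed
 finally show ?B by simp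
qed

lemma [measurable]:
 "(%x. G_kernel m (snd x) (fst x)) : borel_measurable (borel \<Otimes>\<^sub>M borel)"
 unfolding G_kernel_def by measurable

lemma [measurable]:
 "(%x. green m (fst x) (snd x)) : borel_measurable (borel \<Otimes>\<^sub>M borel)"
 unfolding green_def by measurable

lemma [measurable]: "green m u : borel_measurable borel"
 unfolding green_def[abs_def] G_kernel_def by measurable

lemma moebius_eq_0_iff:
 assumes "cmod u < 1" "cmod z <= 1" shows "moebius u z = 0 \<longleftrightarrow> z = u"
 using moebius_denom[OF assms] by (auto simp: moebius_def)

lemma green_nonneg:
 assumes u: "cmod u < 1" and z: "cmod z < 1" "z ~= u" and m: "0 < m"
 shows "0 <= green m u z"
proof -
 define w where "w = moebius u z"
 have w: "cmod w < 1" "w ~= 0" "moebius u w = z"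
  using moebius_in_disc[OF u z(1)] moebius_eq_0_iff[of u z] moebius_involution[of u z] z u by (auto simp: w_def)
 let ?J = "(1 - (cmod u)\<^sup>2)\<^sup>2 / cmod (1 - cnj u * w) ^ 4"
 have J: "?J > 0"
  using one_minus_norm_sq(2)[OF u] moebius_denom(1)[of u w] u w by (intro divide_pos_pos) auto
 have "0 <= ?J * green m u z" unfolding green_moebius[OF u w(1,2) m, unfolded w(3)]
  using one_minus_norm_sq(2)[OF u] radial_weight_nonneg[OF m] by (intro mult_nonneg_nonneg divide_nonneg_nonneg) auto
 thus ?thesis using mult_le_cancel_left_pos[OF J, of 0 "green m u z"] by (simp only: mult_zero_right)
qed

lemma AE_disc_area_neq: "AE z in disc_area. z ~= c"
 unfolding disc_area_def by (subst AE_density) (use AE_lborel_singleton[of c] in auto)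

text \<open>The Jacobian of the automorphism together with the factor that the kernel acquires.\<close>

definition pulled_back_density :: "nat => complex => complex => real" where
 "pulled_back_density m u w =
   (1 - (cmod u)\<^sup>2) ^ m / (fact (m - 1))^2 / cmod (1 - cnj u * w) ^ (2 * (m + 1)) * radial_weight m ((cmod w)^2)"

lemma [measurable]: "pulled_back_density m u : borel_measurable borel"
 unfolding pulled_back_density_def[abs_def] by measurable

lemma green_measure_eq_distr:
 assumes u: "cmod u < 1" and m: "0 < m"
 shows "density disc_area (%z. ennreal (green m u z)) =
   distr (density disc_area (%w. ennreal (pulled_back_density m u w))) borel (moebius u)"
proof (rule measure_eqI)
 let ?J = "%w. (1 - (cmod u)\<^sup>2)\<^sup>2 / cmod (1 - cnj u * w) ^ 4"
 have [measurable]: "?J : borel_measurable borel" by measurable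
 fix A assume "A : sets (density disc_area (%z. ennreal (green m u z)))"
 hence A[measurable]: "A : sets borel" by simp
 have "emeasure (density disc_area (%z. ennreal (green m u z))) A
   = (\<integral>\<^sup>+z. ennreal (green m u z) * indicator A z \<partial>distr (density disc_area (%w. ennreal (?J w))) borel (moebius u))"
  unfolding disc_area_moebius[OF u] by (subst emeasure_density) auto
 also have "... = (\<integral>\<^sup>+w. ennreal (?J w) * (ennreal (green m u (moebius u w)) * indicator A (moebius u w)) \<partial>disc_area)"
  by (subst nn_integral_distr, measurable, subst nn_integral_density) measurable
 also have "... = (\<integral>\<^sup>+w. ennreal (pulled_back_density m u w) * indicator (moebius u -` A) w \<partial>disc_area)"
 proof (rule nn_integral_cong_AE)
  show "AE w in disc_area. ennreal (?J w) * (ennreal (green m u (moebius u w)) * indicator A (moebius u w))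
    = ennreal (pulled_back_density m u w) * indicator (moebius u -` A) w"
   using AE_disc_area AE_disc_area_neq[of 0]
  proof eventually_elim
   case (elim w)
   have "ennreal (?J w) * ennreal (green m u (moebius u w)) = ennreal (pulled_back_density m u w)"
    unfolding pulled_back_density_def green_moebius[OF u elim m, symmetric]
    by (subst ennreal_mult') auto
   thus ?case by (simp add: mult.assoc[symmetric] split: split_indicator)
  qed
 qed
 also have "... = emeasure (distr (density disc_area (%w. ennreal (pulled_back_density m u w))) borel (moebius u)) A"
  using measurable_sets[OF measurable_moebius A] by (subst emeasure_distr) (auto simp: emeasure_density)
 finally show "emeasure (density disc_area (%z. ennreal (green m u z))) A = ..." .
qed auto

lemma integral_green_measure:
 fixes f :: "complex => complex"
 assumes u: "cmod u < 1" and m: "0 < m" and f[measurable]: "f : borel_measurable borel"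
 shows "(LINT z|density disc_area (%z. ennreal (green m u z)). f z) =
  (LINT w|density disc_area (%w. ennreal (radial_weight m ((cmod w)^2))).
    of_real ((1 - (cmod u)\<^sup>2) ^ m / (fact (m - 1))^2 / cmod (1 - cnj u * w) ^ (2 * (m + 1))) * f (moebius u w))"
proof -
 have nn: "0 <= pulled_back_density m u w" for w unfolding pulled_back_density_def
  using one_minus_norm_sq(2)[OF u] radial_weight_nonneg[OF m] by (intro mult_nonneg_nonneg divide_nonneg_nonneg) auto
 have "(LINT z|density disc_area (%z. ennreal (green m u z)). f z)
   = (LINT w|density disc_area (%w. ennreal (pulled_back_density m u w)). f (moebius u w))"
  unfolding green_measure_eq_distr[OF u m] by (rule integral_distr) auto
 also have "... = (LINT w|disc_area. pulled_back_density m u w *\<^sub>R f (moebius u w))"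
  by (rule integral_density) (use nn in auto)
 also have "... = (LINT w|disc_area. radial_weight m ((cmod w)^2) *\<^sub>R
   (of_real ((1 - (cmod u)\<^sup>2) ^ m / (fact (m - 1))^2 / cmod (1 - cnj u * w) ^ (2 * (m + 1))) * f (moebius u w)))"
  by (simp only: pulled_back_density_def scaleR_conv_of_real of_real_mult mult_ac)
 also have "... = (LINT w|density disc_area (%w. ennreal (radial_weight m ((cmod w)^2))).
    of_real ((1 - (cmod u)\<^sup>2) ^ m / (fact (m - 1))^2 / cmod (1 - cnj u * w) ^ (2 * (m + 1))) * f (moebius u w))"
  by (rule integral_density[symmetric]) (use radial_weight_nonneg[OF m] in \<open>auto\<close>)
 finally show ?thesis .
qed

lemma finite_green_measure:
 assumes u: "cmod u < 1" and m: "0 < m"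
 shows "finite_measure (density disc_area (%z. ennreal (green m u z)))"
proof -
 let ?R = "density disc_area (%w. ennreal (radial_weight m ((cmod w)^2)))"
 let ?C = "(1 - (cmod u)\<^sup>2) ^ m / (fact (m - 1))^2 / (1 - cmod u) ^ (2 * (m + 1))"
 interpret R: finite_measure ?R using circular_radial_weight[OF m] by (simp add: circular_measure_def)
 have C0: "0 <= ?C" using one_minus_norm_sq(2)[OF u] u by (intro divide_nonneg_nonneg) auto
 have "(\<integral>\<^sup>+w. ennreal (pulled_back_density m u w) \<partial>disc_area) <= (\<integral>\<^sup>+w. ennreal ?C * ennreal (radial_weight m ((cmod w)^2)) \<partial>disc_area)"
 proof (rule nn_integral_mono_AE)
  show "AE w in disc_area. ennreal (pulled_back_density m u w) <= ennreal ?C * ennreal (radial_weight m ((cmod w)^2))"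
   using AE_disc_area
  proof eventually_elim
   case (elim w)
   have "cmod (cnj u * w) <= cmod u" using elim by (simp add: norm_mult mult_left_le)
   hence "1 - cmod u <= cmod (1 - cnj u * w)" using norm_triangle_ineq2[of 1 "cnj u * w"] by simp
   hence "pulled_back_density m u w <= ?C * radial_weight m ((cmod w)^2)"
    unfolding pulled_back_density_def using u one_minus_norm_sq(2)[OF u] radial_weight_nonneg[OF m]
    by (intro mult_right_mono divide_left_mono power_mono mult_pos_pos zero_less_power divide_nonneg_nonneg) auto
   thus ?case using C0 by (simp flip: ennreal_mult' add: ennreal_leI)
  qed
 qed
 also have "... = ennreal ?C * emeasure ?R (space ?R)"
  by (subst nn_integral_cmult) (auto simp: emeasure_density)
 also have "... < \<infinity>" proof -
  have "emeasure ?R (space ?R) < Orderings.top" using R.emeasure_finite[of "space ?R"] by (simp only: less_top infinity_ennreal_def)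
  thus ?thesis unfolding infinity_ennreal_def by (intro ennreal_mult_less_top[THEN iffD2]) auto
 qed
 finally have "emeasure (density disc_area (%w. ennreal (pulled_back_density m u w))) UNIV < \<infinity>"
  by (subst emeasure_density) auto
 thus ?thesis unfolding green_measure_eq_distr[OF u m]
  by (intro finite_measureI) (auto simp: emeasure_distr)
qed

lemma one_minus_mult_moebius:
 assumes u: "cmod u < 1" and a: "cmod a < 1" and w: "cmod w <= 1"
 shows "1 - a * moebius u w = (1 - a * u) * (1 - moebius (cnj u) a * w) / (1 - cnj u * w)"
proof -
 have d1: "1 - cnj u * w ~= 0" using moebius_denom[OF u w] by simp
 have d2: "1 - u * a ~= 0" using moebius_denom(1)[of "cnj u" a] u a by simp
 have "(1 - a * u) * (1 - moebius (cnj u) a * w) = (1 - a * u) - (cnj u - a) * w"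
  using d2 unfolding moebius_def by (simp add: right_diff_distrib mult.commute[of a])
 moreover have "(1 - a * moebius u w) * (1 - cnj u * w) = (1 - cnj u * w) - a * (u - w)"
  using d1 unfolding moebius_def by (simp add: left_diff_distrib)
 moreover have "(1 - a * u) - (cnj u - a) * w = (1 - cnj u * w) - a * (u - w)"
  by (simp add: algebra_simps)
 ultimately have "(1 - a * moebius u w) * (1 - cnj u * w) = (1 - a * u) * (1 - moebius (cnj u) a * w)"
  by (simp only:)
 thus ?thesis using d1 by (simp add: eq_divide_eq)
qed

text \<open>Under the automorphism a factor \<open>1 / (1 - a z)\<close> becomes a constant times \<open>1 /
(1 - a' w)\<close> with another parameter \<open>a'\<close>. The Jacobian and the factor of the
kernel cancel against the surplus powers, and there remains the integral of a radial weight.\<close>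

lemma green_generating_function:
 assumes u: "cmod u < 1" and m: "0 < m" and a: "cmod a < 1" and b: "cmod b < 1"
 shows "(LINT z|density disc_area (%z. ennreal (green m u z)).
   1 / (1 - b * cnj z) ^ (m + 1) * (1 / (1 - a * z) ^ (m + 1)))
  = 1 / (fact m)^2 * (1 / ((1 - a * b) ^ m * (1 - a * u) * (1 - b * cnj u)))"
proof -
 let ?R = "density disc_area (%w. ennreal (radial_weight m ((cmod w)^2)))"
 let ?q = "1 - (cmod u)\<^sup>2" and ?A = "1 - a * u" and ?B = "1 - b * cnj u"
 let ?a = "moebius (cnj u) a" and ?b = "moebius u b"
 let ?c = "%n. complex_of_nat ((n + m) choose m)"
 have cz: "cmod (cnj u) < 1" using u by simp
 have q: "?q > 0" by (rule one_minus_norm_sq[OF u])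
 have A: "?A ~= 0" using moebius_denom(1)[of "cnj u" a] u a by (simp add: mult.commute)
 have B: "?B ~= 0" using moebius_denom(1)[of "u" b] u b by (simp add: mult.commute)
 have a': "cmod ?a < 1" by (rule moebius_in_disc[OF cz a])
 have b': "cmod ?b < 1" by (rule moebius_in_disc[OF u b])
 have mf[measurable]: "(%z. 1 / (1 - b * cnj z) ^ (m + 1) * (1 / (1 - a * z) ^ (m + 1))) : borel_measurable borel"
  by measurable
 let ?K = "of_real (?q ^ m / (fact (m - 1))^2) / (?A ^ (m + 1) * ?B ^ (m + 1))"
 have pw: "of_real (?q ^ m / (fact (m - 1))^2 / cmod (1 - cnj u * w) ^ (2 * (m + 1))) *
    (1 / (1 - b * cnj (moebius u w)) ^ (m + 1) * (1 / (1 - a * moebius u w) ^ (m + 1)))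
   = ?K * ((\<Sum>n. (?c n * ?b ^ n) * cnj w ^ n) * (\<Sum>n. (?c n * ?a ^ n) * w ^ n))" if w: "cmod w < 1" for w
 proof -
  have w': "cmod w <= 1" using w by simp
  let ?D = "1 - cnj u * w" and ?E = "1 - u * cnj w"
  note d = moebius_denom[OF u w']
  have DE: "complex_of_real (cmod ?D ^ (2 * (m + 1))) = (?D * ?E) ^ (m + 1)"
   unfolding power_mult of_real_power[of "(cmod ?D)\<^sup>2"] complex_norm_square by simp
  have e1: "1 - a * moebius u w = ?A * (1 - ?a * w) / ?D" by (rule one_minus_mult_moebius[OF u a w'])
  have "cnj (1 - cnj b * moebius u w) = cnj ((1 - cnj b * u) * (1 - moebius (cnj u) (cnj b) * w) / ?D)"
   using one_minus_mult_moebius[OF u _ w', of "cnj b"] b by simp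
  hence e2: "1 - b * cnj (moebius u w) = ?B * (1 - ?b * cnj w) / ?E" by (simp add: moebius_def)
  have aw: "cmod (?a * w) < 1" using a' w by (metis less_imp_le mult_left_le norm_ge_zero norm_mult order_le_less_trans)
  have bw: "cmod (?b * cnj w) < 1" using b' w by (metis complex_mod_cnj less_imp_le mult_left_le norm_ge_zero norm_mult order_le_less_trans)
  have s1: "(\<Sum>n. (?c n * ?a ^ n) * w ^ n) = 1 / (1 - ?a * w) ^ (m + 1)"
   using negative_binomial_sums[OF aw, of m] by (simp add: sums_iff power_mult_distrib mult.assoc)
  have s2: "(\<Sum>n. (?c n * ?b ^ n) * cnj w ^ n) = 1 / (1 - ?b * cnj w) ^ (m + 1)"
   using negative_binomial_sums[OF bw, of m] by (simp add: sums_iff power_mult_distrib mult.assoc)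
  have alg: "K / (D * E) ^ (m + 1) * (1 / (B * y / E) ^ (m + 1) * (1 / (A * x / D) ^ (m + 1)))
    = K / (A ^ (m + 1) * B ^ (m + 1)) * (1 / y ^ (m + 1) * (1 / x ^ (m + 1)))"
   if "D ~= 0" "E ~= 0" for K D E A B x y :: complex
   unfolding power_mult_distrib power_divide using that by simp
  show ?thesis
   unfolding e1 e2 s1 s2 of_real_divide[of _ "cmod ?D ^ (2 * (m + 1))"] DE by (rule alg[OF d])
 qed
 have meas: "(%w. (\<Sum>n. (?c n * ?b ^ n) * cnj w ^ n) * (\<Sum>n. (?c n * ?a ^ n) * w ^ n)) : borel_measurable borel"
  by measurable
 have "(LINT z|density disc_area (%z. ennreal (green m u z)). 1 / (1 - b * cnj z) ^ (m + 1) * (1 / (1 - a * z) ^ (m + 1)))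
   = (LINT w|?R. ?K * ((\<Sum>n. (?c n * ?b ^ n) * cnj w ^ n) * (\<Sum>n. (?c n * ?a ^ n) * w ^ n)))"
  unfolding integral_green_measure[OF u m mf]
 proof (rule integral_cong_AE)
  have "AE w in ?R. cmod w < 1" using AE_disc_area by (subst AE_density) auto
  thus "AE w in ?R. of_real (?q ^ m / (fact (m - 1))^2 / cmod (1 - cnj u * w) ^ (2 * (m + 1))) *
    (1 / (1 - b * cnj (moebius u w)) ^ (m + 1) * (1 / (1 - a * moebius u w) ^ (m + 1)))
   = ?K * ((\<Sum>n. (?c n * ?b ^ n) * cnj w ^ n) * (\<Sum>n. (?c n * ?a ^ n) * w ^ n))"
   by eventually_elim (rule pw)
 qed measurable
 also have "... = ?K * (LINT w|?R. (\<Sum>n. (?c n * ?b ^ n) * cnj w ^ n) * (\<Sum>n. (?c n * ?a ^ n) * w ^ n))"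
  by (rule integral_mult_right_zero)
 also have "(LINT w|?R. (\<Sum>n. (?c n * ?b ^ n) * cnj w ^ n) * (\<Sum>n. (?c n * ?a ^ n) * w ^ n))
   = 1 / (of_nat m)^2 * (1 / (1 - ?a * ?b) ^ m)"
 proof (rule sums_unique2[OF circular_integral_product[OF circular_radial_weight[OF m]]])
  show "summable (%n. cmod (?c n * ?a ^ n) * 1 ^ n)" "summable (%n. cmod (?c n * ?b ^ n) * 1 ^ n)"
   using summable_negative_binomial[of "cmod ?a" m] summable_negative_binomial[of "cmod ?b" m] a' b'
   by (simp_all add: norm_mult norm_power)
  have ab: "cmod (?a * ?b) < 1" using a' b' by (metis less_imp_le mult_left_le norm_ge_zero norm_mult order_le_less_trans)
  have "(%n. 1 / (of_nat m)^2 * (of_nat ((n + (m - 1)) choose (m - 1)) * (?a * ?b) ^ n)) sums (1 / (of_nat m)^2 * (1 / (1 - ?a * ?b) ^ (m - 1 + 1)))"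
   by (intro sums_mult negative_binomial_sums ab)
  moreover have "1 / (of_nat m)^2 * (of_nat ((n + (m - 1)) choose (m - 1)) * (?a * ?b) ^ n)
    = ?c n * ?a ^ n * (?c n * ?b ^ n) * of_real (fact n * fact (m - 1) / (real (n + m) * fact (n + m)))" for n
  proof -
   obtain k where k: "m = Suc k" using m by (cases m) auto
   have e1: "?c n = fact (n + m) / (fact m * fact n)"
    using binomial_fact[of m "n + m", where 'a = complex] by simp
   have e2: "complex_of_nat ((n + (m - 1)) choose (m - 1)) = fact (n + (m - 1)) / (fact (m - 1) * fact n)"
    using binomial_fact[of "m - 1" "n + (m - 1)", where 'a = complex] by simp
   have f1: "fact (n + m) = (of_nat (n + m) * fact (n + (m - 1)) :: complex)" unfolding k by (simp add: algebra_simps)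
   have f2: "fact m = (of_nat m * fact (m - 1) :: complex)" unfolding k by simp
   have e3: "of_real (fact n * fact (m - 1) / (real (n + m) * fact (n + m))) = (fact n * fact (m - 1) / (of_nat (n + m) * fact (n + m)) :: complex)"
    by simp
   have alg: "M ~= 0 ==> N ~= 0 ==> X ~= 0 ==> Y ~= 0 ==> Z ~= 0 ==>
     1 / M\<^sup>2 * (Z / (Y * X) * (p * r)) = N * Z / (M * Y * X) * p * (N * Z / (M * Y * X) * r) * (X * Y / (N * (N * Z)))"
    for M N X Y Z p r :: complex by (simp add: power2_eq_square mult_ac)
   have "of_nat (n + m) ~= (0::complex)" "of_nat m ~= (0::complex)" unfolding of_nat_eq_0_iff using m by auto
   thus ?thesis unfolding e1 e2 e3 f1 f2 power_mult_distrib by (intro alg) auto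
  qed
  ultimately show "(%n. ?c n * ?a ^ n * (?c n * ?b ^ n) * of_real (fact n * fact (m - 1) / (real (n + m) * fact (n + m))))
   sums (1 / (of_nat m)^2 * (1 / (1 - ?a * ?b) ^ m))" using m by simp
 qed
 also have "1 - ?a * ?b = of_real ?q * (1 - a * b) / (?A * ?B)" proof -
  have "?a * ?b = (cnj u - a) * (u - b) / (?A * ?B)" by (simp add: moebius_def mult.commute)
  hence "1 - ?a * ?b = (?A * ?B - (cnj u - a) * (u - b)) / (?A * ?B)"
   using A B by (simp add: diff_divide_distrib)
  also have "?A * ?B - (cnj u - a) * (u - b) = (1 - u * cnj u) * (1 - a * b)" by (simp add: algebra_simps)
  finally show ?thesis by (simp only: one_minus_norm_sq(1)[OF u])
 qed
 also have "?K * (1 / (of_nat m)^2 * (1 / (of_real ?q * (1 - a * b) / (?A * ?B)) ^ m))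
   = 1 / (fact m)^2 * (1 / ((1 - a * b) ^ m * ?A * ?B))" proof -
  have f: "fact m = (of_nat m * fact (m - 1) :: complex)" using m by (cases m) auto
  have k: "?K = (of_real ?q) ^ m / (fact (m - 1))^2 / (?A ^ (m + 1) * ?B ^ (m + 1))" by simp
  have Q: "complex_of_real ?q ~= 0" using q by (simp only: of_real_eq_0_iff)
  have alg: "Q ^ m / F\<^sup>2 / (A ^ (m + 1) * B ^ (m + 1)) * (1 / M\<^sup>2 * (1 / (Q * x / (A * B)) ^ m)) = 1 / (M * F)^2 * (1 / (x ^ m * A * B))"
   if "Q ~= 0" "A ~= 0" "B ~= 0" for Q F A B M x :: complex
   using that by (simp add: power_mult_distrib power_divide)
  show ?thesis unfolding f k by (rule alg[OF Q A B])
 qed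
 finally show ?thesis .
qed

lemma green_moments:
 assumes u: "cmod u < 1" and m: "0 < m"
 shows "fact (j + m) / fact j * (fact (l + m) / fact l) *
   (LINT z|density disc_area (%z. ennreal (green m u z)). z ^ j * cnj z ^ l) = newton m (j + m) (l + m) u"
proof -
 let ?M = "density disc_area (%z. ennreal (green m u z))"
 let ?c = "%n. complex_of_nat ((n + m) choose m)"
 let ?F = "1 / (fact m)^2 :: complex"
 have AE1: "AE z in ?M. cmod z < 1" using AE_disc_area by (subst AE_density) auto
 have "?c j * ?c l * (LINT z|?M. z ^ j * cnj z ^ l) = ?F * newton m (j + m) (l + m) u"
 proof (rule moments_from_generating_function[where s = "%j b. ?F * ((SUM i<=j. of_nat ((i + m - 1) choose i) * (b ^ i * u ^ (j - i))) / (1 - b * cnj u))"])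
  show "finite_measure ?M" by (rule finite_green_measure[OF assms])
  show "AE z in ?M. cmod z <= 1" using AE1 by eventually_elim simp
  show "summable (%n. cmod (?c n) * r ^ n)" if "0 <= r" "r < 1" for r
   using summable_negative_binomial[OF that, of m] by simp
  show "(%l. ?F * newton m (j + m) (l + m) u * b ^ l) sums (?F * ((SUM i<=j. of_nat ((i + m - 1) choose i) * (b ^ i * u ^ (j - i))) / (1 - b * cnj u)))"
   if "cmod b < 1" for j b
   using sums_mult[OF newton_generating_function(1)[OF m _ that, of u j], of ?F] u by (simp add: mult.assoc)
  fix a b :: complex assume a: "cmod a < 1" and b: "cmod b < 1"
  have "(LINT z|?M. (\<Sum>n. (?c n * b ^ n) * cnj z ^ n) * (\<Sum>n. (?c n * a ^ n) * z ^ n))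
    = (LINT z|?M. 1 / (1 - b * cnj z) ^ (m + 1) * (1 / (1 - a * z) ^ (m + 1)))"
  proof (rule integral_cong_AE)
   show "AE z in ?M. (\<Sum>n. (?c n * b ^ n) * cnj z ^ n) * (\<Sum>n. (?c n * a ^ n) * z ^ n) = 1 / (1 - b * cnj z) ^ (m + 1) * (1 / (1 - a * z) ^ (m + 1))"
    using AE1
   proof eventually_elim
    case (elim z)
    have az: "cmod (a * z) < 1" using a elim by (metis less_imp_le mult_left_le norm_ge_zero norm_mult order_le_less_trans)
    have bz: "cmod (b * cnj z) < 1" using b elim by (metis complex_mod_cnj less_imp_le mult_left_le norm_ge_zero norm_mult order_le_less_trans)
    show ?case using negative_binomial_sums[OF az, of m] negative_binomial_sums[OF bz, of m]
     by (simp add: sums_iff power_mult_distrib mult.assoc)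
   qed
  qed measurable
  also have "... = ?F * (1 / ((1 - a * b) ^ m * (1 - a * u) * (1 - b * cnj u)))"
   by (rule green_generating_function[OF u m a b])
  finally have I: "(LINT z|?M. (\<Sum>n. (?c n * b ^ n) * cnj z ^ n) * (\<Sum>n. (?c n * a ^ n) * z ^ n)) = ..." .
  show "(%j. ?F * ((SUM i<=j. of_nat ((i + m - 1) choose i) * (b ^ i * u ^ (j - i))) / (1 - b * cnj u)) * a ^ j)
    sums (LINT z|?M. (\<Sum>n. (?c n * b ^ n) * cnj z ^ n) * (\<Sum>n. (?c n * a ^ n) * z ^ n))"
   unfolding I using sums_mult[OF newton_generating_function(2)[OF m _ b a, of u], of ?F] u by (simp add: mult.assoc)
 qed auto
 moreover have "?c j = fact (j + m) / (fact m * fact j)" "?c l = fact (l + m) / (fact m * fact l)"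
  using binomial_fact[of m "j + m", where 'a = complex] binomial_fact[of m "l + m", where 'a = complex] by simp_all
 ultimately show ?thesis by (simp add: field_simps power2_eq_square)
qed

section \<open>Dirichlet integrals of measures\<close>

text \<open>The potential of a unit mass on the circle.\<close>

definition boundary :: "nat => complex => complex => real" where
 "boundary m u z = (1 - (cmod z)\<^sup>2) ^ m / (fact m * fact (m - 1) * (cmod (z - u))^2)"

lemma [measurable]:
 "(%x. boundary m (fst x) (snd x)) : borel_measurable (borel \<Otimes>\<^sub>M borel)"
 unfolding boundary_def by measurable

lemma [measurable]: "boundary m u : borel_measurable borel"
 unfolding boundary_def[abs_def] by measurable

lemma boundary_nonneg: "cmod z < 1 ==> 0 <= boundary m u z" unfolding boundary_def
 by (intro divide_nonneg_nonneg zero_le_power mult_nonneg_nonneg) (auto simp: power_le_one)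

lemma subexponential_circle_powers:
 assumes "cmod u = 1" shows "subexponential (%k. cnj u powi k)" unfolding subexponential_def
 by (auto simp: assms norm_power_int norm_power summable_geometric)

lemma poisson_series_circle_powers:
 assumes u: "cmod u = 1" and z: "cmod z < 1"
 shows "poisson_series (%k. cnj u powi k) z = of_real ((1 - (cmod z)\<^sup>2) / (cmod (z - u))^2)"
proof -
 have zz: "u * cnj u = 1" using u complex_norm_square[of u] by simp
 have u0: "u ~= 0" "cnj u ~= 0" using u by auto
 have inv: "inverse (cnj u) = u" using zz u0 by (simp add: inverse_eq_divide divide_eq_eq)
 have c1: "cmod (cnj u * z) < 1" "cmod (u * cnj z) < 1" using u z by (simp_all add: norm_mult)
 have d: "1 - cnj u * z ~= 0" "1 - u * cnj z ~= 0" using c1 by auto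
 have s1: "(\<Sum>k. cnj u powi int k * z ^ k) = 1 / (1 - cnj u * z)"
  using suminf_geometric[OF c1(1)] by (simp add: power_mult_distrib)
 have "cnj u powi (- int (Suc k)) * cnj z ^ Suc k = u * cnj z * (u * cnj z) ^ k" for k
 proof -
  have "cnj u powi (- int (Suc k)) = u ^ Suc k"
   by (simp only: power_int_minus power_int_of_nat power_inverse[symmetric] inv)
  thus ?thesis by (simp add: power_mult_distrib mult_ac)
 qed
 hence s2: "(\<Sum>k. cnj u powi (- int (Suc k)) * cnj z ^ Suc k) = u * cnj z * (1 / (1 - u * cnj z))"
  using suminf_mult[OF summable_geometric[OF c1(2)], of "u * cnj z"] by (simp only: suminf_geometric[OF c1(2)])
 have nz: "complex_of_real ((cmod (z - u))^2) = (1 - cnj u * z) * (1 - u * cnj z)"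
  unfolding complex_norm_square using zz by (simp add: algebra_simps)
 have "1 / (1 - cnj u * z) + u * cnj z * (1 / (1 - u * cnj z))
   = ((1 - u * cnj z) + u * cnj z * (1 - cnj u * z)) / ((1 - cnj u * z) * (1 - u * cnj z))"
  using d by (simp add: add_frac_eq mult.commute)
 also have "(1 - u * cnj z) + u * cnj z * (1 - cnj u * z) = 1 - (u * cnj u) * (z * cnj z)"
  by (simp add: algebra_simps)
 also have "... = of_real (1 - (cmod z)\<^sup>2)" unfolding zz of_real_diff complex_norm_square by simp
 finally show ?thesis unfolding poisson_series_def s1 s2 of_real_divide nz .
qed

text \<open>Apart from a power of \<open>1 - |z|^2\<close> the kernel is the Poisson kernel. The formula for
smaller discs passes to the limit, first by monotone convergence, which yields integrability, and
then by dominated convergence.\<close>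

lemma boundary_moments:
 assumes u: "cmod u = 1" and m: "0 < m"
 shows "integrable disc_area (boundary m u)"
  and "fact (j + m) / fact j * (fact (l + m) / fact l) *
   (LINT z|disc_area. of_real (boundary m u z) * (z ^ j * cnj z ^ l)) = newton m (j + m) (l + m) u"
proof -
 let ?c = "%k. cnj u powi k"
 let ?F = "fact m * fact (m - 1) :: real"
 let ?B = "%z. ?F * boundary m u z"
 define r where "r n = 1 - inverse (real (Suc (Suc n)))" for n
 have r: "0 < r n" "r n < 1" for n
 proof -
  have "inverse (real (Suc (Suc n))) < 1" by (simp add: inverse_eq_divide)
  thus "0 < r n" "r n < 1" by (auto simp: r_def)
 qed
 have r_mono: "r n <= r k" if "n <= k" for n k
  using that unfolding r_def by (simp add: le_imp_inverse_le)
 have r_lim: "r ----> 1" proof -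
  have "(%n. inverse (real (Suc (Suc n)))) ----> 0"
   using LIMSEQ_Suc[OF LIMSEQ_inverse_real_of_nat] .
  hence "(%n. 1 - inverse (real (Suc (Suc n)))) ----> 1 - 0" by (intro tendsto_intros)
  thus ?thesis by (simp add: r_def[abs_def])
 qed
 have r_at: "filterlim r (at_left 1) sequentially"
  unfolding filterlim_at using r_lim r(2) less_imp_neq[OF r(2)] by simp
 let ?ind = "%n z. indicator {..<(r n)\<^sup>2} ((cmod z)^2) :: real"
 let ?w = "%n z. ?ind n z * (max 0 (1 - (cmod z)\<^sup>2)) ^ (m - 1)"
 let ?M = "%n. density disc_area (%z. ennreal (?w n z))"
 have wP: "complex_of_real (?w n z) * poisson_series ?c z = of_real (?ind n z * ?B z)" if z: "cmod z < 1" for n z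
 proof -
  have "max 0 (1 - (cmod z)\<^sup>2) = 1 - (cmod z)\<^sup>2" using z power_le_one[of "cmod z" 2] by simp
  moreover have "(1 - (cmod z)\<^sup>2) ^ m = (1 - (cmod z)\<^sup>2) ^ (m - 1) * (1 - (cmod z)\<^sup>2)"
   using m by (cases m) auto
  ultimately show ?thesis
   unfolding poisson_series_circle_powers[OF u z] boundary_def of_real_mult[symmetric] of_real_eq_iff
   by simp
 qed
 have [measurable]: "poisson_series ?c : borel_measurable borel"
  unfolding poisson_series_def by measurable
 have I: "(LINT z|disc_area. of_real (?ind n z * ?B z) * (z ^ a * cnj z ^ b)) = ?c (int b - int a) * of_real (beta_part (r n) (m - 1) (max a b))"
  and Int: "integrable disc_area (%z. of_real (?ind n z * ?B z) * (z ^ a * cnj z ^ b))" for n a b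
 proof -
  note M = circular_beta_part[of "r n" "m - 1"]
  note P = circular_integral_poisson[OF M subexponential_circle_powers[OF u], of a b]
  have AE: "AE z in disc_area. ?w n z *\<^sub>R (z ^ a * cnj z ^ b * poisson_series ?c z) = of_real (?ind n z * ?B z) * (z ^ a * cnj z ^ b)"
   using AE_disc_area
  proof eventually_elim
   case (elim z)
   show ?case unfolding wP[OF elim, symmetric] by (simp add: scaleR_conv_of_real mult_ac)
  qed
  have 1: "integrable disc_area (%z. ?w n z *\<^sub>R (z ^ a * cnj z ^ b * poisson_series ?c z))"
   using P(1) r[of n] by (subst (asm) integrable_density) auto
  thus "integrable disc_area (%z. of_real (?ind n z * ?B z) * (z ^ a * cnj z ^ b))"
   by (subst integrable_cong_AE[OF _ _ AE, symmetric]) auto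
  have "(LINT z|disc_area. of_real (?ind n z * ?B z) * (z ^ a * cnj z ^ b)) = (LINT z|disc_area. ?w n z *\<^sub>R (z ^ a * cnj z ^ b * poisson_series ?c z))"
   by (rule integral_cong_AE[symmetric, OF _ _ AE]) auto
  also have "... = (LINT z|?M n. z ^ a * cnj z ^ b * poisson_series ?c z)"
   by (rule integral_density[symmetric]) auto
  finally show "(LINT z|disc_area. of_real (?ind n z * ?B z) * (z ^ a * cnj z ^ b)) = ?c (int b - int a) * of_real (beta_part (r n) (m - 1) (max a b))"
   using P(2) r[of n] by simp
 qed
 have wlim: "(%n. beta_part (r n) (m - 1) k) ----> fact k * fact (m - 1) / fact (k + (m - 1) + 1)" for k
  by (rule filterlim_compose[OF beta_part_tendsto r_at])
 have ind_lim: "(%n. ?ind n z) ----> 1" if z: "cmod z < 1" for z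
 proof -
  have "\<forall>\<^sub>F n in sequentially. cmod z < r n" by (rule order_tendstoD(1)[OF r_lim z])
  hence "\<forall>\<^sub>F n in sequentially. 1 = ?ind n z"
   by eventually_elim (use power_strict_mono[of "cmod z" _ 2] in auto)
  thus ?thesis by (rule Lim_transform_eventually[OF tendsto_const])
 qed
 have B_nn: "0 <= ?B z" if "cmod z < 1" for z using boundary_nonneg[OF that] by simp
 have iB: "integrable disc_area ?B"
 proof (rule integrable_monotone_convergence[where f = "%n z. ?ind n z * ?B z"])
  have eq: "(%z. of_real (?ind n z * ?B z) * (z ^ 0 * cnj z ^ 0)) = (%z. complex_of_real (?ind n z * ?B z))" for n
   by simp
  show i: "integrable disc_area (%z. ?ind n z * ?B z)" for n
   using Int[of n 0 0] unfolding eq complex_of_real_integrable_eq .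
  show "AE z in disc_area. mono (%n. ?ind n z * ?B z)" using AE_disc_area
  proof eventually_elim
   case (elim z)
   show ?case proof (rule monoI)
    fix n k :: nat assume "n <= k"
    hence "(r n)\<^sup>2 <= (r k)^2" using r_mono r[of n] by (intro power_mono) (auto simp: less_imp_le)
    thus "?ind n z * ?B z <= ?ind k z * ?B z"
     using B_nn[OF elim] by (intro mult_right_mono) (auto split: split_indicator)
   qed
  qed
  show "AE z in disc_area. (%n. ?ind n z * ?B z) ----> ?B z" using AE_disc_area
  proof eventually_elim
   case (elim z)
   show ?case using tendsto_mult[OF ind_lim[OF elim] tendsto_const[of "?B z"]] by simp
  qed
  have "(LINT z|disc_area. ?ind n z * ?B z) = beta_part (r n) (m - 1) 0" for n
  proof -
   have "complex_of_real (LINT z|disc_area. ?ind n z * ?B z) = of_real (beta_part (r n) (m - 1) 0)"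
    using I[of n 0 0] unfolding eq integral_complex_of_real by simp
   thus ?thesis by (simp only: of_real_eq_iff)
  qed
  thus "(%n. LINT z|disc_area. ?ind n z * ?B z) ----> fact 0 * fact (m - 1) / fact (0 + (m - 1) + 1)"
   using wlim[of 0] by simp
 qed measurable
 hence "integrable disc_area (%z. inverse ?F * ?B z)" by (rule integrable_mult_right)
 thus "integrable disc_area (boundary m u)" by (simp add: field_simps)
 have "(%n. LINT z|disc_area. of_real (?ind n z * ?B z) * (z ^ j * cnj z ^ l)) ----> (LINT z|disc_area. of_real (?B z) * (z ^ j * cnj z ^ l))"
 proof (rule integral_dominated_convergence[where w = ?B])
  show "AE z in disc_area. (%n. complex_of_real (?ind n z * ?B z) * (z ^ j * cnj z ^ l)) ----> of_real (?B z) * (z ^ j * cnj z ^ l)"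
   using AE_disc_area
  proof eventually_elim
   case (elim z)
   have "(%n. of_real (?ind n z * ?B z) * (z ^ j * cnj z ^ l)) ----> of_real (1 * ?B z) * (z ^ j * cnj z ^ l)"
    by (intro tendsto_intros ind_lim elim)
   thus ?case by simp
  qed
  show "AE z in disc_area. norm (complex_of_real (?ind n z * ?B z) * (z ^ j * cnj z ^ l)) <= ?B z" for n
   using AE_disc_area
  proof eventually_elim
   case (elim z)
   have "norm (complex_of_real (?ind n z * ?B z)) <= ?B z"
    unfolding norm_of_real using boundary_nonneg[OF elim, of m u] by (auto split: split_indicator)
   moreover have "norm (z ^ j * cnj z ^ l) <= 1"
    using elim by (simp add: norm_mult norm_power mult_le_one power_le_one)
   ultimately have "norm (complex_of_real (?ind n z * ?B z)) * norm (z ^ j * cnj z ^ l) <= ?B z * 1"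
    by (intro mult_mono) (use B_nn[OF elim] in auto)
   thus ?case by (simp only: norm_mult mult_1_right)
  qed
 qed (use iB in measurable)
 moreover have "(%n. LINT z|disc_area. of_real (?ind n z * ?B z) * (z ^ j * cnj z ^ l)) ---->
   ?c (int l - int j) * of_real (fact (max j l) * fact (m - 1) / fact (max j l + (m - 1) + 1))"
  unfolding I by (intro tendsto_intros wlim)
 ultimately have a1: "(LINT z|disc_area. of_real (?B z) * (z ^ j * cnj z ^ l)) = ?c (int l - int j) * of_real (fact (max j l) * fact (m - 1) / fact (max j l + (m - 1) + 1))"
  by (rule LIMSEQ_unique)
 have a2: "(LINT z|disc_area. of_real (?B z) * (z ^ j * cnj z ^ l)) = of_real ?F * (LINT z|disc_area. of_real (boundary m u z) * (z ^ j * cnj z ^ l))"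
  by (simp only: integral_mult_right_zero[symmetric] of_real_mult mult.assoc)
 have a3: "max j l + (m - 1) + 1 = max (j + m) (l + m)" "max (j + m) (l + m) - m = max j l" using m by auto
 have V: "of_real ?F * (LINT z|disc_area. of_real (boundary m u z) * (z ^ j * cnj z ^ l))
   = ?c (int l - int j) * (fact (max (j + m) (l + m) - m) * fact (m - 1) / fact (max (j + m) (l + m)))"
  using a1 unfolding a2 a3 by (simp only: of_real_divide of_real_mult of_real_fact)
 have "newton m (j + m) (l + m) u = (SUM i<=min j l. of_nat ((i + m - 1) choose i) * ?c (int l - int j))"
  unfolding newton_shift
 proof (intro sum.cong refl)
  fix i assume i: "i : {..min j l}"
  have z0: "cnj u ~= 0" using u by auto
  have zz: "u * cnj u = 1" using u complex_norm_square[of u] by simp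
  have "u = inverse (cnj u)" using zz z0 by (simp add: inverse_eq_divide eq_divide_eq)
  hence "u ^ (j - i) = inverse (cnj u) ^ (j - i)" by (rule arg_cong[where f = "%x. x ^ (j - i)"])
  hence "u ^ (j - i) * cnj u ^ (l - i) = cnj u powi (- int (j - i)) * cnj u powi (int (l - i))"
   by (simp only: power_int_minus power_int_of_nat power_inverse)
  also have "... = ?c (int l - int j)"
   using i z0 by (subst power_int_add[symmetric]) (auto simp: of_nat_diff)
  finally show "of_nat ((i + m - 1) choose i) * (u ^ (j - i) * cnj u ^ (l - i)) = of_nat ((i + m - 1) choose i) * ?c (int l - int j)" by simp
 qed
 also have "... = of_nat (SUM i<=min j l. (i + m - 1) choose i) * ?c (int l - int j)"
  by (simp add: sum_distrib_right)
 also have "(SUM i<=min j l. (i + m - 1) choose i) = min (j + m) (l + m) choose m" proof -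
  have "(SUM i<=n. (i + m - 1) choose i) = (n + m) choose m" for n
  proof -
   have "(SUM i<=n. ((m - 1) + i) choose i) = Suc ((m - 1) + n) choose n" by (rule sum_choose_lower)
   moreover have "(i + m - 1) = (m - 1) + i" for i using m by simp
   moreover have "Suc ((m - 1) + n) = n + m" using m by simp
   ultimately show ?thesis using binomial_symmetric[of n "n + m"] by (simp add: add.commute[of m n])
  qed
  thus ?thesis by (simp add: min_add_distrib_left)
 qed
 finally have N: "newton m (j + m) (l + m) u = of_nat (min (j + m) (l + m) choose m) * ?c (int l - int j)" .
 have fb: "fact (j + m) / fact j * (fact (l + m) / fact l) * (fact (max (j + m) (l + m) - m) * fact (m - 1) / fact (max (j + m) (l + m)))
   / (fact m * fact (m - 1)) = (of_nat (min (j + m) (l + m) choose m) :: complex)"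
  using fact_binomial_max_min[of m "j + m" "l + m"] m by simp
 have X: "(LINT z|disc_area. of_real (boundary m u z) * (z ^ j * cnj z ^ l))
   = ?c (int l - int j) * (fact (max (j + m) (l + m) - m) * fact (m - 1) / fact (max (j + m) (l + m))) / (fact m * fact (m - 1))"
  unfolding V[symmetric] by simp
 show "fact (j + m) / fact j * (fact (l + m) / fact l) *
   (LINT z|disc_area. of_real (boundary m u z) * (z ^ j * cnj z ^ l)) = newton m (j + m) (l + m) u"
  unfolding X N fb[symmetric] by (simp add: mult_ac)
qed

lemma quad_form_derivative:
 fixes W :: "nat => nat => complex"
 assumes "!!j l. fact (j + m) / fact j * (fact (l + m) / fact l) * W j l = newton m (j + m) (l + m) u"
 shows "(SUM j<=degree f. SUM l<=degree f. coeff ((pderiv ^^ m) f) j * cnj (coeff ((pderiv ^^ m) f) l) * W j l) =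
  quad_form (%j l. newton m j l u) f" unfolding sum_sum_coeff_higher_pderiv quad_form_def
proof (intro sum.cong refl arg_cong2[where f = "(*)"])
 fix j l
 show "(if m <= j & m <= l then fact j / fact (j - m) * (fact l / fact (l - m)) * W (j - m) (l - m) else 0) = newton m j l u"
 proof (cases "m <= j & m <= l")
  case True
  thus ?thesis using assms[of "j - m" "l - m"] by simp
 next
  case False
  thus ?thesis by (auto simp: newton_def)
 qed
qed

lemma integrable_disc_area_poly_kernel:
 assumes K: "integrable disc_area K" and [measurable]: "K : borel_measurable borel"
 shows "integrable disc_area (%z. of_real (K z) * (z ^ j * cnj z ^ l))"
proof (rule Bochner_Integration.integrable_bound[OF K])
 show "AE z in disc_area. norm (complex_of_real (K z) * (z ^ j * cnj z ^ l)) <= norm (K z)"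
  using AE_disc_area
  by eventually_elim (simp add: norm_mult norm_power mult_left_le mult_le_one power_le_one)
qed measurable

lemma integral_poly_kernel:
 assumes K: "integrable disc_area K" and [measurable]: "K : borel_measurable borel"
  and mom: "!!j l. fact (j + m) / fact j * (fact (l + m) / fact l) * (LINT z|disc_area. of_real (K z) * (z ^ j * cnj z ^ l))
    = newton m (j + m) (l + m) u"
 shows "integrable disc_area (%z. (cmod (poly ((pderiv ^^ m) f) z))\<^sup>2 * K z)"
  and "of_real (LINT z|disc_area. (cmod (poly ((pderiv ^^ m) f) z))\<^sup>2 * K z) = quad_form (%j l. newton m j l u) f"
proof -
 let ?p = "(pderiv ^^ m) f" and ?N = "degree f"
 have eq: "complex_of_real ((cmod (poly ?p z))^2 * K z) =
   (SUM j<=?N. SUM l<=?N. coeff ?p j * cnj (coeff ?p l) * (of_real (K z) * (z ^ j * cnj z ^ l)))" for z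
  unfolding of_real_mult cmod_poly_sq[OF degree_higher_pderiv_le] sum_distrib_right by (simp add: mult_ac)
 note i = integrable_disc_area_poly_kernel[OF K]
 have "integrable disc_area (%z. complex_of_real ((cmod (poly ?p z))^2 * K z))"
  unfolding eq by (intro Bochner_Integration.integrable_sum integrable_mult_right i) auto
 thus "integrable disc_area (%z. (cmod (poly ?p z))\<^sup>2 * K z)"
  unfolding complex_of_real_integrable_eq .
 have "of_real (LINT z|disc_area. (cmod (poly ?p z))\<^sup>2 * K z) = (LINT z|disc_area. complex_of_real ((cmod (poly ?p z))^2 * K z))"
  by (rule integral_complex_of_real[symmetric])
 also have "... = (SUM j<=?N. SUM l<=?N. coeff ?p j * cnj (coeff ?p l) * (LINT z|disc_area. of_real (K z) * (z ^ j * cnj z ^ l)))"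
  unfolding eq
  by (subst Bochner_Integration.integral_sum, intro Bochner_Integration.integrable_sum integrable_mult_right i, simp)
    (subst Bochner_Integration.integral_sum, intro integrable_mult_right i, auto)
 also have "... = quad_form (%j l. newton m j l u) f" by (rule quad_form_derivative[OF mom])
 finally show "of_real (LINT z|disc_area. (cmod (poly ?p z))\<^sup>2 * K z) = quad_form (%j l. newton m j l u) f" .
qed

lemma integral_poly_green:
 assumes u: "cmod u < 1" and m: "0 < m"
 shows "integrable disc_area (%z. (cmod (poly ((pderiv ^^ m) f) z))\<^sup>2 * green m u z)"
  and "of_real (LINT z|disc_area. (cmod (poly ((pderiv ^^ m) f) z))\<^sup>2 * green m u z) = quad_form (%j l. newton m j l u) f"
proof -
 have nn: "AE z in disc_area. 0 <= green m u z"
  using AE_disc_area AE_disc_area_neq[of u] by eventually_elim (rule green_nonneg[OF u _ _ m])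
 interpret finite_measure "density disc_area (%z. ennreal (green m u z))"
  by (rule finite_green_measure[OF assms])
 have "integrable (density disc_area (%z. ennreal (green m u z))) (%z. 1::real)" by simp
 hence K: "integrable disc_area (green m u)" by (subst (asm) integrable_density) (use nn in auto)
 have "(LINT z|disc_area. of_real (green m u z) * (z ^ j * cnj z ^ l))
   = (LINT z|density disc_area (%z. ennreal (green m u z)). z ^ j * cnj z ^ l)" for j l
  by (subst integral_density) (use nn in \<open>auto simp: scaleR_conv_of_real\<close>)
 hence mom: "fact (j + m) / fact j * (fact (l + m) / fact l) * (LINT z|disc_area. of_real (green m u z) * (z ^ j * cnj z ^ l))
    = newton m (j + m) (l + m) u" for j l using green_moments[OF assms] by simp
 show "integrable disc_area (%z. (cmod (poly ((pderiv ^^ m) f) z))\<^sup>2 * green m u z)"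
  "of_real (LINT z|disc_area. (cmod (poly ((pderiv ^^ m) f) z))\<^sup>2 * green m u z) = quad_form (%j l. newton m j l u) f"
  using integral_poly_kernel[OF K _ mom] by auto
qed

lemma integral_poly_boundary:
 assumes u: "cmod u = 1" and m: "0 < m"
 shows "integrable disc_area (%z. (cmod (poly ((pderiv ^^ m) f) z))\<^sup>2 * boundary m u z)"
  and "of_real (LINT z|disc_area. (cmod (poly ((pderiv ^^ m) f) z))\<^sup>2 * boundary m u z) = quad_form (%j l. newton m j l u) f"
 using integral_poly_kernel[OF boundary_moments(1)[OF assms] _ boundary_moments(2)[OF assms]] by auto

lemma continuous_on_newton: "continuous_on S (newton m j l)"
 unfolding newton_def[abs_def] by (intro continuous_intros)

lemma [measurable]: "newton m j l : borel_measurable borel"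
 by (intro borel_measurable_continuous_onI continuous_on_newton)

lemma integrable_newton:
 assumes "nu : finite_borel_measures_on (cball 0 1)"
 shows "integrable nu (newton k j l)"
proof -
 interpret finite_measure nu using assms by (simp add: finite_borel_measures_on_def)
 have S[measurable_cong]: "sets nu = sets borel" and A: "AE z in nu. z : cball 0 1"
  using assms by (auto simp: finite_borel_measures_on_def)
 have "compact (newton k j l ` cball 0 1)"
  by (intro compact_continuous_image continuous_on_newton compact_cball)
 then obtain B where B: "ALL w:newton k j l ` cball 0 1. norm w <= B"
  using compact_imp_bounded bounded_iff by metis
 show ?thesis
  by (rule integrable_const_bound[OF AE_mp[OF A AE_I2], of _ B]) (use B in \<open>auto simp: S\<close>)
qed

lemma continuous_on_quad_form_newton: "continuous_on S (%u. quad_form (%j l. newton m j l u) f)"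
 unfolding quad_form_def by (intro continuous_intros continuous_on_newton)

text \<open>Positivity and the bound on the inner integrals give joint integrability.\<close>

lemma fubini_nonneg_kernel:
 fixes g :: "complex => complex => real"
 assumes nu: "finite_measure nu" "sets nu = sets borel"
  and g[measurable]: "(%x. g (fst x) (snd x)) : borel_measurable (borel \<Otimes>\<^sub>M borel)"
  and nn: "!!u. AE z in disc_area. 0 <= g u z" and int: "!!u. integrable disc_area (g u)"
  and bd: "!!u. \<bar>LINT z|disc_area. g u z\<bar> <= C"
 shows "integrable disc_area (%z. LINT u|nu. g u z)"
  and "integrable nu (%u. LINT z|disc_area. g u z)"
  and "(LINT z|disc_area. (LINT u|nu. g u z)) = (LINT u|nu. (LINT z|disc_area. g u z))"
proof -
 interpret N: finite_measure nu by fact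
 interpret D: finite_measure disc_area by (rule finite_measure_disc_area)
 interpret P: pair_sigma_finite nu disc_area ..
 have [measurable_cong]: "sets nu = sets borel" by fact
 have gm[measurable]: "case_prod g : borel_measurable (nu \<Otimes>\<^sub>M disc_area)" proof -
  have "sets (nu \<Otimes>\<^sub>M disc_area) = sets (borel \<Otimes>\<^sub>M borel)" by (intro sets_pair_measure_cong) (auto simp: nu)
  thus ?thesis using g by (simp add: case_prod_beta' cong: measurable_cong_sets)
 qed
 have im: "(%u. LINT z|disc_area. g u z) : borel_measurable nu" by measurable
 have "integrable nu (%u. LINT z|disc_area. norm (g u z))" proof -
  have "(LINT z|disc_area. norm (g u z)) = (LINT z|disc_area. g u z)" for u
   by (rule integral_cong_AE) (use int nn[of u] in \<open>auto elim: eventually_mono\<close>)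
  moreover have "integrable nu (%u. LINT z|disc_area. g u z)"
   by (rule N.integrable_const_bound[of _ C]) (use bd im in auto)
  ultimately show ?thesis by simp
 qed
 hence i: "integrable (nu \<Otimes>\<^sub>M disc_area) (case_prod g)"
  by (intro P.Fubini_integrable gm) (auto simp: int)
 show "integrable disc_area (%z. LINT u|nu. g u z)" by (rule P.integrable_snd[OF i])
 show "integrable nu (%u. LINT z|disc_area. g u z)" using P.integrable_fst'[OF i] by simp
 show "(LINT z|disc_area. (LINT u|nu. g u z)) = (LINT u|nu. (LINT z|disc_area. g u z))"
  by (rule P.Fubini_integral[OF i])
qed

text \<open>The potential is an integral of kernels over the measure; after Fubini the inner integrals are the
quadratic forms of point masses, which depend continuously on the point.\<close>

lemma dirichlet_meas_eq_quad_form: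
 assumes nu: "nu : finite_borel_measures_on (cball 0 1)" and m: "0 < m"
 shows "of_real (dirichlet_meas nu m f) = quad_form (%j l. LINT u|nu. newton m j l u) f"
proof -
 have nu': "finite_measure nu" "sets nu = sets borel" "AE z in nu. z : cball 0 1"
  using nu by (auto simp: finite_borel_measures_on_def)
 interpret N: finite_measure nu by (rule nu')
 have [measurable_cong]: "sets nu = sets borel" by fact
 let ?p = "%z. (cmod (poly ((pderiv ^^ m) f) z))\<^sup>2"
 let ?V = "%u. quad_form (%j l. newton m j l u) f"
 have [measurable]: "ball (0::complex) 1 : sets borel" "sphere (0::complex) 1 : sets borel" by auto
 define g1 where "g1 u z = indicator (ball 0 1) u * (?p z * green m u z)" for u z
 define g2 where "g2 u z = indicator (sphere 0 1) u * (?p z * boundary m u z)" for u z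
 have m1: "(%x. g1 (fst x) (snd x)) : borel_measurable (borel \<Otimes>\<^sub>M borel)"
  unfolding g1_def by measurable
 have m2: "(%x. g2 (fst x) (snd x)) : borel_measurable (borel \<Otimes>\<^sub>M borel)"
  unfolding g2_def by measurable
 have "bounded (?V ` cball 0 1)"
  by (intro compact_imp_bounded compact_continuous_image continuous_on_quad_form_newton) auto
 then obtain C where C0: "0 < C" and C': "ALL x:?V ` cball 0 1. cmod x <= C"
  unfolding bounded_pos by blast
 have C: "cmod (?V u) <= C" if "cmod u <= 1" for u using C' that by simp
 have I1: "of_real (LINT z|disc_area. g1 u z) = indicator (ball 0 1) u * ?V u" for u
  using integral_poly_green(2)[OF _ m, of u f] unfolding g1_def by (auto split: split_indicator)
 have I2: "of_real (LINT z|disc_area. g2 u z) = indicator (sphere 0 1) u * ?V u" for u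
  using integral_poly_boundary(2)[OF _ m, of u f] unfolding g2_def by (auto split: split_indicator)
 have nn1: "AE z in disc_area. 0 <= g1 u z" for u using AE_disc_area AE_disc_area_neq[of u]
  by eventually_elim (auto simp: g1_def green_nonneg m split: split_indicator)
 have nn2: "AE z in disc_area. 0 <= g2 u z" for u
  using AE_disc_area by eventually_elim (auto simp: g2_def boundary_nonneg split: split_indicator)
 have int1: "integrable disc_area (g1 u)" for u
  unfolding g1_def[abs_def] using integral_poly_green(1)[OF _ m, of u f] by (auto split: split_indicator)
 have int2: "integrable disc_area (g2 u)" for u
  unfolding g2_def[abs_def] using integral_poly_boundary(1)[OF _ m, of u f] by (auto split: split_indicator)
 have b1: "\<bar>LINT z|disc_area. g1 u z\<bar> <= C" for u
 proof -
  have "\<bar>LINT z|disc_area. g1 u z\<bar> = cmod (indicator (ball 0 1) u * ?V u)" unfolding I1[symmetric] by simp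
  also have "... <= C" using C[of u] C0 by (auto simp: norm_mult split: split_indicator)
  finally show ?thesis .
 qed
 have b2: "\<bar>LINT z|disc_area. g2 u z\<bar> <= C" for u
 proof -
  have "\<bar>LINT z|disc_area. g2 u z\<bar> = cmod (indicator (sphere 0 1) u * ?V u)" unfolding I2[symmetric] by simp
  also have "... <= C" using C[of u] C0 by (auto simp: norm_mult split: split_indicator)
  finally show ?thesis .
 qed
 note F1 = fubini_nonneg_kernel[OF nu'(1,2) m1 nn1 int1 b1]
 note F2 = fubini_nonneg_kernel[OF nu'(1,2) m2 nn2 int2 b2]
 have U: "?p z * U_potential nu m z = (LINT u|nu. g1 u z) + (LINT u|nu. g2 u z)" for z
 proof -
  have "(LINT u|nu. g1 u z) = (LINT u|nu. (?p z * (1 / (fact (m - 1))^2)) * (indicator (ball 0 1) u * ((-1) ^ (m + 1) * G_kernel m z u / (1 - (cmod u)\<^sup>2) ^ m)))"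
   unfolding g1_def green_def by (intro Bochner_Integration.integral_cong) simp_all
  hence 1: "(LINT u|nu. g1 u z) = ?p z * (1 / (fact (m - 1))^2 * (LINT u:ball 0 1|nu. (-1) ^ (m + 1) * G_kernel m z u / (1 - (cmod u)\<^sup>2) ^ m))"
   unfolding set_lebesgue_integral_def real_scaleR_def by (simp only: integral_mult_right_zero mult.assoc)
  have "(LINT u|nu. g2 u z) = (LINT u|nu. (?p z * (1 / (fact m * fact (m - 1)))) * (indicator (sphere 0 1) u * ((1 - (cmod z)\<^sup>2) ^ m / (cmod (z - u))^2)))"
   unfolding g2_def boundary_def by (intro Bochner_Integration.integral_cong) simp_all
  hence 2: "(LINT u|nu. g2 u z) = ?p z * (1 / (fact m * fact (m - 1)) * (LINT u:sphere 0 1|nu. (1 - (cmod z)\<^sup>2) ^ m / (cmod (z - u))^2))"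
   unfolding set_lebesgue_integral_def real_scaleR_def by (simp only: integral_mult_right_zero mult.assoc)
  show ?thesis unfolding 1 2 U_potential_def by (simp only: distrib_left)
 qed
 have meas: "(%z. ?p z * U_potential nu m z) : borel_measurable borel"
  using borel_measurable_integrable[OF F1(1)] borel_measurable_integrable[OF F2(1)]
  unfolding U by (simp add: measurable_cong_sets[OF sets_disc_area refl])
 have "dirichlet_meas nu m f = (LINT z|disc_area. ?p z * U_potential nu m z)"
  unfolding dirichlet_meas_def by (rule integral_area_measure_unit_ball[OF meas])
 also have "... = (LINT z|disc_area. (LINT u|nu. g1 u z)) + (LINT z|disc_area. (LINT u|nu. g2 u z))"
  unfolding U by (rule Bochner_Integration.integral_add[OF F1(1) F2(1)])
 also have "... = (LINT u|nu. (LINT z|disc_area. g1 u z)) + (LINT u|nu. (LINT z|disc_area. g2 u z))"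
  unfolding F1(3) F2(3) ..
 also have "... = (LINT u|nu. (LINT z|disc_area. g1 u z) + (LINT z|disc_area. g2 u z))"
  by (rule Bochner_Integration.integral_add[symmetric, OF F1(2) F2(2)])
 finally have "of_real (dirichlet_meas nu m f) = (LINT u|nu. complex_of_real ((LINT z|disc_area. g1 u z) + (LINT z|disc_area. g2 u z)))"
  by (simp only: integral_complex_of_real)
 also have "... = (LINT u|nu. ?V u)" proof (rule integral_cong_AE)
  show "AE u in nu. complex_of_real ((LINT z|disc_area. g1 u z) + (LINT z|disc_area. g2 u z)) = ?V u"
   using nu'(3) by eventually_elim (auto simp: I1 I2 split: split_indicator)
  show "(%u. complex_of_real ((LINT z|disc_area. g1 u z) + (LINT z|disc_area. g2 u z))) : borel_measurable nu"
   using borel_measurable_integrable[OF F1(2)] borel_measurable_integrable[OF F2(2)] by measurable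
  show "?V : borel_measurable nu" unfolding quad_form_def by measurable
 qed
 also have "... = quad_form (%j l. LINT u|nu. newton m j l u) f" proof -
  note i = integrable_newton[OF nu]
  show ?thesis unfolding quad_form_def
   by (subst Bochner_Integration.integral_sum, intro Bochner_Integration.integrable_sum integrable_mult_right i)
     (subst Bochner_Integration.integral_sum, intro integrable_mult_right i, simp)
 qed
 finally show ?thesis .
qed

section \<open>A curve filling the disc\<close>

text \<open>Schoenberg's function: even, of period 2, equal to 0 up to 1/3 and to 1 from 2/3 to 1. On numbers
with ternary digits 0 and 2 it reads off digits, so its dyadic series trace out every point of a
square.\<close>

definition schoenberg_step :: "real => real" where
 "schoenberg_step t = min 1 (max 0 (3 * (arccos (cos (pi * t)) / pi) - 1))"

lemma schoenberg_step_range: "0 <= schoenberg_step t" "schoenberg_step t <= 1"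
 by (auto simp: schoenberg_step_def)

lemma continuous_on_schoenberg_step: "continuous_on S schoenberg_step"
 unfolding schoenberg_step_def[abs_def] by (intro continuous_intros) auto

lemma schoenberg_step_add_even: "schoenberg_step (2 * of_int k + t) = schoenberg_step t"
proof -
 have "pi * (2 * of_int k + t) = pi * t + 2 * pi * of_int k" by (simp add: algebra_simps)
 hence "cos (pi * (2 * of_int k + t)) = cos (pi * t)"
  by (simp only: cos_add cos_int_2pin sin_int_2pin mult_zero_right mult_1_right diff_zero)
 thus ?thesis by (simp add: schoenberg_step_def)
qed

lemma schoenberg_step_eq:
 assumes "0 <= t" "t <= 1"
 shows "schoenberg_step t = min 1 (max 0 (3 * t - 1))"
 using assms by (simp add: schoenberg_step_def arccos_cos mult_left_le)

lemma binary_digits_exist: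
 fixes u :: real
 assumes "0 <= u" "u <= 1"
 obtains d :: "nat => int" where "!!n. d n : {0, 1}" "(%n. of_int (d n) / 2 ^ Suc n) sums u"
proof (cases "u = 1")
 case True
 have "(%n. (1/2::real) ^ Suc n) sums 1" by (rule power_half_series)
 thus ?thesis using that[of "%_. 1"] True by (simp add: power_divide)
next
 case False
 define d where "d n = \<lfloor>2 ^ Suc n * u\<rfloor> - 2 * \<lfloor>2 ^ n * u\<rfloor>" for n
 have "d n : {0, 1}" for n
 proof -
  have "(2 ^ Suc n * u) = 2 * (2 ^ n * u)" by simp
  hence "d n = \<lfloor>2 * (2 ^ n * u)\<rfloor> - 2 * \<lfloor>2 ^ n * u\<rfloor>" unfolding d_def by (simp add: mult.assoc)
  also have "... : {0, 1}" by (simp add: insert_iff) linarith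
  finally show ?thesis .
 qed
 moreover have "(%n. of_int (d n) / 2 ^ Suc n) sums u" unfolding sums_def
 proof -
  have part: "(\<Sum>k<n. of_int (d k) / 2 ^ Suc k :: real) = of_int \<lfloor>2 ^ n * u\<rfloor> / 2 ^ n" for n
  proof (induction n)
   case 0
   have "\<lfloor>u\<rfloor> = 0" using assms False by (simp add: floor_eq_iff)
   thus ?case by simp
  next
   case (Suc n)
   have "of_int \<lfloor>2 ^ n * u\<rfloor> / 2 ^ n + of_int (d n) / 2 ^ Suc n = of_int \<lfloor>2 ^ Suc n * u\<rfloor> / (2 ^ Suc n :: real)"
    unfolding d_def by (simp add: field_simps)
   thus ?case using Suc.IH by simp
  qed
  have bd: "\<bar>of_int \<lfloor>2 ^ n * u\<rfloor> / 2 ^ n - u\<bar> <= (1/2) ^ n" for n :: nat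
  proof -
   have "of_int \<lfloor>2 ^ n * u\<rfloor> / 2 ^ n - u = (of_int \<lfloor>2 ^ n * u\<rfloor> - 2 ^ n * u) / 2 ^ n"
    by (simp add: diff_divide_distrib)
   moreover have "\<bar>of_int \<lfloor>2 ^ n * u\<rfloor> - 2 ^ n * u\<bar> <= 1" by linarith
   ultimately show ?thesis by (simp add: power_divide divide_right_mono)
  qed
  have z: "(%n. (1/2::real) ^ n) ----> 0" by (rule LIMSEQ_realpow_zero) auto
  have "(%n. of_int \<lfloor>2 ^ n * u\<rfloor> / 2 ^ n - u) ----> 0"
   by (rule Lim_null_comparison[OF _ z]) (rule always_eventually, rule allI, simp only: real_norm_def bd)
  thus "(%n. \<Sum>k<n. of_int (d k) / 2 ^ Suc k) ----> u"
   unfolding part by (simp add: LIM_zero_iff)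
 qed
 ultimately show ?thesis by (rule that)
qed

lemma schoenberg_step_ternary:
 fixes d :: "nat => int"
 assumes d: "!!n. d n : {0, 1}" and t: "(%n. 2 * of_int (d n) / 3 ^ Suc n) sums t"
 shows "schoenberg_step (3 ^ n * t) = of_int (d n)" "0 <= t" "t <= 1"
proof -
 define tl where "tl n = (\<Sum>k. 2 * of_int (d (k + n)) / 3 ^ Suc k :: real)" for n
 have geo: "(%k. 2 / 3 ^ Suc k :: real) sums 1"
  using sums_mult[OF geometric_sums[of "1/3::real"], of "2/3"] by (simp add: power_divide)
 have sm: "summable (%k. 2 * of_int (d (k + n)) / 3 ^ Suc k :: real)" for n
 proof (rule summable_comparison_test[OF _ sums_summable[OF geo]], intro exI allI impI)
  fix k show "norm (2 * of_int (d (k + n)) / 3 ^ Suc k :: real) <= 2 / 3 ^ Suc k"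
   using d[of "k + n"] by auto
 qed
 have tl_nonneg: "0 <= tl n" for n unfolding tl_def
 proof (rule suminf_nonneg[OF sm])
  fix k show "0 <= (2 * of_int (d (k + n)) / 3 ^ Suc k :: real)" using d[of "k + n"] by auto
 qed
 have tl_le: "tl n <= 1" for n
 proof -
  have "tl n <= (\<Sum>k. 2 / 3 ^ Suc k)" unfolding tl_def
  proof (rule suminf_le[OF _ sm sums_summable[OF geo]])
   fix k show "2 * of_int (d (k + n)) / 3 ^ Suc k <= (2 / 3 ^ Suc k :: real)" using d[of "k + n"] by auto
  qed
  thus ?thesis using geo by (simp add: sums_iff)
 qed
 have tl_rec: "tl n = 2 * of_int (d n) / 3 + tl (Suc n) / 3" for n
 proof -
  have "tl n = 2 * of_int (d (0 + n)) / 3 ^ Suc 0 + (\<Sum>k. 2 * of_int (d (Suc k + n)) / 3 ^ Suc (Suc k))"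
   unfolding tl_def using suminf_split_head[OF sm[of n]] by simp
  also have "(\<Sum>k. 2 * of_int (d (Suc k + n)) / 3 ^ Suc (Suc k)) = (\<Sum>k. (2 * of_int (d (k + Suc n)) / 3 ^ Suc k) / 3 :: real)"
   by simp
  also have "... = tl (Suc n) / 3" unfolding tl_def by (rule suminf_divide[OF sm])
  finally show ?thesis by simp
 qed
 have t0: "t = tl 0" using t by (simp add: tl_def sums_iff)
 have ex: "EX k. 3 ^ n * t = 2 * of_int k + tl n" for n
 proof (induction n)
  case 0 thus ?case using t0 by (intro exI[of _ 0]) simp
 next
  case (Suc n)
  then obtain k where "3 ^ n * t = 2 * of_int k + tl n" by blast
  hence "3 ^ Suc n * t = 2 * of_int (3 * k + d n) + tl (Suc n)" using tl_rec[of n] by simp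
  thus ?case by blast
 qed
 then obtain k where k: "3 ^ n * t = 2 * of_int k + tl n" by blast
 have "schoenberg_step (3 ^ n * t) = schoenberg_step (tl n)" unfolding k by (rule schoenberg_step_add_even)
 also have "... = min 1 (max 0 (3 * tl n - 1))" by (rule schoenberg_step_eq[OF tl_nonneg tl_le])
 also have "... = of_int (d n)"
  using d[of n] tl_nonneg[of "Suc n"] tl_le[of "Suc n"] by (auto simp: tl_rec[of n])
 finally show "schoenberg_step (3 ^ n * t) = of_int (d n)" .
 show "0 <= t" "t <= 1" using tl_nonneg[of 0] tl_le[of 0] t0 by auto
qed

definition schoenberg_coord :: "nat => real => real" where
 "schoenberg_coord i t = (\<Sum>n. schoenberg_step (3 ^ (2 * n + i) * t) / 2 ^ Suc n)"

lemma continuous_on_schoenberg_coord: "continuous_on UNIV (schoenberg_coord i)"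
proof -
 have u: "uniform_limit UNIV (%N t. \<Sum>n<N. schoenberg_step (3 ^ (2 * n + i) * t) / 2 ^ Suc n) (schoenberg_coord i) sequentially"
  unfolding schoenberg_coord_def[abs_def]
 proof (rule Weierstrass_m_test)
  fix n t
  show "norm (schoenberg_step (3 ^ (2 * n + i) * t) / 2 ^ Suc n) <= (1/2) ^ Suc n"
   using schoenberg_step_range[of "3 ^ (2 * n + i) * t"] by (simp add: power_divide divide_right_mono)
  show "summable (%n. (1/2::real) ^ Suc n)" using power_half_series by (rule sums_summable)
 qed
 show ?thesis proof (rule uniform_limit_theorem[OF _ u])
  have "continuous_on UNIV (%t. \<Sum>n<N. schoenberg_step (3 ^ (2 * n + i) * t) / 2 ^ Suc n)" for N
   by (intro continuous_intros continuous_on_compose2[OF continuous_on_schoenberg_step[of UNIV]]) auto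
  thus "\<forall>\<^sub>F N in sequentially. continuous_on UNIV (%t. \<Sum>n<N. schoenberg_step (3 ^ (2 * n + i) * t) / 2 ^ Suc n)"
   by simp
 qed simp
qed

lemma schoenberg_coords_surj:
 assumes "0 <= u" "u <= 1" "0 <= v" "v <= 1"
 obtains t where "0 <= t" "t <= 1" "schoenberg_coord 0 t = u" "schoenberg_coord 1 t = v"
proof -
 obtain a where a: "!!n. a n : {0, 1}" "(%n. of_int (a n) / 2 ^ Suc n) sums u"
  using binary_digits_exist[OF assms(1,2)] by blast
 obtain b where b: "!!n. b n : {0, 1}" "(%n. of_int (b n) / 2 ^ Suc n) sums v"
  using binary_digits_exist[OF assms(3,4)] by blast
 define d where "d n = (if even n then a (n div 2) else b (n div 2))" for n
 have d: "d n : {0, 1}" for n using a(1) b(1) by (simp add: d_def)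
 have "summable (%n. 2 * of_int (d n) / 3 ^ Suc n :: real)"
 proof (rule summable_comparison_test[where g = "%n. 2 * (1/3) ^ Suc n"], intro exI allI impI)
  fix n show "norm (2 * of_int (d n) / 3 ^ Suc n :: real) <= 2 * (1/3) ^ Suc n"
   using d[of n] by (auto simp: power_divide)
  show "summable (%n. 2 * (1/3::real) ^ Suc n)"
   using summable_mult[OF summable_geometric[of "1/3::real"], of "2/3"] by simp
 qed
 then obtain t where t: "(%n. 2 * of_int (d n) / 3 ^ Suc n) sums (t::real)" by (auto simp: summable_def)
 note T = schoenberg_step_ternary[OF d t]
 show ?thesis proof (rule that[of t])
  have "schoenberg_coord 0 t = (\<Sum>n. of_int (a n) / 2 ^ Suc n)"
   unfolding schoenberg_coord_def T(1) by (simp add: d_def)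
  thus "schoenberg_coord 0 t = u" using a(2) by (simp add: sums_iff)
  have "schoenberg_coord 1 t = (\<Sum>n. of_int (b n) / 2 ^ Suc n)"
   unfolding schoenberg_coord_def T(1) by (simp add: d_def)
  thus "schoenberg_coord 1 t = v" using b(2) by (simp add: sums_iff)
 qed (use T in auto)
qed

definition disc_curve :: "real => complex" where
 "disc_curve t = (let w = Complex (2 * schoenberg_coord 0 t - 1) (2 * schoenberg_coord 1 t - 1) in w /\<^sub>R max 1 (cmod w))"

lemma continuous_on_disc_curve: "continuous_on UNIV disc_curve"
proof -
 have "continuous_on UNIV (%t. Complex (2 * schoenberg_coord 0 t - 1) (2 * schoenberg_coord 1 t - 1))"
  by (intro continuous_intros continuous_on_schoenberg_coord)
 thus ?thesis unfolding disc_curve_def[abs_def] Let_def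
  by (intro continuous_intros continuous_on_schoenberg_coord) auto
qed

lemma disc_curve_range: "cmod (disc_curve t) <= 1"
proof -
 have "cmod (w /\<^sub>R max 1 (cmod w)) <= 1" for w
 proof -
  have "cmod (w /\<^sub>R max 1 (cmod w)) = cmod w / max 1 (cmod w)"
   by (simp add: divide_inverse mult.commute)
  also have "... <= 1" by (subst divide_le_eq_1_pos) auto
  finally show ?thesis .
 qed
 thus ?thesis unfolding disc_curve_def Let_def .
qed

lemma disc_curve_surj:
 assumes "cmod z <= 1" shows "EX t:{0..1}. disc_curve t = z"
proof -
 have "\<bar>Re z\<bar> <= 1" "\<bar>Im z\<bar> <= 1"
  using abs_Re_le_cmod[of z] abs_Im_le_cmod[of z] assms by linarith+
 then obtain t where "0 <= t" "t <= 1" "schoenberg_coord 0 t = (Re z + 1) / 2" "schoenberg_coord 1 t = (Im z + 1) / 2"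
  by (rule_tac schoenberg_coords_surj[of "(Re z + 1) / 2" "(Im z + 1) / 2"]) auto
 thus ?thesis
  using assms by (intro bexI[of _ t]) (auto simp: disc_curve_def Let_def field_simps max_def)
qed

text \<open>The least parameter of a point; a measurable right inverse of the curve, as sublevel sets are
images of compact sets.\<close>

definition disc_curve_section :: "complex => real" where
 "disc_curve_section z = (if cmod z <= 1 then Inf {t : {0..1}. disc_curve t = z} else 0)"

lemma disc_curve_section:
 assumes "cmod z <= 1"
 shows "disc_curve_section z : {0..1}" "disc_curve (disc_curve_section z) = z"
  and "t : {0..1} ==> disc_curve t = z ==> disc_curve_section z <= t"
proof -
 let ?F = "{t : {0..1}. disc_curve t = z}"
 have "closed ?F"
  by (rule continuous_closed_preimage_constant[OF continuous_on_subset[OF continuous_on_disc_curve subset_UNIV] closed_atLeastAtMost])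
 moreover have ne: "?F ~= {}" using disc_curve_surj[OF assms] by blast
 moreover have bb: "bdd_below ?F" by (rule bdd_belowI[of _ 0]) auto
 ultimately have "Inf ?F : ?F" by (rule closed_contains_Inf[rotated 2])
 thus "disc_curve_section z : {0..1}" "disc_curve (disc_curve_section z) = z"
  using assms by (auto simp: disc_curve_section_def)
 show "t : {0..1} ==> disc_curve t = z ==> disc_curve_section z <= t"
  using assms bb by (auto simp: disc_curve_section_def intro!: cInf_lower)
qed

lemma [measurable]: "disc_curve_section : borel_measurable borel"
proof (rule borel_measurable_iff_le[THEN iffD2], intro allI)
 fix c :: real
 have "{z : space borel. disc_curve_section z <= c} =
   disc_curve ` {0..min 1 c} \<union> (if 0 <= c then - cball 0 1 else {})"
 proof (rule Set.set_eqI, rule iffI)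
  fix z assume z: "z : {z : space borel. disc_curve_section z <= c}"
  show "z : disc_curve ` {0..min 1 c} \<union> (if 0 <= c then - cball 0 1 else {})"
  proof (cases "cmod z <= 1")
   case True
   hence "disc_curve_section z : {0..min 1 c}" using disc_curve_section(1)[OF True] z by auto
   hence "disc_curve (disc_curve_section z) : disc_curve ` {0..min 1 c}" by (rule imageI)
   thus ?thesis using disc_curve_section(2)[OF True] by simp
  qed (use z in \<open>auto simp: disc_curve_section_def\<close>)
 next
  fix z assume z: "z : disc_curve ` {0..min 1 c} \<union> (if 0 <= c then - cball 0 1 else {})"
  thus "z : {z : space borel. disc_curve_section z <= c}" proof
   assume "z : disc_curve ` {0..min 1 c}"
   then obtain t where t: "t : {0..min 1 c}" "disc_curve t = z" by blast
   hence "cmod z <= 1" using disc_curve_range[of t] by simp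
   from disc_curve_section(3)[OF this, of t] show ?thesis using t by auto
  qed (auto simp: disc_curve_section_def split: if_splits)
 qed
 moreover have "disc_curve ` {0..min 1 c} : sets borel"
  by (intro borel_compact compact_continuous_image continuous_on_subset[OF continuous_on_disc_curve]) auto
 ultimately show "{z : space borel. disc_curve_section z <= c} : sets borel" by auto
qed

section \<open>Moments of measures on the closed disc\<close>

definition has_disc_moments :: "complex measure => (nat => nat => complex) => bool" where
 "has_disc_moments nu a \<longleftrightarrow> nu : finite_borel_measures_on (cball 0 1) &
   (ALL k l. (LINT z|nu. z ^ k * cnj z ^ l) = a k l)"

lemma has_disc_momentsD:
 assumes "has_disc_moments nu a"
 shows "finite_measure nu" "sets nu = sets borel" "AE z in nu. cmod z <= 1" "(LINT z|nu. z ^ k * cnj z ^ l) = a k l"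
 using assms by (auto simp: has_disc_moments_def finite_borel_measures_on_def)

lemma [measurable]: "(%z::complex. z ^ k * cnj z ^ l) : borel_measurable borel"
 by measurable

lemma disc_moment_00:
 assumes "has_disc_moments nu a"
 shows "a 0 0 = of_real (measure nu UNIV)" "cmod (a k l) <= Re (a 0 0)"
proof -
 note M = has_disc_momentsD[OF assms]
 interpret finite_measure nu by (rule M)
 have sp: "space nu = UNIV" using sets_eq_imp_space_eq[OF M(2)] by simp
 show 0: "a 0 0 = of_real (measure nu UNIV)" using M(4)[of 0 0] sp by (simp add: scaleR_conv_of_real)
 have [measurable_cong]: "sets nu = sets borel" by (rule M)
 have "cmod (LINT z|nu. z ^ k * cnj z ^ l) <= (LINT z|nu. norm (z ^ k * cnj z ^ l))" by (rule integral_norm_bound)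
 also have "... <= (LINT z|nu. 1)" proof (rule integral_mono_AE)
  show le: "AE z in nu. norm (z ^ k * cnj z ^ l) <= 1"
   using M(3) by eventually_elim (simp add: norm_mult norm_power mult_le_one power_le_one)
  show "integrable nu (%z. norm (z ^ k * cnj z ^ l))"
   by (rule integrable_const_bound[of _ 1]) (use le in auto)
 qed auto
 finally show "cmod (a k l) <= Re (a 0 0)" using M(4) 0 sp by simp
qed

text \<open>Weak compactness of measures on the disc is reduced to Helly's theorem on the line: measures are
lifted along the curve, a subsequence converges weakly, and the limit is mapped back.\<close>

lemma has_disc_moments_limit:
 assumes nu: "!!n. has_disc_moments (nu n) (a n)" and lim: "!!k l. (%n. a n k l) ----> b k l"
 shows "EX nu. has_disc_moments nu b"
proof (cases "b 0 0 = 0")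
 case True
 have "b k l = 0" for k l
 proof -
  have "(%n. Re (a n 0 0)) ----> Re (b 0 0)" by (intro tendsto_intros lim)
  hence "(%n. a n k l) ----> 0" using disc_moment_00(2)[OF nu] True
   by (intro Lim_null_comparison[of "%n. a n k l" "%n. Re (a n 0 0)"] always_eventually allI) simp_all
  thus ?thesis using lim LIMSEQ_unique by blast
 qed
 moreover have AE0: "AE z in null_measure (borel :: complex measure). Q z" for Q
  by (rule AE_I[of _ _ UNIV]) auto
 moreover have "(LINT z|null_measure borel. z ^ k * cnj z ^ l) = 0" for k l
  by (rule integral_eq_zero_AE[OF AE0])
 ultimately have "has_disc_moments (null_measure borel) b"
  by (auto simp: has_disc_moments_def finite_borel_measures_on_def intro!: finite_measureI)
 thus ?thesis by blast
next
 case False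
 define c where "c n = Re (a n 0 0)" for n
 have clim: "c ----> Re (b 0 0)" unfolding c_def by (intro tendsto_intros lim)
 have c_eq: "a n 0 0 = of_real (c n)" "c n = measure (nu n) UNIV" for n
  using disc_moment_00(1)[OF nu, of n] by (auto simp: c_def)
 have "(%n. a n 0 0) ----> of_real (Re (b 0 0))" unfolding c_eq(1) by (intro tendsto_intros clim)
 hence b00: "b 0 0 = of_real (Re (b 0 0))" using lim LIMSEQ_unique by blast
 have "0 <= Re (b 0 0)" by (rule LIMSEQ_le_const[OF clim]) (auto simp: c_eq(2))
 hence bpos: "0 < Re (b 0 0)" using False b00 by (metis less_eq_real_def of_real_0)
 obtain N where N: "!!n. n >= N ==> 0 < c n"
  using order_tendstoD(1)[OF clim bpos] unfolding eventually_sequentially by blast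
 define P where "P n = distr (density (nu (n + N)) (%_. ennreal (1 / c (n + N)))) borel disc_curve_section" for n
 have mom: "(LINT t|P n. disc_curve t ^ k * cnj (disc_curve t) ^ l) = a (n + N) k l / of_real (c (n + N))"
  and Pd: "real_distribution (P n)" and Psupp: "measure (P n) {-1<..1} = 1" for n k l
 proof -
  note M = has_disc_momentsD[OF nu[of "n + N"]]
  interpret finite_measure "nu (n + N)" by (rule M)
  have [measurable_cong]: "sets (nu (n + N)) = sets borel" by (rule M)
  have sp: "space (nu (n + N)) = UNIV" using sets_eq_imp_space_eq[OF M(2)] by simp
  have cp: "0 < c (n + N)" using N by simp
  have dcm[measurable]: "disc_curve : borel_measurable borel"
   by (intro borel_measurable_continuous_onI continuous_on_disc_curve)
  let ?Q = "density (nu (n + N)) (%_. ennreal (1 / c (n + N)))"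
  have "emeasure ?Q UNIV = ennreal (1 / c (n + N)) * emeasure (nu (n + N)) UNIV"
   using sp by (simp add: emeasure_density_const)
  also have "... = 1"
   using cp c_eq(2)[of "n + N"] by (simp add: emeasure_eq_measure flip: ennreal_mult')
  finally have eQ: "emeasure ?Q UNIV = 1" .
  interpret Q: prob_space ?Q by (rule prob_spaceI) (simp add: eQ sp)
  have "prob_space (P n)" unfolding P_def by (rule Q.prob_space_distr) simp
  then interpret P: prob_space "P n" .
  show "real_distribution (P n)" unfolding real_distribution_def real_distribution_axioms_def
   using \<open>prob_space (P n)\<close> by (simp add: P_def)
  have AEQ: "AE z in ?Q. cmod z <= 1" using M(3) by (subst AE_density) auto
  have "AE t in P n. t : {-1<..1}" unfolding P_def using AEQ disc_curve_section(1)
   by (subst AE_distr_iff) (auto elim!: eventually_mono simp: sp, fastforce)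
  thus "measure (P n) {-1<..1} = 1" by (subst P.prob_eq_1) (auto simp: P_def)
  have "(LINT t|P n. disc_curve t ^ k * cnj (disc_curve t) ^ l)
    = (LINT z|?Q. disc_curve (disc_curve_section z) ^ k * cnj (disc_curve (disc_curve_section z)) ^ l)"
   unfolding P_def by (rule integral_distr) measurable
  also have "... = (LINT z|?Q. z ^ k * cnj z ^ l)"
   by (rule integral_cong_AE) (use AEQ disc_curve_section(2) in \<open>auto elim!: eventually_mono\<close>)
  also have "... = (LINT z|nu (n + N). (1 / c (n + N)) *\<^sub>R (z ^ k * cnj z ^ l))"
   by (rule integral_density) (use cp in auto)
  also have "... = a (n + N) k l / of_real (c (n + N))" by (simp add: M(4) scaleR_conv_of_real)
  finally show "(LINT t|P n. disc_curve t ^ k * cnj (disc_curve t) ^ l) = a (n + N) k l / of_real (c (n + N))" .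
 qed
 have "tight P" unfolding tight_def
 proof (intro conjI allI impI)
  fix e :: real assume "0 < e"
  thus "EX a b. a < b & (ALL n. 1 - e < measure (P n) {a<..b})"
   by (intro exI[of _ "-1"] exI[of _ 1]) (auto simp: Psupp)
 qed (rule Pd)
 from tight_imp_convergent_subsubsequence[OF this strict_mono_id]
 obtain r M where r: "strict_mono r" and M: "real_distribution M" and w: "weak_conv_m (P \<circ> id \<circ> r) M" by blast
 interpret M: real_distribution M by fact
 have dcm[measurable]: "disc_curve : borel_measurable borel"
  by (intro borel_measurable_continuous_onI continuous_on_disc_curve)
 have M_mom: "(LINT t|M. disc_curve t ^ k * cnj (disc_curve t) ^ l) = b k l / b 0 0" for k l
 proof -
  let ?f = "%t. disc_curve t ^ k * cnj (disc_curve t) ^ l"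
  have "(%n. integral\<^sup>L ((P \<circ> id \<circ> r) n) ?f) ----> integral\<^sup>L M ?f"
  proof (rule weak_conv_imp_integral_bdd_continuous_conv[OF _ M w, where B = 1])
   show "real_distribution ((P \<circ> id \<circ> r) n)" for n using Pd by simp
   show "isCont ?f x" for x
   proof -
    have "continuous_on UNIV ?f" by (intro continuous_intros continuous_on_disc_curve)
    thus ?thesis by (simp add: continuous_on_eq_continuous_at)
   qed
   show "norm (?f x) <= 1" for x
    using disc_curve_range[of x] by (simp add: norm_mult norm_power mult_le_one power_le_one)
  qed
  moreover have "(%n. integral\<^sup>L ((P \<circ> id \<circ> r) n) ?f) ----> b k l / of_real (Re (b 0 0))"
  proof -
   have "(%n. a (n + N) k l / of_real (c (n + N))) ----> b k l / of_real (Re (b 0 0))"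
    using LIMSEQ_ignore_initial_segment[OF lim, of N] LIMSEQ_ignore_initial_segment[OF clim, of N] bpos
    by (intro tendsto_intros) auto
   from LIMSEQ_subseq_LIMSEQ[OF this r] show ?thesis by (simp add: mom o_def)
  qed
  ultimately have "integral\<^sup>L M ?f = b k l / of_real (Re (b 0 0))" by (rule LIMSEQ_unique)
  thus ?thesis using b00 by simp
 qed
 define nu' where "nu' = density (distr M borel disc_curve) (%_. ennreal (Re (b 0 0)))"
 have "has_disc_moments nu' b" unfolding has_disc_moments_def finite_borel_measures_on_def
 proof (intro conjI CollectI allI)
  show "sets nu' = sets borel" by (simp add: nu'_def)
  show "finite_measure nu'" proof (rule finite_measureI)
   have "emeasure (distr M borel disc_curve) UNIV = emeasure M (space M)" by (simp add: emeasure_distr)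
   thus "emeasure nu' (space nu') ~= \<infinity>"
    using M.emeasure_space_1 by (simp add: nu'_def emeasure_density_const)
  qed
  show "AE z in nu'. z : cball 0 1"
   unfolding nu'_def by (subst AE_density, simp, subst AE_distr_iff) (auto simp: disc_curve_range)
  fix k l
  have "(LINT z|nu'. z ^ k * cnj z ^ l) = (LINT z|distr M borel disc_curve. Re (b 0 0) *\<^sub>R (z ^ k * cnj z ^ l))"
   unfolding nu'_def by (rule integral_density) (use bpos in auto)
  also have "... = (LINT t|M. Re (b 0 0) *\<^sub>R (disc_curve t ^ k * cnj (disc_curve t) ^ l))"
   by (rule integral_distr) measurable
  also have "... = Re (b 0 0) *\<^sub>R (b k l / b 0 0)" by (simp only: integral_scaleR_right M_mom)
  also have "... = b k l" using b00 False by (metis nonzero_mult_div_cancel_left scaleR_conv_of_real times_divide_eq_right)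
  finally show "(LINT z|nu'. z ^ k * cnj z ^ l) = b k l" .
 qed
 thus ?thesis by blast
qed

inductive_set monomial_span :: "(complex => complex) set" where
 monomial: "(%z. c * (z ^ k * cnj z ^ l)) : monomial_span"
| add: "f : monomial_span ==> g : monomial_span ==> (%z. f z + g z) : monomial_span"

definition preserves_span :: "(complex => complex) => bool" where
 "preserves_span f \<longleftrightarrow> (ALL h:monomial_span. (%z. f z * h z) : monomial_span)"

lemma preserves_span_monomial: "preserves_span (%z. c * (z ^ k * cnj z ^ l))"
 unfolding preserves_span_def
proof
 fix h assume "h : monomial_span"
 thus "(%z. c * (z ^ k * cnj z ^ l) * h z) : monomial_span" proof induction
  case (monomial c' k' l')
  have "(%z. (c * c') * (z ^ (k + k') * cnj z ^ (l + l'))) : monomial_span" by (rule monomial_span.monomial)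
  thus ?case by (simp add: power_add mult_ac)
 next
  case (add f g)
  thus ?case by (simp add: distrib_left monomial_span.add)
 qed
qed

lemma preserves_span_add: "preserves_span f ==> preserves_span g ==> preserves_span (%z. f z + g z)"
 unfolding preserves_span_def by (simp add: distrib_right monomial_span.add)

lemma preserves_span_mult: "preserves_span f ==> preserves_span g ==> preserves_span (%z. f z * g z)"
 unfolding preserves_span_def by (simp add: mult.assoc)

lemma real_polynomial_preserves_span:
 assumes "real_polynomial_function f"
 shows "preserves_span (%z. complex_of_real (f z))" using assms
proof induction
 case (linear f)
 interpret bounded_linear f by fact
 have fz: "f z = Re z * f 1 + Im z * f \<i>" for z
 proof -
  have "z = Re z *\<^sub>R 1 + Im z *\<^sub>R \<i>" by (simp add: complex_eq_iff)
  hence "f z = f (Re z *\<^sub>R 1 + Im z *\<^sub>R \<i>)" by simp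
  thus ?thesis by (simp add: add scale)
 qed
 have ri: "complex_of_real (Re z) = (z + cnj z) / 2" "complex_of_real (Im z) = (z - cnj z) / (2 * \<i>)" for z
  by (auto simp: complex_eq_iff Re_divide Im_divide)
 have eq: "complex_of_real (f z) = (of_real (f 1) / 2 + of_real (f \<i>) / (2 * \<i>)) * (z ^ 1 * cnj z ^ 0)
   + (of_real (f 1) / 2 - of_real (f \<i>) / (2 * \<i>)) * (z ^ 0 * cnj z ^ 1)" for z
 proof -
  have alg: "(z + w) / 2 * p + (z - w) / (2 * \<i>) * q = (p / 2 + q / (2 * \<i>)) * z + (p / 2 - q / (2 * \<i>)) * w" for w p q :: complex
   by (simp add: algebra_simps add_divide_distrib diff_divide_distrib)
  have "complex_of_real (f z) = complex_of_real (Re z) * of_real (f 1) + complex_of_real (Im z) * of_real (f \<i>)"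
   unfolding fz[of z] by (simp only: of_real_add of_real_mult)
  thus ?thesis unfolding ri alg by (simp only: power_one_right power_0 mult_1_right mult_1_left)
 qed
 show ?case by (subst eq) (intro preserves_span_add preserves_span_monomial)
next
 case (const c)
 show ?case using preserves_span_monomial[of "of_real c" 0 0] by simp
qed (auto intro: preserves_span_add preserves_span_mult)

lemma le_zero_of_le_epsilon_mult:
 fixes x K :: real
 assumes K: "0 <= K" and le: "!!e. 0 < e ==> x <= e * K"
 shows "x <= 0"
proof (rule field_le_epsilon)
 fix e :: real assume e: "0 < e"
 have K1: "0 < K + 1" using K by simp
 have "x <= e / (K + 1) * K" using e K1 by (intro le divide_pos_pos)
 also have "... <= e / (K + 1) * (K + 1)" using e K1 by (intro mult_left_mono) auto
 also have "... = 0 + e" using K1 by simp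
 finally show "x <= 0 + e" .
qed

lemma integral_uniform_close:
 fixes f g :: "complex => real"
 assumes "finite_measure M" and A: "AE z in M. cmod z <= 1" and fi: "integrable M f" "integrable M g"
  and fg: "!!z. cmod z <= 1 ==> \<bar>f z - g z\<bar> < e" and sp: "space M = UNIV"
 shows "\<bar>integral\<^sup>L M f - integral\<^sup>L M g\<bar> <= e * measure M UNIV"
proof -
 interpret finite_measure M by fact
 have "\<bar>integral\<^sup>L M f - integral\<^sup>L M g\<bar> = norm (LINT z|M. f z - g z)" using fi by simp
 also have "... <= (LINT z|M. norm (f z - g z))" by (rule integral_norm_bound)
 also have "... <= (LINT z|M. e)"
  by (rule integral_mono_AE) (use fi A fg in \<open>auto elim!: eventually_mono simp: less_imp_le\<close>)
 finally show ?thesis by (simp add: sp mult.commute)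
qed

text \<open>By Stone--Weierstrass the moments determine the integrals of continuous functions, and indicators
of closed sets are limits of such.\<close>

lemma disc_moments_unique:
 assumes M1: "has_disc_moments mu a" and M2: "has_disc_moments nu a"
 shows "mu = nu"
proof -
 note A = has_disc_momentsD[OF M1] and B = has_disc_momentsD[OF M2]
 interpret A: finite_measure mu by (rule A)
 interpret B: finite_measure nu by (rule B)
 have [measurable_cong]: "sets mu = sets borel" "sets nu = sets borel" by (rule A B)+
 have sp: "space mu = UNIV" "space nu = UNIV" using sets_eq_imp_space_eq[OF A(2)] sets_eq_imp_space_eq[OF B(2)] by simp_all
 have imono: "integrable mu (%z. z ^ k * cnj z ^ l)" "integrable nu (%z. z ^ k * cnj z ^ l)" for k l
  by (rule A.integrable_const_bound[of _ 1] B.integrable_const_bound[of _ 1];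
    use A(3) B(3) in \<open>auto elim!: eventually_mono simp: norm_mult norm_power mult_le_one power_le_one\<close>)+
 have span: "integrable mu f & integrable nu f & integral\<^sup>L mu f = integral\<^sup>L nu f" if "f : monomial_span" for f
  using that by induction (auto simp: imono A(4) B(4))
 have poly: "integrable mu f & integrable nu f & integral\<^sup>L mu f = integral\<^sup>L nu f"
  if "real_polynomial_function f" for f
 proof -
  have "(%z. complex_of_real (f z) * (1 * (z ^ 0 * cnj z ^ 0))) : monomial_span"
   using real_polynomial_preserves_span[OF that] monomial_span.monomial[of 1 0 0] unfolding preserves_span_def by (rule bspec)
  hence "(%z. complex_of_real (f z)) : monomial_span" by simp
  from span[OF this] show ?thesis
   unfolding complex_of_real_integrable_eq integral_complex_of_real of_real_eq_iff .
 qed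
 have cont: "integral\<^sup>L mu f = integral\<^sup>L nu f" if f: "continuous_on UNIV f" and bd: "!!z. \<bar>f z\<bar> <= C" for f :: "complex => real" and C
 proof -
  have fm[measurable]: "f : borel_measurable borel" by (rule borel_measurable_continuous_onI[OF f])
  have fi: "integrable mu f" "integrable nu f"
   using bd by (auto intro!: A.integrable_const_bound[of _ C] B.integrable_const_bound[of _ C])
  let ?m = "measure mu UNIV + measure nu UNIV"
  have "\<bar>integral\<^sup>L mu f - integral\<^sup>L nu f\<bar> <= e * ?m" if e: "0 < e" for e
  proof -
   obtain g where g: "real_polynomial_function g" "!!z. z : cball 0 1 ==> \<bar>f z - g z\<bar> < e"
    by (rule Stone_Weierstrass_real_polynomial_function[OF compact_cball[of "0::complex" 1] continuous_on_subset[OF f subset_UNIV] e]) (rule that; blast)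
   note P = poly[OF g(1)]
   have 1: "\<bar>integral\<^sup>L mu f - integral\<^sup>L mu g\<bar> <= e * measure mu UNIV"
    by (rule integral_uniform_close[OF A(1,3) fi(1) _ _ sp(1)]) (use P g(2) in auto)
   have 2: "\<bar>integral\<^sup>L nu f - integral\<^sup>L nu g\<bar> <= e * measure nu UNIV"
    by (rule integral_uniform_close[OF B(1,3) fi(2) _ _ sp(2)]) (use P g(2) in auto)
   show ?thesis using 1 2 P by (simp add: distrib_left)
  qed
  note le = this
  have "\<bar>integral\<^sup>L mu f - integral\<^sup>L nu f\<bar> <= 0"
   by (rule le_zero_of_le_epsilon_mult[OF _ le]) simp
  thus ?thesis by simp
 qed
 have closed: "emeasure mu S = emeasure nu S" if S: "closed S" for S
 proof (cases "S = {}")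
  case False
  let ?f = "%n z. max 0 (1 - real n * infdist z S)"
  have Sm[measurable]: "S : sets borel" using S by (rule borel_closed)
  have fc: "continuous_on UNIV (?f n)" for n by (intro continuous_intros)
  have fb: "\<bar>?f n z\<bar> <= 1" for n z using infdist_nonneg[of z S] by auto
  have fm[measurable]: "?f n : borel_measurable borel" for n by (rule borel_measurable_continuous_onI[OF fc])
  have flim: "(%n. ?f n z) ----> indicator S z" for z
  proof (cases "z : S")
   case True
   thus ?thesis by (simp add: infdist_zero)
  next
   case z: False
   hence pos: "0 < infdist z S" using S False in_closed_iff_infdist_zero[OF S False, of z] infdist_nonneg[of z S] by (simp add: less_le)
   obtain N where "1 < real N * infdist z S" using reals_Archimedean3[OF pos] by blast
   have "\<forall>\<^sub>F n in sequentially. 0 = ?f n z" unfolding eventually_sequentially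
   proof (intro exI[of _ N] allI impI)
    fix n assume "N <= n"
    hence "real N * infdist z S <= real n * infdist z S" using pos by (intro mult_right_mono) auto
    thus "0 = ?f n z" using \<open>1 < real N * infdist z S\<close> by simp
   qed
   thus ?thesis using z by (auto intro: Lim_transform_eventually[OF tendsto_const])
  qed
  have l1: "(%n. integral\<^sup>L mu (?f n)) ----> integral\<^sup>L mu (indicator S)"
   by (rule integral_dominated_convergence[where w = "%_. 1"]) (use fb flim in auto)
  have l2: "(%n. integral\<^sup>L nu (?f n)) ----> integral\<^sup>L nu (indicator S)"
   by (rule integral_dominated_convergence[where w = "%_. 1"]) (use fb flim in auto)
  have "integral\<^sup>L mu (?f n) = integral\<^sup>L nu (?f n)" for n by (rule cont[OF fc fb])
  from LIMSEQ_unique[OF l1[unfolded this] l2]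
  have "integral\<^sup>L mu (indicator S) = (integral\<^sup>L nu (indicator S) :: real)" .
  thus ?thesis by (simp add: sp A.emeasure_eq_measure B.emeasure_eq_measure)
 qed simp
 show ?thesis
 proof (rule measure_eqI_generator_eq[where E = "Collect closed" and \<Omega> = UNIV and A = "%_. UNIV"])
  show "Int_stable (Collect closed :: complex set set)" by (auto simp: Int_stable_def)
  have "sets (borel :: complex measure) = sigma_sets UNIV (Collect closed)"
   by (simp add: borel_eq_closed)
  thus "sets mu = sigma_sets UNIV (Collect closed)" "sets nu = sigma_sets UNIV (Collect closed)"
   by (simp_all add: A(2) B(2))
 qed (auto simp: closed)
qed

section \<open>The moment problem on the closed disc\<close>

text \<open>Nonnegativity of the complex number includes that it is real, so such a matrix is hermitian.\<close>

definition psd :: "(nat => nat => complex) => bool" where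
 "psd A \<longleftrightarrow> (ALL S x. 0 <= (SUM k<=S. SUM l<=S. x k * cnj (x l) * A k l))"

text \<open>On moments this is multiplication by \<open>(1 - |z|^2)^n\<close>.\<close>

primrec bdiff :: "nat => (nat => nat => complex) => nat => nat => complex" where
 "bdiff 0 A = A"
| "bdiff (Suc n) A = (%k l. bdiff n A k l - bdiff n A (Suc k) (Suc l))"

lemma bdiff_Suc_inner: "bdiff (Suc n) A = bdiff n (bdiff 1 A)"
proof (induction n)
 case (Suc n)
 have "bdiff (Suc (Suc n)) A = (%k l. bdiff (Suc n) A k l - bdiff (Suc n) A (Suc k) (Suc l))" by simp
 also have "... = (%k l. bdiff n (bdiff 1 A) k l - bdiff n (bdiff 1 A) (Suc k) (Suc l))"
  unfolding Suc.IH ..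
 finally show ?case by simp
qed simp

lemma bdiff_linear:
 "bdiff n (%k l. c * A k l + d * B k l) = (%k l. c * bdiff n A k l + d * bdiff n B k l)"
 by (induction n) (auto simp: fun_eq_iff algebra_simps)

lemma psd_add_scale:
 assumes "psd A" "psd B" "0 <= c" "0 <= d"
 shows "psd (%k l. of_real c * A k l + of_real d * B k l)" unfolding psd_def
proof (intro allI)
 fix S x
 have "(SUM k<=S. SUM l<=S. x k * cnj (x l) * (of_real c * A k l + of_real d * B k l))
   = of_real c * (SUM k<=S. SUM l<=S. x k * cnj (x l) * A k l) + of_real d * (SUM k<=S. SUM l<=S. x k * cnj (x l) * B k l)"
  by (simp add: sum_distrib_left sum.distrib distrib_left mult_ac)
 moreover have "0 <= of_real c * (SUM k<=S. SUM l<=S. x k * cnj (x l) * A k l)" "0 <= of_real d * (SUM k<=S. SUM l<=S. x k * cnj (x l) * B k l)"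
  using assms unfolding psd_def by (auto intro!: mult_nonneg_nonneg simp: less_eq_complex_def)
 ultimately show "0 <= (SUM k<=S. SUM l<=S. x k * cnj (x l) * (of_real c * A k l + of_real d * B k l))" by simp
qed

lemma psd_rescale:
 assumes "psd A" shows "psd (%k l. of_real r ^ (k + l) * A k l)" unfolding psd_def
proof (intro allI)
 fix S x
 have "0 <= (SUM k<=S. SUM l<=S. (x k * of_real r ^ k) * cnj (x l * of_real r ^ l) * A k l)"
  using assms unfolding psd_def by (rule allE[where x = S]) (erule allE)
 thus "0 <= (SUM k<=S. SUM l<=S. x k * cnj (x l) * (of_real r ^ (k + l) * A k l))"
  by (simp add: power_add mult_ac)
qed

definition all_psd :: "(nat => nat => complex) => bool" where
 "all_psd A \<longleftrightarrow> (ALL n. psd (bdiff n A))"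

lemma all_psd_bdiff: "all_psd A ==> all_psd (bdiff 1 A)"
 unfolding all_psd_def by (metis bdiff_Suc_inner)

lemma all_psd_rescale:
 assumes "all_psd A" "0 <= r" "r <= 1"
 shows "psd (bdiff n (%k l. of_real r ^ (k + l) * A k l))" using assms(1)
proof (induction n arbitrary: A)
 case 0
 hence "psd A" unfolding all_psd_def by (metis bdiff.simps(1))
 thus ?case by (simp add: psd_rescale)
next
 case (Suc n)
 define A' where "A' k l = of_real (1 - r\<^sup>2) * A k l + of_real (r\<^sup>2) * bdiff 1 A k l" for k l
 have "r\<^sup>2 <= 1" using assms by (simp add: power_le_one)
 have "all_psd A'" unfolding all_psd_def
 proof
  fix i
  have "psd (bdiff i A)" "psd (bdiff i (bdiff 1 A))" using Suc.prems all_psd_bdiff[OF Suc.prems] by (auto simp: all_psd_def)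
  thus "psd (bdiff i A')"
   unfolding A'_def[abs_def] bdiff_linear using \<open>r\<^sup>2 <= 1\<close> by (intro psd_add_scale) auto
 qed
 moreover have "bdiff 1 (%k l. of_real r ^ (k + l) * A k l) = (%k l. of_real r ^ (k + l) * A' k l)"
  by (auto simp: fun_eq_iff A'_def algebra_simps power2_eq_square)
 ultimately show ?case unfolding bdiff_Suc_inner using Suc.IH by simp
qed

lemma psd_diag:
 assumes "psd A" shows "0 <= A n n"
proof -
 let ?v = "%i. if i = n then 1 else 0 :: complex"
 have "0 <= (SUM k<=n. SUM l<=n. ?v k * cnj (?v l) * A k l)"
  using assms unfolding psd_def by (rule allE[where x = n]) (erule allE)
 also have "... = (SUM k:{n}. SUM l:{n}. ?v k * cnj (?v l) * A k l)" proof -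
  have "(SUM l<=n. ?v k * cnj (?v l) * A k l) = (SUM l:{n}. ?v k * cnj (?v l) * A k l)" for k
   by (rule sum.mono_neutral_right) auto
  moreover have "(SUM k<=n. SUM l:{n}. ?v k * cnj (?v l) * A k l) = (SUM k:{n}. SUM l:{n}. ?v k * cnj (?v l) * A k l)"
   by (rule sum.mono_neutral_right) auto
  ultimately show ?thesis by simp
 qed
 finally show ?thesis by simp
qed

lemma psd_two_point:
 assumes "psd A" "k ~= l"
 shows "0 <= x * cnj x * A k k + x * cnj y * A k l + y * cnj x * A l k + y * cnj y * A l l"
proof -
 let ?v = "%i. if i = k then x else if i = l then y else 0"
 let ?n = "max k l"
 have "0 <= (SUM i<=?n. SUM j<=?n. ?v i * cnj (?v j) * A i j)"
  using assms(1) unfolding psd_def by (rule allE[where x = ?n]) (erule allE)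
 also have "... = (SUM i:{k,l}. SUM j:{k,l}. ?v i * cnj (?v j) * A i j)" proof -
  have "(SUM j<=?n. ?v i * cnj (?v j) * A i j) = (SUM j:{k,l}. ?v i * cnj (?v j) * A i j)" for i
   by (rule sum.mono_neutral_right) auto
  moreover have "(SUM i<=?n. SUM j:{k,l}. ?v i * cnj (?v j) * A i j) = (SUM i:{k,l}. SUM j:{k,l}. ?v i * cnj (?v j) * A i j)"
   by (rule sum.mono_neutral_right) auto
  ultimately show ?thesis by simp
 qed
 finally show ?thesis using assms(2) by (simp add: add.assoc)
qed

lemma psd_hermitian:
 assumes "psd A" shows "A l k = cnj (A k l)"
proof (cases "k = l")
 case True
 thus ?thesis using psd_diag[OF assms, of k] by (simp add: complex_eq_iff less_eq_complex_def)
next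
 case False
 have d: "Im (A k k) = 0" "Im (A l l) = 0" using psd_diag[OF assms] by (auto simp: less_eq_complex_def)
 have "Im (A k l + A l k) = 0" using psd_two_point[OF assms False, of 1 1] d by (simp add: less_eq_complex_def)
 moreover have "Im (A k l * (- \<i>) + A l k * \<i>) = 0"
  using psd_two_point[OF assms False, of 1 \<i>] d by (simp add: less_eq_complex_def)
 ultimately show ?thesis by (simp add: complex_eq_iff)
qed

lemma psd_offdiag_bound:
 assumes A: "psd A" and c: "0 <= c" "0 <= d"
 shows "2 * (sqrt c * sqrt d) * cmod (A k l) <= c * Re (A k k) + d * Re (A l l)"
proof (cases "k = l")
 case True
 have "cmod (A l l) = Re (A l l)" using psd_diag[OF A, of l] by (simp add: cmod_eq_Re less_eq_complex_def)
 moreover have "2 * (sqrt c * sqrt d) <= c + d"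
  using sum_squares_bound[of "sqrt c" "sqrt d"] c by (simp add: power2_eq_square)
 moreover have "0 <= Re (A l l)" using psd_diag[OF A, of l] by (simp add: less_eq_complex_def)
 ultimately show ?thesis using True mult_right_mono[of "2 * (sqrt c * sqrt d)" "c + d" "Re (A l l)"]
  by (simp add: distrib_right)
next
 case False
 define u where "u = (if A k l = 0 then 1 else A k l / cmod (A k l))"
 have u: "cmod u = 1" by (simp add: u_def norm_divide)
 have uu: "u * cnj u = 1" using u complex_norm_square[of u] by simp
 have uA: "cnj u * A k l = of_real (cmod (A k l))" proof (cases "A k l = 0")
  case False
  have "cnj (A k l) * A k l = of_real (cmod (A k l)) * of_real (cmod (A k l))"
   using complex_norm_square[of "A k l"] by (simp add: power2_eq_square mult.commute)
  thus ?thesis using False by (simp add: u_def)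
 qed simp
 have uA': "u * A l k = of_real (cmod (A k l))"
  using arg_cong[OF uA, of cnj] psd_hermitian[OF A, of l k] by simp
 have "0 <= of_real (sqrt c) * cnj (of_real (sqrt c)) * A k k + of_real (sqrt c) * cnj (- of_real (sqrt d) * u) * A k l
    + (- of_real (sqrt d) * u) * cnj (of_real (sqrt c)) * A l k + (- of_real (sqrt d) * u) * cnj (- of_real (sqrt d) * u) * A l l"
  by (rule psd_two_point[OF A False])
 also have "... = of_real (sqrt c * sqrt c) * A k k - of_real (sqrt c * sqrt d) * (cnj u * A k l) - of_real (sqrt c * sqrt d) * (u * A l k)
   + of_real (sqrt d * sqrt d) * (u * cnj u) * A l l"
  by (simp add: algebra_simps del: real_sqrt_mult_self real_sqrt_abs2)
 also have "... = of_real c * A k k - 2 * of_real (sqrt c * sqrt d * cmod (A k l)) + of_real d * A l l"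
 proof -
  have "sqrt c * sqrt c = c" "sqrt d * sqrt d = d" using c by simp_all
  thus ?thesis unfolding uA uA' uu by (simp only: of_real_mult[of "sqrt c * sqrt d"] mult_1_right) (simp add: algebra_simps)
 qed
 finally have "0 <= Re (of_real c * A k k - 2 * of_real (sqrt c * sqrt d * cmod (A k l)) + of_real d * A l l)"
  by (simp only: less_eq_complex_def zero_complex.sel)
 thus ?thesis by simp
qed

text \<open>Coefficients of \<open>(1 - x)^(-N)\<close>.\<close>

definition nbin :: "nat => nat => nat" where
 "nbin N s = (s + N - 1) choose s"

lemma nbin_pos: "0 < N ==> 0 < nbin N s" by (simp add: nbin_def zero_less_binomial)

lemma nbin_Suc_Suc: "nbin (Suc N) (Suc s) = nbin N (Suc s) + nbin (Suc N) s"
 by (simp add: nbin_def add.commute)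

lemma nbin_step:
 assumes "0 < N" shows "nbin N (Suc n) * Suc n = (n + N) * nbin N n"
proof -
 obtain M where M: "N = Suc M" using assms by (cases N) auto
 show ?thesis using Suc_times_binomial_eq[of "n + M" n] unfolding nbin_def M by (simp add: mult.commute)
qed

lemma nbin_ratio:
 assumes "0 < N"
 shows "real (nbin N n) / real (nbin N (n + h)) = (\<Prod>i<h. real (Suc (n + i)) / real (n + i + N))"
proof (induction h)
 case 0
 thus ?case using nbin_pos[OF assms, of n] by simp
next
 case (Suc h)
 have p: "real (nbin N k) ~= 0" for k using nbin_pos[OF assms, of k] by simp
 have "real (nbin N (Suc (n + h))) * real (Suc (n + h)) = real (n + h + N) * real (nbin N (n + h))"
  using nbin_step[OF assms, of "n + h"] by (metis of_nat_mult)
 hence "real (nbin N (n + h)) / real (nbin N (n + Suc h)) = real (Suc (n + h)) / real (n + h + N)"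
  using p assms by (simp add: frac_eq_eq mult.commute del: of_nat_Suc of_nat_add)
 moreover have "real (nbin N n) / real (nbin N (n + Suc h)) =
   real (nbin N n) / real (nbin N (n + h)) * (real (nbin N (n + h)) / real (nbin N (n + Suc h)))"
  using p by simp
 ultimately show ?case using Suc.IH by simp
qed

lemma nbin_factor_bounds:
 assumes "0 < N"
 shows "0 <= real (Suc n) / real (n + N)" "real (Suc n) / real (n + N) <= 1"
 using assms by (auto simp: divide_le_eq)

lemma nbin_factor_diff:
 assumes "0 < N"
 shows "\<bar>real (Suc (n + h)) / real (n + h + N) - real (Suc n) / real (n + N)\<bar> <= real h / real N"
proof -
 have "real (Suc (n + h)) / real (n + h + N) - real (Suc n) / real (n + N)
   = (real (Suc (n + h)) * real (n + N) - real (Suc n) * real (n + h + N)) / (real (n + h + N) * real (n + N))"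
  using assms by (simp add: diff_frac_eq)
 also have "real (Suc (n + h)) * real (n + N) - real (Suc n) * real (n + h + N) = real h * (real N - 1)"
  by (simp add: algebra_simps)
 finally have e: "real (Suc (n + h)) / real (n + h + N) - real (Suc n) / real (n + N) = real h * (real N - 1) / (real (n + h + N) * real (n + N))" .
 have "real h * (real N - 1) / (real (n + h + N) * real (n + N)) <= real h * real N / (real N * real N)"
  using assms by (intro frac_le mult_mono mult_left_mono) auto
 moreover have "0 <= real h * (real N - 1) / (real (n + h + N) * real (n + N))"
  using assms by (intro divide_nonneg_nonneg mult_nonneg_nonneg) auto
 ultimately show ?thesis unfolding e using assms by simp
qed

lemma abs_sqrt_diff_le: "\<bar>sqrt a - sqrt b\<bar> <= sqrt \<bar>a - b\<bar>" if "0 <= a" "0 <= b" for a b :: real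
proof -
 have "sqrt x <= sqrt y + sqrt (x - y)" if "0 <= y" "y <= x" for x y :: real
  using sqrt_add_le_add_sqrt[of y "x - y"] that by simp
 from this[of a b] this[of b a] show ?thesis using that by (cases "a <= b") auto
qed

lemma prod_factor_diff:
 assumes "0 < N"
 shows "\<bar>(\<Prod>i<u. real (Suc (n + h + i)) / real (n + h + i + N)) - (\<Prod>i<u. real (Suc (n + i)) / real (n + i + N))\<bar> <= real u * real h / real N"
proof -
 have "norm ((\<Prod>i<u. real (Suc (n + h + i)) / real (n + h + i + N)) - (\<Prod>i<u. real (Suc (n + i)) / real (n + i + N)))
   <= (\<Sum>i<u. norm (real (Suc (n + h + i)) / real (n + h + i + N) - real (Suc (n + i)) / real (n + i + N)))"
  by (rule norm_prod_diff) (simp_all only: real_norm_def abs_of_nonneg nbin_factor_bounds[OF assms])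
 also have "... <= (\<Sum>i<u. real h / real N)" proof (rule sum_mono)
  fix i
  show "norm (real (Suc (n + h + i)) / real (n + h + i + N) - real (Suc (n + i)) / real (n + i + N)) <= real h / real N"
   using nbin_factor_diff[OF assms, of "n + i" h] by (simp add: add_ac)
 qed
 finally show ?thesis by simp
qed

lemma prod_factor_bounds:
 assumes "0 < N"
 shows "0 <= (\<Prod>i<u. real (Suc (n + i)) / real (n + i + N))" "(\<Prod>i<u. real (Suc (n + i)) / real (n + i + N)) <= 1"
 by (intro prod_nonneg ballI nbin_factor_bounds[OF assms]) (intro prod_le_1 conjI nbin_factor_bounds[OF assms])

text \<open>For large \<open>N\<close> the normalized product of two weights is close to the shifted weight,
relative to the geometric mean of the weights. This square root is what positivity of the matrix
can absorb.\<close>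

lemma nbin_weight_error:
 assumes N: "0 < N" and n: "k <= n + l"
 defines "n' \<equiv> n + l - k"
 shows "\<bar>real (nbin N n) * real (nbin N n') / real (nbin N (n + l)) - (if k <= n then real (nbin N (n - k)) else 0)\<bar>
  <= sqrt ((2 * real k * real l + real k) / real N) * (sqrt (nbin N n) * sqrt (nbin N n'))"
proof -
 let ?C = "%n. real (nbin N n)"
 have p: "0 < ?C j" for j using nbin_pos[OF N] by simp
 have sq: "sqrt (?C j) * sqrt (?C j) = ?C j" for j using p[of j] by simp
 define f where "f = sqrt (?C n) * sqrt (?C n')"
 have fpos: "0 < f" using p by (simp add: f_def)
 have ff: "f * f = ?C n * ?C n'" unfolding f_def using sq[of n] sq[of n'] by (metis mult.assoc mult.left_commute)
 have nl: "n + l = n' + k" using n by (simp add: n'_def)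
 have R1: "?C n / ?C (n + l) = (\<Prod>i<l. real (Suc (n + i)) / real (n + i + N))" by (rule nbin_ratio[OF N])
 have R2: "?C n' / ?C (n + l) = (\<Prod>i<k. real (Suc (n' + i)) / real (n' + i + N))" unfolding nl by (rule nbin_ratio[OF N])
 have X: "?C n * ?C n' / ?C (n + l) = sqrt (?C n / ?C (n + l) * (?C n' / ?C (n + l))) * f" proof -
  have "?C n / ?C (n + l) * (?C n' / ?C (n + l)) = (f / ?C (n + l)) * (f / ?C (n + l))" using ff by simp
  hence "sqrt (?C n / ?C (n + l) * (?C n' / ?C (n + l))) = \<bar>f / ?C (n + l)\<bar>"
   by (simp only: real_sqrt_abs2)
  hence "sqrt (?C n / ?C (n + l) * (?C n' / ?C (n + l))) = f / ?C (n + l)"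
   using fpos p[of "n + l"] by simp
  thus ?thesis using ff by simp
 qed
 have "\<bar>?C n * ?C n' / ?C (n + l) - (if k <= n then ?C (n - k) else 0)\<bar> <= sqrt ((2 * real k * real l + real k) / real N) * f"
 proof (cases "k <= n")
  case True
  define s where "s = n - k"
  have s: "n = s + k" "n' = s + l" using True n by (auto simp: s_def n'_def)
  have Q1: "?C s / ?C n' = (\<Prod>i<l. real (Suc (s + i)) / real (s + i + N))" unfolding s(2) by (rule nbin_ratio[OF N])
  have Q2: "?C s / ?C n = (\<Prod>i<k. real (Suc (s + i)) / real (s + i + N))" unfolding s(1) by (rule nbin_ratio[OF N])
  have Y: "?C s = sqrt (?C s / ?C n' * (?C s / ?C n)) * f" proof -
   have "?C s / ?C n' * (?C s / ?C n) = (?C s / f) * (?C s / f)" using ff by (simp add: mult.commute)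
   hence "sqrt (?C s / ?C n' * (?C s / ?C n)) = \<bar>?C s / f\<bar>" by (simp only: real_sqrt_abs2)
   hence "sqrt (?C s / ?C n' * (?C s / ?C n)) = ?C s / f" using fpos p[of s] by simp
   thus ?thesis using fpos by simp
  qed
  let ?a = "?C n / ?C (n + l) * (?C n' / ?C (n + l))" and ?b = "?C s / ?C n' * (?C s / ?C n)"
  have d1: "\<bar>?C n / ?C (n + l) - ?C s / ?C n'\<bar> <= real l * real k / real N"
   unfolding R1 Q1 unfolding s(1) by (rule prod_factor_diff[OF N])
  have d2: "\<bar>?C n' / ?C (n + l) - ?C s / ?C n\<bar> <= real k * real l / real N"
   unfolding R2 Q2 unfolding s(2) by (rule prod_factor_diff[OF N])
  have b1: "0 <= ?C n' / ?C (n + l)" "?C n' / ?C (n + l) <= 1" "0 <= ?C s / ?C n'" "?C s / ?C n' <= 1"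
   unfolding R2 Q1 by (rule prod_factor_bounds[OF N])+
  have "?a - ?b = (?C n / ?C (n + l) - ?C s / ?C n') * (?C n' / ?C (n + l)) + ?C s / ?C n' * (?C n' / ?C (n + l) - ?C s / ?C n)"
   by (simp add: algebra_simps)
  hence "\<bar>?a - ?b\<bar> <= \<bar>?C n / ?C (n + l) - ?C s / ?C n'\<bar> * \<bar>?C n' / ?C (n + l)\<bar> + \<bar>?C s / ?C n'\<bar> * \<bar>?C n' / ?C (n + l) - ?C s / ?C n\<bar>"
   unfolding abs_mult[symmetric] by (simp only: abs_triangle_ineq)
  also have "... <= (real l * real k / real N) * 1 + 1 * (real k * real l / real N)"
   by (intro add_mono mult_mono d1 d2) (use b1 in auto)
  also have "... = (2 * real k * real l) / real N" by (simp add: mult.commute[of "real l"])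
  also have "... <= (2 * real k * real l + real k) / real N" by (intro divide_right_mono) auto
  finally have ab: "\<bar>?a - ?b\<bar> <= (2 * real k * real l + real k) / real N" .
  have "\<bar>?C n * ?C n' / ?C (n + l) - ?C s\<bar> = \<bar>sqrt ?a - sqrt ?b\<bar> * f" proof -
   have "\<bar>sqrt ?a * f - sqrt ?b * f\<bar> = \<bar>sqrt ?a - sqrt ?b\<bar> * f"
    using fpos by (simp only: left_diff_distrib[symmetric] abs_mult abs_of_pos)
   thus ?thesis unfolding X[symmetric] Y[symmetric] .
  qed
  also have "... <= sqrt \<bar>?a - ?b\<bar> * f"
   using fpos p by (intro mult_right_mono abs_sqrt_diff_le mult_nonneg_nonneg divide_nonneg_nonneg) (auto simp: less_imp_le)
  also have "... <= sqrt ((2 * real k * real l + real k) / real N) * f"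
   using fpos ab by (intro mult_right_mono real_sqrt_le_mono) auto
  finally show ?thesis using True by (simp add: s_def)
 next
  case False
  hence "0 < l" using n by auto
  then obtain l' where l: "l = Suc l'" by (cases l) auto
  have "?C n / ?C (n + l) <= real k / real N" proof -
   have "?C n / ?C (n + l) = real (Suc n) / real (n + N) * (\<Prod>i<l'. real (Suc (Suc n + i)) / real (Suc n + i + N))"
    unfolding R1 unfolding l prod.lessThan_Suc_shift by simp
   also have "... <= real (Suc n) / real (n + N) * 1"
    by (intro mult_left_mono prod_factor_bounds[OF N]) auto
   also have "... <= real k / real N" using False N by (simp add: frac_le)
   finally show ?thesis .
  qed
  moreover have "0 <= ?C n' / ?C (n + l)" "?C n' / ?C (n + l) <= 1" unfolding R2 by (rule prod_factor_bounds[OF N])+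
  ultimately have "?C n / ?C (n + l) * (?C n' / ?C (n + l)) <= real k / real N * 1"
   using p by (intro mult_mono) (auto simp: less_imp_le)
  also have "... <= (2 * real k * real l + real k) / real N" by (simp add: divide_right_mono)
  finally have fin: "sqrt (?C n / ?C (n + l) * (?C n' / ?C (n + l))) * f <= sqrt ((2 * real k * real l + real k) / real N) * f"
   using fpos by (intro mult_right_mono real_sqrt_le_mono) auto
  have "?C n * ?C n' / ?C (n + l) <= sqrt ((2 * real k * real l + real k) / real N) * f"
   unfolding X by (rule fin)
  moreover have "0 <= ?C n * ?C n' / ?C (n + l)" using p by (intro divide_nonneg_nonneg mult_nonneg_nonneg) auto
  ultimately show ?thesis unfolding if_not_P[OF False] by (simp only: diff_zero abs_of_nonneg)
 qed
 thus ?thesis by (simp add: f_def)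
qed

lemma bdiff_diag_geometric_bound:
 assumes "!!j. cmod (A (k + j) (l + j)) <= B * q ^ j" "0 <= q" "q <= 1"
 shows "cmod (bdiff N A (k + j) (l + j)) <= 2 ^ N * B * q ^ j"
proof (induction N arbitrary: j)
 case 0 thus ?case using assms(1) by simp
next
 case (Suc N)
 have B0: "0 <= B" using order_trans[OF norm_ge_zero assms(1)[of 0]] by simp
 have "cmod (bdiff (Suc N) A (k + j) (l + j)) <= cmod (bdiff N A (k + j) (l + j)) + cmod (bdiff N A (k + Suc j) (l + Suc j))"
  by (simp add: norm_triangle_ineq4)
 also have "... <= 2 ^ N * B * q ^ j + 2 ^ N * B * q ^ Suc j" by (intro add_mono Suc.IH)
 also have "... <= 2 ^ N * B * q ^ j + 2 ^ N * B * q ^ j"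
  using assms B0 by (intro add_left_mono mult_left_mono power_decreasing) auto
 also have "... = 2 ^ Suc N * B * q ^ j" by simp
 finally show ?case .
qed

text \<open>Formally \<open>(1 - D)^(-N) (1 - D)^N = 1\<close> for the diagonal shift \<open>D\<close>;
geometric decay makes the series converge.\<close>

lemma bdiff_negative_binomial_sums:
 assumes bd: "!!j. cmod (A (k + j) (l + j)) <= B * q ^ j" and q: "0 <= q" "q < 1"
 shows "(%s. of_nat (nbin N s) * bdiff N A (k + s) (l + s)) sums A k l"
proof (induction N)
 case 0
 have "(%s. of_nat (nbin 0 s) * bdiff 0 A (k + s) (l + s)) = (%s. if s = 0 then A k l else 0)"
  by (auto simp: fun_eq_iff nbin_def binomial_eq_0)
 thus ?case using sums_single[of 0 "%_. A k l"] by simp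
next
 case (Suc N)
 let ?w = "%s. bdiff N A (k + s) (l + s)"
 have part: "(\<Sum>s<n. of_nat (nbin (Suc N) s) * (?w s - ?w (Suc s))) =
   (\<Sum>s<Suc n. of_nat (nbin N s) * ?w s) - of_nat (nbin (Suc N) n) * ?w n" for n
 proof (induction n)
  case 0 thus ?case by (simp add: nbin_def)
 next
  case (Suc n)
  thus ?case by (simp add: nbin_Suc_Suc algebra_simps)
 qed
 have "(%n. of_nat (nbin (Suc N) n) * ?w n) ----> 0"
 proof (rule Lim_null_comparison)
  have "(%n. of_nat ((n + N) choose N) * q ^ n) ----> 0"
   by (rule summable_LIMSEQ_zero[OF summable_negative_binomial[OF q]])
  hence "(%n. 2 ^ N * B * (of_nat ((n + N) choose N) * q ^ n)) ----> 2 ^ N * B * 0" by (intro tendsto_intros)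
  thus "(%n. 2 ^ N * B * (of_nat ((n + N) choose N) * q ^ n)) ----> 0" by simp
  show "\<forall>\<^sub>F n in sequentially. norm (of_nat (nbin (Suc N) n) * ?w n) <= 2 ^ N * B * (of_nat ((n + N) choose N) * q ^ n)"
  proof (rule always_eventually, rule allI)
   fix n
   have "nbin (Suc N) n = (n + N) choose N" using binomial_symmetric[of n "n + N"] by (simp add: nbin_def)
   thus "norm (of_nat (nbin (Suc N) n) * ?w n) <= 2 ^ N * B * (of_nat ((n + N) choose N) * q ^ n)"
    using mult_left_mono[OF bdiff_diag_geometric_bound[of A k l B q N n, OF bd q(1)], of "of_nat ((n + N) choose N)"] q
    by (simp add: norm_mult mult_ac)
  qed
 qed
 moreover have "(%n. \<Sum>s<Suc n. of_nat (nbin N s) * ?w s) ----> A k l"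
  using Suc.IH unfolding sums_def by (rule LIMSEQ_Suc)
 ultimately have "(%n. (\<Sum>s<Suc n. of_nat (nbin N s) * ?w s) - of_nat (nbin (Suc N) n) * ?w n) ----> A k l - 0"
  by (intro tendsto_diff)
 thus ?case unfolding sums_def bdiff.simps add_Suc_right[symmetric] part by (simp only: diff_zero)
qed

lemma circular_integrable_monomial:
 assumes "circular_measure M rho w"
 shows "integrable M (%z. z ^ a * cnj z ^ b)"
proof -
 interpret finite_measure M using assms by (simp add: circular_measure_def)
 have [measurable_cong]: "sets M = sets borel" using assms by (simp add: circular_measure_def)
 show ?thesis by (rule integrable_const_bound[OF circular_measure_bound[OF assms]]) measurable
qed

lemma beta_part_1: "beta_part 1 k n = fact n * fact k / fact (n + k + 1)"
proof -
 have "beta_part 1 k n = (LINT x:{0<..<1}|lborel. x ^ n * (1 - x) ^ k)"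
  unfolding beta_part_def by (intro set_lebesgue_integral_cong) (auto split: split_indicator)
 thus ?thesis by (simp add: LINT_beta(2))
qed

lemma beta_part_nbin:
 assumes "2 <= N" shows "real (N - 1) * beta_part 1 (N - 2) n = 1 / real (nbin N n)"
proof -
 define M where "M = N - 2"
 have M: "N = Suc (Suc M)" using assms by (simp add: M_def)
 have "real (nbin N n) = fact (n + N - 1) / (fact n * fact (N - 1))"
  using binomial_fact[of n "n + N - 1", where 'a = real] assms unfolding nbin_def by simp
 thus ?thesis unfolding beta_part_1 M by (simp add: mult_ac)
qed

text \<open>A positive matrix defines a nonnegative function that is a sesquianalytic polynomial. Its product
with the radial probability density of order \<open>N\<close> is a measure with computable
moments.\<close>

lemma truncated_berezin_measure:
 assumes N: "2 <= N" and D: "psd D"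
 shows "EX nu. has_disc_moments nu (%k l. SUM n<=S. if k <= n + l & n + l - k <= S
   then of_real (real (nbin N n) * real (nbin N (n + l - k)) / real (nbin N (n + l))) * D n (n + l - k) else 0)"
proof -
 let ?M = "density disc_area (%z. ennreal (indicator {..<1\<^sup>2} ((cmod z)^2) * (max 0 (1 - (cmod z)\<^sup>2)) ^ (N - 2)))"
 have M: "circular_measure ?M 1 (beta_part 1 (N - 2))" by (rule circular_beta_part) simp
 interpret M: finite_measure ?M using M by (simp add: circular_measure_def)
 let ?C = "%n. complex_of_real (real (nbin N n))"
 define h where "h z = (SUM n<=S. SUM n'<=S. (?C n * cnj z ^ n) * cnj (?C n' * cnj z ^ n') * D n n')" for z
 have h_nn: "0 <= h z" for z using D unfolding psd_def h_def by (rule allE[where x = S]) (erule allE)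
 have h_re: "complex_of_real (Re (h z)) = h z" for z using h_nn[of z] by (simp add: complex_eq_iff less_eq_complex_def)
 have h_re_nn: "0 <= Re (h z)" for z using h_nn[of z] by (simp add: less_eq_complex_def)
 have hm[measurable]: "h : borel_measurable borel" unfolding h_def[abs_def] by measurable
 have h_eq: "h z * (z ^ k * cnj z ^ l) = (SUM n<=S. SUM n'<=S. (?C n * ?C n' * D n n') * (z ^ (n' + k) * cnj z ^ (n + l)))" for z k l
  unfolding h_def sum_distrib_right by (intro sum.cong refl) (simp add: power_add mult_ac)
 have hi: "integrable ?M (%z. h z * (z ^ k * cnj z ^ l))" for k l
  unfolding h_eq by (intro Bochner_Integration.integrable_sum integrable_mult_right circular_integrable_monomial[OF M])
 let ?nu = "density ?M (%z. ennreal (real (N - 1) * Re (h z)))"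
 have nn: "0 <= real (N - 1) * Re (h z)" for z using h_re_nn by simp
 have "integrable ?M h" using hi[of 0 0] by simp
 hence ir: "integrable ?M (%z. real (N - 1) * Re (h z))" by (intro integrable_mult_right integrable_Re)
 have "has_disc_moments ?nu (%k l. SUM n<=S. if k <= n + l & n + l - k <= S
   then of_real (real (nbin N n) * real (nbin N (n + l - k)) / real (nbin N (n + l))) * D n (n + l - k) else 0)"
  unfolding has_disc_moments_def finite_borel_measures_on_def
 proof (intro conjI CollectI allI)
  show "sets ?nu = sets borel" by simp
  show "finite_measure ?nu" proof (rule finite_measureI)
   have "emeasure ?nu (space ?nu) = (\<integral>\<^sup>+z. ennreal (real (N - 1) * Re (h z)) \<partial>?M)"
    by (subst emeasure_density) (auto simp del: ennreal_mult')
   also have "... = (\<integral>\<^sup>+z. ennreal (norm (real (N - 1) * Re (h z))) \<partial>?M)"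
    using nn by (intro nn_integral_cong) (simp only: real_norm_def abs_of_nonneg)
   also have "... < \<infinity>" using ir unfolding integrable_iff_bounded by blast
   finally show "emeasure ?nu (space ?nu) ~= \<infinity>" by simp
  qed
  have "AE z in ?M. cmod z <= 1" using M unfolding circular_measure_def by (elim conjE)
  thus "AE z in ?nu. z : cball 0 1" by (subst AE_density) auto
  fix k l
  have "(LINT z|?nu. z ^ k * cnj z ^ l) = (LINT z|?M. (real (N - 1) * Re (h z)) *\<^sub>R (z ^ k * cnj z ^ l))"
   by (rule integral_density) (use nn in auto)
  also have "... = (LINT z|?M. of_real (real (N - 1)) * (h z * (z ^ k * cnj z ^ l)))"
   by (intro Bochner_Integration.integral_cong refl) (simp only: scaleR_conv_of_real of_real_mult h_re mult.assoc)
  also have "... = of_real (real (N - 1)) * (LINT z|?M. h z * (z ^ k * cnj z ^ l))"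
   by (rule integral_mult_right_zero)
  also have "(LINT z|?M. h z * (z ^ k * cnj z ^ l)) = (SUM n<=S. SUM n'<=S. (?C n * ?C n' * D n n') * (LINT z|?M. z ^ (n' + k) * cnj z ^ (n + l)))"
   unfolding h_eq
   by (subst Bochner_Integration.integral_sum, intro Bochner_Integration.integrable_sum integrable_mult_right circular_integrable_monomial[OF M])
     (subst Bochner_Integration.integral_sum, intro integrable_mult_right circular_integrable_monomial[OF M], simp only: integral_mult_right_zero)
  also have "of_real (real (N - 1)) * ... = (SUM n<=S. SUM n'<=S. if n' + k = n + l then ?C n * ?C n' * D n n' / ?C (n + l) else 0)"
   unfolding sum_distrib_left
  proof (intro sum.cong refl)
   fix n n'
   have I: "(LINT z|?M. z ^ (n' + k) * cnj z ^ (n + l)) = (if n' + k = n + l then of_real (beta_part 1 (N - 2) (n + l)) else 0)"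
    using M unfolding circular_measure_def by auto
   have w: "complex_of_real (real (N - 1)) * of_real (beta_part 1 (N - 2) (n + l)) = 1 / ?C (n + l)"
    unfolding of_real_mult[symmetric] beta_part_nbin[OF N] by simp
   have "of_real (real (N - 1)) * (?C n * ?C n' * D n n' * of_real (beta_part 1 (N - 2) (n + l)))
     = ?C n * ?C n' * D n n' * (complex_of_real (real (N - 1)) * of_real (beta_part 1 (N - 2) (n + l)))"
    by (simp only: mult_ac)
   thus "of_real (real (N - 1)) * (?C n * ?C n' * D n n' * (LINT z|?M. z ^ (n' + k) * cnj z ^ (n + l)))
     = (if n' + k = n + l then ?C n * ?C n' * D n n' / ?C (n + l) else 0)" unfolding I w by simp
  qed
  also have "... = (SUM n<=S. if k <= n + l & n + l - k <= S
    then of_real (real (nbin N n) * real (nbin N (n + l - k)) / real (nbin N (n + l))) * D n (n + l - k) else 0)"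
  proof (intro sum.cong refl)
   fix n
   have "(SUM n'<=S. if n' + k = n + l then ?C n * ?C n' * D n n' / ?C (n + l) else 0)
     = (SUM n'<=S. if n' = n + l - k then (if k <= n + l then ?C n * ?C n' * D n n' / ?C (n + l) else 0) else 0)"
    by (intro sum.cong refl) auto
   also have "... = (if k <= n + l & n + l - k <= S then of_real (real (nbin N n) * real (nbin N (n + l - k)) / real (nbin N (n + l))) * D n (n + l - k) else 0)"
    by (simp add: sum.delta)
   finally show "(SUM n'<=S. if n' + k = n + l then ?C n * ?C n' * D n n' / ?C (n + l) else 0)
    = (if k <= n + l & n + l - k <= S then of_real (real (nbin N n) * real (nbin N (n + l - k)) / real (nbin N (n + l))) * D n (n + l - k) else 0)" .
  qed
  finally show "(LINT z|?nu. z ^ k * cnj z ^ l) = (SUM n<=S. if k <= n + l & n + l - k <= S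
    then of_real (real (nbin N n) * real (nbin N (n + l - k)) / real (nbin N (n + l))) * D n (n + l - k) else 0)" .
 qed
 thus ?thesis by blast
qed

lemma truncation_error:
 assumes N: "0 < N" and D: "psd D" and m: "!!S. (SUM n<=S. real (nbin N n) * Re (D n n)) <= B"
 shows "cmod ((SUM n<=S. if k <= n + l & n + l - k <= S
    then of_real (real (nbin N n) * real (nbin N (n + l - k)) / real (nbin N (n + l))) * D n (n + l - k) else 0)
   - (\<Sum>s<Suc S - max k l. of_nat (nbin N s) * D (k + s) (l + s)))
  <= sqrt ((2 * real k * real l + real k) / real N) * B"
proof -
 define I where "I = {n. n <= S & k <= n + l & n + l - k <= S}"
 have fI: "finite I" unfolding I_def by (rule finite_subset[of _ "{..S}"]) auto
 let ?C = "%n. real (nbin N n)"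
 let ?e = "sqrt ((2 * real k * real l + real k) / real N)"
 let ?m = "%n. ?C n * Re (D n n)"
 have m_nn: "0 <= ?m n" for n using psd_diag[OF D, of n] by (simp add: less_eq_complex_def)
 have 1: "(SUM n<=S. if k <= n + l & n + l - k <= S then of_real (?C n * ?C (n + l - k) / ?C (n + l)) * D n (n + l - k) else 0)
   = (SUM n:I. of_real (?C n * ?C (n + l - k) / ?C (n + l)) * D n (n + l - k))"
  unfolding I_def by (subst sum.inter_filter[symmetric]) (auto intro!: sum.cong)
 have 2: "(\<Sum>s<Suc S - max k l. of_nat (nbin N s) * D (k + s) (l + s))
   = (SUM n:I. of_real (if k <= n then ?C (n - k) else 0) * D n (n + l - k))" proof -
  have "(SUM n:I. of_real (if k <= n then ?C (n - k) else 0) * D n (n + l - k))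
    = (SUM n:{n:I. k <= n}. of_real (?C (n - k)) * D n (n + l - k))"
   by (rule sum.mono_neutral_cong_right) (use fI in auto)
  also have "... = (\<Sum>s<Suc S - max k l. of_nat (nbin N s) * D (k + s) (l + s))"
   by (rule sum.reindex_bij_witness[where i = "%s. s + k" and j = "%n. n - k"]) (auto simp: I_def add.commute)
  finally show ?thesis ..
 qed
 have "cmod ((SUM n:I. of_real (?C n * ?C (n + l - k) / ?C (n + l)) * D n (n + l - k)) - (SUM n:I. of_real (if k <= n then ?C (n - k) else 0) * D n (n + l - k)))
   = cmod (SUM n:I. of_real (?C n * ?C (n + l - k) / ?C (n + l) - (if k <= n then ?C (n - k) else 0)) * D n (n + l - k))"
  by (simp only: sum_subtractf[symmetric] left_diff_distrib[symmetric] of_real_diff)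
 also have "... <= (SUM n:I. ?e * ((?m n + ?m (n + l - k)) / 2))" proof (rule sum_norm_le)
  fix n assume n: "n : I"
  hence kn: "k <= n + l" by (simp add: I_def)
  have "norm (of_real (?C n * ?C (n + l - k) / ?C (n + l) - (if k <= n then ?C (n - k) else 0)) * D n (n + l - k))
    = \<bar>?C n * ?C (n + l - k) / ?C (n + l) - (if k <= n then ?C (n - k) else 0)\<bar> * cmod (D n (n + l - k))"
   by (simp only: norm_mult norm_of_real)
  also have "... <= (?e * (sqrt (?C n) * sqrt (?C (n + l - k)))) * cmod (D n (n + l - k))"
   by (intro mult_right_mono nbin_weight_error[OF N kn]) simp
  also have "... = ?e * ((2 * (sqrt (?C n) * sqrt (?C (n + l - k))) * cmod (D n (n + l - k))) / 2)" by simp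
  also have "... <= ?e * ((?m n + ?m (n + l - k)) / 2)"
   by (intro mult_left_mono divide_right_mono psd_offdiag_bound[OF D]) auto
  finally show "norm (of_real (?C n * ?C (n + l - k) / ?C (n + l) - (if k <= n then ?C (n - k) else 0)) * D n (n + l - k))
    <= ?e * ((?m n + ?m (n + l - k)) / 2)" .
 qed
 also have "... = ?e * (((SUM n:I. ?m n) + (SUM n:I. ?m (n + l - k))) / 2)"
  by (simp add: sum_distrib_left[symmetric] sum_divide_distrib[symmetric] sum.distrib)
 also have "... <= ?e * ((B + B) / 2)" proof (intro mult_left_mono divide_right_mono add_mono)
  have "(SUM n:I. ?m n) <= (SUM n<=S. ?m n)"
   by (rule sum_mono2) (use m_nn in \<open>auto simp: I_def\<close>)
  thus "(SUM n:I. ?m n) <= B" using m[of S] by linarith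
  have inj: "inj_on (%n. n + l - k) I" unfolding inj_on_def I_def by auto
  have "(SUM n:I. ?m (n + l - k)) = (SUM n:(%n. n + l - k) ` I. ?m n)" by (simp add: sum.reindex[OF inj])
  also have "... <= (SUM n<=S. ?m n)"
   by (rule sum_mono2) (use m_nn in \<open>auto simp: I_def\<close>)
  finally show "(SUM n:I. ?m (n + l - k)) <= B" using m[of S] by linarith
 qed auto
 finally show ?thesis unfolding 1 2 by simp
qed

lemma all_psd_bounded:
 assumes A: "all_psd A" shows "cmod (A k l) <= Re (A 0 0)"
proof -
 have p0: "psd A" and p1: "psd (bdiff 1 A)" using A unfolding all_psd_def by (metis bdiff.simps(1), blast)
 have "Re (A (Suc n) (Suc n)) <= Re (A n n)" for n
  using psd_diag[OF p1, of n] by (simp add: less_eq_complex_def)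
 hence d: "Re (A n n) <= Re (A 0 0)" for n by (induction n) (auto intro: order_trans)
 show ?thesis using psd_offdiag_bound[OF p0, of 1 1 k l] d[of k] d[of l] by simp
qed

text \<open>Contraction by \<open>r < 1\<close> provides the geometric decay. The measures of order
\<open>N\<close>, truncated late enough, have moments tending to the given ones.\<close>

lemma moments_of_contracted:
 assumes A: "all_psd A" and r: "0 < r" "r < 1"
 shows "EX nu. has_disc_moments nu (%k l. of_real r ^ (k + l) * A k l)"
proof -
 let ?b = "%k l. of_real r ^ (k + l) * A k l"
 let ?B = "Re (A 0 0)"
 have q: "0 <= r\<^sup>2" "r\<^sup>2 < 1" using r by (auto simp: power_less_one_iff)
 have B0: "0 <= ?B" using all_psd_bounded[OF A, of 0 0] norm_ge_zero order_trans by blast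
 have bd: "cmod (?b (k + j) (l + j)) <= ?B * (r\<^sup>2) ^ j" for k l j
 proof -
  have "cmod (?b (k + j) (l + j)) = r ^ (k + l) * (r\<^sup>2) ^ j * cmod (A (k + j) (l + j))"
   using r by (simp add: norm_mult norm_power power_add power2_eq_square power_mult_distrib mult_ac)
  also have "... <= 1 * (r\<^sup>2) ^ j * ?B"
   by (intro mult_mono all_psd_bounded[OF A] power_le_one) (use r in auto)
  finally show ?thesis by (simp add: mult.commute)
 qed
 note sums = bdiff_negative_binomial_sums[of ?b, OF bd q]
 have psdN: "psd (bdiff N ?b)" for N using all_psd_rescale[OF A, of r N] r by simp
 have mass: "(SUM n<=S. real (nbin N n) * Re (bdiff N ?b n n)) <= ?B" for N S
 proof -
  have "(%s. Re (of_nat (nbin N s) * bdiff N ?b s s)) sums Re (?b 0 0)"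
   using sums_Re[OF sums[of N 0 0]] by simp
  hence s: "(%s. real (nbin N s) * Re (bdiff N ?b s s)) sums ?B" by simp
  have "0 <= real (nbin N s) * Re (bdiff N ?b s s)" for s
   using psd_diag[OF psdN, of N s] by (simp add: less_eq_complex_def)
  hence "(SUM n<=S. real (nbin N n) * Re (bdiff N ?b n n)) <= (\<Sum>s. real (nbin N s) * Re (bdiff N ?b s s))"
   by (intro sum_le_suminf sums_summable[OF s]) auto
  thus ?thesis using s by (simp add: sums_iff)
 qed
 let ?p = "%N S k l. (\<Sum>s<Suc S - max k l. of_nat (nbin N s) * bdiff N ?b (k + s) (l + s))"
 have plim: "(%S. ?p N S k l) ----> ?b k l" for N k l
 proof -
  have "filterlim (%S. Suc S - max k l) sequentially sequentially"
   unfolding filterlim_at_top eventually_sequentially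
  proof (intro allI exI impI)
   fix Z n assume "Z + max k l <= n"
   thus "Z <= Suc n - max k l" by simp
  qed
  from filterlim_compose[OF sums[of N k l, unfolded sums_def] this] show ?thesis .
 qed
 have "EX S. ALL k<=N. ALL l<=N. cmod (?p (N + 2) S k l - ?b k l) < inverse (real (Suc N))" for N
 proof -
  have "\<forall>\<^sub>F S in sequentially. ALL k:{..N}. ALL l:{..N}. cmod (?p (N + 2) S k l - ?b k l) < inverse (real (Suc N))"
  proof (intro eventually_ball_finite finite_atMost ballI)
   fix k l
   show "\<forall>\<^sub>F S in sequentially. cmod (?p (N + 2) S k l - ?b k l) < inverse (real (Suc N))"
    using tendstoD[OF plim[of "N + 2" k l], of "inverse (real (Suc N))"] by (simp add: dist_norm)
  qed
  hence "EX S. ALL k:{..N}. ALL l:{..N}. cmod (?p (N + 2) S k l - ?b k l) < inverse (real (Suc N))"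
   unfolding eventually_sequentially by blast
  thus ?thesis by auto
 qed
 hence "EX S. ALL N. ALL k<=N. ALL l<=N. cmod (?p (N + 2) (S N) k l - ?b k l) < inverse (real (Suc N))"
  by (intro choice allI)
 then obtain S where S': "ALL N. ALL k<=N. ALL l<=N. cmod (?p (N + 2) (S N) k l - ?b k l) < inverse (real (Suc N))"
  by (rule exE)
 have S: "cmod (?p (N + 2) (S N) k l - ?b k l) < inverse (real (Suc N))" if "k <= N" "l <= N" for N k l
  using S'[THEN spec, of N] that by blast
 define a where "a N k l = (SUM n<=S N. if k <= n + l & n + l - k <= S N
   then of_real (real (nbin (N + 2) n) * real (nbin (N + 2) (n + l - k)) / real (nbin (N + 2) (n + l))) * bdiff (N + 2) ?b n (n + l - k) else 0)" for N k l
 have "EX nu. has_disc_moments nu (a N)" for N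
  unfolding a_def[abs_def] by (rule truncated_berezin_measure[OF _ psdN]) simp
 then obtain nu where nu: "!!N. has_disc_moments (nu N) (a N)" by metis
 show ?thesis proof (rule has_disc_moments_limit[OF nu])
  fix k l
  let ?K = "2 * real k * real l + real k"
  have "(%N. a N k l - ?b k l) ----> 0" proof (rule Lim_null_comparison)
   show "\<forall>\<^sub>F N in sequentially. norm (a N k l - ?b k l) <= sqrt (?K / real (N + 2)) * ?B + inverse (real (Suc N))"
    unfolding eventually_sequentially
   proof (intro exI[of _ "max k l"] allI impI)
    fix N assume "max k l <= N"
    hence "cmod (?p (N + 2) (S N) k l - ?b k l) <= inverse (real (Suc N))" using S[of k N l] by simp
    moreover have "cmod (a N k l - ?p (N + 2) (S N) k l) <= sqrt (?K / real (N + 2)) * ?B"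
     unfolding a_def by (rule truncation_error[OF _ psdN mass]) simp
    ultimately show "norm (a N k l - ?b k l) <= sqrt (?K / real (N + 2)) * ?B + inverse (real (Suc N))"
     using norm_triangle_ineq[of "a N k l - ?p (N + 2) (S N) k l" "?p (N + 2) (S N) k l - ?b k l"] by simp
   qed
   have "(%N. sqrt (?K / real (N + 2)) * ?B + inverse (real (Suc N))) ----> sqrt 0 * ?B + 0"
   proof (intro tendsto_intros LIMSEQ_inverse_real_of_nat)
    show "(%N. ?K / real (N + 2)) ----> 0"
     using LIMSEQ_ignore_initial_segment[OF lim_const_over_n[of ?K], of 2] by simp
   qed
   thus "(%N. sqrt (?K / real (N + 2)) * ?B + inverse (real (Suc N))) ----> 0" by simp
  qed
  thus "(%N. a N k l) ----> ?b k l" by (simp only: LIM_zero_iff)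
 qed
qed

text \<open>The contracted matrices are moment matrices, and so is their limit for \<open>r\<close> tending to
\<open>1\<close>.\<close>

theorem disc_moment_problem:
 assumes "all_psd A" shows "EX nu. has_disc_moments nu A"
proof -
 define r where "r n = 1 - inverse (real (Suc (Suc n)))" for n
 have r: "0 < r n" "r n < 1" for n
 proof -
  have "inverse (real (Suc (Suc n))) < 1" by (simp add: inverse_eq_divide)
  thus "0 < r n" "r n < 1" by (auto simp: r_def)
 qed
 have "(%n. inverse (real (Suc (Suc n)))) ----> 0"
  using LIMSEQ_Suc[OF LIMSEQ_inverse_real_of_nat] .
 hence "(%n. 1 - inverse (real (Suc (Suc n)))) ----> 1 - 0" by (intro tendsto_intros)
 hence r_lim: "r ----> 1" by (simp add: r_def[abs_def])
 have "EX nu. has_disc_moments nu (%k l. of_real (r n) ^ (k + l) * A k l)" for n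
  by (rule moments_of_contracted[OF assms r])
 then obtain nu where nu: "!!n. has_disc_moments (nu n) (%k l. of_real (r n) ^ (k + l) * A k l)" by metis
 show ?thesis proof (rule has_disc_moments_limit[OF nu])
  fix k l
  have "(%n. of_real (r n) ^ (k + l) * A k l) ----> of_real 1 ^ (k + l) * A k l"
   by (intro tendsto_intros r_lim)
  thus "(%n. of_real (r n) ^ (k + l) * A k l) ----> A k l" by simp
 qed
qed

section \<open>Smooth functions and distributions on the circle\<close>

lemma circle_smooth_deriv:
 assumes "f : circle_smooth"
 shows "(circle_deriv k f has_vector_derivative circle_deriv (Suc k) f t) (at t)"
 using assms by (auto simp: circle_smooth_def vector_derivative_works)

lemma circle_smooth_continuous:
 assumes "f : circle_smooth" shows "continuous_on S (circle_deriv k f)"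
 by (intro continuous_at_imp_continuous_on ballI has_vector_derivative_continuous[OF circle_smooth_deriv[OF assms]])

lemma circle_smoothI:
 assumes "!!z. cmod z ~= 1 ==> f z = 0"
  and "!!t. f (cis t) = F 0 t" "!!k t. (F k has_vector_derivative F (Suc k) t) (at t)"
 shows "f : circle_smooth" "circle_deriv k f = F k"
proof -
 have eq: "circle_deriv k f = F k" for k
 proof (induction k)
  case 0 thus ?case using assms(2) by auto
 next
  case (Suc k)
  thus ?case using vector_derivative_at[OF assms(3)] by auto
 qed
 thus "circle_deriv k f = F k" by simp
 show "f : circle_smooth"
  using assms(1) differentiableI_vector[OF assms(3)] by (auto simp: circle_smooth_def eq)
qed

lemma circle_smooth_add:
 assumes "f : circle_smooth" "g : circle_smooth"
 shows "(%z. f z + g z) : circle_smooth"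
  "circle_deriv k (%z. f z + g z) = (%t. circle_deriv k f t + circle_deriv k g t)"
proof -
 let ?F = "%k t. circle_deriv k f t + circle_deriv k g t"
 have *: "!!z. cmod z ~= 1 ==> f z + g z = 0" "!!t. f (cis t) + g (cis t) = ?F 0 t"
  using assms by (auto simp: circle_smooth_def)
 have d: "(?F k has_vector_derivative ?F (Suc k) t) (at t)" for k t
  by (intro has_vector_derivative_add circle_smooth_deriv assms)
 show "(%z. f z + g z) : circle_smooth" by (rule circle_smoothI(1)[where F = ?F, OF * d])
 show "circle_deriv k (%z. f z + g z) = ?F k" by (rule circle_smoothI(2)[where F = ?F, OF * d])
qed

lemma circle_smooth_scale:
 assumes "f : circle_smooth"
 shows "(%z. c * f z) : circle_smooth"
  "circle_deriv k (%z. c * f z) = (%t. c * circle_deriv k f t)"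
proof -
 let ?F = "%k t. c * circle_deriv k f t"
 have *: "!!z. cmod z ~= 1 ==> c * f z = 0" "!!t. c * f (cis t) = ?F 0 t"
  using assms by (auto simp: circle_smooth_def)
 have d: "(?F k has_vector_derivative ?F (Suc k) t) (at t)" for k t
  by (intro has_vector_derivative_mult_right circle_smooth_deriv assms)
 show "(%z. c * f z) : circle_smooth" by (rule circle_smoothI(1)[where F = ?F, OF * d])
 show "circle_deriv k (%z. c * f z) = ?F k" by (rule circle_smoothI(2)[where F = ?F, OF * d])
qed

lemma circle_smooth_diff:
 assumes "f : circle_smooth" "g : circle_smooth"
 shows "(%z. f z - g z) : circle_smooth"
  "circle_deriv k (%z. f z - g z) = (%t. circle_deriv k f t - circle_deriv k g t)"
 using circle_smooth_add[OF assms(1) circle_smooth_scale(1)[OF assms(2), of "-1"]]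
 unfolding circle_smooth_scale(2)[OF assms(2)] by simp_all

lemma circle_smooth_zero: "(%z. 0) : circle_smooth" "circle_deriv k (%z. 0) = (%t. 0)"
 using circle_smoothI[of "%z. 0" "%k t. 0"] by auto

definition circle_exp :: "int => complex => complex" where
 "circle_exp k = (%z. if cmod z = 1 then cnj z powi k else 0)"

lemma fourier_coeff_eq: "fourier_coeff mu k = mu (circle_exp k)"
 by (simp add: fourier_coeff_def circle_exp_def)

lemma circle_exp_cis: "circle_exp k (cis t) = cis (- (of_int k * t))"
 by (simp add: circle_exp_def cis_cnj cis_power_int)

lemma has_vector_derivative_cis_int:
 "((%t. cis (of_int k * t)) has_vector_derivative (\<i> * of_int k) * cis (of_int k * t)) (at t within S)"
proof -
 have "((%t. cis (of_int k * t)) has_derivative (%h. (of_int k * h) *\<^sub>R (\<i> * cis (of_int k * t)))) (at t)"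
  by (rule has_derivative_cis) (auto intro!: derivative_eq_intros)
 hence "((%t. cis (of_int k * t)) has_vector_derivative (\<i> * of_int k * cis (of_int k * t))) (at t)"
  unfolding has_vector_derivative_def by (simp add: scaleR_conv_of_real mult_ac)
 thus ?thesis by (rule has_vector_derivative_at_within)
qed

lemma circle_exp_smooth:
 "circle_exp k : circle_smooth"
 "circle_deriv j (circle_exp k) = (%t. (- \<i> * of_int k) ^ j * cis (- (of_int k * t)))"
proof -
 have d: "((%t. (- \<i> * of_int k) ^ j * cis (- (of_int k * t))) has_vector_derivative (- \<i> * of_int k) ^ Suc j * cis (- (of_int k * t))) (at t)" for j t
  using has_vector_derivative_mult_right[OF has_vector_derivative_cis_int[of "-k" t UNIV], of "(- \<i> * of_int k) ^ j"]
  by (simp add: mult_ac)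
 have *: "!!z. cmod z ~= 1 ==> circle_exp k z = 0" "!!t. circle_exp k (cis t) = (- \<i> * of_int k) ^ 0 * cis (- (of_int k * t))"
  by (auto simp: circle_exp_cis) (simp add: circle_exp_def)
 let ?F = "%j t. (- \<i> * of_int k) ^ j * cis (- (of_int k * t))"
 show "circle_exp k : circle_smooth" by (rule circle_smoothI(1)[where F = ?F, OF * d])
 show "circle_deriv j (circle_exp k) = ?F j" by (rule circle_smoothI(2)[where F = ?F, OF * d])
qed

lemma circle_seminorm_upper:
 assumes "f : circle_smooth" "t : {0..2*pi}"
 shows "cmod (circle_deriv k f t) <= circle_seminorm k f" unfolding circle_seminorm_def
proof (rule cSUP_upper[OF assms(2)])
 have "compact ((%t. cmod (circle_deriv k f t)) ` {0..2*pi})"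
  by (intro compact_continuous_image continuous_on_norm circle_smooth_continuous assms) auto
 thus "bdd_above ((%t. cmod (circle_deriv k f t)) ` {0..2*pi})"
  by (simp add: bounded_imp_bdd_above compact_imp_bounded)
qed

lemma circle_seminorm_least:
 assumes "!!t. t : {0..2*pi} ==> cmod (circle_deriv k f t) <= B"
 shows "circle_seminorm k f <= B" unfolding circle_seminorm_def by (rule cSUP_least) (use assms in auto)

lemma circle_seminorm_nonneg: "f : circle_smooth ==> 0 <= circle_seminorm k f"
 by (rule order_trans[OF norm_ge_zero circle_seminorm_upper[of f 0 k]]) auto

lemma circle_seminorm_triangle:
 assumes "f : circle_smooth" "g : circle_smooth" "h : circle_smooth"
 shows "circle_seminorm k (%z. f z - h z) <= circle_seminorm k (%z. f z - g z) + circle_seminorm k (%z. g z - h z)"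
proof (rule circle_seminorm_least)
 fix t assume t: "t : {0..2*pi}"
 have "cmod (circle_deriv k (%z. f z - h z) t) = cmod (circle_deriv k (%z. f z - g z) t + circle_deriv k (%z. g z - h z) t)"
  using assms by (simp add: circle_smooth_diff)
 also have "... <= cmod (circle_deriv k (%z. f z - g z) t) + cmod (circle_deriv k (%z. g z - h z) t)"
  by (rule norm_triangle_ineq)
 also have "... <= circle_seminorm k (%z. f z - g z) + circle_seminorm k (%z. g z - h z)"
  by (intro add_mono circle_seminorm_upper circle_smooth_diff assms t)
 finally show "cmod (circle_deriv k (%z. f z - h z) t) <= ..." .
qed

lemma topspace_circle_smooth [simp]: "topspace circle_smooth_topology = circle_smooth"
proof
 show "topspace circle_smooth_topology \<subseteq> circle_smooth"
  unfolding circle_smooth_topology_def topology_generated_by_topspace by auto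
 show "circle_smooth \<subseteq> topspace circle_smooth_topology" proof
  fix f assume f: "f : circle_smooth"
  have "circle_seminorm 0 (%z. f z - f z) <= 0" by (rule circle_seminorm_least) simp
  hence "f : {g : circle_smooth. circle_seminorm 0 (%z. g z - f z) < 1}" using f by simp
  thus "f : topspace circle_smooth_topology"
   unfolding circle_smooth_topology_def topology_generated_by_topspace using f zero_less_one by blast
 qed
qed

text \<open>Finitely many seminorms suffice to control a neighbourhood, which is seen by induction over the
generation of the topology.\<close>

lemma circle_smooth_open_nhd:
 assumes "openin circle_smooth_topology U" "f : U"
 shows "EX K d. 0 < (d::real) & (ALL g:circle_smooth. (ALL k<=K. circle_seminorm k (%z. g z - f z) < d) --> g : U)"
proof -
 have "generate_topology_on {{g : circle_smooth. circle_seminorm k (%z. g z - f z) < eps} | f k eps. f : circle_smooth & 0 < eps} U"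
  using assms(1) unfolding circle_smooth_topology_def by (rule openin_topology_generated_by)
 hence "ALL f:U. EX K d. 0 < (d::real) & (ALL g:circle_smooth. (ALL k<=K. circle_seminorm k (%z. g z - f z) < d) --> g : U)"
 proof induction
  case Empty thus ?case by simp
 next
  case (Int a b)
  show ?case proof
   fix f assume f: "f : a \<inter> b"
   obtain K d where 1: "0 < (d::real)" "ALL g:circle_smooth. (ALL k<=K. circle_seminorm k (%z. g z - f z) < d) --> g : a"
    using Int f by blast
   obtain K' d' where 2: "0 < (d'::real)" "ALL g:circle_smooth. (ALL k<=K'. circle_seminorm k (%z. g z - f z) < d') --> g : b"
    using Int f by blast
   show "EX K d. 0 < (d::real) & (ALL g:circle_smooth. (ALL k<=K. circle_seminorm k (%z. g z - f z) < d) --> g : a \<inter> b)"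
    using 1 2 by (intro exI[of _ "max K K'"] exI[of _ "min d d'"]) auto
  qed
 next
  case (UN K)
  show ?case proof
   fix f assume "f : \<Union> K"
   then obtain s where s: "s : K" "f : s" by blast
   obtain N d where "0 < (d::real)" "ALL g:circle_smooth. (ALL k<=N. circle_seminorm k (%z. g z - f z) < d) --> g : s"
    using UN(2)[OF s(1)] s(2) by blast
   thus "EX N d. 0 < (d::real) & (ALL g:circle_smooth. (ALL k<=N. circle_seminorm k (%z. g z - f z) < d) --> g : \<Union> K)"
    using s(1) by (intro exI[of _ N] exI[of _ d]) blast
  qed
 next
  case (Basis s)
  then obtain h k eps where s: "s = {g : circle_smooth. circle_seminorm k (%z. g z - h z) < eps}" "h : circle_smooth" "0 < eps"
   by blast
  show ?case proof
   fix f assume f: "f : s"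
   have "g : s" if "g : circle_smooth" "ALL i<=k. circle_seminorm i (%z. g z - f z) < eps - circle_seminorm k (%z. f z - h z)" for g
    using circle_seminorm_triangle[of g f h k] that f s by force
   thus "EX K d. 0 < (d::real) & (ALL g:circle_smooth. (ALL k<=K. circle_seminorm k (%z. g z - f z) < d) --> g : s)"
    using f s by (intro exI[of _ k] exI[of _ "eps - circle_seminorm k (%z. f z - h z)"]) auto
  qed
 qed
 thus ?thesis using assms(2) by blast
qed

lemma circle_distributionsD:
 assumes "mu : circle_distributions"
 shows "mu : extensional circle_smooth"
  "f : circle_smooth ==> g : circle_smooth ==> mu (%z. f z + g z) = mu f + mu g"
  "f : circle_smooth ==> mu (%z. c * f z) = c * mu f"
  "continuous_map circle_smooth_topology euclidean mu"
 using assms by (auto simp: circle_distributions_def)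

lemma circle_distribution_nhd:
 assumes mu: "mu : circle_distributions" and f: "f : circle_smooth" and e: "0 < e"
 shows "EX K d. 0 < (d::real) &
  (ALL g:circle_smooth. (ALL k<=K. circle_seminorm k (%z. g z - f z) < d) --> cmod (mu g - mu f) < e)"
proof -
 let ?U = "{g : topspace circle_smooth_topology. mu g : ball (mu f) e}"
 have "openin circle_smooth_topology ?U"
  by (rule openin_continuous_map_preimage[OF circle_distributionsD(4)[OF mu]]) (simp add: open_openin[symmetric])
 moreover have "f : ?U" using f e by simp
 ultimately obtain K d where Kd: "0 < (d::real)"
  "ALL g:circle_smooth. (ALL k<=K. circle_seminorm k (%z. g z - f z) < d) --> g : ?U"
  using circle_smooth_open_nhd[of ?U f] by blast
 have "cmod (mu g - mu f) < e" if "g : ?U" for g using that by (simp add: dist_norm norm_minus_commute)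
 thus ?thesis using Kd by blast
qed

lemma distribution_zero: "mu : circle_distributions ==> mu (%z. 0) = 0"
 using circle_distributionsD(3)[of mu "%z. 0" 0] circle_smooth_zero by simp

text \<open>A distribution is bounded on a neighbourhood of \<open>0\<close>, which contains the exponentials
scaled by a negative power of their frequency.\<close>

lemma fourier_coeff_growth:
 assumes mu: "mu : circle_distributions"
 obtains C N where "!!k. cmod (fourier_coeff mu k) <= C * (1 + \<bar>real_of_int k\<bar>) ^ N"
proof -
 obtain K d where d: "0 < (d::real)" and K: "ALL g:circle_smooth. (ALL k<=K. circle_seminorm k (%z. g z - 0) < d) --> cmod (mu g - mu (%z. 0)) < 1"
  using circle_distribution_nhd[OF mu circle_smooth_zero(1) zero_less_one] by blast
 show ?thesis proof (rule that)
  fix k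
  let ?B = "(1 + \<bar>real_of_int k\<bar>) ^ K"
  have B: "0 < ?B" by (intro zero_less_power) auto
  let ?c = "complex_of_real (d / (2 * ?B))"
  let ?g = "%z. ?c * circle_exp k z"
  have g: "?g : circle_smooth" by (rule circle_smooth_scale(1)[OF circle_exp_smooth(1)])
  have small: "circle_seminorm j (%z. ?g z - 0) < d" if j: "j <= K" for j
  proof -
   have "circle_seminorm j ?g <= d / 2" proof (rule circle_seminorm_least)
    fix t
    have eq: "cmod (circle_deriv j ?g t) = d / (2 * ?B) * \<bar>real_of_int k\<bar> ^ j"
     using B d by (simp add: circle_smooth_scale(2)[OF circle_exp_smooth(1)] circle_exp_smooth(2) norm_mult norm_power norm_divide del: of_real_divide)
    have "\<bar>real_of_int k\<bar> ^ j <= (1 + \<bar>real_of_int k\<bar>) ^ j" by (rule power_mono) auto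
    also have "... <= ?B" by (rule power_increasing[OF j]) auto
    finally have "d / (2 * ?B) * \<bar>real_of_int k\<bar> ^ j <= d / (2 * ?B) * ?B"
     using B d by (intro mult_left_mono) auto
    also have "... = d / 2" using B by simp
    finally show "cmod (circle_deriv j ?g t) <= d / 2" unfolding eq .
   qed
   thus ?thesis using d by simp
  qed
  have "cmod (mu ?g - mu (%z. 0)) < 1" by (intro K[rule_format] g small)
  hence "cmod (?c * mu (circle_exp k)) < 1"
   unfolding circle_distributionsD(3)[OF mu circle_exp_smooth(1)] distribution_zero[OF mu] diff_zero .
  hence "d / (2 * ?B) * cmod (fourier_coeff mu k) < 1"
   using B d unfolding fourier_coeff_eq norm_mult norm_of_real by simp
  thus "cmod (fourier_coeff mu k) <= 2 / d * ?B" using B d by (simp add: field_simps)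
 qed
qed

lemma power_le_binomial: "real (Suc k) ^ N <= fact N * real ((k + N) choose N)"
proof (induction N)
 case (Suc N)
 have "real (Suc k) ^ Suc N <= (fact N * real ((k + N) choose N)) * real (Suc k)"
  using mult_right_mono[OF Suc.IH, of "real (Suc k)"] by (simp add: mult.commute)
 also have "... <= (fact N * real ((k + N) choose N)) * real (Suc (k + N))" by (intro mult_left_mono) auto
 also have "... = fact N * real (Suc (k + N) * ((k + N) choose N))" by (simp only: of_nat_mult mult_ac)
 also have "... = fact N * real (Suc N * (Suc (k + N) choose Suc N))" by (simp only: Suc_times_binomial)
 also have "... = (fact N * real (Suc N)) * real (Suc (k + N) choose Suc N)" by (simp only: of_nat_mult mult.assoc)
 also have "... = fact (Suc N) * real ((k + Suc N) choose Suc N)"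
  by (simp only: fact_Suc of_nat_fact add_Suc_right mult.commute)
 finally show ?case .
qed simp

lemma summable_power_times_geometric:
 assumes "0 <= rho" "rho < (1::real)" shows "summable (%k. real (Suc k) ^ N * rho ^ k)"
proof (rule summable_comparison_test[OF _ summable_mult[OF summable_negative_binomial[OF assms, of N], of "fact N"]], intro exI allI impI)
 fix k
 have "real (Suc k) ^ N * rho ^ k <= (fact N * real ((k + N) choose N)) * rho ^ k"
  by (intro mult_right_mono power_le_binomial) (use assms in auto)
 thus "norm (real (Suc k) ^ N * rho ^ k) <= fact N * (of_nat ((k + N) choose N) * rho ^ k)"
  using assms by (simp add: mult.assoc)
qed

lemma subexponential_fourier_coeff:
 assumes "mu : circle_distributions" shows "subexponential (fourier_coeff mu)"
proof -
 obtain C N where C: "!!k. cmod (fourier_coeff mu k) <= C * (1 + \<bar>real_of_int k\<bar>) ^ N"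
  using fourier_coeff_growth[OF assms] by blast
 show ?thesis unfolding subexponential_def
 proof (intro allI impI conjI)
  fix rho :: real assume rho: "0 <= rho" "rho < 1"
  have C0: "0 <= C" using order_trans[OF norm_ge_zero C[of 0]] by simp
  show "summable (%k. cmod (fourier_coeff mu (int k)) * rho ^ k)"
  proof (rule summable_comparison_test[OF _ summable_mult[OF summable_power_times_geometric[OF rho, of N], of C]], intro exI allI impI)
   fix k
   have "cmod (fourier_coeff mu (int k)) * rho ^ k <= (C * real (Suc k) ^ N) * rho ^ k"
    using C[of "int k"] rho by (intro mult_right_mono) auto
   thus "norm (cmod (fourier_coeff mu (int k)) * rho ^ k) <= C * (real (Suc k) ^ N * rho ^ k)"
    using rho by (simp add: mult.assoc)
  qed
  show "summable (%k. cmod (fourier_coeff mu (- int (Suc k))) * rho ^ k)"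
  proof (rule summable_comparison_test[OF _ summable_mult[OF summable_power_times_geometric[OF rho, of N], of "C * 2 ^ N"]], intro exI allI impI)
   fix k
   have "cmod (fourier_coeff mu (- int (Suc k))) <= C * real (Suc (Suc k)) ^ N"
    using C[of "- int (Suc k)"] by (simp add: add_ac)
   also have "... <= C * (2 * real (Suc k)) ^ N" using C0 by (intro mult_left_mono power_mono) auto
   finally have "cmod (fourier_coeff mu (- int (Suc k))) * rho ^ k <= (C * (2 * real (Suc k)) ^ N) * rho ^ k"
    using rho by (intro mult_right_mono) auto
   thus "norm (cmod (fourier_coeff mu (- int (Suc k))) * rho ^ k) <= C * 2 ^ N * (real (Suc k) ^ N * rho ^ k)"
    using rho by (simp only: power_mult_distrib mult.assoc norm_mult real_norm_def abs_mult abs_norm_cancel abs_of_nonneg zero_le_power)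
  qed
 qed
qed

section \<open>Fourier series of smooth functions\<close>

lemma continuous_on_circle:
 fixes h :: "complex => complex"
 assumes h: "continuous_on UNIV (%t. h (cis t))"
 shows "continuous_on (sphere 0 1) h" unfolding continuous_on_eq_continuous_within
proof
 fix z :: complex assume z: "z : sphere 0 1"
 have hc: "isCont (%t. h (cis t)) t" for t using h by (simp add: continuous_on_eq_continuous_at)
 have cA: "cis (Arg w) = w" if "w : sphere 0 1" for w
 proof -
  have "w ~= 0" using that by auto
  thus ?thesis using that cis_Arg[of w] by (simp add: sgn_div_norm)
 qed
 show "continuous (at z within sphere 0 1) h" proof (cases "z : \<real>\<^sub>\<le>\<^sub>0")
  case False
  have "isCont (%w. h (cis (Arg w))) z" by (rule isCont_o2[OF continuous_at_Arg[OF False] hc])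
  hence "continuous (at z within sphere 0 1) (%w. h (cis (Arg w)))"
   by (rule continuous_at_imp_continuous_at_within)
  thus ?thesis by (rule continuous_transform_within[OF _ zero_less_one z]) (simp add: cA)
 next
  case True
  have "- z \<notin> \<real>\<^sub>\<le>\<^sub>0" using True z by (auto simp: complex_nonpos_Reals_iff complex_eq_iff norm_complex_def)
  have c: "cis (Arg (- w) + pi) = w" if "w : sphere 0 1" for w
   using cA[of "- w"] that by (simp add: cis_mult[symmetric])
  have "isCont (%w. Arg (- w) + pi) z"
   by (intro continuous_intros isCont_o2[OF _ continuous_at_Arg]) (use \<open>- z \<notin> \<real>\<^sub>\<le>\<^sub>0\<close> in auto)
  hence "isCont (%w. h (cis (Arg (- w) + pi))) z" by (rule isCont_o2[OF _ hc])
  hence "continuous (at z within sphere 0 1) (%w. h (cis (Arg (- w) + pi)))"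
   by (rule continuous_at_imp_continuous_at_within)
  thus ?thesis by (rule continuous_transform_within[OF _ zero_less_one z]) (simp add: c)
 qed
qed

lemma integral_cis:
 "((%t. cis (of_int n * t)) has_integral (if n = 0 then 2 * pi else 0)) {0..2 * pi}"
proof (cases "n = 0")
 case True
 thus ?thesis using has_integral_const_real[of "1::complex" 0 "2 * pi"] by (simp add: scaleR_conv_of_real)
next
 case False
 have "((%t. inverse (\<i> * of_int n) * cis (of_int n * t)) has_vector_derivative cis (of_int n * t)) (at t within {0..2*pi})" for t
 proof -
  have "inverse (\<i> * of_int n) * (\<i> * of_int n * cis (of_int n * t)) = cis (of_int n * t)"
   using left_inverse[of "\<i> * complex_of_int n"] False by (simp only: mult.assoc[symmetric]) simp
  thus ?thesis
   using has_vector_derivative_mult_right[OF has_vector_derivative_cis_int[of n t "{0..2*pi}"], of "inverse (\<i> * of_int n)"] by (simp only:)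
 qed
 from fundamental_theorem_of_calculus[OF _ this]
 have "((%t. cis (of_int n * t)) has_integral
   inverse (\<i> * of_int n) * cis (of_int n * (2 * pi)) - inverse (\<i> * of_int n) * cis (of_int n * 0)) {0..2 * pi}" by simp
 moreover have "cis (of_int n * (2 * pi)) = 1" using cis_multiple_2pi[of "of_int n"] by (simp add: mult_ac)
 ultimately show ?thesis using False by simp
qed

definition circle_coeff :: "(complex => complex) => int => complex" where
 "circle_coeff h k = integral {0..2 * pi} (%t. h (cis t) * cis (of_int k * t)) / (2 * pi)"

text \<open>By Stone--Weierstrass the conjugate of such a function is a uniform limit of linear combinations
of the exponentials, so the square of its modulus has integral \<open>0\<close>.\<close>

lemma circle_coeff_zero_imp_zero:
 assumes h: "continuous_on UNIV (%t. h (cis t))" and z: "!!k. circle_coeff h k = 0"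
 shows "h (cis t) = 0"
proof -
 have hS: "continuous_on (sphere 0 1) h" by (rule continuous_on_circle[OF h])
 have hc: "continuous_on {0..2*pi} (%t. h (cis t))" by (rule continuous_on_subset[OF h]) simp
 have cc: "continuous_on S (%t. cis (f t))" if "continuous_on S f" for S and f :: "real => real"
  using that by (intro continuous_intros)
 have mono: "((%t. h (cis t) * (cis t ^ k * cnj (cis t) ^ l)) has_integral 0) {0..2*pi}" for k l
 proof -
  have e: "cis t ^ k * cnj (cis t) ^ l = cis (of_int (int k - int l) * t)" for t
   by (simp add: cis_cnj Complex.DeMoivre cis_mult left_diff_distrib)
  have "(%t. h (cis t) * cis (of_int (int k - int l) * t)) integrable_on {0..2*pi}"
   by (intro integrable_continuous_interval continuous_intros hc cc)
  hence "((%t. h (cis t) * cis (of_int (int k - int l) * t)) has_integral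
    integral {0..2*pi} (%t. h (cis t) * cis (of_int (int k - int l) * t))) {0..2*pi}"
   by (rule integrable_integral)
  moreover have "integral {0..2*pi} (%t. h (cis t) * cis (of_int (int k - int l) * t)) = 0"
   using z[of "int k - int l"] by (simp add: circle_coeff_def)
  ultimately show ?thesis unfolding e by simp
 qed
 have span: "((%t. h (cis t) * g (cis t)) has_integral 0) {0..2*pi}" if "g : monomial_span" for g
  using that
 proof induction
  case (monomial c k l)
  show ?case using has_integral_mult_right[OF mono[of k l], of c] by (simp add: mult_ac)
 next
  case (add f g)
  show ?case using has_integral_add[OF add.IH] by (simp add: distrib_left)
 qed
 have poly: "((%t. h (cis t) * complex_of_real (g (cis t))) has_integral 0) {0..2*pi}" if "real_polynomial_function g" for g
 proof (rule span)
  have "(%z. complex_of_real (g z) * (1 * (z ^ 0 * cnj z ^ 0))) : monomial_span"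
   using real_polynomial_preserves_span[OF that] monomial_span.monomial[of 1 0 0] unfolding preserves_span_def by (rule bspec)
  thus "(%z. complex_of_real (g z)) : monomial_span" by simp
 qed
 obtain B where B: "!!t. cmod (h (cis t)) <= B" proof -
  have "bounded (h ` sphere 0 1)" by (intro compact_imp_bounded compact_continuous_image hS compact_sphere)
  then obtain B where "ALL x:h ` sphere 0 1. norm x <= B" unfolding bounded_iff by blast
  hence "cmod (h (cis t)) <= B" for t by simp
  thus ?thesis by (rule that)
 qed
 have B0: "0 <= B" using order_trans[OF norm_ge_zero B] .
 let ?q = "%t. h (cis t) * cnj (h (cis t))"
 have qi: "(?q has_integral integral {0..2*pi} ?q) {0..2*pi}"
  by (intro integrable_integral integrable_continuous_interval continuous_intros hc)
 have "cmod (integral {0..2*pi} ?q) <= e * (4 * pi * B)" if e: "0 < e" for e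
 proof -
  obtain g1 where g1: "real_polynomial_function g1" "!!z. z : sphere 0 1 ==> \<bar>Re (h z) - g1 z\<bar> < e"
   by (rule Stone_Weierstrass_real_polynomial_function[OF compact_sphere[of "0::complex" 1] continuous_on_Re[OF hS] e]) (rule that; blast)
  obtain g2 where g2: "real_polynomial_function g2" "!!z. z : sphere 0 1 ==> \<bar>Im (h z) - g2 z\<bar> < e"
   by (rule Stone_Weierstrass_real_polynomial_function[OF compact_sphere[of "0::complex" 1] continuous_on_Im[OF hS] e]) (rule that; blast)
  let ?g = "%t. complex_of_real (g1 (cis t)) - \<i> * complex_of_real (g2 (cis t))"
  have "((%t. h (cis t) * ?g t) has_integral 0) {0..2*pi}"
   using has_integral_diff[OF poly[OF g1(1)] has_integral_mult_right[OF poly[OF g2(1)], of "\<i>"]]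
   by (simp add: right_diff_distrib mult_ac)
  from has_integral_diff[OF qi this]
  have i: "((%t. h (cis t) * (cnj (h (cis t)) - ?g t)) has_integral integral {0..2*pi} ?q) {0..2*pi}"
   by (simp add: right_diff_distrib)
  have "cmod (h (cis t) * (cnj (h (cis t)) - ?g t)) <= B * (2 * e)" for t
  proof -
   have "cnj (h (cis t)) - ?g t = of_real (Re (h (cis t)) - g1 (cis t)) - \<i> * of_real (Im (h (cis t)) - g2 (cis t))"
    by (simp add: complex_eq_iff)
   also have "cmod ... <= cmod (of_real (Re (h (cis t)) - g1 (cis t))) + cmod (\<i> * of_real (Im (h (cis t)) - g2 (cis t)))"
    by (rule norm_triangle_ineq4)
   also have "... = \<bar>Re (h (cis t)) - g1 (cis t)\<bar> + \<bar>Im (h (cis t)) - g2 (cis t)\<bar>"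
    by (simp only: norm_mult norm_ii norm_of_real mult_1)
   also have "... <= 2 * e" using g1(2)[of "cis t"] g2(2)[of "cis t"] by simp
   finally show ?thesis unfolding norm_mult by (intro mult_mono B B0 norm_ge_zero)
  qed
  hence "cmod (integral {0..2*pi} ?q) <= B * (2 * e) * measure lborel {0..2*pi}"
   using B0 e by (intro has_integral_bound_real[OF _ finite.emptyI i]) auto
  thus ?thesis by (simp add: mult_ac)
 qed
 note le = this
 have "cmod (integral {0..2*pi} ?q) <= 0" by (rule le_zero_of_le_epsilon_mult[OF _ le]) (use B0 in simp)
 hence "(?q has_integral 0) {0..2*pi}" using qi by simp
 hence "((%t. Re (?q t)) has_integral Re 0) {0..2*pi}" by (rule has_integral_Re)
 hence i0: "((%t. Re (?q t)) has_integral 0) (cbox 0 (2*pi))" by simp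
 have cR: "continuous_on {0..2*pi} (%t. Re (?q t))" by (intro continuous_intros hc)
 have z0: "h (cis s) = 0" if "s : {0..2*pi}" for s
 proof -
  have "Re (?q s) = 0" by (rule has_integral_0_cbox_imp_0[of 0 "2*pi" "%t. Re (?q t)"])
     (use i0 cR that in \<open>auto simp: complex_mult_cnj not_le[THEN iffD2, OF pi_gt_zero]\<close>)
  thus ?thesis by (simp add: complex_mult_cnj sum_power2_eq_zero_iff complex_eq_iff)
 qed
 obtain s where s: "s : {0..2*pi}" "cis s = cis t" proof -
  have "cis (Arg2pi (cis t)) = cis t" using Arg2pi_eq[of "cis t"] by (simp add: cis_conv_exp mult_ac)
  thus ?thesis using Arg2pi_ge_0[of "cis t"] Arg2pi_lt_2pi[of "cis t"] by (intro that[of "Arg2pi (cis t)"]) auto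
 qed
 thus ?thesis using z0 by metis
qed

text \<open>The terms of frequency \<open>n\<close>; the index set is a singleton for \<open>n = 0\<close>.\<close>

definition fourier_block :: "(int => complex) => nat => complex => complex" where
 "fourier_block a n z = (SUM k:{int n, - int n}. a k * circle_exp k z)"

lemma fourier_inversion:
 assumes h: "continuous_on UNIV (%t. h (cis t))"
  and s: "summable (%n. SUM k:{int n, - int n}. cmod (circle_coeff h k))"
 shows "uniform_limit UNIV (%N t. \<Sum>n<N. fourier_block (circle_coeff h) n (cis t)) (%t. h (cis t)) sequentially"
proof -
 let ?a = "circle_coeff h"
 let ?v = "%n z. fourier_block ?a n z"
 have bd: "norm (?v n (cis t)) <= (SUM k:{int n, - int n}. cmod (?a k))" for n t
  unfolding fourier_block_def by (rule sum_norm_le) (simp add: norm_mult circle_exp_cis)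
 have u: "uniform_limit UNIV (%N t. \<Sum>n<N. ?v n (cis t)) (%t. \<Sum>n. ?v n (cis t)) sequentially"
  by (rule Weierstrass_m_test[OF bd s])
 have vc: "continuous_on S (%t. ?v n (cis t))" for S n
  unfolding fourier_block_def circle_exp_cis by (intro continuous_intros)
 have pc: "continuous_on S (%t. \<Sum>n<N. ?v n (cis t))" for S N by (intro continuous_on_sum vc)
 have gc: "continuous_on UNIV (%t. \<Sum>n. ?v n (cis t))"
  by (rule uniform_limit_theorem[OF always_eventually[OF allI[OF pc]] u]) simp
 let ?r = "%z. h z - (\<Sum>n. ?v n z)"
 have rc: "continuous_on UNIV (%t. ?r (cis t))" by (intro continuous_on_diff h gc)
 have "circle_coeff ?r k = 0" for k
 proof -
  let ?e = "%t. cis (of_int k * t)"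
  have ec: "continuous_on S ?e" for S by (intro continuous_intros)
  have bl: "((%t. ?v n (cis t) * ?e t) has_integral (if n = nat \<bar>k\<bar> then 2 * pi * ?a k else 0)) {0..2*pi}" for n
  proof -
   have 1: "((%t. ?a j * cis (of_int (k - j) * t)) has_integral ?a j * (if k - j = 0 then 2 * pi else 0)) {0..2*pi}" for j
    using has_integral_mult_right[OF integral_cis[of "k - j"], of "?a j"] by (simp split: if_splits)
   have 2: "((%t. SUM j:{int n, - int n}. ?a j * cis (of_int (k - j) * t)) has_integral
     (SUM j:{int n, - int n}. ?a j * (if k - j = 0 then 2 * pi else 0))) {0..2*pi}"
    by (intro has_integral_sum 1) simp
   have 3: "?v n (cis t) * ?e t = (SUM j:{int n, - int n}. ?a j * cis (of_int (k - j) * t))" for t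
    unfolding fourier_block_def sum_distrib_right circle_exp_cis
    by (intro sum.cong refl) (simp add: cis_mult algebra_simps)
   have 4: "(SUM j:{int n, - int n}. ?a j * (if k - j = 0 then 2 * pi else 0)) = (if n = nat \<bar>k\<bar> then 2 * pi * ?a k else 0)"
   proof (cases "n = nat \<bar>k\<bar>")
    case True
    have "(SUM j:{int n, - int n}. ?a j * (if k - j = 0 then 2 * pi else 0)) = (SUM j:{k}. ?a j * (if k - j = 0 then 2 * pi else 0))"
     by (rule sum.mono_neutral_right) (use True in auto)
    thus ?thesis using True by (simp add: mult_ac)
   next
    case False
    hence "k ~= int n" "k ~= - int n" by auto
    hence "(SUM j:{int n, - int n}. ?a j * (if k - j = 0 then 2 * pi else 0)) = 0"
     by (intro sum.neutral) auto
    thus ?thesis using False by simp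
   qed
   show ?thesis using 2 unfolding 3 4 .
  qed
  have u2: "uniform_limit {0..2*pi} (%N t. (\<Sum>n<N. ?v n (cis t)) * ?e t) (%t. (\<Sum>n. ?v n (cis t)) * ?e t) sequentially"
  proof (rule uniform_limitI)
   fix e :: real assume "0 < e"
   from uniform_limitD[OF u this] show "\<forall>\<^sub>F N in sequentially. ALL t:{0..2*pi}. dist ((\<Sum>n<N. ?v n (cis t)) * ?e t) ((\<Sum>n. ?v n (cis t)) * ?e t) < e"
    by (rule eventually_mono) (simp add: dist_norm left_diff_distrib[symmetric] norm_mult)
  qed
  have pc2: "continuous_on {0..2*pi} (%t. (\<Sum>n<N. ?v n (cis t)) * ?e t)" for N
   by (intro continuous_on_mult pc ec)
  obtain I J where IJ: "!!N. ((%t. (\<Sum>n<N. ?v n (cis t)) * ?e t) has_integral I N) {0..2*pi}"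
   "((%t. (\<Sum>n. ?v n (cis t)) * ?e t) has_integral J) {0..2*pi}" "I ----> J"
   using uniform_limit_integral[OF u2 pc2 trivial_limit_sequentially] by blast
  have "I N = 2 * pi * ?a k" if N: "nat \<bar>k\<bar> < N" for N
  proof (rule has_integral_unique[OF IJ(1)])
   have "((%t. \<Sum>n<N. ?v n (cis t) * ?e t) has_integral (\<Sum>n<N. if n = nat \<bar>k\<bar> then 2 * pi * ?a k else 0)) {0..2*pi}"
    by (intro has_integral_sum bl) simp
   thus "((%t. (\<Sum>n<N. ?v n (cis t)) * ?e t) has_integral 2 * pi * ?a k) {0..2*pi}"
    using N by (simp add: sum_distrib_right)
  qed
  hence "\<forall>\<^sub>F N in sequentially. I N = 2 * pi * ?a k"
   unfolding eventually_sequentially by (meson Suc_le_lessD)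
  hence "I ----> 2 * pi * ?a k" by (rule tendsto_eventually)
  hence J: "J = 2 * pi * ?a k" using IJ(3) LIMSEQ_unique by blast
  have hi: "((%t. h (cis t) * ?e t) has_integral 2 * pi * ?a k) {0..2*pi}" proof -
   have "(%t. h (cis t) * ?e t) integrable_on {0..2*pi}"
    by (intro integrable_continuous_interval continuous_on_mult ec continuous_on_subset[OF h]) simp
   thus ?thesis using integrable_integral unfolding circle_coeff_def by simp
  qed
  from has_integral_diff[OF hi IJ(2)] have "((%t. ?r (cis t) * ?e t) has_integral 0) {0..2*pi}"
   by (simp add: J left_diff_distrib)
  thus ?thesis by (simp add: circle_coeff_def integral_unique)
 qed
 from circle_coeff_zero_imp_zero[OF rc this] have "(%t. \<Sum>n. ?v n (cis t)) = (%t. h (cis t))" by (auto simp: fun_eq_iff)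
 thus ?thesis using u by simp
qed

lemma periodic_deriv:
 assumes f: "f : circle_smooth"
 shows "circle_deriv j f (t + 2 * pi) = circle_deriv j f t"
proof (induction j arbitrary: t)
 case 0
 show ?case by (simp add: cis_mult[symmetric])
next
 case (Suc j)
 have "((%s. s + 2 * pi) has_vector_derivative 1) (at t)" by (auto intro!: derivative_eq_intros)
 hence "((circle_deriv j f \<circ> (%s. s + 2 * pi)) has_vector_derivative (1 *\<^sub>R circle_deriv (Suc j) f (t + 2 * pi))) (at t)"
  by (rule vector_diff_chain_at) (rule circle_smooth_deriv[OF f])
 hence "(circle_deriv j f has_vector_derivative circle_deriv (Suc j) f (t + 2 * pi)) (at t)"
  using Suc.IH by (simp add: o_def)
 thus ?case using circle_smooth_deriv[OF f] vector_derivative_unique_at by blast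
qed

lemma periodic_deriv_int:
 assumes f: "f : circle_smooth"
 shows "circle_deriv j f (t + 2 * pi * of_int n) = circle_deriv j f t"
proof (induction n rule: int_induct[where k = 0])
 case base
 show ?case by simp
next
 case (step1 i)
 thus ?case using periodic_deriv[OF f, of j "t + 2 * pi * of_int i"] by (simp add: algebra_simps)
next
 case (step2 i)
 thus ?case using periodic_deriv[OF f, of j "t + 2 * pi * of_int (i - 1)"] by (simp add: algebra_simps)
qed

text \<open>Derivatives of a smooth function on the circle are periodic and hence functions on the circle
again.\<close>

definition circle_diff :: "nat => (complex => complex) => complex => complex" where
 "circle_diff j f z = circle_deriv j f (Arg z)"

lemma circle_diff_cis:
 assumes "f : circle_smooth" shows "circle_diff j f (cis t) = circle_deriv j f t"
proof -
 have "cis (Arg (cis t)) = cis t" by (simp add: cis_Arg sgn_div_norm)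
 hence "exp (\<i> * of_real (Arg (cis t))) = exp (\<i> * of_real t)" by (simp only: cis_conv_exp)
 then obtain n where "\<i> * of_real (Arg (cis t)) = \<i> * of_real t + (of_int (2 * n) * pi) * \<i>"
  using exp_eq by blast
 hence "Im (\<i> * of_real (Arg (cis t))) = Im (\<i> * of_real t + (of_int (2 * n) * pi) * \<i>)" by (simp only:)
 hence "Arg (cis t) = t + 2 * pi * of_int n" by simp
 thus ?thesis unfolding circle_diff_def by (simp only: periodic_deriv_int[OF assms])
qed

lemma circle_coeff_deriv:
 assumes f: "f : circle_smooth"
 shows "circle_coeff (circle_diff (Suc j) f) k = (- \<i> * of_int k) * circle_coeff (circle_diff j f) k"
proof -
 let ?F = "circle_deriv j f" and ?G = "circle_deriv (Suc j) f" and ?e = "%t. cis (of_int k * t)"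
 have ec: "continuous_on S ?e" for S by (intro continuous_intros)
 have i1: "((%t. ?F t * ?e t) has_integral integral {0..2*pi} (%t. ?F t * ?e t)) {0..2*pi}"
  by (intro integrable_integral integrable_continuous_interval continuous_on_mult circle_smooth_continuous f ec)
 have i2: "((%t. ?G t * ?e t) has_integral integral {0..2*pi} (%t. ?G t * ?e t)) {0..2*pi}"
  by (intro integrable_integral integrable_continuous_interval continuous_on_mult circle_smooth_continuous f ec)
 have d: "((%t. ?F t * ?e t) has_vector_derivative ?F t * (\<i> * of_int k * ?e t) + ?G t * ?e t) (at t within {0..2*pi})" for t
  by (intro has_vector_derivative_mult has_vector_derivative_cis_int
    has_vector_derivative_at_within[OF circle_smooth_deriv[OF f]])
 have "((%t. ?F t * (\<i> * of_int k * ?e t) + ?G t * ?e t) has_integral ?F (2*pi) * ?e (2*pi) - ?F 0 * ?e 0) {0..2*pi}"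
  by (rule fundamental_theorem_of_calculus[OF _ d]) simp
 moreover have "?e (2*pi) = 1" using cis_multiple_2pi[of "of_int k"] by (simp add: mult_ac)
 moreover have "?F (2*pi) = ?F 0" using periodic_deriv[OF f, of j 0] by simp
 ultimately have "((%t. ?F t * (\<i> * of_int k * ?e t) + ?G t * ?e t) has_integral 0) {0..2*pi}" by simp
 moreover have "((%t. ?F t * (\<i> * of_int k * ?e t) + ?G t * ?e t) has_integral
   (\<i> * of_int k) * integral {0..2*pi} (%t. ?F t * ?e t) + integral {0..2*pi} (%t. ?G t * ?e t)) {0..2*pi}"
  using has_integral_add[OF has_integral_mult_right[OF i1, of "\<i> * of_int k"] i2] by (simp only: mult_ac)
 ultimately have "(\<i> * of_int k) * integral {0..2*pi} (%t. ?F t * ?e t) + integral {0..2*pi} (%t. ?G t * ?e t) = 0"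
  by (rule has_integral_unique[symmetric])
 hence "integral {0..2*pi} (%t. ?G t * ?e t) = - (\<i> * of_int k) * integral {0..2*pi} (%t. ?F t * ?e t)"
  by (simp add: add_eq_0_iff2)
 thus ?thesis unfolding circle_coeff_def circle_diff_cis[OF f] by simp
qed

lemma circle_coeff_cong: "(!!t. f (cis t) = g (cis t)) ==> circle_coeff f k = circle_coeff g k"
 by (simp add: circle_coeff_def)

lemma circle_coeff_diff:
 assumes f: "f : circle_smooth"
 shows "circle_coeff (circle_diff j f) k = (- \<i> * of_int k) ^ j * circle_coeff f k"
proof (induction j)
 case 0
 show ?case using circle_coeff_cong[of "circle_diff 0 f" f k] circle_diff_cis[OF f, of 0] by simp
next
 case (Suc j)
 thus ?case unfolding circle_coeff_deriv[OF f] by simp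
qed

lemma circle_coeff_bound:
 assumes f: "f : circle_smooth"
 shows "\<bar>real_of_int k\<bar> ^ j * cmod (circle_coeff f k) <= circle_seminorm j f"
proof -
 let ?G = "%t. circle_deriv j f t * cis (of_int k * t)"
 have i: "(?G has_integral integral {0..2*pi} ?G) {0..2*pi}"
  by (intro integrable_integral integrable_continuous_interval continuous_on_mult circle_smooth_continuous f continuous_intros)
 have "cmod (integral {0..2*pi} ?G) <= circle_seminorm j f * measure lborel {0..2*pi}"
  by (rule has_integral_bound_real[OF circle_seminorm_nonneg[OF f] finite.emptyI i])
    (auto simp: norm_mult intro!: circle_seminorm_upper f)
 hence "cmod (integral {0..2*pi} ?G / (2 * pi)) <= circle_seminorm j f"
  by (simp add: norm_divide norm_mult divide_le_eq mult_ac)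
 hence "cmod (circle_coeff (circle_diff j f) k) <= circle_seminorm j f"
  unfolding circle_coeff_def circle_diff_cis[OF f] by simp
 thus ?thesis unfolding circle_coeff_diff[OF f] by (simp add: norm_mult norm_power)
qed

lemma circle_coeff_decay:
 assumes f: "f : circle_smooth" and k: "\<bar>k\<bar> = int n"
 shows "real (Suc n) ^ j * cmod (circle_coeff f k) <= 2 ^ j * (circle_seminorm 0 f + circle_seminorm j f)"
proof (cases "n = 0")
 case True
 have "cmod (circle_coeff f k) <= circle_seminorm 0 f" using circle_coeff_bound[OF f, of k 0] by simp
 also have "... <= circle_seminorm 0 f + circle_seminorm j f" using circle_seminorm_nonneg[OF f] by simp
 also have "... <= 2 ^ j * (circle_seminorm 0 f + circle_seminorm j f)"
  using mult_right_mono[of 1 "2 ^ j" "circle_seminorm 0 f + circle_seminorm j f"] circle_seminorm_nonneg[OF f] by simp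
 finally show ?thesis using True by simp
next
 case False
 have "real (Suc n) ^ j * cmod (circle_coeff f k) <= (2 * real n) ^ j * cmod (circle_coeff f k)"
  using False by (intro mult_right_mono power_mono) auto
 also have "... = 2 ^ j * (\<bar>real_of_int k\<bar> ^ j * cmod (circle_coeff f k))" proof -
  have "\<bar>real_of_int k\<bar> = real n" using k by (metis of_int_abs of_int_of_nat_eq)
  thus ?thesis by (simp add: power_mult_distrib)
 qed
 also have "... <= 2 ^ j * circle_seminorm j f" by (intro mult_left_mono circle_coeff_bound[OF f]) simp
 also have "... <= 2 ^ j * (circle_seminorm 0 f + circle_seminorm j f)"
  using circle_seminorm_nonneg[OF f] by simp
 finally show ?thesis .
qed

lemma summable_inverse_Suc_sq: "summable (%n. 1 / real (Suc n) ^ 2)"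
 using inverse_power_summable[of 2, where 'a = real] summable_Suc_iff[of "%n. inverse (real n ^ 2)"]
 by (simp add: inverse_eq_divide)

lemma pair_sum_bound:
 assumes "!!k. \<bar>k\<bar> = int n ==> g k <= (B::real)" "0 <= B"
 shows "(SUM k:{int n, - int n}. g k) <= 2 * B"
proof -
 have "(SUM k:{int n, - int n}. g k) <= of_nat (card {int n, - int n}) * B"
  by (rule sum_bounded_above) (use assms in auto)
 also have "... <= 2 * B" using assms(2) by (intro mult_right_mono) (auto simp: card_insert_if)
 finally show ?thesis .
qed

lemma weighted_block_bound:
 assumes f: "f : circle_smooth"
  and w: "!!k. cmod (w k) <= C * (1 + \<bar>real_of_int k\<bar>) ^ N" and C: "0 <= C"
 shows "(SUM k:{int n, - int n}. cmod (w k * circle_coeff f k))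
  <= 2 * C * 2 ^ (N + 2) * (circle_seminorm 0 f + circle_seminorm (N + 2) f) * (1 / real (Suc n) ^ 2)"
proof -
 let ?P = "circle_seminorm 0 f + circle_seminorm (N + 2) f"
 have P0: "0 <= ?P" using circle_seminorm_nonneg[OF f] by simp
 have n: "real (Suc n) > 0" by simp
 have "(SUM k:{int n, - int n}. cmod (w k * circle_coeff f k)) <= 2 * (C * (2 ^ (N + 2) * ?P) / real (Suc n) ^ 2)"
 proof (rule pair_sum_bound)
  fix k assume k: "\<bar>k\<bar> = int n"
  have ak: "1 + \<bar>real_of_int k\<bar> = real (Suc n)" using k by (metis of_int_abs of_int_of_nat_eq of_nat_Suc)
  have "cmod (w k * circle_coeff f k) * real (Suc n) ^ 2 <= (C * real (Suc n) ^ N) * cmod (circle_coeff f k) * real (Suc n) ^ 2"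
   unfolding norm_mult using w[of k] unfolding ak by (intro mult_right_mono) auto
  also have "... = C * (real (Suc n) ^ (N + 2) * cmod (circle_coeff f k))"
   by (simp only: power_add mult_ac)
  also have "... <= C * (2 ^ (N + 2) * ?P)" by (intro mult_left_mono circle_coeff_decay[OF f k] C)
  finally show "cmod (w k * circle_coeff f k) <= C * (2 ^ (N + 2) * ?P) / real (Suc n) ^ 2"
   by (subst pos_le_divide_eq) auto
 qed (use C P0 in auto)
 thus ?thesis by (simp add: mult_ac)
qed

lemma summable_blocks:
 assumes f: "f : circle_smooth"
  and w: "!!k. cmod (w k) <= C * (1 + \<bar>real_of_int k\<bar>) ^ N" and C: "0 <= C"
 shows "summable (%n. SUM k:{int n, - int n}. cmod (w k * circle_coeff f k))"
  "(\<Sum>n. SUM k:{int n, - int n}. cmod (w k * circle_coeff f k))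
   <= 2 * C * 2 ^ (N + 2) * (circle_seminorm 0 f + circle_seminorm (N + 2) f) * (\<Sum>n. 1 / real (Suc n) ^ 2)"
proof -
 let ?D = "2 * C * 2 ^ (N + 2) * (circle_seminorm 0 f + circle_seminorm (N + 2) f)"
 have s: "summable (%n. ?D * (1 / real (Suc n) ^ 2))" by (rule summable_mult[OF summable_inverse_Suc_sq])
 show 1: "summable (%n. SUM k:{int n, - int n}. cmod (w k * circle_coeff f k))"
 proof (rule summable_comparison_test[OF _ s], intro exI allI impI)
  fix n
  have "0 <= (SUM k:{int n, - int n}. cmod (w k * circle_coeff f k))" by (intro sum_nonneg norm_ge_zero)
  thus "norm (SUM k:{int n, - int n}. cmod (w k * circle_coeff f k)) <= ?D * (1 / real (Suc n) ^ 2)"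
   using weighted_block_bound[OF f w C, of n] by simp
 qed
 have "(\<Sum>n. SUM k:{int n, - int n}. cmod (w k * circle_coeff f k)) <= (\<Sum>n. ?D * (1 / real (Suc n) ^ 2))"
  by (intro suminf_le 1 s weighted_block_bound[OF f w C])
 also have "... = ?D * (\<Sum>n. 1 / real (Suc n) ^ 2)" by (rule suminf_mult[OF summable_inverse_Suc_sq])
 finally show "(\<Sum>n. SUM k:{int n, - int n}. cmod (w k * circle_coeff f k)) <= ?D * (\<Sum>n. 1 / real (Suc n) ^ 2)" .
qed

definition fourier_partial :: "(complex => complex) => nat => complex => complex" where
 "fourier_partial f N = (%z. \<Sum>n<N. fourier_block (circle_coeff f) n z)"

lemma circle_smooth_sum:
 assumes "finite I" "!!i. i : I ==> f i : circle_smooth"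
 shows "(%z. SUM i:I. f i z) : circle_smooth & circle_deriv j (%z. SUM i:I. f i z) = (%t. SUM i:I. circle_deriv j (f i) t)"
 using assms
proof (induction I)
 case empty
 thus ?case using circle_smooth_zero by simp
next
 case (insert x I)
 hence 1: "f x : circle_smooth" and 2: "(%z. SUM i:I. f i z) : circle_smooth"
  "circle_deriv j (%z. SUM i:I. f i z) = (%t. SUM i:I. circle_deriv j (f i) t)" by simp_all
 show ?case using circle_smooth_add[OF 1 2(1)] insert(1,2) by (simp add: 2(2))
qed

lemma fourier_block_smooth:
 "fourier_block a n : circle_smooth"
 "circle_deriv j (fourier_block a n) t = fourier_block (%k. (- \<i> * of_int k) ^ j * a k) n (cis t)"
proof -
 have 1: "(%z. a k * circle_exp k z) : circle_smooth" for k
  by (rule circle_smooth_scale(1)[OF circle_exp_smooth(1)])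
 have 2: "fourier_block a n = (%z. SUM k:{int n, - int n}. a k * circle_exp k z)"
  by (simp add: fun_eq_iff fourier_block_def)
 note S = circle_smooth_sum[of "{int n, - int n}" "%k z. a k * circle_exp k z" j, OF _ 1]
 show "fourier_block a n : circle_smooth" unfolding 2 using S by simp
 have "circle_deriv j (fourier_block a n) = (%t. SUM k:{int n, - int n}. circle_deriv j (%z. a k * circle_exp k z) t)"
  unfolding 2 using S by simp
 thus "circle_deriv j (fourier_block a n) t = fourier_block (%k. (- \<i> * of_int k) ^ j * a k) n (cis t)"
  unfolding fourier_block_def circle_smooth_scale(2)[OF circle_exp_smooth(1)] circle_exp_smooth(2) circle_exp_cis
  by (simp only: mult_ac)
qed

lemma fourier_partial_smooth:
 "fourier_partial f N : circle_smooth"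
 "circle_deriv j (fourier_partial f N) t = (\<Sum>n<N. fourier_block (%k. (- \<i> * of_int k) ^ j * circle_coeff f k) n (cis t))"
 using circle_smooth_sum[of "{..<N}" "%n. fourier_block (circle_coeff f) n" j] fourier_block_smooth
 unfolding fourier_partial_def by auto

lemma fourier_partial_converges:
 assumes f: "f : circle_smooth"
 shows "(%N. circle_seminorm j (%z. fourier_partial f N z - f z)) ----> 0"
proof -
 let ?h = "circle_diff j f"
 have c: "circle_coeff ?h = (%k. (- \<i> * of_int k) ^ j * circle_coeff f k)"
  using circle_coeff_diff[OF f] by (simp add: fun_eq_iff)
 have w: "cmod ((- \<i> * of_int k) ^ j) <= 1 * (1 + \<bar>real_of_int k\<bar>) ^ j" for k
  by (simp add: norm_power norm_mult power_mono)
 have hc: "continuous_on UNIV (%t. ?h (cis t))"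
  unfolding circle_diff_cis[OF f] by (rule circle_smooth_continuous[OF f])
 have s: "summable (%n. SUM k:{int n, - int n}. cmod (circle_coeff ?h k))"
  unfolding c by (rule summable_blocks(1)[OF f w]) simp
 note u = fourier_inversion[OF hc s]
 show ?thesis proof (rule LIMSEQ_I)
  fix e :: real assume "0 < e"
  hence "0 < e / 2" by simp
  from uniform_limitD[OF u this]
  obtain N0 where N0: "!!N t. N0 <= N ==> dist (\<Sum>n<N. fourier_block (circle_coeff ?h) n (cis t)) (?h (cis t)) < e / 2"
   unfolding eventually_sequentially by blast
  have "norm (circle_seminorm j (%z. fourier_partial f N z - f z) - 0) < e" if N: "N0 <= N" for N
  proof -
   have "circle_seminorm j (%z. fourier_partial f N z - f z) <= e / 2"
   proof (rule circle_seminorm_least)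
    fix t
    show "cmod (circle_deriv j (%z. fourier_partial f N z - f z) t) <= e / 2" using N0[OF N, of t]
     unfolding circle_smooth_diff(2)[OF fourier_partial_smooth(1) f] fourier_partial_smooth(2) c circle_diff_cis[OF f]
     by (simp add: dist_norm)
   qed
   moreover have "0 <= circle_seminorm j (%z. fourier_partial f N z - f z)"
    by (intro circle_seminorm_nonneg circle_smooth_diff(1) fourier_partial_smooth f)
   ultimately show ?thesis using \<open>0 < e\<close> by simp
  qed
  thus "EX no. ALL n>=no. norm (circle_seminorm j (%z. fourier_partial f n z - f z) - 0) < e" by blast
 qed
qed

lemma distribution_sum:
 assumes "mu : circle_distributions" "finite I" "!!i. i : I ==> f i : circle_smooth"
 shows "mu (%z. SUM i:I. f i z) = (SUM i:I. mu (f i))" using assms(2,3)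
proof (induction I)
 case empty
 show ?case using distribution_zero[OF assms(1)] by simp
next
 case (insert x I)
 hence "(%z. SUM i:I. f i z) : circle_smooth" using circle_smooth_sum[of I f] by simp
 thus ?case using circle_distributionsD(2)[OF assms(1), of "f x" "%z. SUM i:I. f i z"] insert by simp
qed

lemma distribution_fourier_partial:
 assumes mu: "mu : circle_distributions"
 shows "mu (fourier_partial f N) = (\<Sum>n<N. SUM k:{int n, - int n}. circle_coeff f k * fourier_coeff mu k)"
proof -
 have "mu (fourier_block a n) = (SUM k:{int n, - int n}. a k * fourier_coeff mu k)" for a n
 proof -
  have "fourier_block a n = (%z. SUM k:{int n, - int n}. a k * circle_exp k z)"
   by (simp add: fun_eq_iff fourier_block_def)
  thus ?thesis using distribution_sum[OF mu, of "{int n, - int n}" "%k z. a k * circle_exp k z"]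
   by (simp only: circle_smooth_scale(1)[OF circle_exp_smooth(1)] finite.intros circle_distributionsD(3)[OF mu circle_exp_smooth(1)] fourier_coeff_eq simp_thms)
 qed
 thus ?thesis unfolding fourier_partial_def
  using distribution_sum[OF mu, of "{..<N}" "%n. fourier_block (circle_coeff f) n"] fourier_block_smooth(1) by simp
qed

lemma distribution_eq_fourier_limit:
 assumes mu: "mu : circle_distributions" and f: "f : circle_smooth"
 shows "(%N. \<Sum>n<N. SUM k:{int n, - int n}. circle_coeff f k * fourier_coeff mu k) ----> mu f"
proof (rule LIMSEQ_I)
 fix e :: real assume e: "0 < e"
 obtain K d where d: "0 < (d::real)"
  and K: "ALL g:circle_smooth. (ALL k<=K. circle_seminorm k (%z. g z - f z) < d) --> cmod (mu g - mu f) < e"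
  using circle_distribution_nhd[OF mu f e] by blast
 have "\<forall>\<^sub>F N in sequentially. ALL k:{..K}. circle_seminorm k (%z. fourier_partial f N z - f z) < d"
  by (intro eventually_ball_finite finite_atMost ballI order_tendstoD(2)[OF fourier_partial_converges[OF f] d])
 hence "\<forall>\<^sub>F N in sequentially. cmod (mu (fourier_partial f N) - mu f) < e"
 proof (rule eventually_mono)
  fix N assume "ALL k:{..K}. circle_seminorm k (%z. fourier_partial f N z - f z) < d"
  thus "cmod (mu (fourier_partial f N) - mu f) < e" using K fourier_partial_smooth(1)[of f N] by auto
 qed
 thus "EX no. ALL N>=no. norm ((\<Sum>n<N. SUM k:{int n, - int n}. circle_coeff f k * fourier_coeff mu k) - mu f) < e"
  unfolding eventually_sequentially distribution_fourier_partial[OF mu] .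
qed

theorem distribution_unique:
 assumes "mu : circle_distributions" "nu : circle_distributions"
  and "!!k. fourier_coeff mu k = fourier_coeff nu k"
 shows "mu = nu"
proof (rule extensionalityI[OF circle_distributionsD(1)[OF assms(1)] circle_distributionsD(1)[OF assms(2)]])
 fix f assume f: "f : circle_smooth"
 show "mu f = nu f"
  using LIMSEQ_unique[OF distribution_eq_fourier_limit[OF assms(1) f]] distribution_eq_fourier_limit[OF assms(2) f]
  unfolding assms(3) by blast
qed

lemma circle_coeff_linear:
 assumes f: "f : circle_smooth" and g: "g : circle_smooth"
 shows "circle_coeff (%z. f z + g z) k = circle_coeff f k + circle_coeff g k"
  "circle_coeff (%z. c * f z) k = c * circle_coeff f k"
proof -
 have i: "(%t. h (cis t) * cis (of_int k * t)) integrable_on {0..2*pi}" if "h : circle_smooth" for h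
  by (intro integrable_continuous_interval continuous_on_mult continuous_intros)
    (use circle_smooth_continuous[OF that, of _ 0] in simp)
 show "circle_coeff (%z. f z + g z) k = circle_coeff f k + circle_coeff g k"
  unfolding circle_coeff_def using integral_add[OF i[OF f] i[OF g]] by (simp add: distrib_right add_divide_distrib)
 show "circle_coeff (%z. c * f z) k = c * circle_coeff f k"
  unfolding circle_coeff_def mult.assoc by simp
qed

lemma circle_coeff_exp: "circle_coeff (circle_exp j) k = (if k = j then 1 else 0)"
proof -
 have "circle_exp j (cis t) * cis (of_int k * t) = cis (of_int (k - j) * t)" for t
  by (simp add: circle_exp_cis cis_mult algebra_simps)
 thus ?thesis unfolding circle_coeff_def using integral_unique[OF integral_cis[of "k - j"]] by simp
qed

text \<open>The pairing of the given sequence with Fourier coefficients converges, because the latter decay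
faster than every power, and it is bounded by two seminorms.\<close>

theorem distribution_exists:
 assumes c: "!!k. cmod (c k) <= C * (1 + \<bar>real_of_int k\<bar>) ^ N"
 shows "EX mu:circle_distributions. ALL k. fourier_coeff mu k = c k"
proof -
 have C: "0 <= C" using order_trans[OF norm_ge_zero c[of 0]] by simp
 let ?b = "%f n. SUM k:{int n, - int n}. c k * circle_coeff f k"
 let ?L = "%f. \<Sum>n. ?b f n"
 let ?D = "2 * C * 2 ^ (N + 2) * (\<Sum>n. 1 / real (Suc n) ^ 2)"
 have nb: "norm (?b f n) <= (SUM k:{int n, - int n}. cmod (c k * circle_coeff f k))" for f n by (rule norm_sum)
 have sm: "summable (?b f)" if f: "f : circle_smooth" for f
  by (rule summable_comparison_test[OF _ summable_blocks(1)[OF f c C]]) (use nb in blast)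
 have bound: "cmod (?L f) <= ?D * (circle_seminorm 0 f + circle_seminorm (N + 2) f)" if f: "f : circle_smooth" for f
 proof -
  have "cmod (?L f) <= (\<Sum>n. SUM k:{int n, - int n}. cmod (c k * circle_coeff f k))"
   by (rule norm_suminf_le[OF nb summable_blocks(1)[OF f c C]])
  thus ?thesis using summable_blocks(2)[OF f c C] by (simp add: mult_ac)
 qed
 have add: "?L (%z. f z + g z) = ?L f + ?L g" if "f : circle_smooth" "g : circle_smooth" for f g
  unfolding circle_coeff_linear(1)[OF that] distrib_left sum.distrib
  by (rule suminf_add[OF sm sm, symmetric]) (use that in auto)
 have scale: "?L (%z. a * f z) = a * ?L f" if "f : circle_smooth" for a f
 proof -
  have "?b (%z. a * f z) n = a * ?b f n" for n
   unfolding circle_coeff_linear(2)[OF that that] sum_distrib_left by (simp only: mult_ac)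
  thus ?thesis using suminf_mult[OF sm[OF that], of a] by simp
 qed
 have exp: "?L (circle_exp j) = c j" for j
 proof -
  have "(%n. ?b (circle_exp j) n) = (%n. if n = nat \<bar>j\<bar> then c j else 0)" proof
   fix n
   show "?b (circle_exp j) n = (if n = nat \<bar>j\<bar> then c j else 0)"
   proof (cases "n = nat \<bar>j\<bar>")
    case True
    have "?b (circle_exp j) n = (SUM k:{j}. c k * circle_coeff (circle_exp j) k)"
     by (rule sum.mono_neutral_right) (use True in \<open>auto simp: circle_coeff_exp\<close>)
    thus ?thesis using True by (simp add: circle_coeff_exp)
   next
    case False
    hence "j ~= int n" "j ~= - int n" by auto
    hence "?b (circle_exp j) n = 0" by (intro sum.neutral) (auto simp: circle_coeff_exp)
    thus ?thesis using False by simp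
   qed
  qed
  thus ?thesis using suminf_finite[of "{nat \<bar>j\<bar>}" "%n. if n = nat \<bar>j\<bar> then c j else 0"] by simp
 qed
 have diff: "?L g - ?L f = ?L (%z. g z - f z)" if "f : circle_smooth" "g : circle_smooth" for f g
  using add[OF circle_smooth_diff(1)[OF that(2,1)] that(1)] by (simp add: eq_diff_eq)
 let ?mu = "restrict ?L circle_smooth"
 have "continuous_map circle_smooth_topology euclidean ?mu"
  unfolding continuous_map_def topspace_circle_smooth
 proof (intro conjI allI impI)
  show "?mu : circle_smooth \<rightarrow> topspace euclidean" by simp
  fix V :: "complex set" assume "openin euclidean V"
  hence V: "open V" by (simp add: open_openin[symmetric])
  show "openin circle_smooth_topology {f : circle_smooth. ?mu f : V}"
   unfolding openin_subopen[of _ "{f : circle_smooth. ?mu f : V}"]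
  proof
   fix f assume fV: "f : {f : circle_smooth. ?mu f : V}"
   hence f: "f : circle_smooth" and "?L f : V" by auto
   then obtain e where e: "0 < e" "ball (?L f) e \<subseteq> V" using V openE by blast
   have D0: "0 <= ?D" by (intro mult_nonneg_nonneg C suminf_nonneg summable_inverse_Suc_sq) auto
   define d where "d = e / (2 * ?D + 1)"
   have d: "0 < d" unfolding d_def using e(1) D0 by (intro divide_pos_pos) auto
   have dD: "2 * ?D * d < e" proof -
    have "(2 * ?D + 1) * d = e" unfolding d_def using D0 by simp
    thus ?thesis using d by (simp add: distrib_right)
   qed
   let ?W = "%k. {g : circle_smooth. circle_seminorm k (%z. g z - f z) < d}"
   have op: "openin circle_smooth_topology (?W k)" for k
    unfolding circle_smooth_topology_def using f d by (intro topology_generated_by_Basis) blast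
   have fW: "f : ?W k" for k
   proof -
    have "circle_seminorm k (%z. f z - f z) <= 0"
     by (rule circle_seminorm_least) (simp add: circle_smooth_zero)
    thus ?thesis using f d by simp
   qed
   have sub: "?W 0 \<inter> ?W (N + 2) \<subseteq> {f : circle_smooth. ?mu f : V}" proof
    fix g assume g: "g : ?W 0 \<inter> ?W (N + 2)"
    hence gs: "g : circle_smooth" by simp
    have "cmod (?L g - ?L f) <= ?D * (circle_seminorm 0 (%z. g z - f z) + circle_seminorm (N + 2) (%z. g z - f z))"
     unfolding diff[OF f gs] by (rule bound[OF circle_smooth_diff(1)[OF gs f]])
    also have "... <= ?D * (2 * d)" by (rule mult_left_mono[OF _ D0]) (use g in auto)
    also have "... = 2 * ?D * d" by (simp only: mult_ac)
    also have "... < e" by (rule dD)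
    finally have "?L g : ball (?L f) e" by (simp only: mem_ball dist_norm norm_minus_commute)
    thus "g : {f : circle_smooth. ?mu f : V}" using e(2) gs by auto
   qed
   show "EX T. openin circle_smooth_topology T & f : T & T \<subseteq> {f : circle_smooth. ?mu f : V}"
    by (intro exI[of _ "?W 0 \<inter> ?W (N + 2)"] conjI openin_Int op sub) (use fW in blast)
  qed
 qed
 hence "?mu : circle_distributions" unfolding circle_distributions_def
  using add scale by (auto simp: circle_smooth_add(1) circle_smooth_scale(1))
 moreover have "ALL k. fourier_coeff ?mu k = c k"
  unfolding fourier_coeff_eq using exp circle_exp_smooth(1) by simp
 ultimately show ?thesis by blast
qed

section \<open>Gram matrices of tuples\<close>

definition sesq :: "(nat => nat => complex) => complex poly => complex poly => complex" where
 "sesq A f g = (SUM j<=degree f. SUM l<=degree g. coeff f j * cnj (coeff g l) * A j l)"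

lemma sesq_eq:
 assumes "degree f <= N" "degree g <= M"
 shows "sesq A f g = (SUM j<=N. SUM l<=M. coeff f j * cnj (coeff g l) * A j l)"
proof -
 have "(SUM l<=M. coeff f j * cnj (coeff g l) * A j l) = (SUM l<=degree g. coeff f j * cnj (coeff g l) * A j l)" for j
  by (rule sum.mono_neutral_right) (use assms(2) in \<open>auto simp: coeff_eq_0\<close>)
 hence "(SUM j<=N. SUM l<=M. coeff f j * cnj (coeff g l) * A j l) = (SUM j<=N. SUM l<=degree g. coeff f j * cnj (coeff g l) * A j l)" by simp
 also have "... = (SUM j<=degree f. SUM l<=degree g. coeff f j * cnj (coeff g l) * A j l)"
  by (rule sum.mono_neutral_right) (use assms(1) in \<open>auto simp: coeff_eq_0 intro!: sum.neutral\<close>)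
 finally show ?thesis unfolding sesq_def ..
qed

lemma sesq_add_left: "sesq A (f + g) h = sesq A f h + sesq A g h"
proof -
 let ?N = "max (degree f) (degree g)"
 have "sesq A (f + g) h = (SUM j<=?N. SUM l<=degree h. coeff (f + g) j * cnj (coeff h l) * A j l)"
  by (rule sesq_eq) (auto intro: degree_add_le_max)
 also have "... = sesq A f h + sesq A g h"
  by (subst (1 2) sesq_eq[where N = ?N and M = "degree h"]) (simp_all add: distrib_right sum.distrib)
 finally show ?thesis .
qed

lemma sesq_add_right: "sesq A h (f + g) = sesq A h f + sesq A h g"
proof -
 let ?N = "max (degree f) (degree g)"
 have "sesq A h (f + g) = (SUM j<=degree h. SUM l<=?N. coeff h j * cnj (coeff (f + g) l) * A j l)"
  by (rule sesq_eq) (auto intro: degree_add_le_max)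
 also have "... = sesq A h f + sesq A h g"
  by (subst (1 2) sesq_eq[where M = ?N and N = "degree h"]) (simp_all add: distrib_right distrib_left sum.distrib)
 finally show ?thesis .
qed

lemma sesq_smult_left: "sesq A (Polynomial.smult c f) h = c * sesq A f h"
 by (subst sesq_eq[where N = "degree f" and M = "degree h"])
   (simp_all add: degree_smult_le sesq_def sum_distrib_left mult_ac)

lemma sesq_smult_right: "sesq A h (Polynomial.smult c f) = cnj c * sesq A h f"
 by (subst sesq_eq[where N = "degree h" and M = "degree f"])
   (simp_all add: degree_smult_le sesq_def sum_distrib_left mult_ac)

lemma sesq_zero [simp]: "sesq A 0 f = 0" "sesq A f 0 = 0" by (simp_all add: sesq_def)

lemma sesq_linear_array: "sesq (%j l. c * A j l + d * B j l) f g = c * sesq A f g + d * sesq B f g"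
 by (simp add: sesq_def sum_distrib_left distrib_left sum.distrib mult_ac)

lemma sesq_shift: "sesq A (monom 1 i * f) (monom 1 i * g) = sesq (%j l. A (j + i) (l + i)) f g"
proof -
 have d: "degree (monom 1 i * f) <= degree f + i" for f :: "complex poly"
  using degree_mult_le[of "monom (1::complex) i" f] degree_monom_le[of "1::complex" i] by simp
 have r: "(SUM j<=N + i. if i <= j then F (j - i) j else 0) = (SUM j<=N. F j (j + i))" for F :: "nat => nat => complex" and N
 proof -
  have "(SUM j<=N. F j (j + i)) = (\<Sum>j=0+i..N+i. F (j - i) j)"
   unfolding sum.shift_bounds_cl_nat_ivl atMost_atLeast0 by simp
  also have "... = (SUM j<=N + i. if i <= j then F (j - i) j else 0)"
   by (rule sum.mono_neutral_cong_left) auto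
  finally show ?thesis ..
 qed
 have "sesq A (monom 1 i * f) (monom 1 i * g) = (SUM j<=degree f + i. SUM l<=degree g + i.
   coeff (monom 1 i * f) j * cnj (coeff (monom 1 i * g) l) * A j l)" by (rule sesq_eq[OF d d])
 also have "... = (SUM j<=degree f + i. if i <= j then (SUM l<=degree g + i. if i <= l then coeff f (j - i) * cnj (coeff g (l - i)) * A j l else 0) else 0)"
  by (intro sum.cong refl) (auto simp: coeff_monom_mult intro!: sum.cong sum.neutral)
 also have "... = (SUM j<=degree f. SUM l<=degree g + i. if i <= l then coeff f j * cnj (coeff g (l - i)) * A (j + i) l else 0)"
  by (rule r[where F = "%j' j. SUM l<=degree g + i. if i <= l then coeff f j' * cnj (coeff g (l - i)) * A j l else 0"])
 also have "... = (SUM j<=degree f. SUM l<=degree g. coeff f j * cnj (coeff g l) * A (j + i) (l + i))"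
  by (intro sum.cong refl r[where F = "%l' l. coeff f j * cnj (coeff g l') * A (j + i) l" for j])
 finally show ?thesis unfolding sesq_def .
qed

lemma sesq_polarization:
 "(\<Sum>n<4. \<i> ^ n * sesq A (f + Polynomial.smult (\<i> ^ n) g) (f + Polynomial.smult (\<i> ^ n) g)) / 4 = sesq A f g"
 by (simp add: eval_nat_numeral sesq_add_left sesq_add_right sesq_smult_left sesq_smult_right algebra_simps)

definition gram :: "dirichlet_tuple => nat => nat => complex" where
 "gram mu j l = (\<Sum>i<length (fst mu). of_nat (min j l choose i) * fourier_coeff (fst mu ! i) (int l - int j)) +
   (LINT u|snd mu. newton (length (fst mu)) j l u)"

lemma norm_sq_eq_sesq:
 assumes mu: "mu : dirichlet_tuples m" and m: "0 < m"
 shows "norm_sq mu f = sesq (gram mu) f f"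
proof -
 have len: "length (fst mu) = m" and D: "!!i. i < m ==> fst mu ! i : circle_distributions"
  and M: "snd mu : finite_borel_measures_on (cball 0 1)"
  using mu by (auto simp: dirichlet_tuples_def subset_iff in_set_conv_nth)
 have "norm_sq mu f = (\<Sum>i<m. quad_form (%j l. of_nat (min j l choose i) * fourier_coeff (fst mu ! i) (int l - int j)) f) +
   quad_form (%j l. LINT u|snd mu. newton m j l u) f"
  unfolding norm_sq_def len dirichlet_meas_eq_quad_form[OF M m]
  using dirichlet_dist_eq_quad_form[OF subexponential_fourier_coeff[OF D]] by simp
 also have "... = sesq (gram mu) f f"
  unfolding quad_form_def sesq_def gram_def len distrib_left sum.distrib sum_distrib_left
  by (subst sum.swap) (subst (2) sum.swap, simp)
 finally show ?thesis .
qed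

lemma sesq_form_eq_sesq:
 assumes "mu : dirichlet_tuples m" "0 < m"
 shows "sesq_form mu f g = sesq (gram mu) f g"
 unfolding sesq_form_def norm_sq_eq_sesq[OF assms] by (rule sesq_polarization)

lemma newton_0: "newton 0 j l z = z ^ j * cnj z ^ l"
proof -
 have "newton 0 j l z = (SUM i:{0::nat}. of_nat ((i + 0 - 1) choose i) * (z ^ (j - 0 - i) * cnj z ^ (l - 0 - i)))"
  unfolding newton_def by (rule sum.mono_neutral_right) (auto simp: binomial_eq_0)
 thus ?thesis by simp
qed

lemma newton_boundary: "0 < k ==> j = 0 \<or> l = 0 ==> newton k j l z = 0" by (auto simp: newton_def)

text \<open>Pascal's rule for the coefficients.\<close>

lemma newton_difference:
 "newton (Suc k) (Suc j) (Suc l) z - newton (Suc k) j l z = newton k j l z"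
proof (cases "Suc (min j l) - k")
 case 0
 thus ?thesis by (simp add: newton_def)
next
 case (Suc M)
 hence M: "min j l - k = M" "Suc (min (Suc j) (Suc l)) - Suc k = Suc M" "Suc (min j l) - Suc k = M" by auto
 have e: "j - Suc k - i = j - k - Suc i" for j i :: nat by simp
 have b: "of_nat ((i + Suc k) choose Suc i) - of_nat ((i + k) choose i) = (of_nat ((i + k) choose Suc i) :: complex)" for i by simp
 have "newton (Suc k) (Suc j) (Suc l) z = z ^ (j - k) * cnj z ^ (l - k) +
   (\<Sum>i<M. of_nat ((i + Suc k) choose Suc i) * (z ^ (j - k - Suc i) * cnj z ^ (l - k - Suc i)))"
  unfolding newton_def M by (subst sum.lessThan_Suc_shift) simp
 moreover have "newton (Suc k) j l z = (\<Sum>i<M. of_nat ((i + k) choose i) * (z ^ (j - k - Suc i) * cnj z ^ (l - k - Suc i)))"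
  unfolding newton_def M e by simp
 moreover have "newton k j l z = z ^ (j - k) * cnj z ^ (l - k) +
   (\<Sum>i<M. of_nat ((i + k) choose Suc i) * (z ^ (j - k - Suc i) * cnj z ^ (l - k - Suc i)))"
  unfolding newton_def Suc by (subst sum.lessThan_Suc_shift) simp
 ultimately show ?thesis
  by (simp only: add_diff_eq[symmetric] sum_subtractf[symmetric] left_diff_distrib[symmetric] b)
qed

definition gram_diff :: "dirichlet_tuple => nat => nat => nat => complex" where
 "gram_diff mu s j l = (SUM i:{s..<length (fst mu)}. of_nat (min j l choose (i - s)) * fourier_coeff (fst mu ! i) (int l - int j)) +
   (LINT u|snd mu. newton (length (fst mu) - s) j l u)"

lemma gram_diff_step:
 assumes M: "snd mu : finite_borel_measures_on (cball 0 1)" and s: "s < length (fst mu)"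
 shows "gram_diff mu s (Suc j) (Suc l) - gram_diff mu s j l = gram_diff mu (Suc s) j l"
proof -
 let ?m = "length (fst mu)" and ?c = "%i. fourier_coeff (fst mu ! i) (int l - int j)"
 have ms: "?m - s = Suc (?m - Suc s)" using s by simp
 have "(SUM i:{s..<?m}. of_nat (min (Suc j) (Suc l) choose (i - s)) * fourier_coeff (fst mu ! i) (int (Suc l) - int (Suc j)))
   - (SUM i:{s..<?m}. of_nat (min j l choose (i - s)) * ?c i)
  = (SUM i:{s..<?m}. (of_nat (Suc (min j l) choose (i - s)) - of_nat (min j l choose (i - s))) * ?c i)"
  by (simp add: sum_subtractf left_diff_distrib)
 also have "... = (SUM i:{Suc s..<?m}. of_nat (min j l choose (i - Suc s)) * ?c i)"
 proof (rule sum.mono_neutral_cong_right)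
  show "ALL i:{s..<?m} - {Suc s..<?m}. (of_nat (Suc (min j l) choose (i - s)) - of_nat (min j l choose (i - s))) * ?c i = 0"
  proof
   fix i assume "i : {s..<?m} - {Suc s..<?m}"
   hence "i = s" by auto
   thus "(of_nat (Suc (min j l) choose (i - s)) - of_nat (min j l choose (i - s))) * ?c i = 0" by simp
  qed
  fix i assume "i : {Suc s..<?m}"
  hence "i - s = Suc (i - Suc s)" by auto
  thus "(of_nat (Suc (min j l) choose (i - s)) - of_nat (min j l choose (i - s))) * ?c i = of_nat (min j l choose (i - Suc s)) * ?c i"
   by simp
 qed auto
 finally have 1: "(SUM i:{s..<?m}. of_nat (min (Suc j) (Suc l) choose (i - s)) * fourier_coeff (fst mu ! i) (int (Suc l) - int (Suc j)))
   - (SUM i:{s..<?m}. of_nat (min j l choose (i - s)) * ?c i) = (SUM i:{Suc s..<?m}. of_nat (min j l choose (i - Suc s)) * ?c i)" .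
 have 2: "(LINT u|snd mu. newton (?m - s) (Suc j) (Suc l) u) - (LINT u|snd mu. newton (?m - s) j l u)
   = (LINT u|snd mu. newton (?m - Suc s) j l u)" proof -
  have "(LINT u|snd mu. newton (Suc (?m - Suc s)) (Suc j) (Suc l) u) - (LINT u|snd mu. newton (Suc (?m - Suc s)) j l u)
    = (LINT u|snd mu. newton (Suc (?m - Suc s)) (Suc j) (Suc l) u - newton (Suc (?m - Suc s)) j l u)"
   by (rule Bochner_Integration.integral_diff[symmetric]; rule integrable_newton[OF M])
  thus ?thesis unfolding ms newton_difference .
 qed
 show ?thesis unfolding gram_diff_def 1[symmetric] 2[symmetric] by (simp only: add_diff_add)
qed

lemma bdiff_gram:
 assumes mu: "snd mu : finite_borel_measures_on (cball 0 1)" and s: "s <= length (fst mu)"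
 shows "bdiff s (gram mu) j l = (-1) ^ s * gram_diff mu s j l" using s
proof (induction s arbitrary: j l)
 case 0
 show ?case by (simp add: gram_def gram_diff_def lessThan_atLeast0)
next
 case (Suc s)
 hence IH: "bdiff s (gram mu) j l = (-1) ^ s * gram_diff mu s j l" for j l by simp
 have s: "s < length (fst mu)" using Suc.prems by simp
 show ?case unfolding bdiff.simps IH gram_diff_step[OF mu s, symmetric] by (simp add: right_diff_distrib)
qed

lemma bdiff_gram_boundary:
 assumes mu: "snd mu : finite_borel_measures_on (cball 0 1)" and s: "s < length (fst mu)" and b: "j = 0 \<or> l = 0"
 shows "bdiff s (gram mu) j l = (-1) ^ s * fourier_coeff (fst mu ! s) (int l - int j)"
proof -
 let ?m = "length (fst mu)" and ?c = "%i. fourier_coeff (fst mu ! i) (int l - int j)"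
 have mn: "min j l = 0" using b by auto
 have "(SUM i:{s..<?m}. of_nat (min j l choose (i - s)) * ?c i) = (SUM i:{s}. of_nat (min j l choose (i - s)) * ?c i)"
  by (rule sum.mono_neutral_right) (use s mn in \<open>auto simp: binomial_eq_0\<close>)
 moreover have "newton (?m - s) j l = (%z. 0)"
  using s b newton_boundary[of "?m - s" j l] by (simp add: fun_eq_iff)
 ultimately have "gram_diff mu s j l = ?c s" by (simp add: gram_diff_def)
 thus ?thesis using bdiff_gram[OF mu, of s j l] s by simp
qed

lemma bdiff_gram_top:
 assumes mu: "snd mu : finite_borel_measures_on (cball 0 1)"
 shows "bdiff (length (fst mu)) (gram mu) j l = (-1) ^ length (fst mu) * (LINT z|snd mu. z ^ j * cnj z ^ l)"
 using bdiff_gram[OF mu order_refl, of j l] by (simp add: gram_diff_def newton_0)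

lemma integrable_weighted_monomial:
 assumes "nu : finite_borel_measures_on (cball 0 1)"
 shows "integrable nu (%z. (z ^ j * cnj z ^ l) * complex_of_real ((1 - (cmod z)\<^sup>2) ^ n))"
proof -
 interpret finite_measure nu using assms by (simp add: finite_borel_measures_on_def)
 have [measurable_cong]: "sets nu = sets borel" and A: "AE z in nu. z : cball 0 1"
  using assms by (auto simp: finite_borel_measures_on_def)
 let ?g = "%z. (z ^ j * cnj z ^ l) * complex_of_real ((1 - (cmod z)\<^sup>2) ^ n)"
 show ?thesis proof (rule integrable_const_bound[of _ 1])
  show "AE z in nu. norm (?g z) <= 1" proof (rule AE_mp[OF A AE_I2], rule impI)
   fix z :: complex assume "z : cball 0 1"
   hence z: "cmod z <= 1" by simp
   hence "0 <= 1 - (cmod z)\<^sup>2" "1 - (cmod z)\<^sup>2 <= 1" by (simp_all add: power_le_one)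
   hence p: "\<bar>(1 - (cmod z)\<^sup>2) ^ n\<bar> <= 1" by (simp only: abs_of_nonneg zero_le_power power_le_one)
   hence "norm (?g z) <= (1 * 1) * 1" unfolding norm_mult norm_of_real norm_power complex_mod_cnj
    by (intro mult_mono power_le_one p) (use z in auto)
   thus "norm (?g z) <= 1" by simp
  qed
 qed measurable
qed

lemma bdiff_gram_above:
 assumes mu: "snd mu : finite_borel_measures_on (cball 0 1)"
 shows "bdiff (length (fst mu) + n) (gram mu) j l =
  (-1) ^ length (fst mu) * (LINT z|snd mu. (z ^ j * cnj z ^ l) * of_real ((1 - (cmod z)\<^sup>2) ^ n))"
proof (induction n arbitrary: j l)
 case 0
 show ?case by (simp add: bdiff_gram_top[OF mu])
next
 case (Suc n)
 let ?g = "%j l z. (z ^ j * cnj z ^ l) * complex_of_real ((1 - (cmod z)\<^sup>2) ^ n)"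
 note i = integrable_weighted_monomial[OF mu]
 have "(LINT z|snd mu. ?g j l z) - (LINT z|snd mu. ?g (Suc j) (Suc l) z) = (LINT z|snd mu. ?g j l z - ?g (Suc j) (Suc l) z)"
  by (rule Bochner_Integration.integral_diff[symmetric]; rule i)
 also have "... = (LINT z|snd mu. (z ^ j * cnj z ^ l) * of_real ((1 - (cmod z)\<^sup>2) ^ Suc n))"
 proof (intro Bochner_Integration.integral_cong refl)
  fix z
  have "complex_of_real ((1 - (cmod z)\<^sup>2) ^ Suc n) = (1 - z * cnj z) * of_real ((1 - (cmod z)\<^sup>2) ^ n)"
   by (simp add: complex_norm_square del: of_real_power)
  thus "?g j l z - ?g (Suc j) (Suc l) z = (z ^ j * cnj z ^ l) * of_real ((1 - (cmod z)\<^sup>2) ^ Suc n)"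
   by (simp only: power_Suc[of z] power_Suc[of "cnj z"] left_diff_distrib right_diff_distrib mult_1_left mult_ac)
 qed
 finally show ?case by (simp add: Suc.IH right_diff_distrib[symmetric])
qed

text \<open>Downward induction on the order: a matrix is recovered from its difference along each diagonal,
starting at the boundary.\<close>

lemma bdiff_determines:
 assumes top: "!!j l. bdiff m A j l = bdiff m B j l"
  and bd: "!!s j l. s < m ==> j = 0 \<or> l = 0 ==> bdiff s A j l = bdiff s B j l"
 shows "A = B"
proof -
 have "ALL j l. bdiff (m - i) A j l = bdiff (m - i) B j l" if "i <= m" for i using that
 proof (induction i)
  case 0
  show ?case using top by simp
 next
  case (Suc i)
  define s where "s = m - Suc i"
  have s: "m - i = Suc s" "s < m" using Suc.prems by (auto simp: s_def)
  have st: "bdiff s A j l - bdiff s A (Suc j) (Suc l) = bdiff s B j l - bdiff s B (Suc j) (Suc l)" for j l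
   using Suc s by simp
  have "bdiff s A j l = bdiff s B j l" for j l
  proof (induction j arbitrary: l)
   case 0
   show ?case using bd[OF s(2)] by simp
  next
   case (Suc j)
   show ?case proof (cases l)
    case 0
    thus ?thesis using bd[OF s(2)] by simp
   next
    case (Suc l')
    thus ?thesis using st[of j l'] Suc.IH[of l'] by simp
   qed
  qed
  thus ?case unfolding s_def by simp
 qed
 from this[of m] show ?thesis by (simp add: fun_eq_iff)
qed

lemma bdiff_eq_sum: "bdiff n A j l = (SUM i<=n. ((-1) ^ i * of_nat (n choose i)) * A (j + i) (l + i))"
proof (induction n arbitrary: j l)
 case 0
 show ?case by simp
next
 case (Suc n)
 have "(SUM i<=Suc n. ((-1) ^ i * of_nat (Suc n choose i)) * A (j + i) (l + i))
   = A j l + (SUM i<=n. ((-1) ^ Suc i * of_nat (Suc n choose Suc i)) * A (j + Suc i) (l + Suc i))"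
  by (subst sum.atMost_Suc_shift) simp
 also have "... = A j l + ((SUM i<=n. ((-1) ^ Suc i * of_nat (n choose Suc i)) * A (j + Suc i) (l + Suc i))
   - (SUM i<=n. ((-1) ^ i * of_nat (n choose i)) * A (Suc j + i) (Suc l + i)))"
  unfolding sum_subtractf[symmetric]
  by (intro arg_cong2[of _ _ _ _ "(+)"] refl sum.cong) (simp add: algebra_simps)
 also have "A j l + ((SUM i<=n. ((-1) ^ Suc i * of_nat (n choose Suc i)) * A (j + Suc i) (l + Suc i))
   - (SUM i<=n. ((-1) ^ i * of_nat (n choose i)) * A (Suc j + i) (Suc l + i)))
   = (SUM i<=Suc n. ((-1) ^ i * of_nat (n choose i)) * A (j + i) (l + i))
   - (SUM i<=n. ((-1) ^ i * of_nat (n choose i)) * A (Suc j + i) (Suc l + i))"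
  by (simp only: sum.atMost_Suc_shift[of "%i. ((-1) ^ i * of_nat (n choose i)) * A (j + i) (l + i)" n]) simp
 also have "... = bdiff (Suc n) A j l" unfolding bdiff.simps Suc.IH by (simp add: binomial_eq_0)
 finally show ?case ..
qed

section \<open>Hilbert spaces\<close>

lemma null_comparison:
 assumes "!!n. norm (f n) <= g n" "g ----> (0::real)"
 shows "f ----> 0"
 by (rule Lim_null_comparison[OF always_eventually assms(2)]) (use assms(1) in blast)

lemma quadratic_nonneg_imp_bound:
 fixes a b c :: real
 assumes "0 <= a" "0 <= c" "!!t. 0 <= a + 2 * t * b + t\<^sup>2 * c"
 shows "b <= sqrt a * sqrt c"
proof (rule ccontr)
 assume "~ b <= sqrt a * sqrt c"
 hence b: "sqrt a * sqrt c < b" by simp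
 have b0: "0 < b" using b assms(1,2) by (smt (verit) mult_nonneg_nonneg real_sqrt_ge_zero)
 show False
 proof (cases "c = 0")
  case True
  have "0 <= a + 2 * (- (a + 1) / (2 * b)) * b" using assms(3)[of "- (a + 1) / (2 * b)"] True by simp
  moreover have "2 * (- (a + 1) / (2 * b)) * b = - (a + 1)" using b0 by (simp add: field_simps)
  ultimately show False by simp
 next
  case False
  hence c: "0 < c" using assms(2) by simp
  have "0 <= a + 2 * (- b / c) * b + (- b / c)^2 * c" by (rule assms(3))
  also have "... = a - b\<^sup>2 / c" using c by (simp add: field_simps power2_eq_square)
  finally have "b\<^sup>2 <= a * c" using c by (simp add: field_simps)
  hence "b <= sqrt (a * c)" by (rule real_le_rsqrt)
  thus False using b by (simp add: real_sqrt_mult)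
 qed
qed

lemma unimodular_rotation: "EX c. cmod c = 1 & c * b = of_real (cmod b)"
proof (cases "b = 0")
 case False
 thus ?thesis
  by (intro exI[of _ "cnj b / cmod b"]) (simp add: norm_divide complex_norm_square[symmetric] power2_eq_square mult.commute)
qed (auto intro: exI[of _ 1])

lemma sesq_bdiff:
 "(SUM j<=n. ((-1) ^ j * of_nat (n choose j)) * sesq A (monom 1 j * f) (monom 1 j * f)) = sesq (bdiff n A) f f"
proof -
 have "sesq (bdiff n A) f f = (SUM k<=degree f. SUM l<=degree f. SUM j<=n. ((-1) ^ j * of_nat (n choose j)) * (coeff f k * cnj (coeff f l) * A (k + j) (l + j)))"
  unfolding sesq_def bdiff_eq_sum sum_distrib_left by (intro sum.cong refl) (simp only: mult_ac)
 also have "... = (SUM k<=degree f. SUM j<=n. SUM l<=degree f. ((-1) ^ j * of_nat (n choose j)) * (coeff f k * cnj (coeff f l) * A (k + j) (l + j)))"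
  by (intro sum.cong refl sum.swap)
 also have "... = (SUM j<=n. SUM k<=degree f. SUM l<=degree f. ((-1) ^ j * of_nat (n choose j)) * (coeff f k * cnj (coeff f l) * A (k + j) (l + j)))"
  by (rule sum.swap)
 finally show ?thesis unfolding sesq_shift by (simp only: sesq_def sum_distrib_left)
qed

context complex_inner_product_space
begin

lemma smult_carrier [simp, intro]: "x : carrier H ==> c \<odot> x : carrier H" by (rule smult_in)

lemma ip_zero [simp]: "y : carrier H ==> ip H \<zero> y = 0" "y : carrier H ==> ip H y \<zero> = 0"
proof -
 show z: "ip H \<zero> y = 0" if "y : carrier H" for y
  using ip_add_left[of "\<zero>" "\<zero>" y] that by simp
 show "ip H y \<zero> = 0" if "y : carrier H" using ip_cnj[of "\<zero>" y] z[OF that] that by simp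
qed

lemma minus_eq_smult: "x : carrier H ==> y : carrier H ==> x \<ominus> y = x \<oplus> (-1) \<odot> y"
 by (simp add: M.minus_eq a_inv_eq_smult)

lemma ip_minus_left: "x : carrier H ==> y : carrier H ==> w : carrier H ==> ip H (x \<ominus> y) w = ip H x w - ip H y w"
 by (simp add: minus_eq_smult ip_add_left ip_smult_left)

lemma ip_minus_right: "x : carrier H ==> y : carrier H ==> w : carrier H ==> ip H w (x \<ominus> y) = ip H w x - ip H w y"
 by (simp add: minus_eq_smult ip_add_right ip_smult_right)

lemma ip_self: "x : carrier H ==> ip H x x = of_real ((hnorm H x)^2)"
 using ip_nonneg[of x] by (simp add: hnorm_def complex_eq_iff less_eq_complex_def)

lemma eq_of_minus_zero: "x : carrier H ==> y : carrier H ==> x \<ominus> y = \<zero> ==> x = y"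
 by (metis M.minus_eq M.minus_equality M.minus_minus M.a_inv_closed M.a_comm)

lemma ip_ext:
 assumes "x : carrier H" "y : carrier H" "!!w. w : carrier H ==> ip H x w = ip H y w"
 shows "x = y"
proof -
 have "ip H (x \<ominus> y) (x \<ominus> y) = 0" using assms by (simp add: ip_minus_left)
 hence "x \<ominus> y = \<zero>" using assms by (intro ip_eq_0) auto
 thus ?thesis using assms eq_of_minus_zero by blast
qed

lemma ip_ext_right:
 assumes "x : carrier H" "y : carrier H" "!!w. w : carrier H ==> ip H w x = ip H w y"
 shows "x = y" by (rule ip_ext[OF assms(1,2)]) (use assms ip_cnj in metis)

lemma ip_finsum_left:
 assumes "finite I" "!!i. i : I ==> f i : carrier H" "y : carrier H"
 shows "ip H (\<Oplus>i\<in>I. f i) y = (SUM i:I. ip H (f i) y)" using assms(1,2)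
proof (induction I)
 case empty
 show ?case using assms(3) by simp
next
 case (insert i I)
 hence "f : I \<rightarrow> carrier H" "f i : carrier H" by auto
 thus ?case using insert assms(3) by (simp add: M.finsum_insert ip_add_left M.finsum_closed)
qed

lemma hnorm_smult: "x : carrier H ==> hnorm H (c \<odot> x) = cmod c * hnorm H x"
proof -
 assume x: "x : carrier H"
 have "ip H (c \<odot> x) (c \<odot> x) = of_real ((cmod c * hnorm H x)^2)" proof -
  have "ip H (c \<odot> x) (c \<odot> x) = (c * cnj c) * ip H x x"
   using x by (simp add: ip_smult_left ip_smult_right)
  thus ?thesis unfolding ip_self[OF x] complex_norm_square[symmetric] power_mult_distrib of_real_mult .
 qed
 thus ?thesis unfolding hnorm_def[of H "c \<odot> x"] using hnorm_nonneg[OF x] by (simp add: real_sqrt_abs abs_mult)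
qed

lemma cmod_ip_le:
 assumes x: "x : carrier H" and y: "y : carrier H"
 shows "cmod (ip H x y) <= hnorm H x * hnorm H y"
proof -
 obtain c where c: "cmod c = 1" "c * ip H x y = of_real (cmod (ip H x y))" using unimodular_rotation by blast
 hence "cmod (ip H x y) = Re (ip H (c \<odot> x) y)" using x y by (simp add: ip_smult_left)
 also have "... <= hnorm H (c \<odot> x) * hnorm H y" using x y by (intro Re_ip_le) auto
 finally show ?thesis using x c by (simp add: hnorm_smult)
qed

lemma hnorm_zero [simp]: "hnorm H \<zero> = 0" by (simp add: hnorm_def)

lemma hnorm_eq_0: "x : carrier H ==> hnorm H x = 0 ==> x = \<zero>" using ip_self ip_eq_0 by simp

lemma hnorm_minus_commute: "x : carrier H ==> y : carrier H ==> hnorm H (x \<ominus> y) = hnorm H (y \<ominus> x)"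
 using Metric_space.commute[OF Metric_space_hdist, of x y] by (simp add: hdist_def)

lemma hnorm_minus_triangle:
 "x : carrier H ==> y : carrier H ==> w : carrier H ==> hnorm H (x \<ominus> w) <= hnorm H (x \<ominus> y) + hnorm H (y \<ominus> w)"
 using Metric_space.triangle[OF Metric_space_hdist, of x y w] by (simp add: hdist_def)

text \<open>Convergence in norm, phrased without the topology of the metric space.\<close>

definition hlim :: "(nat => 'a) => 'a => bool" where
 "hlim s x \<longleftrightarrow> (ALL n. s n : carrier H) & x : carrier H & (%n. hnorm H (s n \<ominus> x)) ----> 0"

lemma hlim_unique:
 assumes "hlim s x" "hlim s y" shows "x = y"
proof -
 have c: "!!n. s n : carrier H" "x : carrier H" "y : carrier H"
  and l: "(%n. hnorm H (s n \<ominus> x)) ----> 0" "(%n. hnorm H (s n \<ominus> y)) ----> 0"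
  using assms by (auto simp: hlim_def)
 have "hnorm H (x \<ominus> y) <= hnorm H (s n \<ominus> x) + hnorm H (s n \<ominus> y)" for n
  using hnorm_minus_triangle[OF c(2) c(1) c(3), of n] hnorm_minus_commute[OF c(2) c(1), of n] by simp
 moreover have "(%n. hnorm H (s n \<ominus> x) + hnorm H (s n \<ominus> y)) ----> 0 + 0" by (intro tendsto_add l)
 ultimately have "hnorm H (x \<ominus> y) <= 0 + 0" by (intro LIMSEQ_le_const) auto
 hence "hnorm H (x \<ominus> y) = 0" using hnorm_nonneg[of "x \<ominus> y"] c by simp
 hence "x \<ominus> y = \<zero>" by (rule hnorm_eq_0[rotated]) (use c in simp)
 thus ?thesis by (rule eq_of_minus_zero[OF c(2,3)])
qed

lemma hlim_ip:
 assumes "hlim s x" "hlim t y"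
 shows "(%n. ip H (s n) (t n)) ----> ip H x y"
proof -
 have c: "!!n. s n : carrier H" "!!n. t n : carrier H" "x : carrier H" "y : carrier H"
  and l: "(%n. hnorm H (s n \<ominus> x)) ----> 0" "(%n. hnorm H (t n \<ominus> y)) ----> 0"
  using assms by (auto simp: hlim_def)
 let ?b = "%n. hnorm H (s n \<ominus> x) * hnorm H (t n \<ominus> y) + hnorm H (s n \<ominus> x) * hnorm H y + hnorm H x * hnorm H (t n \<ominus> y)"
 have "norm (ip H (s n) (t n) - ip H x y) <= ?b n" for n
 proof -
  have "ip H (s n) (t n) - ip H x y = ip H (s n \<ominus> x) (t n \<ominus> y) + ip H (s n \<ominus> x) y + ip H x (t n \<ominus> y)"
   using c by (simp add: ip_minus_left ip_minus_right)
  also have "norm ... <= norm (ip H (s n \<ominus> x) (t n \<ominus> y)) + norm (ip H (s n \<ominus> x) y) + norm (ip H x (t n \<ominus> y))"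
   by (intro norm_triangle_mono norm_triangle_ineq order_refl)
  also have "... <= ?b n" using c by (intro add_mono cmod_ip_le) auto
  finally show ?thesis .
 qed
 moreover have "?b ----> 0 * 0 + 0 * hnorm H y + hnorm H x * 0" by (intro tendsto_intros l)
 hence "?b ----> 0" by simp
 ultimately have "(%n. ip H (s n) (t n) - ip H x y) ----> 0"
  by (rule null_comparison)
 thus ?thesis by (simp add: LIM_zero_iff)
qed

lemma hlim_add:
 assumes "hlim s x" "hlim t y" shows "hlim (%n. s n \<oplus> t n) (x \<oplus> y)"
proof -
 have c: "!!n. s n : carrier H" "!!n. t n : carrier H" "x : carrier H" "y : carrier H"
  and l: "(%n. hnorm H (s n \<ominus> x)) ----> 0" "(%n. hnorm H (t n \<ominus> y)) ----> 0"
  using assms by (auto simp: hlim_def)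
 have "(s n \<oplus> t n) \<ominus> (x \<oplus> y) = (s n \<ominus> x) \<oplus> (t n \<ominus> y)" for n
  by (rule ip_ext) (use c in \<open>simp_all add: ip_minus_left ip_add_left\<close>)
 hence "norm (hnorm H ((s n \<oplus> t n) \<ominus> (x \<oplus> y))) <= hnorm H (s n \<ominus> x) + hnorm H (t n \<ominus> y)" for n
  using hnorm_triangle[of "s n \<ominus> x" "t n \<ominus> y"] hnorm_nonneg[of "(s n \<ominus> x) \<oplus> (t n \<ominus> y)"] c by simp
 hence "(%n. hnorm H ((s n \<oplus> t n) \<ominus> (x \<oplus> y))) ----> 0"
  by (rule null_comparison) (use tendsto_add[OF l] in simp)
 thus ?thesis using c by (simp add: hlim_def)
qed

lemma hlim_smult:
 assumes "hlim s x" shows "hlim (%n. c \<odot> s n) (c \<odot> x)"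
proof -
 have c: "!!n. s n : carrier H" "x : carrier H" and l: "(%n. hnorm H (s n \<ominus> x)) ----> 0"
  using assms by (auto simp: hlim_def)
 have "c \<odot> s n \<ominus> c \<odot> x = c \<odot> (s n \<ominus> x)" for n
  by (rule ip_ext) (use c in \<open>simp_all add: ip_minus_left ip_smult_left right_diff_distrib\<close>)
 hence "hnorm H (c \<odot> s n \<ominus> c \<odot> x) = cmod c * hnorm H (s n \<ominus> x)" for n
  using hnorm_smult[of "s n \<ominus> x" c] c by simp
 thus ?thesis using c tendsto_mult_right_zero[OF l, of "cmod c"] by (simp add: hlim_def)
qed

lemma hlim_const: "x : carrier H ==> hlim (%n. x) x" by (simp add: hlim_def M.minus_eq M.r_neg)

lemma hlim_bounded_map:
 assumes T: "linear_map H H T" and b: "!!x. x : carrier H ==> hnorm H (T x) <= C * hnorm H x" and s: "hlim s x"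
 shows "hlim (%n. T (s n)) (T x)"
proof -
 have c: "!!n. s n : carrier H" "x : carrier H" and l: "(%n. hnorm H (s n \<ominus> x)) ----> 0"
  using s by (auto simp: hlim_def)
 have Tc: "T v : carrier H" if "v : carrier H" for v using T that by (auto simp: linear_map_def)
 have "T (s n) \<ominus> T x = T (s n \<ominus> x)" for n
  using T c Tc by (simp add: minus_eq_smult linear_map_def)
 hence "hnorm H (T (s n) \<ominus> T x) <= C * hnorm H (s n \<ominus> x)" for n using b[of "s n \<ominus> x"] c by simp
 hence "norm (hnorm H (T (s n) \<ominus> T x)) <= C * hnorm H (s n \<ominus> x)" for n
  using hnorm_nonneg[of "T (s n) \<ominus> T x"] c Tc by simp
 hence "(%n. hnorm H (T (s n) \<ominus> T x)) ----> 0"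
  by (rule null_comparison) (rule tendsto_mult_right_zero[OF l])
 thus ?thesis using c Tc by (simp add: hlim_def)
qed

end

lemma (in complex_hilbert_space) hlim_of_Cauchy:
 assumes s: "!!n. s n : carrier H" and C: "!!e. 0 < e ==> EX N. ALL i>=N. ALL j>=N. hnorm H (s i \<ominus> s j) < e"
 shows "EX x. hlim s x"
proof -
 interpret MS: Metric_space "carrier H" "hdist H" by (rule Metric_space_hdist)
 have "MS.MCauchy s" unfolding MS.MCauchy_def
 proof (intro conjI allI impI)
  show "range s \<subseteq> carrier H" using s by auto
  fix e :: real assume "0 < e"
  then obtain N where "ALL i>=N. ALL j>=N. hnorm H (s i \<ominus> s j) < e" using C by blast
  thus "EX N. ALL n n'. N <= n --> N <= n' --> hdist H (s n) (s n') < e"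
   using s by (auto simp: hdist_def)
 qed
 then obtain x where "limitin MS.mtopology s x sequentially"
  using complete unfolding MS.mcomplete_def by blast
 hence lim: "x : carrier H & (ALL e>0. EX N. ALL n>=N. s n : carrier H & hdist H (s n) x < e)"
  unfolding MS.limit_metric_sequentially .
 hence x: "x : carrier H" ..
 have l: "EX N. ALL n>=N. hdist H (s n) x < e" if "0 < e" for e
  using lim[THEN conjunct2, rule_format, OF that] by blast
 have "(%n. hnorm H (s n \<ominus> x)) ----> 0" proof (rule LIMSEQ_I)
  fix e :: real assume "0 < e"
  from l[OF this] obtain N where N: "ALL n>=N. hdist H (s n) x < e" by blast
  have "norm (hnorm H (s n \<ominus> x) - 0) < e" if "N <= n" for n
   using N[rule_format, OF that] s[of n] x hnorm_nonneg[of "s n \<ominus> x"] by (simp add: hdist_def)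
  thus "EX N. ALL n>=N. norm (hnorm H (s n \<ominus> x) - 0) < e" by blast
 qed
 thus ?thesis using s x by (auto simp: hlim_def)
qed

text \<open>The functional \<open>|x|^2 - 2 Re (phi x)\<close> is bounded below, and by the parallelogram law
its minimizing sequences are Cauchy. The minimizer represents \<open>phi\<close>.\<close>

theorem (in complex_hilbert_space) riesz_representation:
 assumes add: "!!x y. x : carrier H ==> y : carrier H ==> phi (x \<oplus> y) = phi x + (phi y :: complex)"
  and scale: "!!c x. x : carrier H ==> phi (c \<odot> x) = c * phi x"
  and bound: "!!x. x : carrier H ==> cmod (phi x) <= C * hnorm H x"
 shows "EX z:carrier H. ALL x:carrier H. phi x = ip H x z"
proof -
 define J where "J x = Re (ip H x x) - 2 * Re (phi x)" for x
 have J_ge: "- (C\<^sup>2) <= J x" if x: "x : carrier H" for x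
 proof -
  have "Re (phi x) <= C * hnorm H x" using bound[OF x] complex_Re_le_cmod order_trans by blast
  moreover have "0 <= (hnorm H x - C)^2" by simp
  ultimately show ?thesis unfolding J_def ip_self[OF x] by (simp add: power2_diff mult.commute)
 qed
 have bdd: "bdd_below (J ` carrier H)" by (rule bdd_belowI2[OF J_ge])
 define d where "d = (INF x\<in>carrier H. J x)"
 have d_le: "d <= J x" if "x : carrier H" for x unfolding d_def by (rule cINF_lower[OF bdd that])
 have ne: "carrier H ~= {}" by (auto intro: M.zero_closed)
 have "EX x:carrier H. J x < d + inverse (real (Suc n))" for n
 proof -
  have "d < d + inverse (real (Suc n))" by simp
  thus ?thesis unfolding d_def by (subst (asm) cINF_less_iff[OF ne bdd]) (simp add: d_def)
 qed
 then obtain s where s: "!!n. s n : carrier H" "!!n. J (s n) < d + inverse (real (Suc n))" by metis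
 have par: "(hnorm H (x \<ominus> y))\<^sup>2 <= 2 * J x + 2 * J y - 4 * d" if x: "x : carrier H" and y: "y : carrier H" for x y
 proof -
  let ?w = "(1/2) \<odot> (x \<oplus> y)"
  have w: "?w : carrier H" using x y by simp
  have "4 * J ?w = 2 * J x + 2 * J y - (hnorm H (x \<ominus> y))\<^sup>2" proof -
   have 1: "(hnorm H (x \<ominus> y))\<^sup>2 = Re (ip H x x) - Re (ip H x y) - Re (ip H y x) + Re (ip H y y)"
    using arg_cong[OF ip_self[of "x \<ominus> y"], of Re] x y by (simp add: ip_minus_left ip_minus_right)
   have 2: "Re (ip H ?w ?w) = (Re (ip H x x) + Re (ip H x y) + Re (ip H y x) + Re (ip H y y)) / 4"
   proof -
    have "ip H (c \<odot> (x \<oplus> y)) (c \<odot> (x \<oplus> y)) = (c * cnj c) * (ip H x x + ip H x y + ip H y x + ip H y y)" for c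
     using x y by (simp add: ip_smult_left ip_smult_right ip_add_left ip_add_right algebra_simps)
    hence "Re (ip H ?w ?w) = Re ((1/2 * cnj (1/2)) * (ip H x x + ip H x y + ip H y x + ip H y y))" by (simp only:)
    thus ?thesis by simp
   qed
   have 3: "Re (phi ?w) = (Re (phi x) + Re (phi y)) / 2" using x y by (simp add: add scale)
   show ?thesis unfolding J_def 1 2 3 by (simp add: field_simps)
  qed
  thus ?thesis using d_le[OF w] by linarith
 qed
 have cau: "EX N. ALL i>=N. ALL j>=N. hnorm H (s i \<ominus> s j) < e" if e: "0 < e" for e
 proof -
  obtain N where N: "inverse (real (Suc N)) < e\<^sup>2 / 4" using reals_Archimedean[of "e\<^sup>2 / 4"] e by auto
  have "hnorm H (s i \<ominus> s j) < e" if "N <= i" "N <= j" for i j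
  proof -
   have "inverse (real (Suc i)) <= inverse (real (Suc N))" "inverse (real (Suc j)) <= inverse (real (Suc N))"
    using that by (auto intro!: le_imp_inverse_le)
   hence "(hnorm H (s i \<ominus> s j))\<^sup>2 < e\<^sup>2"
    using par[OF s(1) s(1), of i j] s(2)[of i] s(2)[of j] N by linarith
   thus ?thesis using e power2_less_imp_less by (metis less_eq_real_def)
  qed
  thus ?thesis by blast
 qed
 obtain z where z: "hlim s z" using hlim_of_Cauchy[OF s(1) cau] ..
 hence zc: "z : carrier H" by (simp add: hlim_def)
 have phi_lim: "(%n. phi (s n)) ----> phi z" proof -
  have "phi (s n) - phi z = phi (s n \<ominus> z)" for n
   using s(1)[of n] zc by (simp add: minus_eq_smult add scale)
  hence "norm (phi (s n) - phi z) <= C * hnorm H (s n \<ominus> z)" for n using bound[of "s n \<ominus> z"] s(1)[of n] zc by simp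
  moreover have "(%n. C * hnorm H (s n \<ominus> z)) ----> 0"
   using z unfolding hlim_def by (intro tendsto_mult_right_zero) simp
  ultimately have "(%n. phi (s n) - phi z) ----> 0" by (rule null_comparison)
  thus ?thesis by (simp add: LIM_zero_iff)
 qed
 have "(%n. J (s n)) ----> J z"
  unfolding J_def by (intro tendsto_intros hlim_ip[OF z z] phi_lim)
 moreover have "(%n. d + inverse (real (Suc n))) ----> d + 0"
  by (intro tendsto_intros LIMSEQ_inverse_real_of_nat)
 ultimately have "J z <= d + 0" by (rule LIMSEQ_le) (intro exI allI impI less_imp_le s(2))
 hence Jz: "J z <= d" by simp
 have re: "Re (ip H x z) = Re (phi x)" if x: "x : carrier H" for x
 proof -
  define b where "b = Re (ip H x z) - Re (phi x)"
  have q: "0 <= 0 + 2 * t * b + t\<^sup>2 * Re (ip H x x)" for t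
  proof -
   have "J z <= J (z \<oplus> of_real t \<odot> x)" using Jz d_le[of "z \<oplus> of_real t \<odot> x"] zc x by simp
   also have "... = J z + 2 * t * b + t\<^sup>2 * Re (ip H x x)"
    unfolding J_def b_def norm_sq_add[OF zc x] using ip_cnj[OF x zc] zc x
    by (simp add: add scale power2_eq_square algebra_simps)
   finally show ?thesis by simp
  qed
  have xx: "0 <= Re (ip H x x)" using ip_nonneg[OF x] by (simp add: less_eq_complex_def)
  have "b <= sqrt 0 * sqrt (Re (ip H x x))" by (rule quadratic_nonneg_imp_bound[OF order_refl xx q])
  moreover have "- b <= sqrt 0 * sqrt (Re (ip H x x))"
  proof (rule quadratic_nonneg_imp_bound[OF order_refl xx])
   show "0 <= 0 + 2 * t * - b + t\<^sup>2 * Re (ip H x x)" for t using q[of "- t"] by simp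
  qed
  ultimately show ?thesis by (simp add: b_def)
 qed
 have "phi x = ip H x z" if x: "x : carrier H" for x
 proof (rule complex_eqI)
  show "Re (phi x) = Re (ip H x z)" using re[OF x] by simp
  have "Re (ip H ((- \<i>) \<odot> x) z) = Re (phi ((- \<i>) \<odot> x))" using x by (intro re) simp
  thus "Im (phi x) = Im (ip H x z)" using x zc by (simp add: ip_smult_left scale)
 qed
 thus ?thesis using zc by blast
qed

locale bounded_operator_on = complex_hilbert_space +
 fixes T
 assumes T_bounded: "T : bounded_operators H"
begin

lemma T_linear: "linear_map H H T" and T_bound: "EX C>=0. ALL x:carrier H. hnorm H (T x) <= C * hnorm H x"
proof -
 show "linear_map H H T" using T_bounded by (simp add: bounded_operators_def)
 obtain C where C: "ALL x:carrier H. hnorm H (T x) <= C * hnorm H x" using T_bounded by (auto simp: bounded_operators_def)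
 have "hnorm H (T x) <= \<bar>C\<bar> * hnorm H x" if "x : carrier H" for x
 proof -
  have "C * hnorm H x <= \<bar>C\<bar> * hnorm H x" using hnorm_nonneg[OF that] by (intro mult_right_mono) auto
  thus ?thesis using C that by force
 qed
 thus "EX C>=0. ALL x:carrier H. hnorm H (T x) <= C * hnorm H x" by (intro exI[of _ "\<bar>C\<bar>"]) auto
qed

lemma T_closed [simp, intro]: "x : carrier H ==> T x : carrier H"
 and T_add: "x : carrier H ==> y : carrier H ==> T (x \<oplus> y) = T x \<oplus> T y"
 and T_smult: "x : carrier H ==> T (c \<odot> x) = c \<odot> T x"
 using T_linear by (auto simp: linear_map_def)

lemma T_pow_closed [simp, intro]: "x : carrier H ==> (T ^^ j) x : carrier H" by (induction j) auto

lemma adjoint_op_props: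
 assumes y: "y : carrier H"
 shows "adjoint_op H T y : carrier H" "x : carrier H ==> ip H (T x) y = ip H x (adjoint_op H T y)"
proof -
 obtain C where C: "0 <= C" "ALL x:carrier H. hnorm H (T x) <= C * hnorm H x" using T_bound by blast
 have "EX z:carrier H. ALL x:carrier H. ip H (T x) y = ip H x z" proof (rule riesz_representation)
  fix x assume x: "x : carrier H"
  have "cmod (ip H (T x) y) <= hnorm H (T x) * hnorm H y" using x y by (intro cmod_ip_le) auto
  also have "... <= (C * hnorm H x) * hnorm H y" using C(2) x hnorm_nonneg[OF y] by (intro mult_right_mono) auto
  finally show "cmod (ip H (T x) y) <= (C * hnorm H y) * hnorm H x" by (simp add: mult_ac)
 qed (use y in \<open>auto simp: T_add T_smult ip_add_left ip_smult_left\<close>)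
 then obtain z where z: "z : carrier H & (ALL x:carrier H. ip H (T x) y = ip H x z)" by blast
 have "adjoint_op H T y = z" unfolding adjoint_op_def
 proof (rule the_equality, rule z)
  fix z' assume z': "z' : carrier H & (ALL x:carrier H. ip H (T x) y = ip H x z')"
  show "z' = z" proof (rule ip_ext_right)
   fix w assume "w : carrier H"
   thus "ip H w z' = ip H w z"
    using z[THEN conjunct2, THEN bspec, of w] z'[THEN conjunct2, THEN bspec, of w] by simp
  qed (use z z' in blast)+
 qed
 thus "adjoint_op H T y : carrier H" "x : carrier H ==> ip H (T x) y = ip H x (adjoint_op H T y)"
  using z by auto
qed

lemma adjoint_pow_closed: "y : carrier H ==> (adjoint_op H T ^^ j) y : carrier H"
 by (induction j) (auto intro: adjoint_op_props)

lemma ip_adjoint_pow: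
 assumes "x : carrier H" "y : carrier H"
 shows "ip H ((adjoint_op H T ^^ j) y) x = ip H y ((T ^^ j) x)" using assms
proof (induction j arbitrary: x)
 case 0
 show ?case by simp
next
 case (Suc j)
 let ?w = "(adjoint_op H T ^^ j) y"
 have w: "?w : carrier H" by (rule adjoint_pow_closed) fact
 have "ip H (adjoint_op H T ?w) x = cnj (ip H x (adjoint_op H T ?w))"
  by (rule ip_cnj) (use Suc.prems w adjoint_op_props in auto)
 also have "... = cnj (ip H (T x) ?w)" using adjoint_op_props(2)[OF w Suc.prems(1)] by simp
 also have "... = ip H ?w (T x)" using ip_cnj[of "T x" ?w] Suc.prems w by simp
 also have "... = ip H y ((T ^^ j) (T x))" using Suc by simp
 finally show ?case by (simp add: funpow_swap1)
qed

lemma ip_beta_op: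
 assumes "x : carrier H" "y : carrier H"
 shows "ip H (beta_op H n T x) y = (SUM j<=n. ((-1) ^ (n - j) * of_nat (n choose j)) * ip H ((T ^^ j) x) ((T ^^ j) y))"
 unfolding beta_op_def
 by (subst ip_finsum_left) (use assms in \<open>auto simp: ip_smult_left ip_adjoint_pow adjoint_pow_closed intro!: sum.cong\<close>)

lemma ip_B_op:
 assumes "x : carrier H" "y : carrier H"
 shows "ip H (B_op H n T x) y = (SUM j<=n. ((-1) ^ j * of_nat (n choose j)) * ip H ((T ^^ j) x) ((T ^^ j) y))"
 unfolding B_op_def
 by (subst ip_finsum_left) (use assms in \<open>auto simp: ip_smult_left ip_adjoint_pow adjoint_pow_closed intro!: sum.cong\<close>)

lemma B_op_closed: "x : carrier H ==> B_op H n T x : carrier H"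
 unfolding B_op_def by (intro M.finsum_closed) (auto intro: adjoint_pow_closed)

lemma beta_op_closed: "x : carrier H ==> beta_op H n T x : carrier H"
 unfolding beta_op_def by (intro M.finsum_closed) (auto intro: adjoint_pow_closed)

lemma positive_defect_iff:
 "positive_op H (%x. (-1) ^ m \<odot> B_op H n T x) \<longleftrightarrow>
  (ALL x:carrier H. 0 <= (-1) ^ m * (SUM j<=n. ((-1) ^ j * of_nat (n choose j)) * ip H ((T ^^ j) x) ((T ^^ j) x)))"
 unfolding positive_op_def by (intro ball_cong refl) (simp add: ip_smult_left B_op_closed ip_B_op)

lemma poly_op_closed: "x : carrier H ==> poly_op H p T x : carrier H"
 unfolding poly_op_def by (intro M.finsum_closed) auto

lemma ip_poly_op:
 assumes "x : carrier H" "w : carrier H"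
 shows "ip H (poly_op H p T x) w = sesq (%j l. ip H ((T ^^ j) x) w) p 1" unfolding poly_op_def sesq_def
 by (subst ip_finsum_left) (use assms in \<open>auto simp: ip_smult_left\<close>)

lemma ip_poly_op_poly_op:
 assumes x: "x : carrier H"
 shows "ip H (poly_op H p T x) (poly_op H q T x) = sesq (%j l. ip H ((T ^^ j) x) ((T ^^ l) x)) p q"
proof -
 have *: "ip H ((T ^^ j) x) (poly_op H q T x) = (SUM l<=degree q. cnj (coeff q l) * ip H ((T ^^ j) x) ((T ^^ l) x))" for j
 proof -
  have "ip H ((T ^^ j) x) (poly_op H q T x) = cnj (ip H (poly_op H q T x) ((T ^^ j) x))"
   by (rule ip_cnj) (use x poly_op_closed in auto)
  also have "... = (SUM l<=degree q. cnj (coeff q l) * cnj (ip H ((T ^^ l) x) ((T ^^ j) x)))"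
   using x by (subst ip_poly_op) (auto simp: sesq_def)
  also have "... = (SUM l<=degree q. cnj (coeff q l) * ip H ((T ^^ j) x) ((T ^^ l) x))"
   by (intro sum.cong refl arg_cong2[of _ _ _ _ "(*)"] ip_cnj[symmetric]) (use x in auto)
  finally show ?thesis .
 qed
 show ?thesis
  by (subst ip_poly_op[OF x poly_op_closed[OF x]]) (simp add: sesq_def * sum_distrib_left mult.assoc)
qed

lemma poly_op_add: "x : carrier H ==> poly_op H (p + q) T x = poly_op H p T x \<oplus> poly_op H q T x"
 by (rule ip_ext) (simp_all add: poly_op_closed ip_add_left ip_poly_op sesq_add_left)

lemma poly_op_smult: "x : carrier H ==> poly_op H (Polynomial.smult c p) T x = c \<odot> poly_op H p T x"
 by (rule ip_ext) (simp_all add: poly_op_closed ip_smult_left ip_poly_op sesq_smult_left)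

lemma poly_op_diff: "x : carrier H ==> poly_op H (p - q) T x = poly_op H p T x \<ominus> poly_op H q T x"
 using poly_op_add[of x p "Polynomial.smult (-1) q"] poly_op_smult[of x "-1" q]
 by (simp add: minus_eq_smult poly_op_closed)

lemma poly_op_one: "x : carrier H ==> poly_op H 1 T x = x"
 by (rule ip_ext) (simp_all add: poly_op_closed ip_poly_op sesq_def)

lemma poly_op_shift:
 assumes x: "x : carrier H" shows "poly_op H ([:0, 1:] * p) T x = T (poly_op H p T x)"
proof (rule ip_ext)
 fix w assume w: "w : carrier H"
 have "ip H (T (poly_op H p T x)) w = ip H (poly_op H p T x) (adjoint_op H T w)"
  by (rule adjoint_op_props(2)[OF w poly_op_closed[OF x]])
 also have "... = (SUM j<=degree p. coeff p j * ip H ((T ^^ j) x) (adjoint_op H T w))"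
  using ip_poly_op[OF x adjoint_op_props(1)[OF w]] by (simp add: sesq_def)
 also have "... = (SUM j<=degree p. coeff p j * ip H ((T ^^ Suc j) x) w)"
  using adjoint_op_props(2)[OF w] x by simp
 also have "... = (SUM j<=Suc (degree p). coeff (pCons 0 p) j * ip H ((T ^^ j) x) w)"
  by (subst sum.atMost_Suc_shift) simp
 also have "... = sesq (%j l. ip H ((T ^^ j) x) w) (pCons 0 p) 1"
  by (subst sesq_eq[where N = "Suc (degree p)" and M = 0]) (simp_all add: degree_pCons_le)
 also have "... = ip H (poly_op H ([:0, 1:] * p) T x) w" using ip_poly_op[OF x w] by simp
 finally show "ip H (poly_op H ([:0, 1:] * p) T x) w = ip H (T (poly_op H p T x)) w" ..
qed (use x poly_op_closed in auto)

end

section \<open>The model space of an allowable tuple\<close>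

lemma complex_nonneg_limit:
 fixes d :: "nat => complex"
 assumes l: "d ----> L" and nn: "!!k. 0 <= d k" shows "0 <= L"
proof -
 have p: "0 <= Re (d k)" "Im (d k) = 0" for k using nn[of k] by (auto simp: less_eq_complex_def)
 have "0 <= Re L" by (rule LIMSEQ_le_const[OF tendsto_Re[OF l]]) (use p in auto)
 moreover have "(%k. 0) ----> Im L" using tendsto_Im[OF l] p by simp
 hence "Im L = 0" using LIMSEQ_unique tendsto_const by blast
 ultimately show ?thesis by (simp add: less_eq_complex_def)
qed

locale allowable_tuple =
 fixes m :: nat and mu :: dirichlet_tuple
 assumes m_pos: "0 < m" and allow: "allowable m mu"
begin

abbreviation S :: "complex poly => complex poly => complex" where "S \<equiv> sesq (gram mu)"
abbreviation N :: "complex poly => real" where "N \<equiv> poly_norm mu"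
abbreviation cls :: "(nat => complex poly) => (nat => complex poly) set" where "cls \<equiv> seq_class mu"
abbreviation K :: "(nat => complex poly) set hilbert" where "K \<equiv> model_space mu"

lemma mu_tuple: "mu : dirichlet_tuples m" using allow by (simp add: allowable_def)

lemma length_mu: "length (fst mu) = m" and snd_mu: "snd mu : finite_borel_measures_on (cball 0 1)"
 using mu_tuple by (auto simp: dirichlet_tuples_def)

lemma norm_sq_S: "norm_sq mu f = S f f" by (rule norm_sq_eq_sesq[OF mu_tuple m_pos])

lemma sesq_form_S: "sesq_form mu f g = S f g" by (rule sesq_form_eq_sesq[OF mu_tuple m_pos])

lemma S_nonneg: "0 <= Re (S f f)" "Im (S f f) = 0"
proof -
 obtain C where C: "0 < (C::real)" "0 <= norm_sq mu ([:0, 1:] * f)" "norm_sq mu ([:0, 1:] * f) <= of_real C * norm_sq mu f"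
  using allow by (auto simp: allowable_def)
 have "0 <= of_real C * norm_sq mu f" using C(2,3) by (rule order_trans)
 thus "0 <= Re (S f f)" "Im (S f f) = 0"
  using C(1) unfolding norm_sq_S by (auto simp: less_eq_complex_def zero_le_mult_iff)
qed

lemma S_self: "S f f = of_real ((N f)^2)"
 unfolding poly_norm_def norm_sq_S using S_nonneg[of f] by (simp add: complex_eq_iff)

lemma N_nonneg [simp]: "0 <= N f" using S_nonneg(1)[of f] by (simp add: poly_norm_def norm_sq_S)

lemma S_cnj: "S g f = cnj (S f g)"
proof (rule complex_eqI)
 have "Im (S (f + g) (f + g)) = 0" by (simp add: S_self)
 thus "Im (S g f) = Im (cnj (S f g))" by (simp add: sesq_add_left sesq_add_right S_self)
 have "Im (S (f + Polynomial.smult \<i> g) (f + Polynomial.smult \<i> g)) = 0" by (simp add: S_self)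
 thus "Re (S g f) = Re (cnj (S f g))"
  by (simp add: sesq_add_left sesq_add_right sesq_smult_left sesq_smult_right S_self)
qed

lemma Re_S_le: "Re (S f g) <= N f * N g"
proof -
 have "Re (S f g) <= sqrt ((N f)^2) * sqrt ((N g)^2)" proof (rule quadratic_nonneg_imp_bound)
  fix t :: real
  let ?h = "f + Polynomial.smult (of_real t) g"
  have "0 <= Re (S ?h ?h)" by (simp add: S_self)
  also have "Re (S ?h ?h) = (N f)^2 + 2 * t * Re (S f g) + t\<^sup>2 * (N g)^2"
   using S_cnj[of g f] by (simp add: sesq_add_left sesq_add_right sesq_smult_left sesq_smult_right S_self power2_eq_square algebra_simps)
  finally show "0 <= (N f)^2 + 2 * t * Re (S f g) + t\<^sup>2 * (N g)^2" .
 qed auto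
 thus ?thesis by simp
qed

lemma N_smult: "N (Polynomial.smult c f) = cmod c * N f"
proof -
 have "S (Polynomial.smult c f) (Polynomial.smult c f) = (c * cnj c) * S f f"
  by (simp add: sesq_smult_left sesq_smult_right)
 hence "of_real ((N (Polynomial.smult c f))^2) = complex_of_real ((cmod c * N f)^2)"
  unfolding S_self complex_norm_square[symmetric] power_mult_distrib of_real_mult .
 hence "(N (Polynomial.smult c f))\<^sup>2 = (cmod c * N f)^2" by (simp only: of_real_eq_iff)
 thus ?thesis by (simp add: power2_eq_iff_nonneg)
qed

lemma cmod_S_le: "cmod (S f g) <= N f * N g"
proof -
 obtain c where c: "cmod c = 1" "c * S f g = of_real (cmod (S f g))" using unimodular_rotation by blast
 hence "cmod (S f g) = Re (S (Polynomial.smult c f) g)" by (simp add: sesq_smult_left)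
 also have "... <= N (Polynomial.smult c f) * N g" by (rule Re_S_le)
 finally show ?thesis by (simp add: N_smult c)
qed

lemma N_triangle: "N (f + g) <= N f + N g"
proof -
 have "(N (f + g))\<^sup>2 = (N f)^2 + 2 * Re (S f g) + (N g)^2"
  using arg_cong[OF S_self[of "f + g"], of Re] S_cnj[of g f] by (simp add: sesq_add_left sesq_add_right S_self)
 also have "... <= (N f + N g)^2" using Re_S_le[of f g] by (simp add: power2_sum)
 finally show ?thesis by (rule power2_le_imp_le) simp
qed

lemma N_zero [simp]: "N 0 = 0" by (simp add: poly_norm_def norm_sq_S)

lemma N_minus: "N (- f) = N f" using N_smult[of "-1" f] by simp

lemma N_minus_commute: "N (f - g) = N (g - f)" using N_minus[of "f - g"] by simp

lemma N_minus_triangle: "N (f - h) <= N (f - g) + N (g - h)" using N_triangle[of "f - g" "g - h"] by simp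

lemma N_diff_bound: "\<bar>N f - N g\<bar> <= N (f - g)"
 using N_triangle[of "f - g" g] N_triangle[of "g - f" f] N_minus_commute[of f g] by simp

lemma N_shift: "EX C>=0. ALL f. N ([:0, 1:] * f) <= C * N f"
proof -
 obtain C where C: "0 < (C::real)" "ALL f. norm_sq mu ([:0, 1:] * f) <= of_real C * norm_sq mu f"
  using allow unfolding allowable_def by blast
 have "N ([:0, 1:] * f) <= sqrt C * N f" for f
 proof -
  have "Re (norm_sq mu ([:0, 1:] * f)) <= C * Re (norm_sq mu f)" using C(2) by (simp add: less_eq_complex_def)
  thus ?thesis unfolding poly_norm_def by (metis real_sqrt_le_iff real_sqrt_mult)
 qed
 thus ?thesis using C(1) by (intro exI[of _ "sqrt C"]) auto
qed

lemma null_rel_iff: "(s, t) : null_rel mu \<longleftrightarrow> s : cauchy_seqs mu & t : cauchy_seqs mu & (%n. N (s n - t n)) ----> 0"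
 by (simp add: null_rel_def)

lemma equiv_null_rel: "equiv (cauchy_seqs mu) (null_rel mu)"
proof (rule equivI)
 show "null_rel mu \<subseteq> cauchy_seqs mu \<times> cauchy_seqs mu" by (auto simp: null_rel_def)
 show "refl_on (cauchy_seqs mu) (null_rel mu)" by (auto simp: refl_on_def null_rel_iff)
 show "sym (null_rel mu)" by (rule symI) (auto simp: null_rel_iff N_minus_commute)
 show "trans (null_rel mu)" proof (rule transI)
  fix s t u assume "(s, t) : null_rel mu" "(t, u) : null_rel mu"
  hence 1: "s : cauchy_seqs mu" "u : cauchy_seqs mu" "(%n. N (s n - t n)) ----> 0" "(%n. N (t n - u n)) ----> 0"
   by (auto simp: null_rel_iff)
  have "norm (N (s n - u n)) <= N (s n - t n) + N (t n - u n)" for n using N_minus_triangle[of "s n" "u n" "t n"] by simp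
  moreover have "(%n. N (s n - t n) + N (t n - u n)) ----> 0" using tendsto_add[OF 1(3,4)] by simp
  ultimately have "(%n. N (s n - u n)) ----> 0" by (rule null_comparison)
  thus "(s, u) : null_rel mu" using 1 by (simp add: null_rel_iff)
 qed
qed

lemma cls_carrier: "s : cauchy_seqs mu ==> cls s : carrier K"
 by (simp add: model_space_def seq_class_def quotientI)

lemma carrier_cls: "X : carrier K ==> EX s:cauchy_seqs mu. X = cls s"
 by (auto simp: model_space_def seq_class_def elim!: quotientE)

lemma cls_eq_iff: "s : cauchy_seqs mu ==> t : cauchy_seqs mu ==> cls s = cls t \<longleftrightarrow> (%n. N (s n - t n)) ----> 0"
 unfolding seq_class_def using eq_equiv_class_iff[OF equiv_null_rel, of s t] by (simp add: null_rel_iff)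

lemma seq_rep_props:
 assumes s: "s : cauchy_seqs mu"
 shows "seq_rep (cls s) : cauchy_seqs mu" "(%n. N (s n - seq_rep (cls s) n)) ----> 0"
proof -
 have "s : cls s" unfolding seq_class_def by (rule equiv_class_self[OF equiv_null_rel s])
 hence "seq_rep (cls s) : cls s" unfolding seq_rep_def by (rule someI[where P = "%x. x : cls s"])
 hence "(s, seq_rep (cls s)) : null_rel mu" by (simp add: seq_class_def)
 thus "seq_rep (cls s) : cauchy_seqs mu" "(%n. N (s n - seq_rep (cls s) n)) ----> 0"
  by (auto simp: null_rel_iff)
qed

lemma cauchy_add:
 assumes "s : cauchy_seqs mu" "t : cauchy_seqs mu"
 shows "(%n. s n + t n) : cauchy_seqs mu" unfolding cauchy_seqs_def
proof (intro CollectI allI impI)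
 fix e :: real assume "0 < e"
 hence e: "0 < e / 2" by simp
 obtain N1 where N1: "ALL i>=N1. ALL j>=N1. N (s i - s j) < e / 2" using assms(1) e unfolding cauchy_seqs_def by blast
 obtain N2 where N2: "ALL i>=N2. ALL j>=N2. N (t i - t j) < e / 2" using assms(2) e unfolding cauchy_seqs_def by blast
 have "N (s i + t i - (s j + t j)) < e" if "max N1 N2 <= i" "max N1 N2 <= j" for i j
 proof -
  have "N (s i + t i - (s j + t j)) <= N (s i - s j) + N (t i - t j)"
   using N_triangle[of "s i - s j" "t i - t j"] by (simp add: add_diff_add)
  moreover have "N (s i - s j) < e / 2" "N (t i - t j) < e / 2" using N1 N2 that by auto
  ultimately show ?thesis by simp
 qed
 thus "EX M. ALL i>=M. ALL j>=M. N (s i + t i - (s j + t j)) < e" by blast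
qed

lemma cauchy_bounded_map:
 assumes s: "s : cauchy_seqs mu" and C: "0 <= C" "!!f g. N (F f - F g) <= C * N (f - g)"
 shows "(%n. F (s n)) : cauchy_seqs mu" unfolding cauchy_seqs_def
proof (intro CollectI allI impI)
 fix e :: real assume "0 < e"
 hence e: "0 < e / (C + 1)" using C(1) by simp
 obtain M where M: "ALL i>=M. ALL j>=M. N (s i - s j) < e / (C + 1)" using s e unfolding cauchy_seqs_def by blast
 have "N (F (s i) - F (s j)) < e" if "M <= i" "M <= j" for i j
 proof -
  have "N (F (s i) - F (s j)) <= (C + 1) * N (s i - s j)"
   using C(2)[of "s i" "s j"] by (simp add: distrib_right add_increasing2)
  also have "... < (C + 1) * (e / (C + 1))" using M that C(1) by (intro mult_strict_left_mono) auto
  also have "... = e" using C(1) by simp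
  finally show ?thesis .
 qed
 thus "EX M. ALL i>=M. ALL j>=M. N (F (s i) - F (s j)) < e" by blast
qed

lemma cauchy_smult: "s : cauchy_seqs mu ==> (%n. Polynomial.smult c (s n)) : cauchy_seqs mu"
 by (rule cauchy_bounded_map[where C = "cmod c"]) (auto simp: N_smult smult_diff_right[symmetric])

lemma cauchy_shift: "s : cauchy_seqs mu ==> (%n. [:0, 1:] * s n) : cauchy_seqs mu"
proof -
 assume s: "s : cauchy_seqs mu"
 obtain C where "0 <= C" "ALL f. N ([:0, 1:] * f) <= C * N f" using N_shift by blast
 thus ?thesis by (intro cauchy_bounded_map[OF s, of C]) (simp_all only: right_diff_distrib[symmetric])
qed

lemma cauchy_const: "(%n. f) : cauchy_seqs mu" by (auto simp: cauchy_seqs_def)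

lemma cauchy_N_bounded:
 assumes "s : cauchy_seqs mu" shows "EX B>=0. \<forall>\<^sub>F n in sequentially. N (s n) <= B"
proof -
 obtain M where M: "ALL i>=M. ALL j>=M. N (s i - s j) < 1" using assms zero_less_one unfolding cauchy_seqs_def by blast
 have "N (s n) <= N (s M) + 1" if "M <= n" for n
  using N_diff_bound[of "s n" "s M"] M that by (smt (verit) order_refl)
 hence "\<forall>\<^sub>F n in sequentially. N (s n) <= N (s M) + 1" unfolding eventually_sequentially by blast
 thus ?thesis by (intro exI[of _ "N (s M) + 1"]) simp
qed

lemma S_diff_bound: "cmod (S f g - S f' g') <= N (f - f') * N g + N f' * N (g - g')"
proof -
 have "S f g - S f' g' = S (f - f') g + S f' (g - g')"
  using sesq_add_left[of "gram mu" "f - f'" f' g] sesq_add_right[of "gram mu" f' "g - g'" g'] by simp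
 thus ?thesis using norm_triangle_ineq[of "S (f - f') g" "S f' (g - g')"] cmod_S_le[of "f - f'" g] cmod_S_le[of f' "g - g'"]
  by simp
qed

lemma S_limit_transfer:
 assumes s: "s : cauchy_seqs mu" and t: "t : cauchy_seqs mu"
  and s': "(%n. N (s n - s' n)) ----> 0" and t': "(%n. N (t n - t' n)) ----> 0" and s'c: "s' : cauchy_seqs mu"
 shows "(%n. S (s n) (t n) - S (s' n) (t' n)) ----> 0"
proof -
 obtain B1 where B1: "0 <= B1" "\<forall>\<^sub>F n in sequentially. N (t n) <= B1" using cauchy_N_bounded[OF t] by blast
 obtain B2 where B2: "0 <= B2" "\<forall>\<^sub>F n in sequentially. N (s' n) <= B2" using cauchy_N_bounded[OF s'c] by blast
 have "\<forall>\<^sub>F n in sequentially. norm (S (s n) (t n) - S (s' n) (t' n)) <= N (s n - s' n) * B1 + B2 * N (t n - t' n)"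
  using B1(2) B2(2)
 proof eventually_elim
  case (elim n)
  have "N (s n - s' n) * N (t n) + N (s' n) * N (t n - t' n) <= N (s n - s' n) * B1 + B2 * N (t n - t' n)"
   by (intro add_mono mult_mono elim B2(1)) auto
  thus ?case using S_diff_bound[of "s n" "t n" "s' n" "t' n"] by (rule order_trans[rotated])
 qed
 moreover have "(%n. N (s n - s' n) * B1 + B2 * N (t n - t' n)) ----> 0"
  using tendsto_add[OF tendsto_mult_left_zero[OF s', of B1] tendsto_mult_right_zero[OF t', of B2]] by simp
 ultimately show ?thesis by (rule Lim_null_comparison)
qed

lemma S_convergent:
 assumes s: "s : cauchy_seqs mu" and t: "t : cauchy_seqs mu"
 shows "convergent (%n. S (s n) (t n))"
proof (rule Cauchy_convergent, rule metric_CauchyI)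
 fix e :: real assume e: "0 < e"
 obtain B1 M1 where B1: "0 <= B1" "!!n. M1 <= n ==> N (t n) <= B1"
  using cauchy_N_bounded[OF t] unfolding eventually_sequentially by blast
 obtain B2 M2 where B2: "0 <= B2" "!!n. M2 <= n ==> N (s n) <= B2"
  using cauchy_N_bounded[OF s] unfolding eventually_sequentially by blast
 define d where "d = e / (B1 + B2 + 1)"
 have d: "0 < d" using e B1(1) B2(1) by (simp add: d_def)
 obtain M3 where M3: "ALL i>=M3. ALL j>=M3. N (s i - s j) < d" using s d unfolding cauchy_seqs_def by blast
 obtain M4 where M4: "ALL i>=M4. ALL j>=M4. N (t i - t j) < d" using t d unfolding cauchy_seqs_def by blast
 let ?M = "max (max M1 M2) (max M3 M4)"
 have "dist (S (s i) (t i)) (S (s j) (t j)) < e" if "?M <= i" "?M <= j" for i j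
 proof -
  have "cmod (S (s i) (t i) - S (s j) (t j)) <= N (s i - s j) * N (t i) + N (s j) * N (t i - t j)" by (rule S_diff_bound)
  also have "... <= d * B1 + B2 * d" proof -
   have "N (s i - s j) <= d" "N (t i - t j) <= d" using that M3 M4 by (auto intro: less_imp_le)
   moreover have "N (t i) <= B1" "N (s j) <= B2" using that by (auto intro: B1 B2)
   ultimately show ?thesis using d B1(1) B2(1) by (intro add_mono mult_mono) auto
  qed
  also have "... < d * (B1 + B2 + 1)" using d by (simp add: algebra_simps)
  also have "... = e" using B1(1) B2(1) by (simp add: d_def)
  finally show ?thesis by (simp add: dist_norm)
 qed
 thus "EX M. ALL i>=M. ALL j>=M. dist (S (s i) (t i)) (S (s j) (t j)) < e" by blast
qed

lemma cls_add:
 assumes s: "s : cauchy_seqs mu" and t: "t : cauchy_seqs mu"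
 shows "cls s \<oplus>\<^bsub>K\<^esub> cls t = cls (%n. s n + t n)"
proof -
 let ?s = "seq_rep (cls s)" and ?t = "seq_rep (cls t)"
 note P = seq_rep_props[OF s] seq_rep_props[OF t]
 have "norm (N ((?s n + ?t n) - (s n + t n))) <= N (s n - ?s n) + N (t n - ?t n)" for n
  using N_triangle[of "?s n - s n" "?t n - t n"] N_minus_commute[of "s n"] N_minus_commute[of "t n"] by (simp add: add_diff_add)
 hence "(%n. N ((?s n + ?t n) - (s n + t n))) ----> 0"
  by (rule null_comparison) (use tendsto_add[OF P(2,4)] in simp)
 hence "cls (%n. ?s n + ?t n) = cls (%n. s n + t n)"
  by (subst cls_eq_iff) (use P s t cauchy_add in auto)
 thus ?thesis by (simp add: model_space_def)
qed

lemma cls_smult: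
 assumes s: "s : cauchy_seqs mu"
 shows "c \<odot>\<^bsub>K\<^esub> cls s = cls (%n. Polynomial.smult c (s n))"
proof -
 let ?s = "seq_rep (cls s)"
 note P = seq_rep_props[OF s]
 have "N (Polynomial.smult c (?s n) - Polynomial.smult c (s n)) = cmod c * N (s n - ?s n)" for n
  by (simp add: smult_diff_right[symmetric] N_smult N_minus_commute)
 hence "(%n. N (Polynomial.smult c (?s n) - Polynomial.smult c (s n))) ----> 0"
  using tendsto_mult_right_zero[OF P(2), of "cmod c"] by simp
 hence "cls (%n. Polynomial.smult c (?s n)) = cls (%n. Polynomial.smult c (s n))"
  by (subst cls_eq_iff) (use P s cauchy_smult in auto)
 thus ?thesis by (simp add: model_space_def)
qed

lemma cls_zero: "\<zero>\<^bsub>K\<^esub> = cls (%n. 0)" by (simp add: model_space_def)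

lemma cls_ip:
 assumes s: "s : cauchy_seqs mu" and t: "t : cauchy_seqs mu"
 shows "(%n. S (s n) (t n)) ----> ip K (cls s) (cls t)"
proof -
 let ?s = "seq_rep (cls s)" and ?t = "seq_rep (cls t)"
 note P = seq_rep_props[OF s] seq_rep_props[OF t]
 have "(%n. S (?s n) (?t n)) ----> lim (%n. S (?s n) (?t n))"
  using S_convergent[OF P(1,3)] by (simp add: convergent_LIMSEQ_iff)
 from tendsto_add[OF S_limit_transfer[OF s t P(2,4,1)] this]
 have "(%n. S (s n) (t n)) ----> lim (%n. S (?s n) (?t n))" by simp
 thus ?thesis by (simp add: model_space_def sesq_form_S)
qed

lemma abelian_group_K: "abelian_group K"
proof (rule abelian_groupI)
 fix x y z assume "x : carrier K" "y : carrier K" "z : carrier K"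
 then obtain s t u where *: "s : cauchy_seqs mu" "t : cauchy_seqs mu" "u : cauchy_seqs mu" "x = cls s" "y = cls t" "z = cls u"
  using carrier_cls by metis
 show "x \<oplus>\<^bsub>K\<^esub> y : carrier K" using * by (simp add: cls_add cls_carrier cauchy_add)
 show "(x \<oplus>\<^bsub>K\<^esub> y) \<oplus>\<^bsub>K\<^esub> z = x \<oplus>\<^bsub>K\<^esub> (y \<oplus>\<^bsub>K\<^esub> z)" using * by (simp add: cls_add cauchy_add add.assoc)
 show "x \<oplus>\<^bsub>K\<^esub> y = y \<oplus>\<^bsub>K\<^esub> x" using * by (simp add: cls_add add.commute)
next
 show "\<zero>\<^bsub>K\<^esub> : carrier K" by (simp add: cls_zero cls_carrier cauchy_const)
next
 fix x assume "x : carrier K"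
 then obtain s where s: "s : cauchy_seqs mu" "x = cls s" using carrier_cls by blast
 show "\<zero>\<^bsub>K\<^esub> \<oplus>\<^bsub>K\<^esub> x = x" using s by (simp add: cls_zero cls_add cauchy_const)
 have "cls (%n. Polynomial.smult (-1) (s n)) \<oplus>\<^bsub>K\<^esub> x = cls (%n. Polynomial.smult (-1) (s n) + s n)"
  unfolding s(2) by (rule cls_add[OF cauchy_smult[OF s(1)] s(1)])
 hence "cls (%n. Polynomial.smult (-1) (s n)) \<oplus>\<^bsub>K\<^esub> x = \<zero>\<^bsub>K\<^esub>" by (simp add: cls_zero)
 thus "EX y:carrier K. y \<oplus>\<^bsub>K\<^esub> x = \<zero>\<^bsub>K\<^esub>" using s cls_carrier[OF cauchy_smult] by blast
qed

lemma inner_product_space_K: "complex_inner_product_space K"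
proof -
 have F: "carrier complex_field = UNIV" "a \<oplus>\<^bsub>complex_field\<^esub> b = a + b" "a \<otimes>\<^bsub>complex_field\<^esub> b = a * b" "\<one>\<^bsub>complex_field\<^esub> = 1" for a b
  by (simp_all add: complex_field_def)
 have mod: "module complex_field K" proof (rule moduleI[OF cring_complex_field abelian_group_K])
  fix a b x y assume "x : carrier K" "y : carrier K"
  then obtain s t where *: "s : cauchy_seqs mu" "t : cauchy_seqs mu" "x = cls s" "y = cls t" using carrier_cls by metis
  show "a \<odot>\<^bsub>K\<^esub> (x \<oplus>\<^bsub>K\<^esub> y) = a \<odot>\<^bsub>K\<^esub> x \<oplus>\<^bsub>K\<^esub> a \<odot>\<^bsub>K\<^esub> y"
   using * by (simp add: cls_add cls_smult cauchy_add cauchy_smult smult_add_right)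
 next
  fix a b x assume "x : carrier K"
  then obtain s where *: "s : cauchy_seqs mu" "x = cls s" using carrier_cls by metis
  show "a \<odot>\<^bsub>K\<^esub> x : carrier K" using * by (simp add: cls_smult cls_carrier cauchy_smult)
  show "(a \<oplus>\<^bsub>complex_field\<^esub> b) \<odot>\<^bsub>K\<^esub> x = a \<odot>\<^bsub>K\<^esub> x \<oplus>\<^bsub>K\<^esub> b \<odot>\<^bsub>K\<^esub> x"
   using * by (simp add: F cls_add cls_smult cauchy_smult smult_add_left)
  show "(a \<otimes>\<^bsub>complex_field\<^esub> b) \<odot>\<^bsub>K\<^esub> x = a \<odot>\<^bsub>K\<^esub> (b \<odot>\<^bsub>K\<^esub> x)"
   using * by (simp add: F cls_smult cauchy_smult)
  show "\<one>\<^bsub>complex_field\<^esub> \<odot>\<^bsub>K\<^esub> x = x" using * by (simp add: F cls_smult)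
 qed
 show ?thesis
 proof (intro complex_inner_product_space.intro mod complex_inner_product_space_axioms.intro)
  fix x y z assume "x : carrier K" "y : carrier K" "z : carrier K"
  then obtain s t u where *: "s : cauchy_seqs mu" "t : cauchy_seqs mu" "u : cauchy_seqs mu" "x = cls s" "y = cls t" "z = cls u"
   using carrier_cls by metis
  have "(%n. S (s n + t n) (u n)) ----> ip K x z + ip K y z"
   unfolding sesq_add_left *(4-6) by (intro tendsto_add cls_ip *)
  thus "ip K (x \<oplus>\<^bsub>K\<^esub> y) z = ip K x z + ip K y z"
   using cls_ip[OF cauchy_add[OF *(1,2)] *(3)] * LIMSEQ_unique by (simp add: cls_add) blast
 next
  fix c x y assume "x : carrier K" "y : carrier K"
  then obtain s t where *: "s : cauchy_seqs mu" "t : cauchy_seqs mu" "x = cls s" "y = cls t" using carrier_cls by metis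
  have "(%n. S (Polynomial.smult c (s n)) (t n)) ----> c * ip K x y"
   unfolding sesq_smult_left *(3,4) by (intro tendsto_mult tendsto_const cls_ip *)
  thus "ip K (c \<odot>\<^bsub>K\<^esub> x) y = c * ip K x y"
   using cls_ip[OF cauchy_smult[OF *(1)] *(2), of c] * LIMSEQ_unique by (simp add: cls_smult) blast
 next
  fix x y assume "x : carrier K" "y : carrier K"
  then obtain s t where *: "s : cauchy_seqs mu" "t : cauchy_seqs mu" "x = cls s" "y = cls t" using carrier_cls by metis
  have "(%n. cnj (S (s n) (t n))) ----> cnj (ip K x y)" unfolding *(3,4) by (intro tendsto_cnj cls_ip *)
  thus "ip K y x = cnj (ip K x y)" unfolding S_cnj[symmetric]
   using cls_ip[OF *(2,1)] * LIMSEQ_unique by blast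
 next
  fix x assume "x : carrier K"
  then obtain s where *: "s : cauchy_seqs mu" "x = cls s" using carrier_cls by metis
  have l: "(%n. complex_of_real ((N (s n))^2)) ----> ip K x x" using cls_ip[OF *(1) *(1)] *(2) by (simp only: S_self)
  have "(%n. Re (complex_of_real ((N (s n))^2))) ----> Re (ip K x x)" "(%n. Im (complex_of_real ((N (s n))^2))) ----> Im (ip K x x)"
   by (intro tendsto_Re tendsto_Im l)+
  hence lr: "(%n. (N (s n))\<^sup>2) ----> Re (ip K x x)" and li: "(%n. 0) ----> Im (ip K x x)" by simp_all
  have "0 <= Re (ip K x x)" by (rule LIMSEQ_le_const[OF lr]) auto
  moreover have "Im (ip K x x) = 0" using LIMSEQ_unique[OF li tendsto_const] .
  ultimately show "0 <= ip K x x" by (simp add: less_eq_complex_def)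
  assume "ip K x x = 0"
  hence "(%n. (N (s n))\<^sup>2) ----> 0" using lr by simp
  hence "(%n. sqrt ((N (s n))^2)) ----> sqrt 0" by (rule tendsto_real_sqrt)
  hence "(%n. N (s n - 0)) ----> 0" by simp
  thus "x = \<zero>\<^bsub>K\<^esub>" using cls_eq_iff[OF *(1) cauchy_const[of 0]] * by (simp add: cls_zero)
 qed
qed

sublocale K: complex_inner_product_space K by (rule inner_product_space_K)

lemma cls_minus:
 assumes s: "s : cauchy_seqs mu" and t: "t : cauchy_seqs mu"
 shows "cls s \<ominus>\<^bsub>K\<^esub> cls t = cls (%n. s n - t n)"
 unfolding K.minus_eq_smult[OF cls_carrier[OF s] cls_carrier[OF t]] cls_smult[OF t] cls_add[OF s cauchy_smult[OF t]] by simp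

lemma cauchy_diff: "s : cauchy_seqs mu ==> t : cauchy_seqs mu ==> (%n. s n - t n) : cauchy_seqs mu"
 using cauchy_add[OF _ cauchy_smult, of s t "-1"] by simp

lemma hnorm_cls:
 assumes s: "s : cauchy_seqs mu" shows "(%n. N (s n)) ----> hnorm K (cls s)"
proof -
 have "(%n. sqrt (Re (complex_of_real ((N (s n))^2)))) ----> sqrt (Re (ip K (cls s) (cls s)))"
  using cls_ip[OF s s] unfolding S_self by (intro tendsto_real_sqrt tendsto_Re)
 thus ?thesis by (simp add: hnorm_def)
qed

lemma poly_class_carrier [simp, intro]: "poly_class mu f : carrier K"
 by (simp add: poly_class_def cls_carrier cauchy_const)

lemma poly_class_add: "poly_class mu (f + g) = poly_class mu f \<oplus>\<^bsub>K\<^esub> poly_class mu g"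
 by (simp add: poly_class_def cls_add cauchy_const)

lemma poly_class_smult: "poly_class mu (Polynomial.smult c f) = c \<odot>\<^bsub>K\<^esub> poly_class mu f"
 by (simp add: poly_class_def cls_smult cauchy_const)

lemma hnorm_poly_class_diff: "hnorm K (poly_class mu f \<ominus>\<^bsub>K\<^esub> poly_class mu g) = N (f - g)"
 using hnorm_cls[OF cauchy_diff[OF cauchy_const[of f] cauchy_const[of g]]]
 unfolding poly_class_def cls_minus[OF cauchy_const cauchy_const] by (rule LIMSEQ_unique) simp

lemma ip_poly_class: "ip K (poly_class mu f) (poly_class mu g) = S f g"
 using cls_ip[OF cauchy_const[of f] cauchy_const[of g]] unfolding poly_class_def
 by (rule LIMSEQ_unique) simp

lemma poly_classes_tend_to:
 assumes s: "s : cauchy_seqs mu" shows "K.hlim (%k. poly_class mu (s k)) (cls s)" unfolding K.hlim_def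
proof (intro conjI allI cls_carrier s poly_class_carrier LIMSEQ_I)
 fix e :: real assume "0 < e"
 hence "0 < e / 2" by simp
 then obtain M where M: "ALL i>=M. ALL j>=M. N (s i - s j) < e / 2" using s unfolding cauchy_seqs_def by blast
 have "hnorm K (poly_class mu (s k) \<ominus>\<^bsub>K\<^esub> cls s) <= e / 2" if "M <= k" for k
 proof -
  have "(%n. N (s k - s n)) ----> hnorm K (poly_class mu (s k) \<ominus>\<^bsub>K\<^esub> cls s)"
   unfolding poly_class_def cls_minus[OF cauchy_const s] by (rule hnorm_cls[OF cauchy_diff[OF cauchy_const s]])
  thus ?thesis by (rule LIMSEQ_le_const2) (use M that in \<open>auto intro!: exI[of _ M] less_imp_le\<close>)
 qed
 hence "norm (hnorm K (poly_class mu (s k) \<ominus>\<^bsub>K\<^esub> cls s) - 0) < e" if "M <= k" for k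
  using K.hnorm_nonneg[of "poly_class mu (s k) \<ominus>\<^bsub>K\<^esub> cls s"] cls_carrier[OF s] \<open>0 < e\<close> that by force
 thus "EX M. ALL k>=M. norm (hnorm K (poly_class mu (s k) \<ominus>\<^bsub>K\<^esub> cls s) - 0) < e" by blast
qed

lemma poly_class_dense:
 assumes "X : carrier K" "0 < e" shows "EX f. hnorm K (poly_class mu f \<ominus>\<^bsub>K\<^esub> X) < e"
proof -
 obtain s where s: "s : cauchy_seqs mu" "X = cls s" using carrier_cls assms(1) by blast
 have "(%k. hnorm K (poly_class mu (s k) \<ominus>\<^bsub>K\<^esub> X)) ----> 0" using poly_classes_tend_to[OF s(1)] s(2) by (simp add: K.hlim_def)
 hence "\<forall>\<^sub>F k in sequentially. hnorm K (poly_class mu (s k) \<ominus>\<^bsub>K\<^esub> X) < e" using assms(2) by (rule order_tendstoD)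
 thus ?thesis unfolding eventually_sequentially by blast
qed

lemma hilbert_space_K: "complex_hilbert_space K"
proof (intro complex_hilbert_space.intro inner_product_space_K complex_hilbert_space_axioms.intro)
 interpret MS: Metric_space "carrier K" "hdist K" by (rule K.Metric_space_hdist)
 show "MS.mcomplete" unfolding MS.mcomplete_def
 proof (intro allI impI)
  fix sg assume C: "MS.MCauchy sg"
  hence sg: "!!n. sg n : carrier K" by (auto simp: MS.MCauchy_def)
  have "EX f. hnorm K (poly_class mu f \<ominus>\<^bsub>K\<^esub> sg n) < inverse (real (Suc n))" for n
   by (rule poly_class_dense[OF sg]) simp
  then obtain p where p: "!!n. hnorm K (poly_class mu (p n) \<ominus>\<^bsub>K\<^esub> sg n) < inverse (real (Suc n))" by metis
  have small: "inverse (real (Suc i)) < e" if "inverse (real (Suc M)) < e" "M <= i" for i M e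
  proof -
   have "inverse (real (Suc i)) <= inverse (real (Suc M))" using that(2) by (intro le_imp_inverse_le) auto
   thus ?thesis using that(1) by linarith
  qed
  have pc: "p : cauchy_seqs mu" unfolding cauchy_seqs_def
  proof (intro CollectI allI impI)
   fix e :: real assume "0 < e"
   hence e: "0 < e / 3" by simp
   obtain M1 where M1: "ALL i j. M1 <= i --> M1 <= j --> hdist K (sg i) (sg j) < e / 3" using C e unfolding MS.MCauchy_def by blast
   obtain M2 where M2: "inverse (real (Suc M2)) < e / 3" using reals_Archimedean[OF e] by auto
   have "N (p i - p j) < e" if ij: "max M1 M2 <= i" "max M1 M2 <= j" for i j
   proof -
    have "N (p i - p j) <= hnorm K (poly_class mu (p i) \<ominus>\<^bsub>K\<^esub> sg i) + hnorm K (sg i \<ominus>\<^bsub>K\<^esub> poly_class mu (p j))"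
     unfolding hnorm_poly_class_diff[symmetric] by (intro K.hnorm_minus_triangle sg poly_class_carrier)
    also have "hnorm K (sg i \<ominus>\<^bsub>K\<^esub> poly_class mu (p j)) <= hnorm K (sg i \<ominus>\<^bsub>K\<^esub> sg j) + hnorm K (sg j \<ominus>\<^bsub>K\<^esub> poly_class mu (p j))"
     by (intro K.hnorm_minus_triangle sg poly_class_carrier)
    also have "hnorm K (sg j \<ominus>\<^bsub>K\<^esub> poly_class mu (p j)) = hnorm K (poly_class mu (p j) \<ominus>\<^bsub>K\<^esub> sg j)"
     by (intro K.hnorm_minus_commute sg poly_class_carrier)
    finally have "N (p i - p j) <= hnorm K (poly_class mu (p i) \<ominus>\<^bsub>K\<^esub> sg i) + (hnorm K (sg i \<ominus>\<^bsub>K\<^esub> sg j) + hnorm K (poly_class mu (p j) \<ominus>\<^bsub>K\<^esub> sg j))" by simp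
    moreover have "hnorm K (sg i \<ominus>\<^bsub>K\<^esub> sg j) < e / 3" using M1 ij sg by (simp add: hdist_def)
    ultimately show ?thesis using p[of i] p[of j] small[OF M2, of i] small[OF M2, of j] ij by simp
   qed
   thus "EX M. ALL i>=M. ALL j>=M. N (p i - p j) < e" by blast
  qed
  have "limitin MS.mtopology sg (cls p) sequentially" unfolding MS.limit_metric_sequentially
  proof (intro conjI allI impI cls_carrier pc)
   fix e :: real assume "0 < e"
   hence e: "0 < e / 2" by simp
   have "(%k. hnorm K (poly_class mu (p k) \<ominus>\<^bsub>K\<^esub> cls p)) ----> 0"
    using poly_classes_tend_to[OF pc] by (simp add: K.hlim_def)
   from order_tendstoD(2)[OF this e] obtain M1 where M1: "!!k. M1 <= k ==> hnorm K (poly_class mu (p k) \<ominus>\<^bsub>K\<^esub> cls p) < e / 2"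
    unfolding eventually_sequentially by blast
   obtain M2 where M2: "inverse (real (Suc M2)) < e / 2" using reals_Archimedean[OF e] by auto
   have "sg k : carrier K & hdist K (sg k) (cls p) < e" if k: "max M1 M2 <= k" for k
   proof -
    have "hnorm K (sg k \<ominus>\<^bsub>K\<^esub> cls p) <= hnorm K (sg k \<ominus>\<^bsub>K\<^esub> poly_class mu (p k)) + hnorm K (poly_class mu (p k) \<ominus>\<^bsub>K\<^esub> cls p)"
     by (intro K.hnorm_minus_triangle sg poly_class_carrier cls_carrier pc)
    also have "hnorm K (sg k \<ominus>\<^bsub>K\<^esub> poly_class mu (p k)) = hnorm K (poly_class mu (p k) \<ominus>\<^bsub>K\<^esub> sg k)"
     by (intro K.hnorm_minus_commute sg poly_class_carrier)
    finally show ?thesis using p[of k] small[OF M2, of k] M1[of k] k sg[of k] cls_carrier[OF pc] by (simp add: hdist_def)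
   qed
   thus "EX M. ALL k>=M. sg k : carrier K & hdist K (sg k) (cls p) < e" by blast
  qed
  thus "EX x. limitin MS.mtopology sg x sequentially" by blast
 qed
qed

sublocale K: complex_hilbert_space K by (rule hilbert_space_K)

definition Z :: "(nat => complex poly) set => (nat => complex poly) set" where
 "Z = restrict (%X. cls (%n. [:0, 1:] * seq_rep X n)) (carrier K)"

lemma Z_cls:
 assumes s: "s : cauchy_seqs mu" shows "Z (cls s) = cls (%n. [:0, 1:] * s n)"
proof -
 let ?s = "seq_rep (cls s)"
 note P = seq_rep_props[OF s]
 obtain C where C: "0 <= C" "ALL f. N ([:0, 1:] * f) <= C * N f" using N_shift by blast
 have "norm (N ([:0, 1:] * ?s n - [:0, 1:] * s n)) <= C * N (s n - ?s n)" for n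
  using C(2)[rule_format, of "?s n - s n"] N_minus_commute[of "s n" "?s n"] by (simp only: right_diff_distrib real_norm_def abs_of_nonneg N_nonneg)
 hence "(%n. N ([:0, 1:] * ?s n - [:0, 1:] * s n)) ----> 0"
  by (rule null_comparison) (rule tendsto_mult_right_zero[OF P(2)])
 hence "cls (%n. [:0, 1:] * ?s n) = cls (%n. [:0, 1:] * s n)"
  by (subst cls_eq_iff[OF cauchy_shift[OF P(1)] cauchy_shift[OF s]])
 thus ?thesis using cls_carrier[OF s] by (simp only: Z_def restrict_apply if_True)
qed

lemma Z_poly_class: "Z (poly_class mu f) = poly_class mu ([:0, 1:] * f)"
 unfolding poly_class_def by (rule Z_cls[OF cauchy_const])

lemma Z_bounded: "Z : bounded_operators K" unfolding bounded_operators_def linear_map_def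
proof (intro CollectI conjI)
 show "Z : carrier K \<rightarrow> carrier K" proof
  fix x assume "x : carrier K"
  then obtain s where s: "s : cauchy_seqs mu" "x = cls s" using carrier_cls by blast
  show "Z x : carrier K" unfolding s(2) Z_cls[OF s(1)] by (rule cls_carrier[OF cauchy_shift[OF s(1)]])
 qed
 show "ALL x:carrier K. ALL y:carrier K. Z (x \<oplus>\<^bsub>K\<^esub> y) = Z x \<oplus>\<^bsub>K\<^esub> Z y"
 proof (intro ballI)
  fix x y assume "x : carrier K" "y : carrier K"
  then obtain s t where *: "s : cauchy_seqs mu" "t : cauchy_seqs mu" "x = cls s" "y = cls t" using carrier_cls by metis
  show "Z (x \<oplus>\<^bsub>K\<^esub> y) = Z x \<oplus>\<^bsub>K\<^esub> Z y"
   unfolding *(3,4) cls_add[OF *(1,2)] Z_cls[OF *(1)] Z_cls[OF *(2)] Z_cls[OF cauchy_add[OF *(1,2)]]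
    cls_add[OF cauchy_shift[OF *(1)] cauchy_shift[OF *(2)]] distrib_left ..
 qed
 show "ALL c. ALL x:carrier K. Z (c \<odot>\<^bsub>K\<^esub> x) = c \<odot>\<^bsub>K\<^esub> Z x"
 proof (intro allI ballI)
  fix c x assume "x : carrier K"
  then obtain s where *: "s : cauchy_seqs mu" "x = cls s" using carrier_cls by metis
  show "Z (c \<odot>\<^bsub>K\<^esub> x) = c \<odot>\<^bsub>K\<^esub> Z x"
   unfolding *(2) cls_smult[OF *(1)] Z_cls[OF *(1)] Z_cls[OF cauchy_smult[OF *(1)]]
    cls_smult[OF cauchy_shift[OF *(1)]] mult_smult_right ..
 qed
 obtain C where C: "0 <= C" "ALL f. N ([:0, 1:] * f) <= C * N f" using N_shift by blast
 have "hnorm K (Z x) <= C * hnorm K x" if x: "x : carrier K" for x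
 proof -
  obtain s where s: "s : cauchy_seqs mu" "x = cls s" using carrier_cls x by blast
  show ?thesis unfolding s(2) Z_cls[OF s(1)]
   by (rule LIMSEQ_le[OF hnorm_cls[OF cauchy_shift[OF s(1)]] tendsto_mult[OF tendsto_const hnorm_cls[OF s(1)]]])
     (use C(2) in blast)
 qed
 thus "EX C. ALL x:carrier K. hnorm K (Z x) <= C * hnorm K x" by blast
qed

text \<open>Bounded operators that agree on the dense set of classes of polynomials agree.\<close>

lemma M_z_eq: "M_z mu = Z" unfolding M_z_def
proof (rule the_equality)
 show "Z : bounded_operators K & Z : extensional (carrier K) & (ALL f. Z (poly_class mu f) = poly_class mu ([:0, 1:] * f))"
  using Z_bounded Z_poly_class by (auto simp: Z_def)
next
 fix T assume T: "T : bounded_operators K & T : extensional (carrier K) & (ALL f. T (poly_class mu f) = poly_class mu ([:0, 1:] * f))"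
 have lim: "K.hlim (%k. poly_class mu ([:0, 1:] * s k)) (R (cls s))"
  if s: "s : cauchy_seqs mu" and R: "R : bounded_operators K" "!!f. R (poly_class mu f) = poly_class mu ([:0, 1:] * f)" for R s
 proof -
  obtain C where C: "!!x. x : carrier K ==> hnorm K (R x) <= C * hnorm K x" and lin: "linear_map K K R"
   using R(1) unfolding bounded_operators_def by blast
  show ?thesis using K.hlim_bounded_map[OF lin C poly_classes_tend_to[OF s]] unfolding R(2) .
 qed
 show "T = Z" proof (rule extensionalityI[of _ "carrier K"])
  show "T : extensional (carrier K)" "Z : extensional (carrier K)" using T by (auto simp: Z_def)
  fix x assume "x : carrier K"
  then obtain s where s: "s : cauchy_seqs mu" "x = cls s" using carrier_cls by blast
  show "T x = Z x" unfolding s(2)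
   by (rule K.hlim_unique[OF lim[OF s(1)] lim[OF s(1) Z_bounded Z_poly_class]]) (use T in auto)
 qed
qed

sublocale Z: bounded_operator_on K Z by unfold_locales (rule Z_bounded)

lemma cauchy_monom: "s : cauchy_seqs mu ==> (%n. monom 1 j * s n) : cauchy_seqs mu"
proof (induction j)
 case (Suc j)
 from cauchy_shift[OF Suc.IH[OF Suc.prems]] show ?case by (simp add: monom_Suc)
qed (simp add: monom_0)

lemma Z_pow_cls: "s : cauchy_seqs mu ==> (Z ^^ j) (cls s) = cls (%n. monom 1 j * s n)"
proof (induction j)
 case (Suc j)
 have "(Z ^^ Suc j) (cls s) = cls (%n. [:0, 1:] * (monom 1 j * s n))"
  using Suc Z_cls[OF cauchy_monom[OF Suc.prems, of j]] by simp
 thus ?case by (simp add: monom_Suc)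
qed (simp add: monom_0)

lemma sesq_moment_integral:
 "sesq (%j l. LINT z|snd mu. (z ^ j * cnj z ^ l) * of_real ((1 - (cmod z)\<^sup>2) ^ n)) f f =
  of_real (LINT z|snd mu. (cmod (poly f z))\<^sup>2 * (1 - (cmod z)\<^sup>2) ^ n)"
proof -
 let ?g = "%j l z. (z ^ j * cnj z ^ l) * complex_of_real ((1 - (cmod z)\<^sup>2) ^ n)"
 note i = integrable_weighted_monomial[OF snd_mu]
 have "sesq (%j l. LINT z|snd mu. ?g j l z) f f = (SUM j<=degree f. SUM l<=degree f. (LINT z|snd mu. coeff f j * cnj (coeff f l) * ?g j l z))"
  unfolding sesq_def by (simp only: integral_mult_right_zero)
 also have "... = (SUM j<=degree f. (LINT z|snd mu. (SUM l<=degree f. coeff f j * cnj (coeff f l) * ?g j l z)))"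
  by (intro sum.cong refl Bochner_Integration.integral_sum[symmetric] integrable_mult_right i)
 also have "... = (LINT z|snd mu. (SUM j<=degree f. SUM l<=degree f. coeff f j * cnj (coeff f l) * ?g j l z))"
  by (intro Bochner_Integration.integral_sum[symmetric] Bochner_Integration.integrable_sum integrable_mult_right i)
 also have "... = (LINT z|snd mu. complex_of_real ((cmod (poly f z))^2 * (1 - (cmod z)\<^sup>2) ^ n))"
 proof (intro Bochner_Integration.integral_cong refl)
  fix z
  have "complex_of_real ((cmod (poly f z))^2) = poly f z * cnj (poly f z)" by (rule complex_norm_square)
  also have "... = (SUM j<=degree f. SUM l<=degree f. (coeff f j * z ^ j) * (cnj (coeff f l) * cnj z ^ l))"
   unfolding poly_altdef cnj_sum complex_cnj_mult complex_cnj_power sum_product ..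
  finally have "complex_of_real ((cmod (poly f z))^2 * (1 - (cmod z)\<^sup>2) ^ n) =
    (SUM j<=degree f. SUM l<=degree f. (coeff f j * z ^ j) * (cnj (coeff f l) * cnj z ^ l)) * complex_of_real ((1 - (cmod z)\<^sup>2) ^ n)"
   by (simp only: of_real_mult)
  thus "(SUM j<=degree f. SUM l<=degree f. coeff f j * cnj (coeff f l) * ?g j l z) = complex_of_real ((cmod (poly f z))^2 * (1 - (cmod z)\<^sup>2) ^ n)"
   unfolding sum_distrib_right by (simp only: mult_ac)
 qed
 finally show ?thesis unfolding integral_complex_of_real .
qed

text \<open>The defect form is the integral of \<open>|f|^2 (1 - |z|^2)^(n-m)\<close>.\<close>

lemma defect_nonneg:
 assumes n: "m <= n"
 shows "0 <= (-1) ^ m * (SUM j<=n. ((-1) ^ j * of_nat (n choose j)) * S (monom 1 j * f) (monom 1 j * f))"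
proof -
 have A: "AE z in snd mu. z : cball 0 1" using snd_mu by (auto simp: finite_borel_measures_on_def)
 have "(SUM j<=n. ((-1) ^ j * of_nat (n choose j)) * S (monom 1 j * f) (monom 1 j * f)) = sesq (bdiff n (gram mu)) f f"
  by (rule sesq_bdiff)
 also have "bdiff n (gram mu) = (%j l. (-1) ^ m * (LINT z|snd mu. (z ^ j * cnj z ^ l) * of_real ((1 - (cmod z)\<^sup>2) ^ (n - m))) + 0 * 0)"
  using bdiff_gram_above[OF snd_mu, of "n - m"] n by (auto simp: fun_eq_iff length_mu)
 also have "sesq ... f f = (-1) ^ m * of_real (LINT z|snd mu. (cmod (poly f z))\<^sup>2 * (1 - (cmod z)\<^sup>2) ^ (n - m))"
  unfolding sesq_linear_array[where B = "%j l. 0"] sesq_moment_integral by simp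
 finally have "(-1) ^ m * (SUM j<=n. ((-1) ^ j * of_nat (n choose j)) * S (monom 1 j * f) (monom 1 j * f))
  = of_real (LINT z|snd mu. (cmod (poly f z))\<^sup>2 * (1 - (cmod z)\<^sup>2) ^ (n - m))"
  by (simp add: mult.assoc[symmetric] power_add[symmetric])
 moreover have "0 <= (LINT z|snd mu. (cmod (poly f z))\<^sup>2 * (1 - (cmod z)\<^sup>2) ^ (n - m))"
 proof (rule integral_nonneg_AE, rule AE_mp[OF A AE_I2], rule impI)
  fix z :: complex assume "z : cball 0 1"
  hence "0 <= 1 - (cmod z)\<^sup>2" by (simp add: power_le_one)
  thus "0 <= (cmod (poly f z))^2 * (1 - (cmod z)\<^sup>2) ^ (n - m)" by (intro mult_nonneg_nonneg zero_le_power) auto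
 qed
 ultimately show ?thesis by (simp add: less_eq_complex_def)
qed

lemma M_z_dirichlet_type: "dirichlet_type m K (M_z mu)" unfolding dirichlet_type_def M_z_eq
proof (intro conjI Z_bounded allI impI)
 fix n assume n: "m <= n"
 show "positive_op K (%x. (-1) ^ m \<odot>\<^bsub>K\<^esub> B_op K n Z x)"
  unfolding Z.positive_defect_iff
 proof
  fix x assume "x : carrier K"
  then obtain s where s: "s : cauchy_seqs mu" "x = cls s" using carrier_cls by blast
  let ?d = "%k. (-1) ^ m * (SUM j<=n. ((-1) ^ j * of_nat (n choose j)) * S (monom 1 j * s k) (monom 1 j * s k))"
  let ?L = "(-1) ^ m * (SUM j<=n. ((-1) ^ j * of_nat (n choose j)) * ip K ((Z ^^ j) x) ((Z ^^ j) x))"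
  have l: "?d ----> ?L"
   unfolding s(2) Z_pow_cls[OF s(1)] by (intro tendsto_intros cls_ip cauchy_monom s(1))
  show "0 <= ?L" by (rule complex_nonneg_limit[OF l defect_nonneg[OF n]])
 qed
qed

lemma poly_op_poly_class: "poly_op K p Z (poly_class mu 1) = poly_class mu p"
proof -
 have pw: "(Z ^^ j) (poly_class mu 1) = poly_class mu (monom 1 j)" for j
  unfolding poly_class_def using Z_pow_cls[OF cauchy_const[of 1], of j] by simp
 have sum: "(\<Oplus>\<^bsub>K\<^esub>j\<in>I. poly_class mu (g j)) = poly_class mu (SUM j:I. g j)" if "finite I" for I :: "nat set" and g
  using that
 proof (induction I)
  case empty
  show ?case by (simp add: poly_class_def cls_zero)
 next
  case (insert x I)
  have "(%j. poly_class mu (g j)) : I \<rightarrow> carrier K" by auto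
  thus ?case using insert by (simp add: K.M.finsum_insert poly_class_add)
 qed
 have "poly_op K p Z (poly_class mu 1) = (\<Oplus>\<^bsub>K\<^esub>j\<in>{..degree p}. poly_class mu (monom (coeff p j) j))"
  unfolding poly_op_def pw by (simp add: poly_class_smult[symmetric] smult_monom)
 also have "... = poly_class mu p" by (subst sum) (simp_all add: poly_as_sum_of_monoms)
 finally show ?thesis .
qed

lemma cyclic_vector_one: "cyclic_vector K Z (poly_class mu 1)" unfolding cyclic_vector_def
proof (intro conjI poly_class_carrier)
 interpret MS: Metric_space "carrier K" "hdist K" by (rule K.Metric_space_hdist)
 show "MS.mtopology closure_of range (%p. poly_op K p Z (poly_class mu 1)) = carrier K"
  unfolding poly_op_poly_class MS.metric_closure_of
 proof (intro Set.set_eqI iffI)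
  fix x assume x: "x : carrier K"
  have "EX y:range (poly_class mu). y : MS.mball x r" if r: "0 < r" for r
  proof -
   obtain f where "hnorm K (poly_class mu f \<ominus>\<^bsub>K\<^esub> x) < r" using poly_class_dense[OF x r] by blast
   hence "poly_class mu f : MS.mball x r"
    using x K.hnorm_minus_commute[OF x poly_class_carrier, of f] by (simp add: MS.in_mball hdist_def)
   thus ?thesis by blast
  qed
  thus "x : {x : carrier K. ALL r>0. EX y:range (%p. poly_class mu p). y : MS.mball x r}" using x by simp
 qed simp
qed

lemma M_z_cyclic: "cyclic_op K (M_z mu)" unfolding cyclic_op_def M_z_eq using cyclic_vector_one by blast

end

section \<open>Cyclic Dirichlet type operators\<close>

lemma bdiff_bdiff: "bdiff n (bdiff m A) = bdiff (n + m) A" by (induction n) simp_all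

lemma bdiff_scale: "bdiff n (%k l. c * A k l) = (%k l. c * bdiff n A k l)"
 using bdiff_linear[of n c A 0 "%k l. 0"] by simp

lemma psd_of_sesq:
 assumes "!!p. 0 <= sesq A p p" shows "psd A" unfolding psd_def
proof (intro allI)
 fix S and x :: "nat => complex"
 let ?p = "SUM k<=S. monom (x k) k"
 have c: "coeff ?p k = (if k <= S then x k else 0)" for k by (simp add: coeff_sum)
 have d: "degree ?p <= S" by (rule degree_le) (simp add: c)
 show "0 <= (SUM k<=S. SUM l<=S. x k * cnj (x l) * A k l)"
  using assms[of ?p] unfolding sesq_eq[OF d d] c by simp
qed

lemma dirichlet_tuplesD:
 assumes "mu : dirichlet_tuples m"
 shows "length (fst mu) = m" "j < m ==> fst mu ! j : circle_distributions"
  "snd mu : finite_borel_measures_on (cball 0 1)"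
 using assms by (auto simp: dirichlet_tuples_def intro: subsetD[OF _ nth_mem])

lemma (in complex_inner_product_space) hlim_Cauchy:
 assumes h: "hlim s x" and r: "0 < r" shows "EX N. ALL i>=N. ALL j>=N. hnorm H (s i \<ominus> s j) < r"
proof -
 have c: "!!n. s n : carrier H" "x : carrier H" and l: "(%n. hnorm H (s n \<ominus> x)) ----> 0"
  using h by (auto simp: hlim_def)
 have "0 < r / 2" using r by simp
 from order_tendstoD(2)[OF l this] obtain N where N: "!!n. N <= n ==> hnorm H (s n \<ominus> x) < r / 2"
  unfolding eventually_sequentially by blast
 have "hnorm H (s i \<ominus> s j) < r" if "N <= i" "N <= j" for i j
  using hnorm_minus_triangle[OF c(1) c(2) c(1), of i j] hnorm_minus_commute[OF c(2) c(1), of j] N[OF that(1)] N[OF that(2)] by simp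
 thus ?thesis by blast
qed

lemma (in bounded_operator_on) orbit_dense:
 assumes cyclic: "cyclic_vector H T e" and x: "x : carrier H"
 shows "EX s. hlim (%n. poly_op H (s n) T e) x"
proof -
 interpret MS: Metric_space "carrier H" "hdist H" by (rule Metric_space_hdist)
 have e: "e : carrier H" using cyclic by (simp add: cyclic_vector_def)
 have "x : MS.mtopology closure_of (range (%p. poly_op H p T e))" using cyclic x by (simp add: cyclic_vector_def)
 hence ex: "EX p. hnorm H (poly_op H p T e \<ominus> x) < r" if "0 < r" for r
  unfolding MS.metric_closure_of using that x hnorm_minus_commute[OF x poly_op_closed[OF e]]
  by (auto simp: MS.in_mball hdist_def poly_op_closed e)
 have "EX p. hnorm H (poly_op H p T e \<ominus> x) < inverse (real (Suc n))" for n by (rule ex) simp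
 then obtain s where s: "!!n. hnorm H (poly_op H (s n) T e \<ominus> x) < inverse (real (Suc n))" by metis
 have "norm (hnorm H (poly_op H (s n) T e \<ominus> x)) <= inverse (real (Suc n))" for n
  using less_imp_le[OF s[of n]] hnorm_nonneg[of "poly_op H (s n) T e \<ominus> x"] x poly_op_closed[OF e] by simp
 hence "(%n. hnorm H (poly_op H (s n) T e \<ominus> x)) ----> 0"
  by (rule null_comparison) (rule LIMSEQ_inverse_real_of_nat)
 hence "hlim (%n. poly_op H (s n) T e) x" unfolding hlim_def using x poly_op_closed[OF e] by simp
 thus ?thesis by blast
qed

text \<open>A sequence of polynomials \<open>s\<close> converges at \<open>(T1, e1)\<close> if and only if it
converges at \<open>(T2, e2)\<close>; the unitary maps one limit to the other.\<close>

theorem cyclic_unitary: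
 assumes H1: "complex_hilbert_space H1" "T1 : bounded_operators H1" "cyclic_vector H1 T1 e1"
  and H2: "complex_hilbert_space H2" "T2 : bounded_operators H2" "cyclic_vector H2 T2 e2"
  and eq: "!!p q. ip H2 (poly_op H2 p T2 e2) (poly_op H2 q T2 e2) = ip H1 (poly_op H1 p T1 e1) (poly_op H1 q T1 e1)"
 shows "EX V. unitary H1 H2 V & (ALL x:carrier H1. V (T1 x) = T2 (V x)) & V e1 = e2"
proof -
 interpret A: bounded_operator_on H1 T1 using H1 by (simp add: bounded_operator_on_def bounded_operator_on_axioms_def)
 interpret B: bounded_operator_on H2 T2 using H2 by (simp add: bounded_operator_on_def bounded_operator_on_axioms_def)
 have e: "e1 : carrier H1" "e2 : carrier H2" using H1(3) H2(3) by (auto simp: cyclic_vector_def)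
 let ?a = "%s n. poly_op H1 (s n) T1 e1" and ?b = "%s n. poly_op H2 (s n) T2 e2"
 define R where "R s x y \<longleftrightarrow> A.hlim (?a s) x & B.hlim (?b s) y" for s x y
 have R_in: "x : carrier H1" "y : carrier H2" if "R s x y" for s x y using that by (auto simp: R_def A.hlim_def B.hlim_def)
 have N: "hnorm H2 (?b s i \<ominus>\<^bsub>H2\<^esub> ?b s j) = hnorm H1 (?a s i \<ominus>\<^bsub>H1\<^esub> ?a s j)" for s i j
  unfolding A.poly_op_diff[OF e(1), symmetric] B.poly_op_diff[OF e(2), symmetric] hnorm_def eq ..
 have ex2: "EX s y. R s x y" if "x : carrier H1" for x
 proof -
  obtain s where s: "A.hlim (?a s) x" using A.orbit_dense[OF H1(3) \<open>x : carrier H1\<close>] by blast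
  have "EX y. B.hlim (?b s) y"
   by (rule B.hlim_of_Cauchy[OF B.poly_op_closed[OF e(2)]]) (unfold N, rule A.hlim_Cauchy[OF s])
  thus ?thesis using s unfolding R_def by blast
 qed
 have ex1: "EX s x. R s x y" if "y : carrier H2" for y
 proof -
  obtain s where s: "B.hlim (?b s) y" using B.orbit_dense[OF H2(3) \<open>y : carrier H2\<close>] by blast
  have "EX x. A.hlim (?a s) x"
   by (rule A.hlim_of_Cauchy[OF A.poly_op_closed[OF e(1)]]) (unfold N[symmetric], rule B.hlim_Cauchy[OF s])
  thus ?thesis using s unfolding R_def by blast
 qed
 have R_ip: "ip H2 y y' = ip H1 x x'" if "R s x y" "R s' x' y'" for s x y s' x' y'
  using B.hlim_ip[of "?b s" y "?b s'" y'] A.hlim_ip[of "?a s" x "?a s'" x'] that unfolding R_def eq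
  by (meson LIMSEQ_unique)
 have R_fun: "y = y'" if "R s x y" "R s' x y'" for s s' x y y'
 proof -
  note c = R_in[OF that(1)] R_in[OF that(2)]
  have "ip H2 (y \<ominus>\<^bsub>H2\<^esub> y') (y \<ominus>\<^bsub>H2\<^esub> y') = 0"
   using c R_ip[OF that(1) that(1)] R_ip[OF that(1) that(2)] R_ip[OF that(2) that(1)] R_ip[OF that(2) that(2)]
   by (simp add: B.ip_minus_left B.ip_minus_right)
  hence "y \<ominus>\<^bsub>H2\<^esub> y' = \<zero>\<^bsub>H2\<^esub>" using c by (intro B.ip_eq_0) auto
  thus ?thesis using c B.eq_of_minus_zero by blast
 qed
 define V where "V x = (SOME y. EX s. R s x y)" for x
 have V: "V x = y" if "R s x y" for s x y
 proof -
  have "EX s. R s x (V x)" unfolding V_def by (rule someI_ex) (use that in blast)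
  thus ?thesis using R_fun that by blast
 qed
 have "unitary H1 H2 V" unfolding unitary_def linear_map_def
 proof (intro conjI ballI allI)
  show "V : carrier H1 \<rightarrow> carrier H2" using ex2 V R_in by fastforce
  show "V ` carrier H1 = carrier H2" proof (intro Set.equalityI subsetI)
   fix y assume "y : V ` carrier H1" thus "y : carrier H2" using ex2 V R_in by fastforce
  next
   fix y assume "y : carrier H2"
   then obtain s x where "R s x y" using ex1 by blast
   thus "y : V ` carrier H1" using V[of s x y] R_in(1)[of s x y] by blast
  qed
  fix x x' assume "x : carrier H1" "x' : carrier H1"
  then obtain s y s' y' where R: "R s x y" "R s' x' y'" using ex2 by metis
  have "R (%n. s n + s' n) (x \<oplus>\<^bsub>H1\<^esub> x') (y \<oplus>\<^bsub>H2\<^esub> y')"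
   using A.hlim_add[of "?a s" x "?a s'" x'] B.hlim_add[of "?b s" y "?b s'" y'] R unfolding R_def
   by (simp add: A.poly_op_add B.poly_op_add e)
  thus "V (x \<oplus>\<^bsub>H1\<^esub> x') = V x \<oplus>\<^bsub>H2\<^esub> V x'" using V R by metis
  show "ip H2 (V x) (V x') = ip H1 x x'" using R_ip[OF R] V R by simp
 next
  fix c x assume "x : carrier H1"
  then obtain s y where R: "R s x y" using ex2 by blast
  have "R (%n. Polynomial.smult c (s n)) (c \<odot>\<^bsub>H1\<^esub> x) (c \<odot>\<^bsub>H2\<^esub> y)"
   using A.hlim_smult[of "?a s" x c] B.hlim_smult[of "?b s" y c] R unfolding R_def
   by (simp add: A.poly_op_smult B.poly_op_smult e)
  thus "V (c \<odot>\<^bsub>H1\<^esub> x) = c \<odot>\<^bsub>H2\<^esub> V x" using V R by metis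
 qed
 moreover have "V (T1 x) = T2 (V x)" if "x : carrier H1" for x
 proof -
  obtain s y where R: "R s x y" using ex2 \<open>x : carrier H1\<close> by blast
  obtain C where C: "!!x. x : carrier H1 ==> hnorm H1 (T1 x) <= C * hnorm H1 x" using A.T_bound by blast
  obtain D where D: "!!x. x : carrier H2 ==> hnorm H2 (T2 x) <= D * hnorm H2 x" using B.T_bound by blast
  have "R (%n. [:0, 1:] * s n) (T1 x) (T2 y)"
   using A.hlim_bounded_map[OF A.T_linear C, of "?a s" x] B.hlim_bounded_map[OF B.T_linear D, of "?b s" y] R
   unfolding R_def by (simp only: A.poly_op_shift[OF e(1)] B.poly_op_shift[OF e(2)])
  thus ?thesis using V R by metis
 qed
 moreover have "V e1 = e2"
  by (rule V[of "%n. 1"]) (simp add: R_def A.poly_op_one B.poly_op_one A.hlim_const B.hlim_const e)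
 ultimately show ?thesis by blast
qed

locale cyclic_dirichlet = complex_hilbert_space +
 fixes m T e
 assumes m_pos: "0 < m" and dirichlet: "dirichlet_type m H T"
  and cyclic: "cyclic_vector H T e" and unit: "hnorm H e = 1"

sublocale cyclic_dirichlet \<subseteq> bounded_operator_on H T
 by unfold_locales (use dirichlet in \<open>simp add: dirichlet_type_def\<close>)

context cyclic_dirichlet
begin

lemma e_carrier [simp, intro]: "e : carrier H" using cyclic by (simp add: cyclic_vector_def)

definition A :: "nat => nat => complex" where
 "A j l = ip H ((T ^^ j) e) ((T ^^ l) e)"

lemma sesq_A: "sesq A p q = ip H (poly_op H p T e) (poly_op H q T e)"
 by (simp add: ip_poly_op_poly_op A_def[abs_def])

lemma A_cnj: "cnj (A k l) = A l k" unfolding A_def by (rule ip_cnj[symmetric]) auto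

lemma bdiff_A_cnj: "cnj (bdiff n A k l) = bdiff n A l k"
 by (induction n arbitrary: k l) (simp_all add: A_cnj)

lemma ip_beta_eq: "ip H (beta_op H n T ((T ^^ k) e)) ((T ^^ l) e) = (-1) ^ n * bdiff n A k l"
proof -
 have "(-1) ^ (n - j) = (-1) ^ n * ((-1) ^ j :: complex)" if "j <= n" for j
 proof -
  have e: "n + j = (n - j) + 2 * j" using that by simp
  show ?thesis unfolding power_add[symmetric] e by (simp add: power_add power_mult)
 qed
 hence "(SUM j<=n. ((-1) ^ (n - j) * of_nat (n choose j)) * ip H ((T ^^ j) ((T ^^ k) e)) ((T ^^ j) ((T ^^ l) e)))
   = (SUM j<=n. (-1) ^ n * (((-1) ^ j * of_nat (n choose j)) * A (k + j) (l + j)))"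
  by (intro sum.cong refl) (simp add: A_def add.commute[of k] add.commute[of l] funpow_add)
 thus ?thesis by (simp add: ip_beta_op bdiff_eq_sum sum_distrib_left)
qed

lemma ip_beta_e: "ip H (beta_op H n T e) ((T ^^ l) e) = (-1) ^ n * bdiff n A 0 l"
 using ip_beta_eq[of n 0 l] by simp

lemma pow_poly_op: "(T ^^ j) (poly_op H p T e) = poly_op H (monom 1 j * p) T e"
proof (induction j)
 case 0
 show ?case by (simp add: monom_0)
next
 case (Suc j)
 have "monom 1 (Suc j) * p = [:0, 1:] * (monom 1 j * p)" by (simp add: monom_Suc)
 thus ?case using Suc poly_op_shift[OF e_carrier, of "monom 1 j * p"] by simp
qed

lemma psd_bdiff:
 assumes n: "m <= n" shows "psd (%k l. (-1) ^ m * bdiff n A k l)"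
proof (rule psd_of_sesq)
 fix p
 let ?x = "poly_op H p T e"
 have x: "?x : carrier H" by (rule poly_op_closed) simp
 have "0 <= (-1) ^ m * (SUM j<=n. ((-1) ^ j * of_nat (n choose j)) * ip H ((T ^^ j) ?x) ((T ^^ j) ?x))"
  using dirichlet n x unfolding dirichlet_type_def positive_defect_iff by blast
 also have "... = (-1) ^ m * sesq (bdiff n A) p p" unfolding pow_poly_op sesq_A[symmetric] sesq_bdiff ..
 also have "... = sesq (%k l. (-1) ^ m * bdiff n A k l) p p"
  using sesq_linear_array[of "(-1) ^ m" "bdiff n A" 0 "%k l. 0" p p] by simp
 finally show "0 <= sesq (%k l. (-1) ^ m * bdiff n A k l) p p" .
qed

lemma all_psd_moments: "all_psd (%k l. (-1) ^ m * bdiff m A k l)"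
 unfolding all_psd_def bdiff_scale bdiff_bdiff by (intro allI psd_bdiff) simp

text \<open>For order \<open>m\<close> the diagonal is nonnegative and decreasing up to sign, as its next
difference is nonnegative; each summation costs one power of \<open>k\<close>.\<close>

lemma bdiff_growth: "EX M>=0. ALL k. cmod (bdiff (m - i) A k k) <= M * real (Suc k) ^ i" if "i <= m"
 using that
proof (induction i)
 case 0
 let ?r = "%k. (-1) ^ m * bdiff m A k k"
 have r0: "0 <= ?r k" for k using psd_diag[OF psd_bdiff[OF order_refl]] by simp
 have "0 <= (-1) ^ m * bdiff (Suc m) A k k" for k using psd_diag[OF psd_bdiff[of "Suc m"]] by simp
 hence step: "Re (?r (Suc k)) <= Re (?r k)" for k by (simp add: less_eq_complex_def right_diff_distrib)
 have dec: "Re (?r k) <= Re (?r 0)" for k by (induction k) (use step order_trans in blast)+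
 have "cmod (bdiff m A k k) = cmod (?r k)" for k by (simp add: norm_mult norm_power)
 also have "cmod (?r k) = Re (?r k)" for k
 proof -
  have "cmod z = Re z" if "0 <= z" for z using that by (simp add: cmod_eq_Re less_eq_complex_def)
  from this[OF r0[of k]] show ?thesis .
 qed
 finally have "cmod (bdiff m A k k) <= Re (?r 0)" for k using dec by simp
 thus ?case using r0[of 0] by (intro exI[of _ "Re (?r 0)"]) (simp add: less_eq_complex_def)
next
 case (Suc i)
 then obtain M where M: "0 <= M" "!!k. cmod (bdiff (m - i) A k k) <= M * real (Suc k) ^ i" by auto
 define s where "s = m - Suc i"
 have s: "m - i = Suc s" using Suc.prems by (simp add: s_def)
 let ?c = "cmod (bdiff s A 0 0)"
 have b: "cmod (bdiff s A k k) <= ?c + real k * (M * real (Suc k) ^ i)" for k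
 proof (induction k)
  case (Suc k)
  have "bdiff s A (Suc k) (Suc k) = bdiff s A k k - bdiff (Suc s) A k k" by simp
  hence "cmod (bdiff s A (Suc k) (Suc k)) <= cmod (bdiff s A k k) + cmod (bdiff (Suc s) A k k)"
   using norm_triangle_ineq4 by metis
  also have "... <= (?c + real k * (M * real (Suc k) ^ i)) + M * real (Suc k) ^ i"
   using Suc.IH M(2)[of k] unfolding s by (rule add_mono)
  also have "... = ?c + real (Suc k) * (M * real (Suc k) ^ i)" by (simp add: distrib_right)
  also have "... <= ?c + real (Suc k) * (M * real (Suc (Suc k)) ^ i)"
   using M(1) by (intro add_left_mono mult_left_mono power_mono) auto
  finally show ?case .
 qed simp
 have "cmod (bdiff s A k k) <= (?c + M) * real (Suc k) ^ Suc i" for k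
 proof -
  have "?c <= ?c * real (Suc k) ^ Suc i" using mult_left_mono[OF one_le_power[of "real (Suc k)" "Suc i"], of ?c] by simp
  moreover have "real k * (M * real (Suc k) ^ i) <= real (Suc k) * (M * real (Suc k) ^ i)"
   using M(1) by (intro mult_right_mono) auto
  moreover have "real (Suc k) * (M * real (Suc k) ^ i) = M * real (Suc k) ^ Suc i" by simp
  ultimately show ?thesis using b[of k] unfolding distrib_right by linarith
 qed
 thus ?case using M(1) unfolding s_def[symmetric] by (intro exI[of _ "?c + M"]) simp
qed

lemma orbit_growth: "EX M>=0. ALL k. hnorm H ((T ^^ k) e) <= M * real (Suc k) ^ m"
proof -
 obtain M where M: "0 <= M" "!!k. cmod (A k k) <= M * real (Suc k) ^ m" using bdiff_growth[OF order_refl] by auto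
 have "hnorm H ((T ^^ k) e) <= (1 + M) * real (Suc k) ^ m" for k
 proof -
  let ?h = "hnorm H ((T ^^ k) e)"
  have sq: "?h\<^sup>2 <= M * real (Suc k) ^ m" using M(2)[of k] ip_self[of "(T ^^ k) e"] by (simp add: A_def del: of_real_power)
  have "0 <= (?h - 1)^2 + ?h\<^sup>2 + 1" by simp
  hence "?h <= 1 + ?h\<^sup>2" by (simp add: power2_diff)
  also have "... <= real (Suc k) ^ m + M * real (Suc k) ^ m" using sq one_le_power[of "real (Suc k)" m] by linarith
  finally show ?thesis by (simp add: distrib_right)
 qed
 thus ?thesis using M(1) by (intro exI[of _ "1 + M"]) auto
qed

lemma associated_exists: "EX mu. associated_tuple m H T e mu"
proof -
 obtain M where M: "0 <= M" "!!k. hnorm H ((T ^^ k) e) <= M * real (Suc k) ^ m" using orbit_growth by blast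
 define c where "c i k = (if 0 <= k then ip H (beta_op H i T e) ((T ^^ nat k) e) else cnj (ip H (beta_op H i T e) ((T ^^ nat (- k)) e)))" for i k
 have bd: "cmod (c i k) <= (hnorm H (beta_op H i T e) * M) * (1 + \<bar>real_of_int k\<bar>) ^ m" for i k
 proof -
  have b: "beta_op H i T e : carrier H" by (rule beta_op_closed) simp
  have "cmod (c i k) = cmod (ip H (beta_op H i T e) ((T ^^ nat \<bar>k\<bar>) e))" by (auto simp: c_def)
  also have "... <= hnorm H (beta_op H i T e) * hnorm H ((T ^^ nat \<bar>k\<bar>) e)" using b by (intro cmod_ip_le) auto
  also have "... <= hnorm H (beta_op H i T e) * (M * real (Suc (nat \<bar>k\<bar>)) ^ m)"
   using hnorm_nonneg[OF b] by (intro mult_left_mono M)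
  also have "real (Suc (nat \<bar>k\<bar>)) = 1 + \<bar>real_of_int k\<bar>" by simp
  finally show ?thesis by (simp add: mult.assoc)
 qed
 have "EX mu:circle_distributions. ALL k. fourier_coeff mu k = c i k" for i
  by (rule distribution_exists[OF bd])
 then obtain d where d: "!!i. d i : circle_distributions" "!!i k. fourier_coeff (d i) k = c i k" by metis
 obtain nu where nu: "has_disc_moments nu (%k l. (-1) ^ m * bdiff m A k l)" using disc_moment_problem[OF all_psd_moments] by blast
 have real: "cnj (ip H (beta_op H i T e) e) = ip H (beta_op H i T e) e" for i
  using ip_beta_e[of i 0] bdiff_A_cnj[of i 0 0] by simp
 have "associated_tuple m H T e (map d [0..<m], nu)" unfolding associated_tuple_def
 proof (intro conjI allI impI)
  show "(map d [0..<m], nu) : dirichlet_tuples m"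
   using d(1) nu by (auto simp: dirichlet_tuples_def has_disc_moments_def)
  fix j k assume j: "j < m"
  show "fourier_coeff (fst (map d [0..<m], nu) ! j) (int k) = ip H (beta_op H j T e) ((T ^^ k) e)"
   using j by (simp add: d(2) c_def)
  show "cnj (fourier_coeff (fst (map d [0..<m], nu) ! j) (- int k)) = ip H (beta_op H j T e) ((T ^^ k) e)"
   using j real[of j] by (cases k) (simp_all add: d(2) c_def nat_add_distrib)
 next
  fix k l
  show "(LINT z|snd (map d [0..<m], nu). z ^ k * cnj z ^ l) = ip H (beta_op H m T ((T ^^ k) e)) ((T ^^ l) e)"
   using nu by (simp add: has_disc_moments_def ip_beta_eq)
 qed
 thus ?thesis by blast
qed

lemma associated_unique:
 assumes "associated_tuple m H T e mu" "associated_tuple m H T e mu'" shows "mu = mu'"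
proof (rule prod_eqI)
 have t: "mu : dirichlet_tuples m" "mu' : dirichlet_tuples m" using assms by (auto simp: associated_tuple_def)
 have L: "length (fst mu) = m" "length (fst mu') = m"
  and D: "!!j. j < m ==> fst mu ! j : circle_distributions" "!!j. j < m ==> fst mu' ! j : circle_distributions"
  and M: "snd mu : finite_borel_measures_on (cball 0 1)" "snd mu' : finite_borel_measures_on (cball 0 1)"
  using dirichlet_tuplesD[OF t(1)] dirichlet_tuplesD[OF t(2)] by auto
 show "fst mu = fst mu'" proof (rule nth_equalityI)
  fix j assume "j < length (fst mu)"
  hence j: "j < m" using L by simp
  show "fst mu ! j = fst mu' ! j" proof (rule distribution_unique[OF D(1)[OF j] D(2)[OF j]])
   fix k :: int
   show "fourier_coeff (fst mu ! j) k = fourier_coeff (fst mu' ! j) k" proof (cases k rule: int_cases2)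
    case (nonneg n)
    thus ?thesis using assms j unfolding associated_tuple_def by simp
   next
    case (nonpos n)
    have "cnj (fourier_coeff (fst mu ! j) (- int n)) = cnj (fourier_coeff (fst mu' ! j) (- int n))"
     using assms j unfolding associated_tuple_def by metis
    thus ?thesis using nonpos by simp
   qed
  qed
 qed (simp add: L)
 show "snd mu = snd mu'"
  by (rule disc_moments_unique[where a = "%k l. ip H (beta_op H m T ((T ^^ k) e)) ((T ^^ l) e)"])
    (use assms M in \<open>simp_all add: has_disc_moments_def associated_tuple_def\<close>)
qed

text \<open>Both matrices have the same \<open>m\<close>-th difference and the same differences of lower order
in row and column \<open>0\<close>.\<close>

lemma gram_associated:
 assumes mu: "associated_tuple m H T e mu" shows "gram mu = A"
proof -
 have L: "length (fst mu) = m" and M: "snd mu : finite_borel_measures_on (cball 0 1)"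
  using mu by (auto simp: associated_tuple_def dirichlet_tuples_def)
 have sg: "(-1) ^ n * ((-1) ^ n * x) = (x :: complex)" for n x
  by (simp add: mult.assoc[symmetric] power_add[symmetric])
 show ?thesis proof (rule bdiff_determines[of m])
  fix j l :: nat
  show "bdiff m (gram mu) j l = bdiff m A j l"
   using bdiff_gram_top[OF M, of j l] mu unfolding L associated_tuple_def by (simp add: ip_beta_eq sg)
 next
  fix s j l :: nat assume s: "s < m" and b: "j = 0 \<or> l = 0"
  have g: "bdiff s (gram mu) j l = (-1) ^ s * fourier_coeff (fst mu ! s) (int l - int j)"
   by (rule bdiff_gram_boundary[OF M _ b]) (simp add: L s)
  have f1: "fourier_coeff (fst mu ! s) (int k) = (-1) ^ s * bdiff s A 0 k" for k
   using mu s unfolding associated_tuple_def by (simp add: ip_beta_e)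
  have "cnj (fourier_coeff (fst mu ! s) (- int k)) = (-1) ^ s * bdiff s A 0 k" for k
   using mu s unfolding associated_tuple_def by (simp add: ip_beta_e)
  hence "cnj (cnj (fourier_coeff (fst mu ! s) (- int k))) = cnj ((-1) ^ s * bdiff s A 0 k)" for k by simp
  hence f2: "fourier_coeff (fst mu ! s) (- int k) = (-1) ^ s * bdiff s A k 0" for k by (simp add: bdiff_A_cnj)
  show "bdiff s (gram mu) j l = bdiff s A j l" using b f1[of l] f2[of j] by (auto simp: g sg)
 qed
qed

lemma norm_sq_associated:
 assumes mu: "associated_tuple m H T e mu"
 shows "norm_sq mu f = of_real ((hnorm H (poly_op H f T e))^2)"
proof -
 have "mu : dirichlet_tuples m" using mu by (simp add: associated_tuple_def)
 hence "norm_sq mu f = sesq A f f" using norm_sq_eq_sesq m_pos gram_associated[OF mu] by metis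
 thus ?thesis by (simp only: sesq_A ip_self poly_op_closed e_carrier)
qed

lemma associated_allowable:
 assumes mu: "associated_tuple m H T e mu" shows "allowable m mu" "normalized mu"
proof -
 obtain C where C: "0 <= C" "ALL x:carrier H. hnorm H (T x) <= C * hnorm H x" using T_bound by blast
 have "(hnorm H (poly_op H ([:0, 1:] * f) T e))\<^sup>2 <= (C\<^sup>2 + 1) * (hnorm H (poly_op H f T e))^2" for f
 proof -
  let ?x = "poly_op H f T e"
  have x: "?x : carrier H" by (rule poly_op_closed) simp
  have "(hnorm H (T ?x))\<^sup>2 <= (C * hnorm H ?x)^2" by (rule power_mono) (use C x hnorm_nonneg in auto)
  also have "... <= (C\<^sup>2 + 1) * (hnorm H ?x)^2" by (simp add: power_mult_distrib distrib_right)
  finally show ?thesis by (simp only: poly_op_shift[OF e_carrier])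
 qed
 note le = this
 have pos: "0 < C\<^sup>2 + 1" by (simp add: add_nonneg_pos)
 have "0 <= norm_sq mu ([:0, 1:] * f) & norm_sq mu ([:0, 1:] * f) <= of_real (C\<^sup>2 + 1) * norm_sq mu f" for f
  unfolding norm_sq_associated[OF mu] of_real_mult[symmetric] using le[of f] by (simp only: less_eq_complex_def Re_complex_of_real Im_complex_of_real) simp
 thus "allowable m mu" using mu pos unfolding allowable_def associated_tuple_def by blast
 show "normalized mu" unfolding normalized_def norm_sq_associated[OF mu] by (simp add: poly_op_one unit)
qed

theorem model_unitary:
 assumes mu: "associated_tuple m H T e mu"
 shows "EX U. unitary H (model_space mu) U & (ALL x:carrier H. U (T x) = M_z mu (U x)) & U e = poly_class mu 1"
proof -
 interpret al: allowable_tuple m mu by unfold_locales (rule m_pos, rule associated_allowable[OF mu])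
 show ?thesis unfolding al.M_z_eq
 proof (rule cyclic_unitary[OF complex_hilbert_space_axioms T_bounded cyclic al.hilbert_space_K al.Z_bounded al.cyclic_vector_one])
  fix p q
  show "ip (model_space mu) (poly_op (model_space mu) p al.Z (poly_class mu 1)) (poly_op (model_space mu) q al.Z (poly_class mu 1))
    = ip H (poly_op H p T e) (poly_op H q T e)"
   unfolding al.poly_op_poly_class al.ip_poly_class gram_associated[OF mu] by (rule sesq_A)
 qed
qed

end

lemma associated_tuple_transfer:
 assumes H1: "complex_hilbert_space H1" "T1 : bounded_operators H1" "e1 : carrier H1"
  and H2: "complex_hilbert_space H2" "T2 : bounded_operators H2"
  and V: "unitary H1 H2 V" "ALL x:carrier H1. V (T1 x) = T2 (V x)" "V e1 = e2"
  and mu: "associated_tuple m H2 T2 e2 mu"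
 shows "associated_tuple m H1 T1 e1 mu"
proof -
 interpret A: bounded_operator_on H1 T1 using H1 by (simp add: bounded_operator_on_def bounded_operator_on_axioms_def)
 interpret B: bounded_operator_on H2 T2 using H2 by (simp add: bounded_operator_on_def bounded_operator_on_axioms_def)
 have Vc: "V x : carrier H2" if "x : carrier H1" for x using V(1) that by (auto simp: unitary_def)
 have Vip: "ip H2 (V x) (V y) = ip H1 x y" if "x : carrier H1" "y : carrier H1" for x y using V(1) that by (auto simp: unitary_def)
 have Vp: "V ((T1 ^^ k) x) = (T2 ^^ k) (V x)" if "x : carrier H1" for k x
  using that V(2) by (induction k) auto
 have eq: "ip H2 (beta_op H2 n T2 ((T2 ^^ k) e2)) ((T2 ^^ l) e2) = ip H1 (beta_op H1 n T1 ((T1 ^^ k) e1)) ((T1 ^^ l) e1)" for n k l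
 proof -
  have "ip H2 (beta_op H2 n T2 ((T2 ^^ k) e2)) ((T2 ^^ l) e2) = ip H2 (beta_op H2 n T2 (V ((T1 ^^ k) e1))) (V ((T1 ^^ l) e1))"
   using Vp[OF H1(3)] V(3) by simp
  also have "... = (SUM j<=n. ((-1) ^ (n - j) * of_nat (n choose j)) * ip H2 ((T2 ^^ j) (V ((T1 ^^ k) e1))) ((T2 ^^ j) (V ((T1 ^^ l) e1))))"
   by (intro B.ip_beta_op Vc A.T_pow_closed H1(3))
  also have "... = (SUM j<=n. ((-1) ^ (n - j) * of_nat (n choose j)) * ip H1 ((T1 ^^ j) ((T1 ^^ k) e1)) ((T1 ^^ j) ((T1 ^^ l) e1)))"
   by (intro sum.cong refl) (simp only: Vp[symmetric] Vip A.T_pow_closed H1(3))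
  also have "... = ip H1 (beta_op H1 n T1 ((T1 ^^ k) e1)) ((T1 ^^ l) e1)"
   by (intro A.ip_beta_op[symmetric] A.T_pow_closed H1(3))
  finally show ?thesis .
 qed
 have eq0: "ip H2 (beta_op H2 n T2 e2) ((T2 ^^ l) e2) = ip H1 (beta_op H1 n T1 e1) ((T1 ^^ l) e1)" for n l
  using eq[of n 0 l] by simp
 show ?thesis using mu unfolding associated_tuple_def eq eq0 .
qed

theorem theorem1p2:
  fixes m :: nat
  assumes "m \<ge> 1"
  shows
    "(\<forall>\<mu>. allowable m \<mu> \<and> normalized \<mu> \<longrightarrow>
        complex_hilbert_space (model_space \<mu>) \<and>
        dirichlet_type m (model_space \<mu>) (M_z \<mu>) \<and>
        cyclic_op (model_space \<mu>) (M_z \<mu>))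
     \<and>
     (\<forall>(H :: 'a hilbert) T e.
        complex_hilbert_space H \<and> dirichlet_type m H T \<and> cyclic_vector H T e \<and> hnorm H e = 1 \<longrightarrow>
        (\<exists>!\<mu>. associated_tuple m H T e \<mu>) \<and>
        (\<forall>\<mu>. associated_tuple m H T e \<mu> \<longrightarrow>
           allowable m \<mu> \<and> normalized \<mu> \<and>
           (\<exists>U. unitary H (model_space \<mu>) U \<and>
                (\<forall>x\<in>carrier H. U (T x) = M_z \<mu> (U x)) \<and>
                U e = poly_class \<mu> 1)))
     \<and>
     (\<forall>(H1 :: 'b hilbert) T1 e1 (H2 :: 'c hilbert) T2 e2 \<mu>1 \<mu>2.
        complex_hilbert_space H1 \<and> dirichlet_type m H1 T1 \<and> cyclic_vector H1 T1 e1 \<and> hnorm H1 e1 = 1 \<and>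
        complex_hilbert_space H2 \<and> dirichlet_type m H2 T2 \<and> cyclic_vector H2 T2 e2 \<and> hnorm H2 e2 = 1 \<and>
        associated_tuple m H1 T1 e1 \<mu>1 \<and> associated_tuple m H2 T2 e2 \<mu>2 \<longrightarrow>
        (\<mu>1 = \<mu>2 \<longleftrightarrow>
           (\<exists>V. unitary H1 H2 V \<and>
                (\<forall>x\<in>carrier H1. V (T1 x) = T2 (V x)) \<and>
                V e1 = e2)))"
proof (intro conjI allI impI; (elim conjE)?)
 have m: "0 < m" using assms by simp
 {
  fix mu assume al: "allowable m mu"
  interpret allowable_tuple m mu by unfold_locales (rule m, rule al)
  show "complex_hilbert_space (model_space mu)" by (rule hilbert_space_K)
  show "dirichlet_type m (model_space mu) (M_z mu)" by (rule M_z_dirichlet_type)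
  show "cyclic_op (model_space mu) (M_z mu)" by (rule M_z_cyclic)
 next
  fix H :: "'a hilbert" and T e
  assume H: "complex_hilbert_space H" "dirichlet_type m H T" "cyclic_vector H T e" "hnorm H e = 1"
  interpret cyclic_dirichlet H m T e by (intro cyclic_dirichlet.intro cyclic_dirichlet_axioms.intro H m)
  show "\<exists>!mu. associated_tuple m H T e mu" using associated_exists associated_unique by blast
  fix mu assume mu: "associated_tuple m H T e mu"
  show "allowable m mu" "normalized mu" by (rule associated_allowable[OF mu])+
  show "EX U. unitary H (model_space mu) U & (ALL x:carrier H. U (T x) = M_z mu (U x)) & U e = poly_class mu 1"
   by (rule model_unitary[OF mu])
 next
  fix H1 :: "'b hilbert" and T1 e1 and H2 :: "'c hilbert" and T2 e2 mu1 mu2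
  assume H1: "complex_hilbert_space H1" "dirichlet_type m H1 T1" "cyclic_vector H1 T1 e1" "hnorm H1 e1 = 1"
   and H2: "complex_hilbert_space H2" "dirichlet_type m H2 T2" "cyclic_vector H2 T2 e2" "hnorm H2 e2 = 1"
   and mu: "associated_tuple m H1 T1 e1 mu1" "associated_tuple m H2 T2 e2 mu2"
  interpret A: cyclic_dirichlet H1 m T1 e1
   by (intro cyclic_dirichlet.intro cyclic_dirichlet_axioms.intro H1 m)
  interpret B: cyclic_dirichlet H2 m T2 e2
   by (intro cyclic_dirichlet.intro cyclic_dirichlet_axioms.intro H2 m)
  show "mu1 = mu2 \<longleftrightarrow> (EX V. unitary H1 H2 V & (ALL x:carrier H1. V (T1 x) = T2 (V x)) & V e1 = e2)"
  proof
   assume eq: "mu1 = mu2"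
   have AB: "A.A = B.A" using A.gram_associated[OF mu(1)] B.gram_associated[OF mu(2)] eq by simp
   show "EX V. unitary H1 H2 V & (ALL x:carrier H1. V (T1 x) = T2 (V x)) & V e1 = e2"
    by (rule cyclic_unitary[OF H1(1) A.T_bounded H1(3) H2(1) B.T_bounded H2(3)])
      (simp only: A.sesq_A[symmetric] B.sesq_A[symmetric] AB)
  next
   assume "EX V. unitary H1 H2 V & (ALL x:carrier H1. V (T1 x) = T2 (V x)) & V e1 = e2"
   then obtain V where V: "unitary H1 H2 V" "ALL x:carrier H1. V (T1 x) = T2 (V x)" "V e1 = e2" by blast
   have "associated_tuple m H1 T1 e1 mu2"
    by (rule associated_tuple_transfer[OF H1(1) A.T_bounded A.e_carrier H2(1) B.T_bounded V mu(2)])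
   thus "mu1 = mu2" by (rule A.associated_unique[OF mu(1)])
  qed
 }
qed

end
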